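(* In the Framework of the context, with any $a\in\mathbb R$ and $\gamma>0$ and $n\ge n_0$: let $f$ be a local $L^5(\nu_\rho)$ function supported on sites $\Lambda_{\ell_0}$ such that $\varphi_f(\rho)=\varphi_f'(\rho)=0$. There exists a constant $C=C(\rho,\ell_0)$ such that, for $t\ge0$, $\ell\ge\ell_0^3$ and $h\in\ell^1(\mathbb Z)\cap\ell^2(\mathbb Z)$, $$\mathbb E_{\nu_\rho}\Big[\Big(\int_0^t\sum_{x\in\mathbb Z}\Big(\tau_xf(\eta^n_s)-\frac{\varphi_f''(\rho)}2\Big\{\big((\eta^n_s)^{(\ell)}(x)-\rho\big)^2-\frac{\sigma^2_\ell(\rho)}{2\ell+1}\Big\}\Big)h(x)\,ds\Big)^2\Big]$$ $$\le C\|f\|^2_{L^5(\nu_\rho)}\Big(\frac{t\ell}n\Big(\frac1n\sum_{x\in\mathbb Z}h^2(x)\Big)+\frac{t^2n^2}{\ell^{2+\alpha_0}}\Big(\frac1n\sum_{x\in\mathbb Z}|h(x)|\Big)^2\Big).$$ On the other hand, when only $\varphi_f(\rho)=0$ is known, $$\mathbb E_{\nu_\rho}\Big[\Big(\int_0^t\sum_{x\in\mathbb Z}\Big(\tau_xf(\eta^n_s)-\varphi_f'(\rho)\big\{(\eta^n_s)^{(\ell)}(x)-\rho\big\}\Big)h(x)\,ds\Big)^2\Big]$$ $$\le C\|f\|^2_{L^5(\nu_\rho)}\Big(\frac{t\ell^2}n\Big(\frac1n\sum_{x\in\mathbb Z}h^2(x)\Big)+\frac{t^2n^2}{\ell^{1+\alpha_0}}\Big(\frac1n\sum_{x\in\mathbb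 Z}|h(x)|\Big)^2\Big).$$ Here $\alpha_0>0$ is the power in assumption (EE) and $(\eta^n_s)^{(\ell)}(x)=\frac1{2\ell+1}\sum_{y\in\Lambda_\ell}\eta^n_s(x+y)$.
   Context: **Framework.** $\mathbb N_0=\{0,1,2,\dots\}$, $\Omega=\mathbb N_0^{\mathbb Z}$ (in some models the effective state space is $\{0,1\}^{\mathbb Z}$), $\Lambda_k=\{j\in\mathbb Z:|j|\le k\}$, $(\tau_x\eta)(z)=\eta(x+z)$, $\tau_xf(\eta)=f(\tau_x\eta)$. $\eta^{x,y}$ is $\eta$ with one particle moved from $x$ to $y$; $\nabla_{x,y}f(\eta)=f(\eta^{x,y})-f(\eta)$. A local function depends on finitely many coordinates. $\eta^{(\ell)}=\frac1{2\ell+1}\sum_{y\in\Lambda_\ell}\eta(y)$, $\eta^c_\ell=\{\eta(x):x\notin\Lambda_\ell\}$. A probability measure $\nu_\rho$ on $\Omega$ is fixed; the following are assumed. (R1) For all $n\ge1$, $b^{R,n}_x=\tau_xb^{R,n}_0$, $b^{L,n}_x=\tau_xb^{L,n}_0$ are nonnegative functions with $b_0^{R,n},b_0^{L,n}$ depending only on $\{\eta(y):y\in\Lambda_R\}$ for some $R\ge1$, and $|b^{R,n}_0(\eta)|+|b^{L,n}_0(\eta)|\le C\sum_{y\in\Lambda_R}\eta(y)$ uniformly in $n$ (impossible jumps have rate $0$). There are nonnegative functions $c^n_x=\tau_xc^n$, $c^n=c^n_0$ depending only on $\{\eta(y):y\in\Lambda_R\}$, with $b^{R,n}_x-b^{L,n}_x=c^n_x-c^n_{x+1}$.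 Pointwise in $\eta$, $b_0^{R,n}\to b_0^R$, $b_0^{L,n}\to b_0^L$, $c^n_0\to c_0$ as $n\to\infty$. Set $b^n_x=b^{R,n}_x+b^{L,n}_x$, $b^n=b^n_0$, $b=b^R_0+b^L_0$, $c=c_0$. (R2) For all $n,x$ (detailed balance): $E_{\nu_\rho}[b^{R,n}_x(\eta)f(\eta)g(\eta^{x,x+1})]=E_{\nu_\rho}[b^{L,n}_x(\eta)f(\eta^{x+1,x})g(\eta)]$ for bounded local $f,g$. (M) For $a\in\mathbb R$, $\gamma>0$ let $p_n=\frac12+\frac a{2n^\gamma}$, $q_n=1-p_n$, and let $n_0$ be such that $0\le p_n,q_n\le1$ for $n\ge n_0$. For $n\ge n_0$, $\{\eta^n_t\}$ is an $L^2(\nu_\rho)$ Markov process with strongly continuous Markov semigroup and generator $L_n$ having a core of local $L^2(\nu_\rho)$ functions, on which $$L_nf(\eta)=n^2\sum_{x\in\mathbb Z}\{b^{R,n}_x(\eta)p_n\nabla_{x,x+1}f(\eta)+b^{L,n}_x(\eta)q_n\nabla_{x+1,x}f(\eta)\}.$$ $\mathbb P_\kappa,\mathbb E_\kappa$: path law and expectation when $\eta_0\sim\kappa$; $E_\kappa$: expectation under $\kappa$. (IM1) $\nu_\rho$ is translation invariant; $\lim_{|x|\to\infty}E_{\nu_\rho}[f\,\tau_xh]=E_{\nu_\rho}[f]E_{\nu_\rho}[h]$ for local $f,h\in L^2(\nu_\rho)$; $E_{\nu_\rho}[\eta(0)]=\rho$; $E_{\nu_\rho}[e^{\lambda\eta(0)}]<\infty$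 for $|\lambda|\le\lambda^*$, some $\lambda^*>0$. (IM2) With $\mathcal Y^n_0=\frac1{\sqrt n}\sum_x(\eta(x)-\rho)\delta_{x/n}$ and $\mathcal C^n_\kappa(G,H)$ the covariance of $\mathcal Y^n_0(G),\mathcal Y^n_0(H)$ under $\kappa$: under $\nu_\rho$, $\mathcal Y^n_0$ converges weakly to a spatial Gaussian process with covariance $\mathcal C_{\nu_\rho}(G,H)=\lim_n\mathcal C^n_{\nu_\rho}(G,H)$ and $\mathcal C_{\nu_\rho}(G,G)\le C(\rho)\|G\|^2_{L^2(\mathbb R)}$; and $\sup_{\ell\ge1}\|(\ell^{-1/2}\sum_{x=1}^\ell(\eta(x)-\rho))^2\|_{L^4(\nu_\rho)}<\infty$. Set $\sigma^2_\ell(\rho)=E_{\nu_\rho}[((2\ell+1)^{-1/2}\sum_{x\in\Lambda_\ell}(\eta(x)-\rho))^2]$. (D1) For $|\lambda|<\lambda^*$ the tilted measures $\nu_\rho^\lambda$, with $\frac{d\nu_\rho^\lambda}{d\nu_\rho}(\eta=e\text{ on }\Lambda_\ell\mid\eta=\xi\text{ off }\Lambda_\ell)=e^{\lambda\sum_{x\in\Lambda_\ell}(e(x)-\rho)}/Z(\lambda,\ell,\xi)$, are well defined as limits $\ell\to\infty$ independent of $\xi$, and $E_{\nu^\lambda_\rho}[\eta(0)]$ is strictly increasing in $\lambda$. For $z$ in the range of densities, $\lambda(z)$ is defined by $E_{\nu_\rho^{\lambda(z)}}[\eta(0)]=z$ and $\nu_z=\nu_\rho^{\lambda(z)}$. For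 local $f\in L^2(\nu_\rho)$: $\varphi_f(z)=E_{\nu_z}[f]$, $\varphi'_f(z)=\lambda'(z)E_{\nu_z}[(f-E_{\nu_z}[f])\sum_{x\in\mathbb Z}(\eta(x)-z)]$, $\varphi''_f(z)=\lambda'(z)^2E_{\nu_z}[(f-E_{\nu_z}[f])(\sum_x(\eta(x)-z))^2]+\lambda''(z)E_{\nu_z}[(f-E_{\nu_z}[f])\sum_x(\eta(x)-z)]$ (limits of sums over finite boxes). (D2) These limits are well defined, $|\varphi'_f(\rho)|,|\varphi''_f(\rho)|\le C(\rho)\|f\|_{L^2(\nu_\rho)}$, and $\varphi'_{f_n}(\rho)\to\varphi'_f(\rho)$, $\varphi''_{f_n}(\rho)\to\varphi''_f(\rho)$ for local $f_n\to f$ pointwise with $f_n\le\hat f\in L^2(\nu_\rho)$. (G) Let $\nu_{k,\ell,\xi}=\nu_\rho(\cdot\mid\sum_{x\in\Lambda_\ell}\eta(x)=k,\ \eta=\xi\text{ off }\Lambda_\ell)$ and let $W(k,\ell,\xi,n)\in[0,\infty]$ be the reciprocal of the spectral gap of the localized symmetric dynamics with generator $\frac12\sum_{x,x+1\in\Lambda_\ell}\{b^{R,n}_x\nabla_{x,x+1}+b^{L,n}_x\nabla_{x+1,x}\}$, i.e. the best constant in $\mathrm{Var}(f,\nu_{k,\ell,\xi})\le W\cdot\frac12\sum_{x,x+1\in\Lambda_\ell}E_{\nu_{k,\ell,\xi}}[b^{R,n}_x(\nabla_{x,x+1}f)^2]$. There is $C=C(\rho)$ with $E_{\nu_\rho}[W(\sum_{x\in\Lambda_\ell}\eta(x),\ell,\eta^c_\ell,n)^2]\le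 C\ell^4$ for all $n\ge 1$ and $\ell\ge1$. (EE) There is $\alpha_0>0$ such that for local $f\in L^5(\nu_\rho)$ supported on $\Lambda_{\ell_0}$ and $\ell\ge\ell_0$, with $C=C(\rho,\ell_0,\alpha_0)$: if $\varphi_f(\rho)=\varphi_f'(\rho)=0$, then $\|E_{\nu_\rho}[f|\eta^{(\ell)},\eta^c_\ell]-\frac{\varphi''_f(\rho)}2[(\eta^{(\ell)}-\rho)^2-\frac{\sigma^2_\ell(\rho)}{2\ell+1}]\|_{L^4(\nu_\rho)}\le C\|f\|_{L^5(\nu_\rho)}\ell^{-1-\alpha_0/2}$; if only $\varphi_f(\rho)=0$, then $\|E_{\nu_\rho}[f|\eta^{(\ell)},\eta^c_\ell]-\varphi'_f(\rho)(\eta^{(\ell)}-\rho)\|_{L^4(\nu_\rho)}\le C\|f\|_{L^5(\nu_\rho)}\ell^{-1/2-\alpha_0/2}$. Under these assumptions $\nu_\rho$ is invariant for $L_n$. Constants may depend on the constants in the assumptions but not on $n,t,\ell,h,f$. *)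

theory Defs
  imports "HOL-Probability.Probability"
begin

section \<open>Configurations and local functions\<close>

type_synonym config = "int \<Rightarrow> nat"

definition config_space :: "config measure" where
  "config_space = Pi\<^sub>M UNIV (\<lambda>_. count_space UNIV)"

definition box :: "nat \<Rightarrow> int set" where
  "box l = {- int l..int l}"

definition translate :: "int \<Rightarrow> config \<Rightarrow> config" where
  "translate x \<eta> = (\<lambda>z. \<eta> (x + z))"

text \<open>Moving a particle away from an empty site leaves the configuration unchanged; such jumps
  will have rate zero.\<close>

definition move :: "int \<Rightarrow> int \<Rightarrow> config \<Rightarrow> config" where
  "move x y \<eta> = (if \<eta> x = 0 then \<eta> else \<eta>(x := \<eta> x - 1, y := \<eta> y + 1))"

definition grad :: "int \<Rightarrow> int \<Rightarrow> (config \<Rightarrow> real) \<Rightarrow> config \<Rightarrow> real" where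
  "grad x y f \<eta> = f (move x y \<eta>) - f \<eta>"

definition supported_on :: "nat \<Rightarrow> (config \<Rightarrow> real) \<Rightarrow> bool" where
  "supported_on l f \<longleftrightarrow> (\<forall>\<eta> \<zeta>. (\<forall>x\<in>box l. \<eta> x = \<zeta> x) \<longrightarrow> f \<eta> = f \<zeta>)"

definition local_fun :: "(config \<Rightarrow> real) \<Rightarrow> bool" where
  "local_fun f \<longleftrightarrow> (\<exists>l. supported_on l f)"

definition block_avg :: "nat \<Rightarrow> config \<Rightarrow> int \<Rightarrow> real" where
  "block_avg l \<eta> x = (\<Sum>y\<in>box l. real (\<eta> (x + y))) / (2 * real l + 1)"

definition Lp :: "real \<Rightarrow> 'a measure \<Rightarrow> ('a \<Rightarrow> real) set" where
  "Lp p M = {f \<in> borel_measurable M. integrable M (\<lambda>x. \<bar>f x\<bar> powr p)}"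

definition Lnorm :: "real \<Rightarrow> 'a measure \<Rightarrow> ('a \<Rightarrow> real) \<Rightarrow> real" where
  "Lnorm p M f = (\<integral>x. \<bar>f x\<bar> powr p \<partial>M) powr (1 / p)"


section \<open>Jump rates\<close>

text \<open>\<open>bR n\<close> and \<open>bL n\<close> are the rates at the bond \<open>{0, 1}\<close>; the rate at the bond \<open>{x, x + 1}\<close> in
  the configuration \<open>\<eta>\<close> is \<open>bR n (translate x \<eta>)\<close>, respectively \<open>bL n (translate x \<eta>)\<close>.\<close>

definition gradient_rates ::
    "(nat \<Rightarrow> config \<Rightarrow> real) \<Rightarrow> (nat \<Rightarrow> config \<Rightarrow> real) \<Rightarrow> bool" where
  "gradient_rates bR bL \<longleftrightarrow> (\<exists>R\<ge>1.
     (\<forall>n\<ge>1. supported_on R (bR n) \<and> supported_on R (bL n)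
        \<and> (\<forall>\<eta>. bR n \<eta> \<ge> 0 \<and> bL n \<eta> \<ge> 0)
        \<and> (\<forall>\<eta>. \<eta> 0 = 0 \<longrightarrow> bR n \<eta> = 0) \<and> (\<forall>\<eta>. \<eta> 1 = 0 \<longrightarrow> bL n \<eta> = 0)) \<and>
     (\<exists>C. \<forall>n\<ge>1. \<forall>\<eta>. \<bar>bR n \<eta>\<bar> + \<bar>bL n \<eta>\<bar> \<le> C * (\<Sum>y\<in>box R. real (\<eta> y))) \<and>
     (\<exists>c :: nat \<Rightarrow> config \<Rightarrow> real.
        (\<forall>n\<ge>1. supported_on R (c n) \<and> (\<forall>\<eta>. c n \<eta> \<ge> 0) \<and>
          (\<forall>x \<eta>. bR n (translate x \<eta>) - bL n (translate x \<eta>) = c n (translate x \<eta>) - c n (translate (x + 1) \<eta>))) \<and>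
        (\<forall>\<eta>. convergent (\<lambda>n. bR n \<eta>) \<and> convergent (\<lambda>n. bL n \<eta>) \<and> convergent (\<lambda>n. c n \<eta>))))"

definition detailed_balance ::
    "config measure \<Rightarrow> (nat \<Rightarrow> config \<Rightarrow> real) \<Rightarrow> (nat \<Rightarrow> config \<Rightarrow> real) \<Rightarrow> bool" where
  "detailed_balance \<nu> bR bL \<longleftrightarrow> (\<forall>n\<ge>1. \<forall>x f g.
     local_fun f \<and> bounded (range f) \<and> local_fun g \<and> bounded (range g) \<longrightarrow>
     (\<integral>\<eta>. bR n (translate x \<eta>) * f \<eta> * g (move x (x + 1) \<eta>) \<partial>\<nu>)
       = (\<integral>\<eta>. bL n (translate x \<eta>) * f (move (x + 1) x \<eta>) * g \<eta> \<partial>\<nu>))"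


section \<open>The static measure\<close>

definition mixing_exp_moments :: "config measure \<Rightarrow> real \<Rightarrow> real \<Rightarrow> bool" where
  "mixing_exp_moments \<nu> \<rho> \<theta>s \<longleftrightarrow>
     (\<forall>x. distr \<nu> config_space (translate x) = \<nu>) \<and>
     (\<forall>f h. local_fun f \<and> local_fun h \<and> f \<in> Lp 2 \<nu> \<and> h \<in> Lp 2 \<nu> \<longrightarrow>
        ((\<lambda>x. \<integral>\<eta>. f \<eta> * h (translate x \<eta>) \<partial>\<nu>) \<longlongrightarrow> (\<integral>\<eta>. f \<eta> \<partial>\<nu>) * (\<integral>\<eta>. h \<eta> \<partial>\<nu>))
          (filtercomap abs at_top)) \<and>
     integrable \<nu> (\<lambda>\<eta>. real (\<eta> 0)) \<and> (\<integral>\<eta>. real (\<eta> 0) \<partial>\<nu>) = \<rho> \<and>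
     \<theta>s > 0 \<and> (\<forall>\<theta>. \<bar>\<theta>\<bar> \<le> \<theta>s \<longrightarrow> integrable \<nu> (\<lambda>\<eta>. exp (\<theta> * real (\<eta> 0))))"

definition schwartz :: "(real \<Rightarrow> real) set" where
  "schwartz = {G. \<forall>k. (\<forall>x. (deriv ^^ k) G differentiable at x) \<and>
                  (\<forall>j. bounded (range (\<lambda>x. x ^ j * (deriv ^^ k) G x)))}"

definition fluct_field :: "real \<Rightarrow> nat \<Rightarrow> (real \<Rightarrow> real) \<Rightarrow> config \<Rightarrow> real" where
  "fluct_field \<rho> n G \<eta> = (\<Sum>\<^sub>\<infinity>x\<in>UNIV. (real (\<eta> x) - \<rho>) * G (real_of_int x / real n)) / sqrt (real n)"

definition fluct_cov ::
    "config measure \<Rightarrow> real \<Rightarrow> nat \<Rightarrow> (real \<Rightarrow> real) \<Rightarrow> (real \<Rightarrow> real) \<Rightarrow> real" where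
  "fluct_cov \<nu> \<rho> n G H =
     (\<integral>\<eta>. fluct_field \<rho> n G \<eta> * fluct_field \<rho> n H \<eta> \<partial>\<nu>)
       - (\<integral>\<eta>. fluct_field \<rho> n G \<eta> \<partial>\<nu>) * (\<integral>\<eta>. fluct_field \<rho> n H \<eta> \<partial>\<nu>)"

definition limit_cov :: "config measure \<Rightarrow> real \<Rightarrow> (real \<Rightarrow> real) \<Rightarrow> (real \<Rightarrow> real) \<Rightarrow> real" where
  "limit_cov \<nu> \<rho> G H = lim (\<lambda>n. fluct_cov \<nu> \<rho> n G H)"

definition centred_gaussian :: "real \<Rightarrow> real measure" where
  "centred_gaussian v =
     (if v = 0 then return borel 0 else density lborel (\<lambda>x. ennreal (normal_density 0 (sqrt v) x)))"

text \<open>A random field indexed by test functions, given by its law \<open>Q\<close> on the product space.\<close>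

definition gaussian_field ::
    "((real \<Rightarrow> real) \<Rightarrow> (real \<Rightarrow> real) \<Rightarrow> real) \<Rightarrow> ((real \<Rightarrow> real) \<Rightarrow> real) measure \<Rightarrow> bool" where
  "gaussian_field K Q \<longleftrightarrow> prob_space Q \<and> sets Q = sets (Pi\<^sub>M schwartz (\<lambda>_. borel)) \<and>
     (\<forall>(k::nat) G a. (\<forall>i<k. G i \<in> schwartz) \<longrightarrow>
        (let v = (\<Sum>i<k. \<Sum>j<k. a i * a j * K (G i) (G j)) in
          v \<ge> 0 \<and> distr Q borel (\<lambda>y. \<Sum>i<k. a i * y (G i)) = centred_gaussian v))"

text \<open>Weak convergence of the random fields means convergence of the joint laws of finitely many
  test-function evaluations.\<close>

definition static_fluctuations :: "config measure \<Rightarrow> real \<Rightarrow> bool" where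
  "static_fluctuations \<nu> \<rho> \<longleftrightarrow>
     (\<forall>G\<in>schwartz. \<forall>H\<in>schwartz. convergent (\<lambda>n. fluct_cov \<nu> \<rho> n G H)) \<and>
     (\<exists>Q. gaussian_field (limit_cov \<nu> \<rho>) Q \<and>
        (\<forall>(k::nat) G (F :: (nat \<Rightarrow> real) \<Rightarrow> real).
           (\<forall>i<k. G i \<in> schwartz) \<and> continuous_on UNIV F \<and> bounded (range F) \<longrightarrow>
           (\<lambda>n. \<integral>\<eta>. F (\<lambda>i. if i < k then fluct_field \<rho> n (G i) \<eta> else 0) \<partial>\<nu>)
             \<longlonglongrightarrow> (\<integral>y. F (\<lambda>i. if i < k then y (G i) else 0) \<partial>Q))) \<and>
     (\<exists>C. \<forall>G\<in>schwartz. limit_cov \<nu> \<rho> G G \<le> C * (\<integral>u. (G u)\<^sup>2 \<partial>lborel)) \<and>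
     (\<exists>B. \<forall>l\<ge>1.
        Lnorm 4 \<nu> (\<lambda>\<eta>. ((\<Sum>x = 1..int l. real (\<eta> x) - \<rho>) / sqrt (real l))\<^sup>2) \<le> B)"

definition sigma2 :: "config measure \<Rightarrow> real \<Rightarrow> nat \<Rightarrow> real" where
  "sigma2 \<nu> \<rho> l = (\<integral>\<eta>. ((\<Sum>x\<in>box l. real (\<eta> x) - \<rho>) / sqrt (2 * real l + 1))\<^sup>2 \<partial>\<nu>)"


section \<open>Conditional and tilted measures\<close>

definition outside_alg :: "nat \<Rightarrow> config measure" where
  "outside_alg l =
     vimage_algebra UNIV (\<lambda>\<eta>. restrict \<eta> (- box l)) (Pi\<^sub>M (- box l) (\<lambda>_. count_space UNIV))"

definition canonical_alg :: "nat \<Rightarrow> config measure" where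
  "canonical_alg l =
     vimage_algebra UNIV (\<lambda>\<eta>. (block_avg l \<eta> 0, restrict \<eta> (- box l)))
       (borel \<Otimes>\<^sub>M Pi\<^sub>M (- box l) (\<lambda>_. count_space UNIV))"

definition agree_off :: "nat \<Rightarrow> config \<Rightarrow> config set" where
  "agree_off l \<xi> = {\<eta>. \<forall>x. x \<notin> box l \<longrightarrow> \<eta> x = \<xi> x}"

text \<open>A version of the conditional law of \<open>\<nu>\<close> given the configuration \<open>\<xi>\<close> off the box. It lives on
  the countable set of configurations agreeing with \<open>\<xi>\<close> off the box and is therefore given by its
  point masses.\<close>

definition cond_law :: "config measure \<Rightarrow> nat \<Rightarrow> config \<Rightarrow> config measure" where
  "cond_law \<nu> l \<xi> = point_measure (agree_off l \<xi>)
     (\<lambda>e. ennreal (real_cond_exp \<nu> (outside_alg l) (indicator {\<eta>. \<forall>x\<in>box l. \<eta> x = e x}) \<xi>))"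

definition canonical_law :: "config measure \<Rightarrow> nat \<Rightarrow> nat \<Rightarrow> config \<Rightarrow> config measure" where
  "canonical_law \<nu> k l \<xi> =
     uniform_measure (cond_law \<nu> l \<xi>) {\<eta> \<in> agree_off l \<xi>. (\<Sum>x\<in>box l. \<eta> x) = k}"

definition tilt_weight :: "real \<Rightarrow> real \<Rightarrow> nat \<Rightarrow> config \<Rightarrow> ennreal" where
  "tilt_weight \<rho> \<theta> l \<eta> = ennreal (exp (\<theta> * (\<Sum>x\<in>box l. real (\<eta> x) - \<rho>)))"

definition partition_fun :: "config measure \<Rightarrow> real \<Rightarrow> real \<Rightarrow> nat \<Rightarrow> config \<Rightarrow> ennreal" where
  "partition_fun \<nu> \<rho> \<theta> l \<xi> = (\<integral>\<^sup>+\<eta>. tilt_weight \<rho> \<theta> l \<eta> \<partial>cond_law \<nu> l \<xi>)"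

definition tilted_law :: "config measure \<Rightarrow> real \<Rightarrow> real \<Rightarrow> nat \<Rightarrow> config \<Rightarrow> config measure" where
  "tilted_law \<nu> \<rho> \<theta> l \<xi> =
     density (cond_law \<nu> l \<xi>) (\<lambda>\<eta>. tilt_weight \<rho> \<theta> l \<eta> / partition_fun \<nu> \<rho> \<theta> l \<xi>)"

text \<open>\<open>\<nu>T \<theta>\<close> is the weak limit of the finite-volume tilts for almost every boundary condition.
  Single sites carry the discrete topology, so weak convergence is convergence of the probabilities
  of cylinder events.\<close>

definition tilted_family ::
    "config measure \<Rightarrow> real \<Rightarrow> real \<Rightarrow> (real \<Rightarrow> config measure) \<Rightarrow> bool" where
  "tilted_family \<nu> \<rho> \<theta>s \<nu>T \<longleftrightarrow>
     (\<forall>\<theta>. \<bar>\<theta>\<bar> < \<theta>s \<longrightarrow>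
        prob_space (\<nu>T \<theta>) \<and> sets (\<nu>T \<theta>) = sets config_space \<and>
        (AE \<xi> in \<nu>. (\<forall>l. partition_fun \<nu> \<rho> \<theta> l \<xi> < \<infinity>) \<and>
           (\<forall>k e. (\<lambda>l. emeasure (tilted_law \<nu> \<rho> \<theta> l \<xi>) {\<eta> \<in> agree_off l \<xi>. \<forall>x\<in>box k. \<eta> x = e x})
                    \<longlonglongrightarrow> emeasure (\<nu>T \<theta>) {\<eta>. \<forall>x\<in>box k. \<eta> x = e x})) \<and>
        integrable (\<nu>T \<theta>) (\<lambda>\<eta>. real (\<eta> 0))) \<and>
     strict_mono_on {-\<theta>s<..<\<theta>s} (\<lambda>\<theta>. \<integral>\<eta>. real (\<eta> 0) \<partial>\<nu>T \<theta>)"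

definition tilt_of :: "(real \<Rightarrow> config measure) \<Rightarrow> real \<Rightarrow> real \<Rightarrow> real" where
  "tilt_of \<nu>T \<theta>s z = (THE \<theta>. \<bar>\<theta>\<bar> < \<theta>s \<and> (\<integral>\<eta>. real (\<eta> 0) \<partial>\<nu>T \<theta>) = z)"

definition nu_at :: "(real \<Rightarrow> config measure) \<Rightarrow> real \<Rightarrow> real \<Rightarrow> config measure" where
  "nu_at \<nu>T \<theta>s z = \<nu>T (tilt_of \<nu>T \<theta>s z)"

definition phi :: "(real \<Rightarrow> config measure) \<Rightarrow> real \<Rightarrow> (config \<Rightarrow> real) \<Rightarrow> real \<Rightarrow> real" where
  "phi \<nu>T \<theta>s f z = (\<integral>\<eta>. f \<eta> \<partial>nu_at \<nu>T \<theta>s z)"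

definition box_moment ::
    "(real \<Rightarrow> config measure) \<Rightarrow> real \<Rightarrow> (config \<Rightarrow> real) \<Rightarrow> real \<Rightarrow> nat \<Rightarrow> nat \<Rightarrow> real" where
  "box_moment \<nu>T \<theta>s f z j l =
     (\<integral>\<eta>. (f \<eta> - phi \<nu>T \<theta>s f z) * (\<Sum>x\<in>box l. real (\<eta> x) - z) ^ j \<partial>nu_at \<nu>T \<theta>s z)"

definition phi' :: "(real \<Rightarrow> config measure) \<Rightarrow> real \<Rightarrow> (config \<Rightarrow> real) \<Rightarrow> real \<Rightarrow> real" where
  "phi' \<nu>T \<theta>s f z = deriv (tilt_of \<nu>T \<theta>s) z * lim (box_moment \<nu>T \<theta>s f z 1)"

definition phi'' :: "(real \<Rightarrow> config measure) \<Rightarrow> real \<Rightarrow> (config \<Rightarrow> real) \<Rightarrow> real \<Rightarrow> real" where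
  "phi'' \<nu>T \<theta>s f z =
     (deriv (tilt_of \<nu>T \<theta>s) z)\<^sup>2 * lim (box_moment \<nu>T \<theta>s f z 2)
       + deriv (deriv (tilt_of \<nu>T \<theta>s)) z * lim (box_moment \<nu>T \<theta>s f z 1)"

text \<open>Differentiability of the tilt as a function of the density is what the derivatives in \<open>phi'\<close> and
  \<open>phi''\<close> presuppose. The bound and the continuity are required on each fixed box only: for
  product measures and \<open>f\<close> the sum of \<open>\<eta> x - \<rho>\<close> over a box, \<open>phi'\<close> grows like the size of the box but the
  \<open>L\<^sup>2\<close> norm only like its square root. Domination in the last clause is two-sided: with only an upper
  bound the continuity fails already for product measures with unbounded occupation numbers.\<close>

definition density_derivatives ::
    "config measure \<Rightarrow> real \<Rightarrow> real \<Rightarrow> (real \<Rightarrow> config measure) \<Rightarrow> bool" where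
  "density_derivatives \<nu> \<rho> \<theta>s \<nu>T \<longleftrightarrow>
     (\<forall>\<^sub>F z in nhds \<rho>. tilt_of \<nu>T \<theta>s differentiable at z) \<and>
     deriv (tilt_of \<nu>T \<theta>s) differentiable at \<rho> \<and>
     (\<forall>f. local_fun f \<and> f \<in> Lp 2 \<nu> \<longrightarrow>
        convergent (box_moment \<nu>T \<theta>s f \<rho> 1) \<and> convergent (box_moment \<nu>T \<theta>s f \<rho> 2)) \<and>
     (\<forall>k. \<exists>C. \<forall>f. supported_on k f \<and> f \<in> Lp 2 \<nu> \<longrightarrow>
        \<bar>phi' \<nu>T \<theta>s f \<rho>\<bar> \<le> C * Lnorm 2 \<nu> f \<and> \<bar>phi'' \<nu>T \<theta>s f \<rho>\<bar> \<le> C * Lnorm 2 \<nu> f) \<and>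
     (\<forall>k F f fhat. (\<forall>n::nat. supported_on k (F n)) \<and> supported_on k f \<and> fhat \<in> Lp 2 \<nu> \<and>
        (\<forall>\<eta>. (\<lambda>n. F n \<eta>) \<longlonglongrightarrow> f \<eta>) \<and> (\<forall>n \<eta>. \<bar>F n \<eta>\<bar> \<le> fhat \<eta>) \<longrightarrow>
        (\<lambda>n. phi' \<nu>T \<theta>s (F n) \<rho>) \<longlonglongrightarrow> phi' \<nu>T \<theta>s f \<rho> \<and>
        (\<lambda>n. phi'' \<nu>T \<theta>s (F n) \<rho>) \<longlonglongrightarrow> phi'' \<nu>T \<theta>s f \<rho>)"


section \<open>Spectral gap and equivalence of ensembles\<close>

definition var_under :: "config measure \<Rightarrow> (config \<Rightarrow> real) \<Rightarrow> real" where
  "var_under \<kappa> f = (\<integral>\<eta>. (f \<eta> - (\<integral>\<zeta>. f \<zeta> \<partial>\<kappa>))\<^sup>2 \<partial>\<kappa>)"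

definition dirichlet_box ::
    "config measure \<Rightarrow> (config \<Rightarrow> real) \<Rightarrow> nat \<Rightarrow> (config \<Rightarrow> real) \<Rightarrow> real" where
  "dirichlet_box \<kappa> b l f =
     (\<Sum>x | x \<in> box l \<and> x + 1 \<in> box l. \<integral>\<eta>. b (translate x \<eta>) * (grad x (x + 1) f \<eta>)\<^sup>2 \<partial>\<kappa>) / 2"

text \<open>The infimum over the empty set is \<open>\<infinity>\<close>, the value in the absence of a spectral gap.\<close>

definition inv_gap ::
    "config measure \<Rightarrow> (nat \<Rightarrow> config \<Rightarrow> real) \<Rightarrow> nat \<Rightarrow> nat \<Rightarrow> config \<Rightarrow> nat \<Rightarrow> ennreal" where
  "inv_gap \<nu> bR k l \<xi> n = Inf {w. \<forall>f.
     ennreal (var_under (canonical_law \<nu> k l \<xi>) f)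
       \<le> w * ennreal (dirichlet_box (canonical_law \<nu> k l \<xi>) (bR n) l f)}"

definition spectral_gap_bound :: "config measure \<Rightarrow> (nat \<Rightarrow> config \<Rightarrow> real) \<Rightarrow> bool" where
  "spectral_gap_bound \<nu> bR \<longleftrightarrow> (\<exists>C::real. \<forall>n\<ge>1. \<forall>l\<ge>1.
     (\<integral>\<^sup>+\<eta>. (inv_gap \<nu> bR (\<Sum>x\<in>box l. \<eta> x) l \<eta> n)\<^sup>2 \<partial>\<nu>) \<le> ennreal (C * real l ^ 4))"

definition equivalence_of_ensembles ::
    "config measure \<Rightarrow> real \<Rightarrow> real \<Rightarrow> (real \<Rightarrow> config measure) \<Rightarrow> real \<Rightarrow> bool" where
  "equivalence_of_ensembles \<nu> \<rho> \<theta>s \<nu>T \<alpha>\<^sub>0 \<longleftrightarrow> \<alpha>\<^sub>0 > 0 \<and> (\<forall>l\<^sub>0. \<exists>C. \<forall>f l.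
     supported_on l\<^sub>0 f \<and> f \<in> Lp 5 \<nu> \<and> l \<ge> l\<^sub>0 \<and> l \<ge> 1 \<and> phi \<nu>T \<theta>s f \<rho> = 0 \<longrightarrow>
     (phi' \<nu>T \<theta>s f \<rho> = 0 \<longrightarrow>
        Lnorm 4 \<nu> (\<lambda>\<eta>. real_cond_exp \<nu> (canonical_alg l) f \<eta>
            - phi'' \<nu>T \<theta>s f \<rho> / 2 * ((block_avg l \<eta> 0 - \<rho>)\<^sup>2 - sigma2 \<nu> \<rho> l / (2 * real l + 1)))
          \<le> C * Lnorm 5 \<nu> f * real l powr (- 1 - \<alpha>\<^sub>0 / 2)) \<and>
     Lnorm 4 \<nu> (\<lambda>\<eta>. real_cond_exp \<nu> (canonical_alg l) f \<eta>
         - phi' \<nu>T \<theta>s f \<rho> * (block_avg l \<eta> 0 - \<rho>))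
       \<le> C * Lnorm 5 \<nu> f * real l powr (- 1 / 2 - \<alpha>\<^sub>0 / 2))"


section \<open>Dynamics\<close>

definition jump_prob :: "real \<Rightarrow> real \<Rightarrow> nat \<Rightarrow> real" where
  "jump_prob a \<gamma> n = 1 / 2 + a / (2 * real n powr \<gamma>)"

text \<open>For local \<open>f\<close> only finitely many summands are nonzero.\<close>

definition generator_formula ::
    "(nat \<Rightarrow> config \<Rightarrow> real) \<Rightarrow> (nat \<Rightarrow> config \<Rightarrow> real) \<Rightarrow> real \<Rightarrow> real \<Rightarrow> nat
      \<Rightarrow> (config \<Rightarrow> real) \<Rightarrow> config \<Rightarrow> real" where
  "generator_formula bR bL a \<gamma> n f \<eta> = (real n)\<^sup>2 * (\<Sum>\<^sub>\<infinity>x\<in>UNIV.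
     bR n (translate x \<eta>) * jump_prob a \<gamma> n * grad x (x + 1) f \<eta>
       + bL n (translate x \<eta>) * (1 - jump_prob a \<gamma> n) * grad (x + 1) x f \<eta>)"

text \<open>Elements of \<open>L\<^sup>2\<close> are represented by functions, so all identities hold almost everywhere.\<close>

definition markov_semigroup ::
    "config measure \<Rightarrow> (real \<Rightarrow> (config \<Rightarrow> real) \<Rightarrow> config \<Rightarrow> real) \<Rightarrow> bool" where
  "markov_semigroup \<nu> T \<longleftrightarrow>
     (\<forall>t\<ge>0. \<forall>f\<in>Lp 2 \<nu>. T t f \<in> Lp 2 \<nu>) \<and>
     (\<forall>t\<ge>0. \<forall>f\<in>Lp 2 \<nu>. \<forall>g\<in>Lp 2 \<nu>. \<forall>\<alpha> \<beta>.
        AE \<eta> in \<nu>. T t (\<lambda>\<zeta>. \<alpha> * f \<zeta> + \<beta> * g \<zeta>) \<eta> = \<alpha> * T t f \<eta> + \<beta> * T t g \<eta>) \<and>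
     (\<forall>t\<ge>0. \<exists>K. \<forall>f\<in>Lp 2 \<nu>. Lnorm 2 \<nu> (T t f) \<le> K * Lnorm 2 \<nu> f) \<and>
     (\<forall>t\<ge>0. \<forall>f\<in>Lp 2 \<nu>. (AE \<eta> in \<nu>. f \<eta> \<ge> 0) \<longrightarrow> (AE \<eta> in \<nu>. T t f \<eta> \<ge> 0)) \<and>
     (\<forall>t\<ge>0. AE \<eta> in \<nu>. T t (\<lambda>_. 1) \<eta> = 1) \<and>
     (\<forall>f\<in>Lp 2 \<nu>. AE \<eta> in \<nu>. T 0 f \<eta> = f \<eta>) \<and>
     (\<forall>s\<ge>0. \<forall>t\<ge>0. \<forall>f\<in>Lp 2 \<nu>. AE \<eta> in \<nu>. T (s + t) f \<eta> = T s (T t f) \<eta>) \<and>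
     (\<forall>f\<in>Lp 2 \<nu>. ((\<lambda>t. Lnorm 2 \<nu> (\<lambda>\<eta>. T t f \<eta> - f \<eta>)) \<longlongrightarrow> 0) (at_right 0))"

text \<open>\<open>f\<close> is in the domain of the generator of \<open>T\<close>, which maps it to \<open>g\<close>.\<close>

definition has_generator ::
    "config measure \<Rightarrow> (real \<Rightarrow> (config \<Rightarrow> real) \<Rightarrow> config \<Rightarrow> real)
      \<Rightarrow> (config \<Rightarrow> real) \<Rightarrow> (config \<Rightarrow> real) \<Rightarrow> bool" where
  "has_generator \<nu> T f g \<longleftrightarrow> f \<in> Lp 2 \<nu> \<and> g \<in> Lp 2 \<nu> \<and>
     ((\<lambda>t. Lnorm 2 \<nu> (\<lambda>\<eta>. (T t f \<eta> - f \<eta>) / t - g \<eta>)) \<longlongrightarrow> 0) (at_right 0)"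

definition generator_core ::
    "config measure \<Rightarrow> (real \<Rightarrow> (config \<Rightarrow> real) \<Rightarrow> config \<Rightarrow> real)
      \<Rightarrow> ((config \<Rightarrow> real) \<Rightarrow> config \<Rightarrow> real) \<Rightarrow> (config \<Rightarrow> real) set \<Rightarrow> bool" where
  "generator_core \<nu> T L D \<longleftrightarrow>
     (\<lambda>_. 0) \<in> D \<and> (\<forall>f\<in>D. \<forall>g\<in>D. \<forall>\<alpha> \<beta>. (\<lambda>\<eta>. \<alpha> * f \<eta> + \<beta> * g \<eta>) \<in> D) \<and>
     (\<forall>f\<in>D. has_generator \<nu> T f (L f)) \<and>
     (\<forall>f g. has_generator \<nu> T f g \<longrightarrow> (\<forall>\<epsilon>>0. \<exists>u\<in>D.
        Lnorm 2 \<nu> (\<lambda>\<eta>. f \<eta> - u \<eta>) < \<epsilon> \<and> Lnorm 2 \<nu> (\<lambda>\<eta>. g \<eta> - L u \<eta>) < \<epsilon>))"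

definition past :: "'w measure \<Rightarrow> (real \<Rightarrow> 'w \<Rightarrow> config) \<Rightarrow> real \<Rightarrow> 'w measure" where
  "past P X s = sigma (space P)
     {X u -` A \<inter> space P | u A. 0 \<le> u \<and> u \<le> s \<and> A \<in> sets config_space}"

text \<open>Joint measurability in time and chance is what makes the time integrals of the path meaningful.\<close>

definition markov_process ::
    "config measure \<Rightarrow> (real \<Rightarrow> (config \<Rightarrow> real) \<Rightarrow> config \<Rightarrow> real)
      \<Rightarrow> 'w measure \<Rightarrow> (real \<Rightarrow> 'w \<Rightarrow> config) \<Rightarrow> bool" where
  "markov_process \<nu> T P X \<longleftrightarrow> prob_space P \<and>
     (\<lambda>(s, \<omega>). X s \<omega>) \<in> restrict_space borel {0..} \<Otimes>\<^sub>M P \<rightarrow>\<^sub>M config_space \<and>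
     distr P config_space (X 0) = \<nu> \<and>
     (\<forall>s\<ge>0. \<forall>t\<ge>0. \<forall>g\<in>Lp 2 \<nu>. AE \<omega> in P.
        real_cond_exp P (past P X s) (\<lambda>\<omega>'. g (X (s + t) \<omega>')) \<omega> = T t g (X s \<omega>))"

text \<open>\<open>X\<close> under \<open>P\<close> is the process at scaling parameter \<open>n\<close> started from \<open>\<nu>\<close>.\<close>

definition particle_process ::
    "config measure \<Rightarrow> (nat \<Rightarrow> config \<Rightarrow> real) \<Rightarrow> (nat \<Rightarrow> config \<Rightarrow> real) \<Rightarrow> real \<Rightarrow> real \<Rightarrow> nat
      \<Rightarrow> 'w measure \<Rightarrow> (real \<Rightarrow> 'w \<Rightarrow> config) \<Rightarrow> bool" where
  "particle_process \<nu> bR bL a \<gamma> n P X \<longleftrightarrow> (\<exists>T D. markov_semigroup \<nu> T \<and>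
     (\<forall>f\<in>D. local_fun f) \<and> generator_core \<nu> T (generator_formula bR bL a \<gamma> n) D \<and>
     markov_process \<nu> T P X)"

end

theory Submission
  imports Defs
begin

text \<open>
  Conditioning \<open>f\<close> on the density and the exterior of a block of size \<open>l\<close> splits the additive functional
  into two parts. For the difference between \<open>f\<close> and its conditional expectation one passes through blocks of
  sizes \<open>l, l/2, l/4, \<dots>\<close>; each difference of successive conditional expectations has mean zero under the
  canonical measures, so the spectral gap bounds its pairing with a core function \<open>\<phi>\<close> by the Dirichlet form,
  and the overlapping blocks are summed by Cauchy--Schwarz. A pairing bound of this kind controls the second
  moment of the time integral: the Laplace transform of the autocorrelation is a resolvent quadratic form,
  which is bounded by the dual norm, and approximate subadditivity of the second moment in time turns the
  Laplace bound into one at each time. The antisymmetric part of the generator does not contribute to the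
  Dirichlet form, because the gradient condition makes it telescope and mixing kills the boundary term. For
  the remaining part, the conditional expectation minus its first or second order expansion in the density,
  the equivalence of ensembles and stationarity suffice.
\<close>

text \<open>Three obstacles shape the proof. Detailed balance is given for bounded local functions
  only, and the generator only on its core, so energy estimates are made for truncated core
  functions and then passed to the limit. Contraction of the semigroup is not given either: it is
  derived by Cauchy--Schwarz on path space, which presupposes stationarity and hence invariance, so
  invariance has to be proved with the orbit bounds that positivity yields for bounded functions.
  Finally, resolvents are cut off at a finite time; the cut-off object makes sense without discount
  as well and serves both the invariance proof and the variance bound.

  The powers of \<open>l\<close> arise as follows. A block of size \<open>l\<close> costs a factor
  \<open>l\<close> for the spectral gap and \<open>sqrt l\<close> for the overlap, while the fourth
  norm of the conditional expectation gains \<open>1 / l\<close> in the quadratic and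
  \<open>1 / sqrt l\<close> in the linear case. The products \<open>sqrt l\<close> and
  \<open>l\<close> grow geometrically under doubling, so the largest block dominates, and their
  squares are the factors \<open>l\<close> and \<open>l ^ 2\<close> of the theorem. The factor
  \<open>n ^ 2\<close> of the generator yields the two powers of \<open>1 / n\<close>.\<close>

definition square_integrable :: "'a measure \<Rightarrow> ('a \<Rightarrow> real) \<Rightarrow> bool" where
  "square_integrable M f \<longleftrightarrow> f \<in> borel_measurable M \<and> integrable M (\<lambda>x. (f x)\<^sup>2)"

definition ip :: "'a measure \<Rightarrow> ('a \<Rightarrow> real) \<Rightarrow> ('a \<Rightarrow> real) \<Rightarrow> real" where
  "ip M f g = (\<integral>x. f x * g x \<partial>M)"

definition n2 :: "'a measure \<Rightarrow> ('a \<Rightarrow> real) \<Rightarrow> real" where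
  "n2 M f = sqrt (\<integral>x. (f x)\<^sup>2 \<partial>M)"

lemma abs_powr_numeral: "\<bar>x::real\<bar> powr (numeral k) = \<bar>x\<bar> ^ numeral k"
  by (cases "x = 0") (auto simp: powr_numeral)

lemma Lp_2_iff: "f \<in> Lp 2 M \<longleftrightarrow> square_integrable M f"
  by (simp add: Lp_def square_integrable_def abs_powr_numeral)

lemma Lnorm_2: "Lnorm 2 M f = n2 M f"
  by (simp add: Lnorm_def n2_def abs_powr_numeral powr_half_sqrt)

lemma square_integrable_measurable[measurable_dest]: "square_integrable M f \<Longrightarrow> f \<in> borel_measurable M"
  by (simp add: square_integrable_def)

lemma square_integrable_sq: "square_integrable M f \<Longrightarrow> integrable M (\<lambda>x. (f x)\<^sup>2)"
  by (simp add: square_integrable_def)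

lemma square_integrable_mult:
  assumes "square_integrable M f" "square_integrable M g"
  shows "integrable M (\<lambda>x. f x * g x)"
proof -
  have [measurable]: "f \<in> borel_measurable M" "g \<in> borel_measurable M"
    using assms by (auto simp: square_integrable_def)
  have "integrable M (\<lambda>x. ((f x)\<^sup>2 + (g x)\<^sup>2))"
    using assms by (auto simp: square_integrable_def)
  then show ?thesis
  proof (rule Bochner_Integration.integrable_bound)
    show "AE x in M. norm (f x * g x) \<le> norm ((f x)\<^sup>2 + (g x)\<^sup>2)"
    proof (intro always_eventually allI)
      fix x
      have "0 \<le> (\<bar>f x\<bar> - \<bar>g x\<bar>)\<^sup>2" by simp
      then have "2 * (\<bar>f x\<bar> * \<bar>g x\<bar>) \<le> (f x)\<^sup>2 + (g x)\<^sup>2"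
        by (simp add: power2_diff)
      moreover have "0 \<le> \<bar>f x\<bar> * \<bar>g x\<bar>" by simp
      ultimately show "norm (f x * g x) \<le> norm ((f x)\<^sup>2 + (g x)\<^sup>2)"
        unfolding real_norm_def abs_mult by linarith
    qed
  qed measurable
qed

lemma square_integrable_lincomb:
  assumes "square_integrable M f" "square_integrable M g"
  shows "square_integrable M (\<lambda>x. a * f x + b * g x)"
proof -
  have "integrable M (\<lambda>x. a\<^sup>2 * (f x)\<^sup>2 + 2 * a * b * (f x * g x) + b\<^sup>2 * (g x)\<^sup>2)"
    using assms square_integrable_mult[OF assms] by (auto simp: square_integrable_def)
  also have "(\<lambda>x. a\<^sup>2 * (f x)\<^sup>2 + 2 * a * b * (f x * g x) + b\<^sup>2 * (g x)\<^sup>2) = (\<lambda>x. (a * f x + b * g x)\<^sup>2)"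
    by (auto simp: power2_eq_square algebra_simps)
  finally show ?thesis using assms by (auto simp: square_integrable_def)
qed

lemma square_integrable_add:
  "square_integrable M f \<Longrightarrow> square_integrable M g \<Longrightarrow> square_integrable M (\<lambda>x. f x + g x)"
  using square_integrable_lincomb[of M f g 1 1] by simp

lemma square_integrable_diff:
  "square_integrable M f \<Longrightarrow> square_integrable M g \<Longrightarrow> square_integrable M (\<lambda>x. f x - g x)"
  using square_integrable_lincomb[of M f g 1 "-1"] by simp

lemma square_integrable_cmult:
  "square_integrable M f \<Longrightarrow> square_integrable M (\<lambda>x. a * f x)"
  using square_integrable_lincomb[of M f f a 0] by simp

lemma square_integrable_zero[simp]: "square_integrable M (\<lambda>x. 0)"
  by (simp add: square_integrable_def)

lemma square_integrable_sum:
  "(\<And>i. i \<in> I \<Longrightarrow> square_integrable M (f i)) \<Longrightarrow> square_integrable M (\<lambda>x. \<Sum>i\<in>I. f i x)"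
  by (induction I rule: infinite_finite_induct) (auto intro: square_integrable_add)

lemma (in finite_measure) square_integrable_bounded:
  assumes "f \<in> borel_measurable M" "\<And>x. \<bar>f x\<bar> \<le> B"
  shows "square_integrable M f"
proof -
  have "(f x)\<^sup>2 \<le> B\<^sup>2" for x using assms(2)[of x] by (metis abs_ge_zero power2_abs power_mono)
  then show ?thesis unfolding square_integrable_def
    using assms(1) by (auto intro!: integrable_const_bound[where B="B\<^sup>2"])
qed

lemma (in finite_measure) square_integrable_const[simp]: "square_integrable M (\<lambda>_. c)"
  by (simp add: square_integrable_def)

lemma (in finite_measure) square_integrable_integrable:
  assumes "square_integrable M f" shows "integrable M f"
  using square_integrable_mult[OF assms square_integrable_const[of 1]] unfolding mult_1_right .

lemma n2_nonneg[simp]: "0 \<le> n2 M f" by (simp add: n2_def)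

lemma n2_sq: "(n2 M f)\<^sup>2 = (\<integral>x. (f x)\<^sup>2 \<partial>M)"
  by (simp add: n2_def)

lemma ip_self: "ip M f f = (n2 M f)\<^sup>2"
  unfolding n2_sq ip_def by (simp add: power2_eq_square)

lemma ip_commute: "ip M f g = ip M g f"
  by (simp add: ip_def mult.commute)

lemma ip_cong_AE:
  assumes "square_integrable M f" "square_integrable M f'" "square_integrable M g" "AE x in M. f x = f' x"
  shows "ip M f g = ip M f' g"
  unfolding ip_def
  by (rule integral_cong_AE) (use assms in \<open>auto simp: square_integrable_def\<close>)

lemma n2_cong_AE:
  assumes "f \<in> borel_measurable M" "g \<in> borel_measurable M" "AE x in M. f x = g x"
  shows "n2 M f = n2 M g"
  unfolding n2_def
  by (rule arg_cong[where f=sqrt], rule integral_cong_AE) (use assms in auto)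

lemma ip_lincomb_left:
  assumes "square_integrable M f" "square_integrable M g" "square_integrable M h"
  shows "ip M (\<lambda>x. a * f x + b * g x) h = a * ip M f h + b * ip M g h"
  using square_integrable_mult[OF assms(1,3)] square_integrable_mult[OF assms(2,3)]
  by (simp add: ip_def distrib_right mult.assoc)

lemma ip_lincomb_right:
  assumes "square_integrable M f" "square_integrable M g" "square_integrable M h"
  shows "ip M h (\<lambda>x. a * f x + b * g x) = a * ip M h f + b * ip M h g"
  using ip_lincomb_left[OF assms] by (simp add: ip_commute)

lemma ip_diff_left:
  assumes "square_integrable M f" "square_integrable M g" "square_integrable M h"
  shows "ip M (\<lambda>x. f x - g x) h = ip M f h - ip M g h"
  using ip_lincomb_left[OF assms, of 1 "-1"] by simp

lemma ip_diff_right: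
  assumes "square_integrable M f" "square_integrable M g" "square_integrable M h"
  shows "ip M h (\<lambda>x. f x - g x) = ip M h f - ip M h g"
  using ip_diff_left[OF assms] by (simp add: ip_commute)

lemma ip_sum_left:
  assumes "\<And>i. i \<in> I \<Longrightarrow> square_integrable M (f i)" "square_integrable M h"
  shows "ip M (\<lambda>x. \<Sum>i\<in>I. f i x) h = (\<Sum>i\<in>I. ip M (f i) h)"
  unfolding ip_def sum_distrib_right
  by (rule Bochner_Integration.integral_sum) (use assms square_integrable_mult in auto)

lemma n2_lincomb_sq:
  assumes "square_integrable M f" "square_integrable M g"
  shows "(n2 M (\<lambda>x. a * f x + b * g x))\<^sup>2 = a\<^sup>2 * (n2 M f)\<^sup>2 + 2 * a * b * ip M f g + b\<^sup>2 * (n2 M g)\<^sup>2"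
  using assms square_integrable_lincomb[OF assms, of a b]
  by (simp add: ip_self[symmetric] ip_lincomb_left ip_lincomb_right ip_commute[of M g f])
    (simp add: algebra_simps power2_eq_square)

lemma n2_cmult: "n2 M (\<lambda>x. a * f x) = \<bar>a\<bar> * n2 M f"
  by (simp add: n2_def power_mult_distrib real_sqrt_mult)

lemma ip_Cauchy_Schwarz:
  assumes "square_integrable M f" "square_integrable M g"
  shows "\<bar>ip M f g\<bar> \<le> n2 M f * n2 M g"
proof -
  let ?a = "n2 M f" and ?b = "n2 M g" and ?c = "ip M f g"
  have *: "0 \<le> s\<^sup>2 * ?a\<^sup>2 + 2 * s * t * ?c + t\<^sup>2 * ?b\<^sup>2" for s t
    using n2_lincomb_sq[OF assms, of s t] by (metis zero_le_power2)
  have "?c\<^sup>2 \<le> (?a * ?b)\<^sup>2"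
  proof (cases "?b = 0")
    case True
    have "?c = 0"
    proof (rule ccontr)
      assume "?c \<noteq> 0"
      have "0 \<le> ?a\<^sup>2 + 2 * t * ?c" for t using *[of 1 t] True by simp
      \<comment> \<open>At this value of \<open>t\<close> the affine function equals
        \<open>- 1\<close>.\<close>
      from this[of "- (?a\<^sup>2 + 1) / (2 * ?c)"] \<open>?c \<noteq> 0\<close> show False by (simp add: field_simps)
    qed
    then show ?thesis by simp
  next
    case False
    \<comment> \<open>Up to scale the minimising combination, \<open>s = ?b ^ 2\<close> and
      \<open>t = - ?c\<close>: the form becomes \<open>?b ^ 2\<close> times the
      discriminant.\<close>
    have "0 \<le> (?b\<^sup>2)\<^sup>2 * ?a\<^sup>2 + 2 * ?b\<^sup>2 * (- ?c) * ?c + (-?c)\<^sup>2 * ?b\<^sup>2" by (rule *)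
    also have "\<dots> = ?b\<^sup>2 * (?b\<^sup>2 * ?a\<^sup>2 - ?c\<^sup>2)" by (simp add: power2_eq_square algebra_simps)
    finally have "0 \<le> ?b\<^sup>2 * ?a\<^sup>2 - ?c\<^sup>2" using False by (simp add: zero_le_mult_iff)
    then show ?thesis by (simp add: power_mult_distrib mult.commute)
  qed
  then show ?thesis by (metis abs_le_square_iff abs_mult abs_of_nonneg n2_nonneg)
qed

lemma n2_triangle:
  assumes "square_integrable M f" "square_integrable M g"
  shows "n2 M (\<lambda>x. f x + g x) \<le> n2 M f + n2 M g"
proof (rule power2_le_imp_le)
  have "(n2 M (\<lambda>x. f x + g x))\<^sup>2 = (n2 M f)\<^sup>2 + 2 * ip M f g + (n2 M g)\<^sup>2"
    using n2_lincomb_sq[OF assms, of 1 1] by simp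
  also have "\<dots> \<le> (n2 M f + n2 M g)\<^sup>2"
    using ip_Cauchy_Schwarz[OF assms] by (simp add: power2_sum)
  finally show "(n2 M (\<lambda>x. f x + g x))\<^sup>2 \<le> (n2 M f + n2 M g)\<^sup>2" .
qed simp

lemma n2_minus_commute: "n2 M (\<lambda>x. f x - g x) = n2 M (\<lambda>x. g x - f x)"
  by (simp add: n2_def power2_commute)

lemma n2_sum_le:
  assumes "\<And>i. i \<in> I \<Longrightarrow> square_integrable M (f i)"
  shows "n2 M (\<lambda>x. \<Sum>i\<in>I. f i x) \<le> (\<Sum>i\<in>I. n2 M (f i))"
  using assms
proof (induction I rule: infinite_finite_induct)
  case (insert i I)
  have "n2 M (\<lambda>x. f i x + (\<Sum>i\<in>I. f i x)) \<le> n2 M (f i) + n2 M (\<lambda>x. \<Sum>i\<in>I. f i x)"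
    using insert by (intro n2_triangle square_integrable_sum) auto
  with insert show ?case by force
qed (auto simp: n2_def)

lemma ip_tendsto_left:
  assumes "square_integrable M f" "square_integrable M h" "\<And>n. square_integrable M (F n)"
    and "((\<lambda>n. n2 M (\<lambda>x. F n x - f x)) \<longlongrightarrow> 0) G"
  shows "((\<lambda>n. ip M (F n) h) \<longlongrightarrow> ip M f h) G"
proof -
  have "((\<lambda>n. ip M (F n) h - ip M f h) \<longlongrightarrow> 0) G"
  proof (rule Lim_null_comparison)
    show "\<forall>\<^sub>F n in G. norm (ip M (F n) h - ip M f h) \<le> n2 M (\<lambda>x. F n x - f x) * n2 M h"
      using ip_Cauchy_Schwarz[OF square_integrable_diff[OF assms(3,1)] assms(2)]
      by (simp add: ip_diff_left assms)
    show "((\<lambda>n. n2 M (\<lambda>x. F n x - f x) * n2 M h) \<longlongrightarrow> 0) G"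
      using tendsto_mult_right[OF assms(4), of "n2 M h"] by simp
  qed
  then show ?thesis by (simp add: LIM_zero_iff)
qed

section \<open>Completeness of L2 and the Riesz representation theorem\<close>

context prob_space
begin

lemma n2_const[simp]: "n2 M (\<lambda>_. c) = \<bar>c\<bar>"
  by (simp add: n2_def prob_space)

lemma integral_abs_le_n2:
  assumes "square_integrable M f"
  shows "(\<integral>x. \<bar>f x\<bar> \<partial>M) \<le> n2 M f"
proof -
  have "square_integrable M (\<lambda>x. \<bar>f x\<bar>)"
    using assms by (auto simp: square_integrable_def)
  from ip_Cauchy_Schwarz[OF this square_integrable_const[of 1]]
  show ?thesis by (simp add: ip_def n2_def prob_space)
qed

lemma abs_integral_le_n2:
  assumes "square_integrable M f"
  shows "\<bar>\<integral>x. f x \<partial>M\<bar> \<le> n2 M f"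
  using integral_abs_le_n2[OF assms] integral_abs_bound[of M f] by linarith

lemma L2_complete:
  assumes sq: "\<And>n::nat. square_integrable M (f n)"
    and r: "\<And>n. n2 M (\<lambda>x. f (Suc n) x - f n x) \<le> r n" "summable r"
  shows "\<exists>v. square_integrable M v \<and> (\<lambda>n. n2 M (\<lambda>x. f n x - v x)) \<longlonglongrightarrow> 0"
proof -
  have [measurable]: "f n \<in> borel_measurable M" for n using sq by (simp add: square_integrable_def)
  define d where "d n x = f (Suc n) x - f n x" for n x
  have [measurable]: "d n \<in> borel_measurable M" for n unfolding d_def by measurable
  have dsq: "square_integrable M (d n)" for n
    unfolding d_def using sq square_integrable_diff by blast
  have rnn: "0 \<le> r n" for n using r(1)[of n] n2_nonneg order_trans by blast
  have "(\<integral>\<^sup>+x. (\<Sum>n. ennreal \<bar>d n x\<bar>) \<partial>M) = (\<Sum>n. \<integral>\<^sup>+x. ennreal \<bar>d n x\<bar> \<partial>M)"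
    by (rule nn_integral_suminf) measurable
  also have "\<dots> \<le> (\<Sum>n. ennreal (r n))"
  proof (rule suminf_le)
    fix n
    have "integrable M (\<lambda>x. \<bar>d n x\<bar>)" using square_integrable_integrable[OF dsq] by simp
    then have "(\<integral>\<^sup>+x. ennreal \<bar>d n x\<bar> \<partial>M) = ennreal (\<integral>x. \<bar>d n x\<bar> \<partial>M)"
      by (intro nn_integral_eq_integral) auto
    also have "\<dots> \<le> ennreal (r n)"
      using order_trans[OF integral_abs_le_n2[OF dsq, of n] r(1)[of n, folded d_def]] by (rule ennreal_leI)
    finally show "(\<integral>\<^sup>+x. ennreal \<bar>d n x\<bar> \<partial>M) \<le> ennreal (r n)" .
  qed auto
  also have "\<dots> < \<infinity>" using r(2) rnn by (simp add: suminf_ennreal2)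
  finally have "(\<integral>\<^sup>+x. (\<Sum>n. ennreal \<bar>d n x\<bar>) \<partial>M) \<noteq> \<infinity>" by simp
  then have "AE x in M. (\<Sum>n. ennreal \<bar>d n x\<bar>) \<noteq> \<infinity>"
    by (intro nn_integral_PInf_AE) auto
  moreover have conv: "convergent (\<lambda>n. f n x)" if "(\<Sum>n. ennreal \<bar>d n x\<bar>) \<noteq> \<infinity>" for x
  proof -
    have "summable (\<lambda>n. \<bar>d n x\<bar>)" using that by (intro summable_suminf_not_top) auto
    then have "summable (\<lambda>n. d n x)" by (rule summable_rabs_cancel)
    then have "convergent (\<lambda>n. \<Sum>k<n. d k x)" by (simp add: summable_iff_convergent)
    then have "convergent (\<lambda>n. f 0 x + (\<Sum>k<n. d k x))" by (intro convergent_add convergent_const)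
    moreover have "f 0 x + (\<Sum>k<n. d k x) = f n x" for n
      unfolding d_def using sum_lessThan_telescope[of "\<lambda>k. f k x" n] by simp
    ultimately show ?thesis by simp
  qed
  ultimately have AEconv: "AE x in M. convergent (\<lambda>n. f n x)" by auto
  define v where "v x = lim (\<lambda>n. f n x)" for x
  have [measurable]: "v \<in> borel_measurable M" unfolding v_def by measurable
  \<comment> \<open>The tail of the series of bounds dominates the distance from \<open>f n\<close>
    to all later members and, through Fatou, to the limit.\<close>
  define R where "R n = (\<Sum>k. r (k + n))" for n
  have sumr: "summable (\<lambda>k. r (k + n))" for n using r(2) by (simp add: summable_iff_shift)
  have Rnn: "0 \<le> R n" for n unfolding R_def using rnn sumr by (intro suminf_nonneg) auto
  have tail: "n2 M (\<lambda>x. f (n + m) x - f n x) \<le> R n" for n m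
  proof -
    have "(\<lambda>x. f (n + m) x - f n x) = (\<lambda>x. \<Sum>k<m. d (k + n) x)"
    proof
      fix x show "f (n + m) x - f n x = (\<Sum>k<m. d (k + n) x)"
        unfolding d_def using sum_lessThan_telescope[of "\<lambda>k. f (k + n) x" m] by (simp add: add.commute)
    qed
    then have "n2 M (\<lambda>x. f (n + m) x - f n x) \<le> (\<Sum>k<m. n2 M (d (k + n)))"
      using n2_sum_le[of "{..<m}" M "\<lambda>k. d (k + n)"] dsq by simp
    also have "\<dots> \<le> (\<Sum>k<m. r (k + n))" using r(1) by (intro sum_mono) (simp add: d_def[abs_def])
    also have "\<dots> \<le> R n" unfolding R_def using sumr rnn by (intro sum_le_suminf) auto
    finally show ?thesis .
  qed
  have nn: "(\<integral>\<^sup>+x. ennreal ((f n x - v x)\<^sup>2) \<partial>M) \<le> ennreal ((R n)\<^sup>2)" for n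
  proof -
    have "(\<integral>\<^sup>+x. ennreal ((f n x - v x)\<^sup>2) \<partial>M) = (\<integral>\<^sup>+x. liminf (\<lambda>m. ennreal ((f (n + m) x - f n x)\<^sup>2)) \<partial>M)"
    proof (rule nn_integral_cong_AE, use AEconv in eventually_elim)
      case (elim x)
      then have "(\<lambda>m. f m x) \<longlonglongrightarrow> v x" by (simp add: v_def convergent_LIMSEQ_iff)
      then have "(\<lambda>m. f (m + n) x) \<longlonglongrightarrow> v x" by (rule LIMSEQ_ignore_initial_segment)
      then have "(\<lambda>m. ennreal ((f (n + m) x - f n x)\<^sup>2)) \<longlonglongrightarrow> ennreal ((v x - f n x)\<^sup>2)"
        by (intro tendsto_ennrealI tendsto_power tendsto_diff tendsto_const) (simp add: add.commute)
      from lim_imp_Liminf[OF trivial_limit_sequentially this] show ?case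
        by (simp only: power2_commute[of "v x" "f n x"])
    qed
    also have "\<dots> \<le> liminf (\<lambda>m. \<integral>\<^sup>+x. ennreal ((f (n + m) x - f n x)\<^sup>2) \<partial>M)"
      by (rule nn_integral_liminf) measurable
    also have "\<dots> \<le> liminf (\<lambda>m. ennreal ((R n)\<^sup>2))"
    proof (rule Liminf_mono, rule always_eventually, rule allI)
      fix m
      have s: "square_integrable M (\<lambda>x. f (n + m) x - f n x)" using sq square_integrable_diff by blast
      have "(\<integral>\<^sup>+x. ennreal ((f (n + m) x - f n x)\<^sup>2) \<partial>M) = ennreal ((n2 M (\<lambda>x. f (n + m) x - f n x))\<^sup>2)"
        unfolding n2_sq using s by (intro nn_integral_eq_integral) (auto simp: square_integrable_def)
      also have "\<dots> \<le> ennreal ((R n)\<^sup>2)" using tail[of n m] by (intro ennreal_leI power_mono) auto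
      finally show "(\<integral>\<^sup>+x. ennreal ((f (n + m) x - f n x)\<^sup>2) \<partial>M) \<le> ennreal ((R n)\<^sup>2)" .
    qed
    also have "\<dots> = ennreal ((R n)\<^sup>2)" by (simp add: Liminf_const)
    finally show ?thesis .
  qed
  have dv: "square_integrable M (\<lambda>x. f n x - v x)" for n
    unfolding square_integrable_def
    using nn[of n] by (auto intro!: integrableI_bounded simp: top_unique less_top[symmetric])
  have vsq: "square_integrable M v"
    using square_integrable_diff[OF sq[of 0] dv[of 0]] by simp
  have le: "n2 M (\<lambda>x. f n x - v x) \<le> R n" for n
  proof (rule power2_le_imp_le[OF _ Rnn])
    have "ennreal ((n2 M (\<lambda>x. f n x - v x))\<^sup>2) = (\<integral>\<^sup>+x. ennreal ((f n x - v x)\<^sup>2) \<partial>M)"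
      unfolding n2_sq using dv[of n] by (intro nn_integral_eq_integral[symmetric]) (auto simp: square_integrable_def)
    also note nn[of n]
    finally show "(n2 M (\<lambda>x. f n x - v x))\<^sup>2 \<le> (R n)\<^sup>2" by simp
  qed
  have "R = (\<lambda>n. suminf r - (\<Sum>k<n. r k))"
    unfolding R_def using suminf_minus_initial_segment[OF r(2)] by auto
  moreover have "(\<lambda>n. suminf r - (\<Sum>k<n. r k)) \<longlonglongrightarrow> suminf r - suminf r"
    by (intro tendsto_diff tendsto_const summable_LIMSEQ r(2))
  ultimately have "R \<longlonglongrightarrow> 0" by simp
  then have "(\<lambda>n. n2 M (\<lambda>x. f n x - v x)) \<longlonglongrightarrow> 0"
    by (rule tendsto_sandwich[OF _ _ tendsto_const, rotated -1]) (use le in auto)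
  with vsq show ?thesis by blast
qed

text \<open>Direct method of the calculus of variations: the functional \<open>S\<close>, the
  squared norm minus twice \<open>\<Phi>\<close>, is bounded below, and its minimiser represents
  \<open>\<Phi>\<close>.\<close>

lemma L2_Riesz:
  assumes lin: "\<And>f g a b. square_integrable M f \<Longrightarrow> square_integrable M g \<Longrightarrow>
      \<Phi> (\<lambda>x. a * f x + b * g x) = a * \<Phi> f + b * \<Phi> g"
    and bnd: "\<And>f. square_integrable M f \<Longrightarrow> \<bar>\<Phi> f\<bar> \<le> K * n2 M f"
  shows "\<exists>v. square_integrable M v \<and> (\<forall>g. square_integrable M g \<longrightarrow> \<Phi> g = ip M v g)"
proof -
  define S where "S v = (n2 M v)\<^sup>2 - 2 * \<Phi> v" for v
  define A where "A = S ` {v. square_integrable M v}"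
  have Alow: "- K\<^sup>2 \<le> S v" if "square_integrable M v" for v
  proof -
    have "0 \<le> (n2 M v - K)\<^sup>2" by simp
    with bnd[OF that] show ?thesis by (simp add: S_def power2_diff mult.commute abs_le_iff)
  qed
  have Ane: "A \<noteq> {}" and Abdd: "bdd_below A"
    using Alow unfolding A_def bdd_below_def by (auto intro: square_integrable_zero)
  define i where "i = Inf A"
  have ile: "i \<le> S v" if "square_integrable M v" for v
    unfolding i_def using that Abdd by (intro cInf_lower) (auto simp: A_def)
  \<comment> \<open>The tolerance \<open>(1/16)^n\<close> is chosen so that the parallelogram
    identity makes consecutive members \<open>2 * (1/4)^n\<close> close, which is summable.\<close>
  have "\<exists>v. square_integrable M v \<and> S v < i + (1/16)^n" for n
  proof -
    have "Inf A < i + (1/16)^n" by (simp add: i_def)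
    then show ?thesis using cInf_less_iff[OF Ane Abdd] by (auto simp: A_def)
  qed
  then obtain v where v: "\<And>n. square_integrable M (v n)" "\<And>n. S (v n) < i + (1/16)^n" by metis
  have step: "n2 M (\<lambda>x. v (Suc n) x - v n x) \<le> 2 * (1/4)^n" for n
  proof (rule power2_le_imp_le)
    let ?p = "v (Suc n)" and ?q = "v n"
    let ?m = "\<lambda>x. (1/2) * ?p x + (1/2) * ?q x"
    have "i \<le> S ?m" using v by (intro ile square_integrable_lincomb) auto
    also have "S ?m = (n2 M ?p)\<^sup>2 / 4 + ip M ?p ?q / 2 + (n2 M ?q)\<^sup>2 / 4 - \<Phi> ?p - \<Phi> ?q"
      using v(1) unfolding S_def lin[OF v(1) v(1)] n2_lincomb_sq[OF v(1) v(1)]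
      by (simp add: power2_eq_square field_simps)
    finally have 1: "i \<le> (n2 M ?p)\<^sup>2 / 4 + ip M ?p ?q / 2 + (n2 M ?q)\<^sup>2 / 4 - \<Phi> ?p - \<Phi> ?q" .
    have 2: "(n2 M (\<lambda>x. ?p x - ?q x))\<^sup>2 = (n2 M ?p)\<^sup>2 - 2 * ip M ?p ?q + (n2 M ?q)\<^sup>2"
      using n2_lincomb_sq[OF v(1) v(1), of 1 "Suc n" "-1" n] by simp
    have 3: "(n2 M ?p)\<^sup>2 - 2 * \<Phi> ?p < i + (1/16)^Suc n" "(n2 M ?q)\<^sup>2 - 2 * \<Phi> ?q < i + (1/16)^n"
      using v(2) unfolding S_def by blast+
    have 4: "(1/16::real)^Suc n \<le> (1/16)^n" by simp
    have "(n2 M (\<lambda>x. ?p x - ?q x))\<^sup>2 \<le> 4 * (1/16)^n" using 1 2 3 4 by linarith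
    also have "\<dots> = (2 * (1/4)^n)\<^sup>2"
      by (simp add: power_mult_distrib power_even_eq[symmetric] power2_eq_square power_divide flip: power_mult_distrib)
    finally show "(n2 M (\<lambda>x. ?p x - ?q x))\<^sup>2 \<le> (2 * (1/4)^n)\<^sup>2" .
  qed simp
  have "summable (\<lambda>n. 2 * (1/4::real)^n)" by (intro summable_mult summable_geometric) simp
  from L2_complete[OF v(1) step this] obtain w where
    w: "square_integrable M w" "(\<lambda>n. n2 M (\<lambda>x. v n x - w x)) \<longlonglongrightarrow> 0" by blast
  have "\<Phi> g = ip M w g" if g: "square_integrable M g" for g
  proof -
    define c where "c = ip M w g - \<Phi> g"
    \<comment> \<open>First variation: \<open>v n + t g\<close> cannot fall below the infimum, and
      \<open>v n\<close> is within \<open>(1/16)^n\<close> of it. In the limit a quadratic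
      polynomial in \<open>t\<close> without constant term is nonnegative, which forces its linear
      coefficient to vanish.\<close>
    have main: "0 \<le> t\<^sup>2 * (n2 M g)\<^sup>2 + 2 * t * c" for t
    proof (rule LIMSEQ_le)
      have lim: "(\<lambda>n. ip M (v n) g) \<longlonglongrightarrow> ip M w g" by (rule ip_tendsto_left[OF w(1) g v(1) w(2)])
      have "(\<lambda>n. t\<^sup>2 * (n2 M g)\<^sup>2 + 2 * t * (ip M (v n) g - \<Phi> g) + (1/16)^n)
          \<longlonglongrightarrow> t\<^sup>2 * (n2 M g)\<^sup>2 + 2 * t * (ip M w g - \<Phi> g) + 0"
        by (intro tendsto_intros lim LIMSEQ_realpow_zero) auto
      then show "(\<lambda>n. t\<^sup>2 * (n2 M g)\<^sup>2 + 2 * t * (ip M (v n) g - \<Phi> g) + (1/16)^n)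
          \<longlonglongrightarrow> t\<^sup>2 * (n2 M g)\<^sup>2 + 2 * t * c" by (simp add: c_def)
      show "(\<lambda>n::nat. 0::real) \<longlonglongrightarrow> 0" by simp
      show "\<exists>N. \<forall>n\<ge>N. 0 \<le> t\<^sup>2 * (n2 M g)\<^sup>2 + 2 * t * (ip M (v n) g - \<Phi> g) + (1/16)^n"
      proof (intro exI allI impI)
        fix n :: nat
        have "i \<le> S (\<lambda>x. 1 * v n x + t * g x)" using v(1) g by (intro ile square_integrable_lincomb) auto
        also have "\<dots> = S (v n) + t\<^sup>2 * (n2 M g)\<^sup>2 + 2 * t * (ip M (v n) g - \<Phi> g)"
          unfolding S_def lin[OF v(1) g] n2_lincomb_sq[OF v(1) g] by (simp add: algebra_simps)
        finally show "0 \<le> t\<^sup>2 * (n2 M g)\<^sup>2 + 2 * t * (ip M (v n) g - \<Phi> g) + (1/16)^n"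
          using v(2)[of n] by linarith
      qed
    qed
    have "c = 0"
    proof (rule ccontr)
      assume c: "c \<noteq> 0"
      \<comment> \<open>The added \<open>1\<close> covers the case that \<open>g\<close> has norm
        zero.\<close>
      define G where "G = (n2 M g)\<^sup>2 + 1"
      have G: "G > 0" by (simp add: G_def add_nonneg_pos)
      have "0 \<le> (- c / G)\<^sup>2 * (n2 M g)\<^sup>2 + 2 * (- c / G) * c" by (rule main)
      also have "\<dots> \<le> (- c / G)\<^sup>2 * G + 2 * (- c / G) * c"
        by (intro add_right_mono mult_left_mono) (auto simp: G_def)
      also have "\<dots> = - (c\<^sup>2 / G)" using G by (simp add: power2_eq_square field_simps)
      also have "\<dots> < 0" using c G by simp
      finally show False by simp
    qed
    then show ?thesis by (simp add: c_def)
  qed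
  with w(1) show ?thesis by blast
qed

end

lemma square_integrable_dominated:
  assumes "square_integrable M g" "f \<in> borel_measurable M" "\<And>x. \<bar>f x\<bar> \<le> \<bar>g x\<bar>"
  shows "square_integrable M f"
  unfolding square_integrable_def
proof
  show "integrable M (\<lambda>x. (f x)\<^sup>2)"
    by (rule Bochner_Integration.integrable_bound[OF square_integrable_sq[OF assms(1)]])
      (use assms in \<open>auto intro!: always_eventually simp: abs_le_square_iff[symmetric]\<close>)
qed (use assms in auto)

section \<open>Boxes, translations and moves of configurations\<close>

lemma box_mono: "k \<le> l \<Longrightarrow> box k \<subseteq> box l"
  by (auto simp: box_def)

lemma finite_box[simp]: "finite (box l)"
  by (simp add: box_def)

lemma card_box: "card (box l) = 2 * l + 1"
  by (simp add: box_def)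

lemma zero_in_box[simp]: "0 \<in> box l"
  by (simp add: box_def)

lemma space_config_space[simp]: "space config_space = UNIV"
  by (simp add: config_space_def space_PiM)

lemma measurable_coord[measurable]: "(\<lambda>\<eta>. \<eta> x) \<in> config_space \<rightarrow>\<^sub>M count_space UNIV"
  unfolding config_space_def by (rule measurable_component_singleton) simp

lemma measurable_translate[measurable]: "translate x \<in> config_space \<rightarrow>\<^sub>M config_space"
  unfolding translate_def config_space_def by (intro measurable_PiM_single') (auto simp: space_PiM)

lemma translate_translate: "translate x (translate y \<eta>) = translate (y + x) \<eta>"
  by (auto simp: translate_def add.assoc)

lemma translate_0[simp]: "translate 0 \<eta> = \<eta>"
  by (simp add: translate_def)

lemma move_translate: "move x y (translate z \<eta>) = translate z (move (z + x) (z + y) \<eta>)"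
  by (auto simp: move_def translate_def fun_eq_iff)

subsection \<open>Local functions\<close>

lemma supported_on_mono: "supported_on k f \<Longrightarrow> k \<le> l \<Longrightarrow> supported_on l f"
  using box_mono[of k l] unfolding supported_on_def by (meson subsetD)

lemma supported_on_translate:
  assumes "supported_on l f" shows "supported_on (l + nat \<bar>x\<bar>) (\<lambda>\<eta>. f (translate x \<eta>))"
  unfolding supported_on_def
proof (intro allI impI)
  fix \<eta> \<zeta> :: config
  assume *: "\<forall>y\<in>box (l + nat \<bar>x\<bar>). \<eta> y = \<zeta> y"
  have "\<forall>y\<in>box l. translate x \<eta> y = translate x \<zeta> y"
    unfolding translate_def by (auto intro!: *[rule_format] simp: box_def)
  with assms show "f (translate x \<eta>) = f (translate x \<zeta>)" by (auto simp: supported_on_def)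
qed

lemma supported_on_move:
  assumes "supported_on l f" shows "supported_on (l + nat \<bar>x\<bar> + nat \<bar>y\<bar>) (\<lambda>\<eta>. f (move x y \<eta>))"
  unfolding supported_on_def
proof (intro allI impI)
  fix \<eta> \<zeta> :: config
  assume *: "\<forall>z\<in>box (l + nat \<bar>x\<bar> + nat \<bar>y\<bar>). \<eta> z = \<zeta> z"
  then have 1: "\<eta> x = \<zeta> x" "\<eta> y = \<zeta> y" by (auto intro!: *[rule_format] simp: box_def)
  have 2: "\<eta> z = \<zeta> z" if "z \<in> box l" for z using that by (intro *[rule_format]) (auto simp: box_def)
  have "\<forall>z\<in>box l. move x y \<eta> z = move x y \<zeta> z"
    using 1 2 by (auto simp: move_def)
  with assms show "f (move x y \<eta>) = f (move x y \<zeta>)" by (auto simp: supported_on_def)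
qed

lemma supported_on_comp: "supported_on l f \<Longrightarrow> supported_on l (\<lambda>\<eta>. F (f \<eta>))"
  unfolding supported_on_def by (intro allI impI arg_cong[where f=F]) blast

lemma supported_on_const[simp]: "supported_on l (\<lambda>_. c)"
  by (simp add: supported_on_def)

lemma local_funI: "supported_on l f \<Longrightarrow> local_fun f"
  by (auto simp: local_fun_def)

lemma local_fun_obtain2:
  assumes "local_fun f" "local_fun g"
  obtains l where "supported_on l f" "supported_on l g"
  using assms unfolding local_fun_def
  by (meson max.cobounded1 max.cobounded2 supported_on_mono)

lemma local_fun_const[simp, intro]: "local_fun (\<lambda>_. c)"
  by (auto simp: local_fun_def)

lemma local_fun_comp: "local_fun f \<Longrightarrow> local_fun (\<lambda>\<eta>. F (f \<eta>))"
  unfolding local_fun_def supported_on_def by metis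

lemma local_fun_comp2:
  assumes "local_fun f" "local_fun g" shows "local_fun (\<lambda>\<eta>. F (f \<eta>) (g \<eta>))"
proof -
  obtain l where "supported_on l f" "supported_on l g" using assms by (rule local_fun_obtain2)
  then have "supported_on l (\<lambda>\<eta>. F (f \<eta>) (g \<eta>))" unfolding supported_on_def by metis
  then show ?thesis by (auto simp: local_fun_def)
qed

lemma local_fun_translate: "local_fun f \<Longrightarrow> local_fun (\<lambda>\<eta>. f (translate x \<eta>))"
  using supported_on_translate unfolding local_fun_def by metis

lemma local_fun_move: "local_fun f \<Longrightarrow> local_fun (\<lambda>\<eta>. f (move x y \<eta>))"
  using supported_on_move unfolding local_fun_def by metis

lemma local_fun_grad: "local_fun f \<Longrightarrow> local_fun (grad x y f)"
  unfolding grad_def[abs_def] by (intro local_fun_comp2[of _ _ "(-)"] local_fun_move)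

lemma supported_on_coord: "x \<in> box l \<Longrightarrow> supported_on l (\<lambda>\<eta>. F (\<eta> x))"
  by (auto simp: supported_on_def)

lemma local_fun_coord[simp, intro]: "local_fun (\<lambda>\<eta>. F (\<eta> x))"
  unfolding local_fun_def by (intro exI[of _ "nat \<bar>x\<bar>"] supported_on_coord) (auto simp: box_def)

lemma countable_box_patterns: "countable (box l \<rightarrow>\<^sub>E (UNIV::nat set))"
  by (intro countable_PiE) auto

text \<open>Only countably many patterns fit on a box, so every preimage is a countable union of
  cylinders and locality alone gives measurability.\<close>

lemma supported_on_measurable:
  assumes "supported_on l f" shows "f \<in> borel_measurable config_space"
proof (rule measurableI)
  fix B :: "real set"
  let ?P = "(\<lambda>\<eta>. restrict \<eta> (box l)) ` (f -` B)"
  have "?P \<subseteq> box l \<rightarrow>\<^sub>E UNIV" by auto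
  then have c: "countable ?P" using countable_box_patterns countable_subset by blast
  have "f -` B = (\<Union>e\<in>?P. {\<eta>\<in>space config_space. \<forall>x\<in>box l. \<eta> x = e x})"
  proof (intro equalityI subsetI)
    fix \<eta> assume "\<eta> \<in> (\<Union>e\<in>?P. {\<eta>\<in>space config_space. \<forall>x\<in>box l. \<eta> x = e x})"
    then obtain \<zeta> where "f \<zeta> \<in> B" "\<forall>x\<in>box l. \<eta> x = \<zeta> x" by auto
    with assms have "f \<eta> = f \<zeta>" by (auto simp: supported_on_def)
    with \<open>f \<zeta> \<in> B\<close> show "\<eta> \<in> f -` B" by simp
  qed auto
  also have "\<dots> \<in> sets config_space"
    by (rule sets.countable_UN''[OF c]) measurable
  finally show "f -` B \<inter> space config_space \<in> sets config_space" by simp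
qed simp

lemma local_fun_measurable: "local_fun f \<Longrightarrow> f \<in> borel_measurable config_space"
  using supported_on_measurable by (auto simp: local_fun_def)

lemma grad_outside:
  assumes "supported_on l f" "x \<notin> box l" "y \<notin> box l" shows "grad x y f \<eta> = 0"
proof -
  have "\<forall>z\<in>box l. move x y \<eta> z = \<eta> z" using assms by (auto simp: move_def)
  with assms(1) have "f (move x y \<eta>) = f \<eta>" by (auto simp: supported_on_def)
  then show ?thesis by (simp add: grad_def)
qed

subsection \<open>Stationary measures on configurations\<close>

locale stationary_config = prob_space \<nu> for \<nu> :: "config measure" +
  fixes \<rho> \<theta>s :: real
  assumes sets_nu: "sets \<nu> = sets config_space"
    and mixing: "mixing_exp_moments \<nu> \<rho> \<theta>s"
begin

lemma space_nu[simp]: "space \<nu> = UNIV"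
  using sets_eq_imp_space_eq[OF sets_nu] by simp

lemma measurable_nu: "measurable \<nu> N = measurable config_space N"
  by (rule measurable_cong_sets[OF sets_nu refl])

lemma measurable_to_nu: "measurable N \<nu> = measurable N config_space"
  by (rule measurable_cong_sets[OF refl sets_nu])

lemma local_fun_meas: "local_fun f \<Longrightarrow> f \<in> borel_measurable \<nu>"
  by (simp add: measurable_nu local_fun_measurable)

lemma measurable_translate_nu[measurable]: "translate x \<in> \<nu> \<rightarrow>\<^sub>M \<nu>"
  by (simp add: measurable_nu measurable_to_nu measurable_translate)

lemma distr_translate: "distr \<nu> \<nu> (translate x) = \<nu>"
proof -
  have "distr \<nu> \<nu> (translate x) = distr \<nu> config_space (translate x)"
    by (rule distr_cong) (auto simp: sets_nu)
  then show ?thesis using mixing by (simp add: mixing_exp_moments_def)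
qed

lemma integral_translate:
  fixes f :: "config \<Rightarrow> real"
  assumes "f \<in> borel_measurable \<nu>" shows "(\<integral>\<eta>. f (translate x \<eta>) \<partial>\<nu>) = (\<integral>\<eta>. f \<eta> \<partial>\<nu>)"
  using integral_distr[of "translate x" \<nu> \<nu> f] assms by (simp add: distr_translate)

lemma integrable_translate:
  fixes f :: "config \<Rightarrow> real"
  assumes "f \<in> borel_measurable \<nu>" shows "integrable \<nu> (\<lambda>\<eta>. f (translate x \<eta>)) \<longleftrightarrow> integrable \<nu> f"
  using integrable_distr_eq[of "translate x" \<nu> \<nu> f] assms by (simp add: distr_translate)

lemma square_integrable_translate:
  assumes "square_integrable \<nu> f" shows "square_integrable \<nu> (\<lambda>\<eta>. f (translate x \<eta>))"
proof -
  have [measurable]: "f \<in> borel_measurable \<nu>" using assms by (simp add: square_integrable_def)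
  show ?thesis
    using assms integrable_translate[of "\<lambda>\<eta>. (f \<eta>)\<^sup>2" x] by (simp add: square_integrable_def)
qed

lemma n2_translate:
  assumes "f \<in> borel_measurable \<nu>" shows "n2 \<nu> (\<lambda>\<eta>. f (translate x \<eta>)) = n2 \<nu> f"
  using integral_translate[of "\<lambda>\<eta>. (f \<eta>)\<^sup>2" x] assms by (simp add: n2_def)

lemma ip_translate:
  assumes "f \<in> borel_measurable \<nu>" "g \<in> borel_measurable \<nu>"
  shows "ip \<nu> (\<lambda>\<eta>. f (translate x \<eta>)) (\<lambda>\<eta>. g (translate x \<eta>)) = ip \<nu> f g"
  using integral_translate[of "\<lambda>\<eta>. f \<eta> * g \<eta>" x] assms by (simp add: ip_def)

lemma ip_translate_left:
  assumes "f \<in> borel_measurable \<nu>" "g \<in> borel_measurable \<nu>"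
  shows "ip \<nu> (\<lambda>\<eta>. f (translate x \<eta>)) g = ip \<nu> f (\<lambda>\<eta>. g (translate (- x) \<eta>))"
proof -
  have [measurable]: "f \<in> borel_measurable \<nu>" "g \<in> borel_measurable \<nu>" using assms by auto
  have "(\<lambda>\<eta>. g (translate (- x) \<eta>)) \<in> borel_measurable \<nu>" by measurable
  from ip_translate[OF assms(1) this, of x] show ?thesis by (simp add: translate_translate)
qed

text \<open>One term of the exponential series is at most the whole series. This turns the
  exponential moments into moments of every order, of which the eighth is the highest in
  use.\<close>

lemma exp_moment_bound: "real k ^ m \<le> fact m / \<theta> ^ m * exp (\<theta> * real k)" if "\<theta> > 0"
proof -
  have "(\<theta> * real k) ^ m / fact m \<le> exp (\<theta> * real k)"
  proof -
    have "summable (\<lambda>n. (\<theta> * real k) ^ n / fact n)"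
      using summable_exp[of "\<theta> * real k"] by (simp add: divide_inverse mult.commute)
    then have "(\<Sum>n\<in>{m}. (\<theta> * real k) ^ n / fact n) \<le> (\<Sum>n. (\<theta> * real k) ^ n / fact n)"
      using that by (intro sum_le_suminf) auto
    then show ?thesis by (simp add: exp_def divide_inverse mult.commute)
  qed
  then show ?thesis using that by (simp add: field_simps power_mult_distrib)
qed

lemma coord_moment: "integrable \<nu> (\<lambda>\<eta>. real (\<eta> x) ^ k)"
proof -
  have \<theta>: "\<theta>s > 0" and e: "integrable \<nu> (\<lambda>\<eta>. exp (\<theta>s * real (\<eta> 0)))"
    using mixing by (auto simp: mixing_exp_moments_def)
  have [measurable]: "(\<lambda>\<eta>. real (\<eta> 0) ^ k) \<in> borel_measurable \<nu>" by (intro local_fun_meas) auto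
  have "integrable \<nu> (\<lambda>\<eta>. fact k / \<theta>s ^ k * exp (\<theta>s * real (\<eta> 0)))" using e by simp
  then have "integrable \<nu> (\<lambda>\<eta>. real (\<eta> 0) ^ k)"
    by (rule Bochner_Integration.integrable_bound)
      (use exp_moment_bound[OF \<theta>] \<theta> in \<open>auto intro!: always_eventually order_trans[OF _ abs_ge_self]\<close>)
  then have "integrable \<nu> (\<lambda>\<eta>. real (translate x \<eta> 0) ^ k)"
    using integrable_translate[of "\<lambda>\<eta>. real (\<eta> 0) ^ k" x] by simp
  then show ?thesis by (simp add: translate_def)
qed

lemma coord_square_integrable: "square_integrable \<nu> (\<lambda>\<eta>. real (\<eta> x))"
  unfolding square_integrable_def using coord_moment[of x 2] by (auto intro!: local_fun_meas)

end

subsection \<open>Truncation\<close>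

definition clip :: "real \<Rightarrow> real \<Rightarrow> real" where
  "clip m y = max (- m) (min m y)"

text \<open>The Huber function: half the square up to height \<open>m\<close>, linear beyond.
  Written through \<open>clip\<close>, it inherits convexity from the projection property without
  any differentiation.\<close>

definition huber :: "real \<Rightarrow> real \<Rightarrow> real" where
  "huber m y = clip m y * y - (clip m y)\<^sup>2 / 2"

lemma clip_bound: "0 \<le> m \<Longrightarrow> \<bar>clip m y\<bar> \<le> m"
  by (auto simp: clip_def)

text \<open>\<open>clip m\<close> is the projection of the line onto the interval from
  \<open>- m\<close> to \<open>m\<close>, and this is the variational inequality that characterises
  such a projection.\<close>

lemma clip_projection: "0 \<le> m \<Longrightarrow> 0 \<le> (clip m y - clip m x) * (y - clip m y)"
  by (cases "y > m"; cases "y < - m") (auto simp: clip_def zero_le_mult_iff)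

lemma clip_mult_bounds:
  assumes "0 \<le> m" shows "(clip m y)\<^sup>2 \<le> clip m y * y" "clip m y * y \<le> m * \<bar>y\<bar>"
proof -
  show "(clip m y)\<^sup>2 \<le> clip m y * y"
    using clip_projection[OF assms, of y 0] assms by (simp add: clip_def power2_eq_square algebra_simps)
  have "clip m y * y \<le> \<bar>clip m y\<bar> * \<bar>y\<bar>" by (metis abs_ge_self abs_mult)
  also have "\<dots> \<le> m * \<bar>y\<bar>" using clip_bound[OF assms] by (intro mult_right_mono) auto
  finally show "clip m y * y \<le> m * \<bar>y\<bar>" .
qed

lemma huber_bounds:
  assumes "0 \<le> m" shows "0 \<le> huber m y" "huber m y \<le> m * \<bar>y\<bar>"
proof -
  note b = clip_mult_bounds[OF assms, of y]
  show "0 \<le> huber m y" using b(1) zero_le_power2[of "clip m y"] unfolding huber_def by linarith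
  show "huber m y \<le> m * \<bar>y\<bar>" using b(2) zero_le_power2[of "clip m y"] unfolding huber_def by linarith
qed

text \<open>The two sides differ by exactly the product in \<open>clip_projection\<close>. The
  subtracted square is the gain from strict convexity; it becomes the Dirichlet form of the
  truncated function.\<close>

lemma huber_convex:
  assumes "0 \<le> m"
  shows "clip m x * (y - x) \<le> huber m y - huber m x - (clip m y - clip m x)\<^sup>2 / 2"
  using clip_projection[OF assms, of y x]
  by (simp add: huber_def power2_eq_square field_simps)

lemma clip_eventually: "\<forall>\<^sub>F m in sequentially. clip (real m) y = y"
proof -
  obtain N where "\<bar>y\<bar> \<le> real N" using real_arch_simple by blast
  then show ?thesis by (intro eventually_sequentiallyI[of N]) (auto simp: clip_def)
qed

lemma clip_le: "0 \<le> m \<Longrightarrow> \<bar>clip m y\<bar> \<le> \<bar>y\<bar>"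
  by (auto simp: clip_def)

section \<open>Detailed balance, the gradient condition and the energy bound\<close>

definition bond_energy :: "config measure \<Rightarrow> (config \<Rightarrow> real) \<Rightarrow> int \<Rightarrow> (config \<Rightarrow> real) \<Rightarrow> real" where
  "bond_energy \<nu> b x \<phi> = (\<integral>\<eta>. b (translate x \<eta>) * (grad x (x + 1) \<phi> \<eta>)\<^sup>2 \<partial>\<nu>)"

locale reversible_rates = stationary_config \<nu> \<rho> \<theta>s for \<nu> \<rho> \<theta>s +
  fixes bR bL :: "nat \<Rightarrow> config \<Rightarrow> real" and n :: nat and c :: "config \<Rightarrow> real" and R :: nat and C :: real
  assumes supp: "supported_on R (bR n)" "supported_on R (bL n)" "supported_on R c"
    and nonneg: "0 \<le> bR n \<eta>" "0 \<le> bL n \<eta>" "0 \<le> c \<eta>"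
    and linear_growth: "bR n \<eta> + bL n \<eta> \<le> C * (\<Sum>y\<in>box R. real (\<eta> y))"
    and gradient: "bR n (translate x \<eta>) - bL n (translate x \<eta>) = c (translate x \<eta>) - c (translate (x + 1) \<eta>)"
    and reversible: "local_fun f \<Longrightarrow> bounded (range f) \<Longrightarrow> local_fun g \<Longrightarrow> bounded (range g) \<Longrightarrow>
      (\<integral>\<eta>. bR n (translate x \<eta>) * f \<eta> * g (move x (x + 1) \<eta>) \<partial>\<nu>)
       = (\<integral>\<eta>. bL n (translate x \<eta>) * f (move (x + 1) x \<eta>) * g \<eta> \<partial>\<nu>)"
begin

abbreviation "rR x \<eta> \<equiv> bR n (translate x \<eta>)"
abbreviation "rL x \<eta> \<equiv> bL n (translate x \<eta>)"

lemma local_rates: "local_fun (rR x)" "local_fun (rL x)" "local_fun (\<lambda>\<eta>. c (translate x \<eta>))"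
  using supp[THEN local_funI] by (auto intro!: local_fun_translate)

lemma meas_rates[measurable]: "rR x \<in> borel_measurable \<nu>" "rL x \<in> borel_measurable \<nu>"
    "(\<lambda>\<eta>. c (translate x \<eta>)) \<in> borel_measurable \<nu>"
  using local_rates local_fun_meas by blast+

lemma square_integrable_box_sum: "square_integrable \<nu> (\<lambda>\<eta>. a + b * (\<Sum>y\<in>S. real (\<eta> y)))"
  by (intro square_integrable_add square_integrable_cmult square_integrable_sum coord_square_integrable
      square_integrable_const)

lemma square_integrable_rates:
  "square_integrable \<nu> (rR x)" "square_integrable \<nu> (rL x)"
proof -
  have *: "square_integrable \<nu> (\<lambda>\<eta>. 0 + \<bar>C\<bar> * (\<Sum>y\<in>box R. real (\<eta> y)))"
    by (rule square_integrable_box_sum)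
  have b: "bR n \<eta> \<le> \<bar>C\<bar> * (\<Sum>y\<in>box R. real (\<eta> y))" "bL n \<eta> \<le> \<bar>C\<bar> * (\<Sum>y\<in>box R. real (\<eta> y))" for \<eta>
  proof -
    have "bR n \<eta> + bL n \<eta> \<le> \<bar>C\<bar> * (\<Sum>y\<in>box R. real (\<eta> y))"
      using linear_growth[of \<eta>] by (rule order_trans) (intro mult_right_mono sum_nonneg, auto)
    then show "bR n \<eta> \<le> \<bar>C\<bar> * (\<Sum>y\<in>box R. real (\<eta> y))" "bL n \<eta> \<le> \<bar>C\<bar> * (\<Sum>y\<in>box R. real (\<eta> y))"
      using nonneg[of \<eta>] by auto
  qed
  have "square_integrable \<nu> (bR n)" "square_integrable \<nu> (bL n)"
    by (rule square_integrable_dominated[OF *];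
        use meas_rates[of 0] nonneg b in \<open>auto intro: order_trans[OF _ abs_ge_self]\<close>)+
  then show "square_integrable \<nu> (rR x)" "square_integrable \<nu> (rL x)"
    by (auto intro: square_integrable_translate)
qed

text \<open>The gradient condition lets one transport \<open>c\<close> to an empty region, so it inherits linear growth.\<close>

lemma c_linear_growth: "c \<eta> \<le> c (\<lambda>_. 0) + real (2 * R + 1) * (\<bar>C\<bar> * (real (2 * R + 1) * (\<Sum>y\<in>box R. real (\<eta> y))))"
proof -
  define \<zeta> where "\<zeta> = (\<lambda>x. if x \<in> box R then \<eta> x else 0)"
  let ?S = "\<Sum>y\<in>box R. real (\<eta> y)"
  have S: "real (\<zeta> y) \<le> ?S" for y
    by (auto simp: \<zeta>_def sum_nonneg intro!: member_le_sum)
  have "c \<eta> = c \<zeta>" using supp(3) by (auto simp: supported_on_def \<zeta>_def)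
  also have "c \<zeta> = c (translate (int k) \<zeta>) + (\<Sum>x<k. rR (int x) \<zeta> - rL (int x) \<zeta>)" for k :: nat
  proof (induction k)
    case (Suc k)
    then show ?case using gradient[of "int k" \<zeta>] by (simp add: add.commute)
  qed simp
  \<comment> \<open>The box has \<open>2 * R + 1\<close> sites, so this shift empties the window
    seen by \<open>c\<close>.\<close>
  from this[of "2 * R + 1"] have "c \<zeta> = c (translate (int (2 * R + 1)) \<zeta>) + (\<Sum>x<2 * R + 1. rR (int x) \<zeta> - rL (int x) \<zeta>)" .
  also have "c (translate (int (2 * R + 1)) \<zeta>) = c (\<lambda>_. 0)"
  proof -
    have "\<forall>x\<in>box R. translate (int (2 * R + 1)) \<zeta> x = 0"
      by (auto simp: translate_def \<zeta>_def box_def)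
    then show ?thesis
      by (intro supp(3)[unfolded supported_on_def, rule_format, of "translate (int (2 * R + 1)) \<zeta>" "\<lambda>_. 0"]) blast
  qed
  also have "(\<Sum>x<2 * R + 1. rR (int x) \<zeta> - rL (int x) \<zeta>) \<le> (\<Sum>x<2 * R + 1. \<bar>C\<bar> * (real (2 * R + 1) * ?S))"
  proof (rule sum_mono)
    fix x
    have "rR (int x) \<zeta> - rL (int x) \<zeta> \<le> rR (int x) \<zeta> + rL (int x) \<zeta>" using nonneg by simp
    also have "\<dots> \<le> C * (\<Sum>y\<in>box R. real (translate (int x) \<zeta> y))" by (rule linear_growth)
    also have "\<dots> \<le> \<bar>C\<bar> * (\<Sum>y\<in>box R. ?S)"
    proof (rule mult_mono)
      show "(\<Sum>y\<in>box R. real (translate (int x) \<zeta> y)) \<le> (\<Sum>y\<in>box R. ?S)"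
        by (rule sum_mono) (simp only: translate_def S)
    qed (auto intro!: sum_nonneg)
    also have "\<dots> = \<bar>C\<bar> * (real (2 * R + 1) * ?S)" by (simp add: card_box)
    finally show "rR (int x) \<zeta> - rL (int x) \<zeta> \<le> \<bar>C\<bar> * (real (2 * R + 1) * ?S)" .
  qed
  finally show ?thesis by (simp add: algebra_simps)
qed

lemma square_integrable_c: "square_integrable \<nu> c"
proof (rule square_integrable_dominated)
  show "square_integrable \<nu> (\<lambda>\<eta>. c (\<lambda>_. 0) + (real (2 * R + 1) * (\<bar>C\<bar> * real (2 * R + 1))) * (\<Sum>y\<in>box R. real (\<eta> y)))"
    by (rule square_integrable_box_sum)
  show "c \<in> borel_measurable \<nu>" using meas_rates(3)[of 0] by simp
  show "\<bar>c \<eta>\<bar> \<le> \<bar>c (\<lambda>_. 0) + (real (2 * R + 1) * (\<bar>C\<bar> * real (2 * R + 1))) * (\<Sum>y\<in>box R. real (\<eta> y))\<bar>" for \<eta>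
    using c_linear_growth[of \<eta>] nonneg(3)[of \<eta>] by (intro order_trans[OF _ abs_ge_self]) (simp add: mult.assoc)
qed

lemma bounded_min: "bounded (range (\<lambda>\<eta>. min (F \<eta>) (real k)))" if "\<And>\<eta>. 0 \<le> F \<eta>" for F :: "config \<Rightarrow> real"
  by (rule boundedI[of _ "real k"]) (use that in auto)

lemma nn_integral_min_limit:
  fixes F w :: "config \<Rightarrow> real"
  assumes [measurable]: "F \<in> borel_measurable \<nu>" "w \<in> borel_measurable \<nu>" and "\<And>\<eta>. 0 \<le> F \<eta>" "\<And>\<eta>. 0 \<le> w \<eta>"
  shows "(\<lambda>k. \<integral>\<^sup>+\<eta>. ennreal (w \<eta> * min (F \<eta>) (real k)) \<partial>\<nu>) \<longlonglongrightarrow> (\<integral>\<^sup>+\<eta>. ennreal (w \<eta> * F \<eta>) \<partial>\<nu>)"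
proof (rule nn_integral_LIMSEQ)
  show "incseq (\<lambda>k \<eta>. ennreal (w \<eta> * min (F \<eta>) (real k)))"
    by (auto simp: incseq_def le_fun_def intro!: ennreal_leI mult_left_mono assms)
  fix \<eta>
  obtain N where N: "F \<eta> \<le> real N" using real_arch_simple by blast
  show "(\<lambda>k. ennreal (w \<eta> * min (F \<eta>) (real k))) \<longlonglongrightarrow> ennreal (w \<eta> * F \<eta>)"
    by (rule tendsto_eventually, rule eventually_sequentiallyI[of N]) (use N in \<open>simp add: min_def\<close>)
qed measurable

lemma integrable_bounded_times:
  assumes "square_integrable \<nu> w" "F \<in> borel_measurable \<nu>" "\<And>\<eta>. \<bar>F \<eta>\<bar> \<le> B"
  shows "integrable \<nu> (\<lambda>\<eta>. w \<eta> * F \<eta>)"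
  using square_integrable_mult[OF assms(1) square_integrable_bounded[OF assms(2,3)]] .

text \<open>Detailed balance is tested with the constant \<open>1\<close> and with
  \<open>min F k\<close>, which is bounded, and monotone convergence removes the cut. Extended
  nonnegative integrals postpone the question of integrability.\<close>

lemma nn_reversible_R:
  assumes F: "local_fun F" "\<And>\<eta>. 0 \<le> F \<eta>"
  shows "(\<integral>\<^sup>+\<eta>. ennreal (rR x \<eta> * F (move x (x + 1) \<eta>)) \<partial>\<nu>) = (\<integral>\<^sup>+\<eta>. ennreal (rL x \<eta> * F \<eta>) \<partial>\<nu>)"
proof -
  have [measurable]: "F \<in> borel_measurable \<nu>" "(\<lambda>\<eta>. F (move x (x + 1) \<eta>)) \<in> borel_measurable \<nu>"
    using F(1) local_fun_move local_fun_meas by blast+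
  have eq: "(\<integral>\<^sup>+\<eta>. ennreal (rR x \<eta> * min (F (move x (x + 1) \<eta>)) (real k)) \<partial>\<nu>)
      = (\<integral>\<^sup>+\<eta>. ennreal (rL x \<eta> * min (F \<eta>) (real k)) \<partial>\<nu>)" for k
  proof -
    have "integrable \<nu> (\<lambda>\<eta>. rR x \<eta> * min (F (move x (x + 1) \<eta>)) (real k))"
      by (rule integrable_bounded_times[where B="real k"]) (auto simp: F square_integrable_rates)
    moreover have "integrable \<nu> (\<lambda>\<eta>. rL x \<eta> * min (F \<eta>) (real k))"
      by (rule integrable_bounded_times[where B="real k"]) (auto simp: F square_integrable_rates)
    moreover have "(\<integral>\<eta>. rR x \<eta> * min (F (move x (x + 1) \<eta>)) (real k) \<partial>\<nu>) = (\<integral>\<eta>. rL x \<eta> * min (F \<eta>) (real k) \<partial>\<nu>)"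
      using reversible[of "\<lambda>_. 1" "\<lambda>\<eta>. min (F \<eta>) (real k)" x] bounded_min[of F k] F
        local_fun_comp[OF F(1), of "\<lambda>y. min y (real k)"]
      by (auto simp: image_constant_conv)
    ultimately show ?thesis
      by (subst (1 2) nn_integral_eq_integral) (auto simp: F nonneg)
  qed
  have "(\<lambda>k. \<integral>\<^sup>+\<eta>. ennreal (rR x \<eta> * min (F (move x (x + 1) \<eta>)) (real k)) \<partial>\<nu>)
      \<longlonglongrightarrow> (\<integral>\<^sup>+\<eta>. ennreal (rR x \<eta> * F (move x (x + 1) \<eta>)) \<partial>\<nu>)"
    by (rule nn_integral_min_limit) (auto simp: F nonneg)
  moreover have "(\<lambda>k. \<integral>\<^sup>+\<eta>. ennreal (rL x \<eta> * min (F \<eta>) (real k)) \<partial>\<nu>)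
      \<longlonglongrightarrow> (\<integral>\<^sup>+\<eta>. ennreal (rL x \<eta> * F \<eta>) \<partial>\<nu>)"
    by (rule nn_integral_min_limit) (auto simp: F nonneg)
  ultimately show ?thesis unfolding eq by (rule LIMSEQ_unique)
qed

lemma nn_reversible_L:
  assumes F: "local_fun F" "\<And>\<eta>. 0 \<le> F \<eta>"
  shows "(\<integral>\<^sup>+\<eta>. ennreal (rL x \<eta> * F (move (x + 1) x \<eta>)) \<partial>\<nu>) = (\<integral>\<^sup>+\<eta>. ennreal (rR x \<eta> * F \<eta>) \<partial>\<nu>)"
proof -
  have [measurable]: "F \<in> borel_measurable \<nu>" "(\<lambda>\<eta>. F (move (x + 1) x \<eta>)) \<in> borel_measurable \<nu>"
    using F(1) local_fun_move local_fun_meas by blast+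
  have eq: "(\<integral>\<^sup>+\<eta>. ennreal (rL x \<eta> * min (F (move (x + 1) x \<eta>)) (real k)) \<partial>\<nu>)
      = (\<integral>\<^sup>+\<eta>. ennreal (rR x \<eta> * min (F \<eta>) (real k)) \<partial>\<nu>)" for k
  proof -
    have "integrable \<nu> (\<lambda>\<eta>. rL x \<eta> * min (F (move (x + 1) x \<eta>)) (real k))"
      by (rule integrable_bounded_times[where B="real k"]) (auto simp: F square_integrable_rates)
    moreover have "integrable \<nu> (\<lambda>\<eta>. rR x \<eta> * min (F \<eta>) (real k))"
      by (rule integrable_bounded_times[where B="real k"]) (auto simp: F square_integrable_rates)
    moreover have "(\<integral>\<eta>. rL x \<eta> * min (F (move (x + 1) x \<eta>)) (real k) \<partial>\<nu>) = (\<integral>\<eta>. rR x \<eta> * min (F \<eta>) (real k) \<partial>\<nu>)"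
      using reversible[of "\<lambda>\<eta>. min (F \<eta>) (real k)" "\<lambda>_. 1" x] bounded_min[of F k] F
        local_fun_comp[OF F(1), of "\<lambda>y. min y (real k)"]
      by (auto simp: image_constant_conv)
    ultimately show ?thesis
      by (subst (1 2) nn_integral_eq_integral) (auto simp: F nonneg)
  qed
  have "(\<lambda>k. \<integral>\<^sup>+\<eta>. ennreal (rL x \<eta> * min (F (move (x + 1) x \<eta>)) (real k)) \<partial>\<nu>)
      \<longlonglongrightarrow> (\<integral>\<^sup>+\<eta>. ennreal (rL x \<eta> * F (move (x + 1) x \<eta>)) \<partial>\<nu>)"
    by (rule nn_integral_min_limit) (auto simp: F nonneg)
  moreover have "(\<lambda>k. \<integral>\<^sup>+\<eta>. ennreal (rR x \<eta> * min (F \<eta>) (real k)) \<partial>\<nu>)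
      \<longlonglongrightarrow> (\<integral>\<^sup>+\<eta>. ennreal (rR x \<eta> * F \<eta>) \<partial>\<nu>)"
    by (rule nn_integral_min_limit) (auto simp: F nonneg)
  ultimately show ?thesis unfolding eq by (rule LIMSEQ_unique)
qed

text \<open>Square integrability of \<open>F\<close> gives no direct control of \<open>F\<close>
  after a move. The identity of nonnegative integrals supplies it, since its other side integrates a
  product of two square integrable functions.\<close>

lemma reversible_nonneg:
  assumes F: "local_fun F" "\<And>\<eta>. 0 \<le> F \<eta>" "square_integrable \<nu> F"
  shows "integrable \<nu> (\<lambda>\<eta>. rR x \<eta> * F (move x (x + 1) \<eta>))" (is "integrable \<nu> ?f")
    "(\<integral>\<eta>. rR x \<eta> * F (move x (x + 1) \<eta>) \<partial>\<nu>) = (\<integral>\<eta>. rL x \<eta> * F \<eta> \<partial>\<nu>)"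
    "integrable \<nu> (\<lambda>\<eta>. rL x \<eta> * F (move (x + 1) x \<eta>))" (is "integrable \<nu> ?g")
    "(\<integral>\<eta>. rL x \<eta> * F (move (x + 1) x \<eta>) \<partial>\<nu>) = (\<integral>\<eta>. rR x \<eta> * F \<eta> \<partial>\<nu>)"
proof -
  have [measurable]: "F \<in> borel_measurable \<nu>" "(\<lambda>\<eta>. F (move x (x + 1) \<eta>)) \<in> borel_measurable \<nu>"
     "(\<lambda>\<eta>. F (move (x + 1) x \<eta>)) \<in> borel_measurable \<nu>"
    using F(1) local_fun_move local_fun_meas by blast+
  have iL: "integrable \<nu> (\<lambda>\<eta>. rL x \<eta> * F \<eta>)" and iR: "integrable \<nu> (\<lambda>\<eta>. rR x \<eta> * F \<eta>)"
    using square_integrable_mult square_integrable_rates F by blast+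
  have 1: "(\<integral>\<^sup>+\<eta>. ennreal (?f \<eta>) \<partial>\<nu>) = ennreal (\<integral>\<eta>. rL x \<eta> * F \<eta> \<partial>\<nu>)"
    unfolding nn_reversible_R[OF F(1,2)] using iL by (intro nn_integral_eq_integral) (auto simp: F nonneg)
  have 2: "(\<integral>\<^sup>+\<eta>. ennreal (?g \<eta>) \<partial>\<nu>) = ennreal (\<integral>\<eta>. rR x \<eta> * F \<eta> \<partial>\<nu>)"
    unfolding nn_reversible_L[OF F(1,2)] using iR by (intro nn_integral_eq_integral) (auto simp: F nonneg)
  show "integrable \<nu> ?f" by (rule integrableI_nonneg) (auto simp: 1 F nonneg)
  show "integrable \<nu> ?g" by (rule integrableI_nonneg) (auto simp: 2 F nonneg)
  show "integral\<^sup>L \<nu> ?f = (\<integral>\<eta>. rL x \<eta> * F \<eta> \<partial>\<nu>)"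
    by (rule integral_eq_nn_integral[THEN trans]) (auto simp: 1 F nonneg integral_nonneg)
  show "integral\<^sup>L \<nu> ?g = (\<integral>\<eta>. rR x \<eta> * F \<eta> \<partial>\<nu>)"
    by (rule integral_eq_nn_integral[THEN trans]) (auto simp: 2 F nonneg integral_nonneg)
qed

lemma reversible_L2:
  assumes F: "local_fun F" "square_integrable \<nu> F"
  shows "integrable \<nu> (\<lambda>\<eta>. rR x \<eta> * F (move x (x + 1) \<eta>))"
    "(\<integral>\<eta>. rR x \<eta> * F (move x (x + 1) \<eta>) \<partial>\<nu>) = (\<integral>\<eta>. rL x \<eta> * F \<eta> \<partial>\<nu>)"
    "integrable \<nu> (\<lambda>\<eta>. rL x \<eta> * F (move (x + 1) x \<eta>))"
    "(\<integral>\<eta>. rL x \<eta> * F (move (x + 1) x \<eta>) \<partial>\<nu>) = (\<integral>\<eta>. rR x \<eta> * F \<eta> \<partial>\<nu>)"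
proof -
  let ?P = "\<lambda>\<eta>. max 0 (F \<eta>)" and ?N = "\<lambda>\<eta>. max 0 (- F \<eta>)"
  have PN: "F \<eta> = ?P \<eta> - ?N \<eta>" for \<eta> by auto
  have meas: "F \<in> borel_measurable \<nu>" using F by (simp add: square_integrable_def)
  have sq: "square_integrable \<nu> ?P" "square_integrable \<nu> ?N"
    by (rule square_integrable_dominated[OF F(2)]; use meas in auto)+
  have loc: "local_fun ?P" "local_fun ?N" using F(1) by (auto intro: local_fun_comp)
  note P = reversible_nonneg[OF loc(1) _ sq(1), of x] and N = reversible_nonneg[OF loc(2) _ sq(2), of x]
  have i: "integrable \<nu> (\<lambda>\<eta>. rL x \<eta> * ?P \<eta>)" "integrable \<nu> (\<lambda>\<eta>. rL x \<eta> * ?N \<eta>)"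
     "integrable \<nu> (\<lambda>\<eta>. rR x \<eta> * ?P \<eta>)" "integrable \<nu> (\<lambda>\<eta>. rR x \<eta> * ?N \<eta>)"
    using sq square_integrable_rates square_integrable_mult by blast+
  have 1: "(\<lambda>\<eta>. rR x \<eta> * F (move x (x + 1) \<eta>)) = (\<lambda>\<eta>. rR x \<eta> * ?P (move x (x + 1) \<eta>) - rR x \<eta> * ?N (move x (x + 1) \<eta>))"
    by (rule ext, subst PN) (rule right_diff_distrib)
  have 2: "(\<lambda>\<eta>. rL x \<eta> * F (move (x + 1) x \<eta>)) = (\<lambda>\<eta>. rL x \<eta> * ?P (move (x + 1) x \<eta>) - rL x \<eta> * ?N (move (x + 1) x \<eta>))"
    by (rule ext, subst PN) (rule right_diff_distrib)
  have 3: "(\<lambda>\<eta>. rL x \<eta> * F \<eta>) = (\<lambda>\<eta>. rL x \<eta> * ?P \<eta> - rL x \<eta> * ?N \<eta>)"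
    by (rule ext, subst PN) (rule right_diff_distrib)
  have 4: "(\<lambda>\<eta>. rR x \<eta> * F \<eta>) = (\<lambda>\<eta>. rR x \<eta> * ?P \<eta> - rR x \<eta> * ?N \<eta>)"
    by (rule ext, subst PN) (rule right_diff_distrib)
  show "integrable \<nu> (\<lambda>\<eta>. rR x \<eta> * F (move x (x + 1) \<eta>))" unfolding 1
    by (rule Bochner_Integration.integrable_diff) (rule P N, simp)+
  show "integrable \<nu> (\<lambda>\<eta>. rL x \<eta> * F (move (x + 1) x \<eta>))" unfolding 2
    by (rule Bochner_Integration.integrable_diff) (rule P N, simp)+
  show "(\<integral>\<eta>. rR x \<eta> * F (move x (x + 1) \<eta>) \<partial>\<nu>) = (\<integral>\<eta>. rL x \<eta> * F \<eta> \<partial>\<nu>)"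
    unfolding 1 3 using P N i by (subst (1 2) Bochner_Integration.integral_diff) auto
  show "(\<integral>\<eta>. rL x \<eta> * F (move (x + 1) x \<eta>) \<partial>\<nu>) = (\<integral>\<eta>. rR x \<eta> * F \<eta> \<partial>\<nu>)"
    unfolding 2 4 using P N i by (subst (1 2) Bochner_Integration.integral_diff) auto
qed

text \<open>The bonds that touch \<open>box l\<close> are those with
  \<open>- l - 1 <= x <= l\<close>, so a window with \<open>l < N\<close> contains them all. The
  window may be as large as desired, which the telescoping argument exploits.\<close>

lemma generator_formula_finite:
  assumes "supported_on l f" "l < N"
  shows "generator_formula bR bL a \<gamma> n f \<eta> = (real n)\<^sup>2 * (\<Sum>x\<in>box N.
     rR x \<eta> * jump_prob a \<gamma> n * grad x (x + 1) f \<eta> + rL x \<eta> * (1 - jump_prob a \<gamma> n) * grad (x + 1) x f \<eta>)"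
proof -
  have "x \<notin> box l" "x + 1 \<notin> box l" if "x \<notin> box N" for x
    using that assms(2) by (auto simp: box_def)
  then have z: "grad x (x + 1) f \<eta> = 0" "grad (x + 1) x f \<eta> = 0" if "x \<notin> box N" for x
    using that grad_outside[OF assms(1)] by blast+
  show ?thesis
    unfolding generator_formula_def
    by (subst infsum_cong_neutral[where T="box N" and g="\<lambda>x. rR x \<eta> * jump_prob a \<gamma> n * grad x (x + 1) f \<eta>
        + rL x \<eta> * (1 - jump_prob a \<gamma> n) * grad (x + 1) x f \<eta>"]) (auto simp: z infsum_finite)
qed

lemma telescope_rates: "(\<Sum>x\<in>box N. rL x \<eta> - rR x \<eta>) = c (translate (int N + 1) \<eta>) - c (translate (- int N) \<eta>)"
proof -
  have *: "rL x \<eta> - rR x \<eta> = c (translate (x + 1) \<eta>) - c (translate x \<eta>)" for x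
    using gradient[of x \<eta>] by simp
  have "(\<Sum>x=- int N..- int N + int k. c (translate (x + 1) \<eta>) - c (translate x \<eta>))
      = c (translate (- int N + int k + 1) \<eta>) - c (translate (- int N) \<eta>)" for k
  proof (induction k)
    case (Suc k)
    have "{- int N..- int N + int (Suc k)} = insert (- int N + int (Suc k)) {- int N..- int N + int k}" by auto
    with Suc show ?case by (simp add: algebra_simps)
  qed simp
  from this[of "2 * N"] show ?thesis by (simp add: box_def *)
qed

text \<open>The sum telescopes to two translates of \<open>c\<close>, far to the right and far to
  the left. By mixing both pair with \<open>F\<close> to the same product of means, so their
  difference cancels in the limit.\<close>

lemma boundary_vanishes:
  assumes "local_fun F" "square_integrable \<nu> F"
  shows "(\<lambda>N. \<integral>\<eta>. (\<Sum>x\<in>box N. rL x \<eta> - rR x \<eta>) * F \<eta> \<partial>\<nu>) \<longlonglongrightarrow> 0"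
proof -
  have ct: "square_integrable \<nu> (\<lambda>\<eta>. c (translate x \<eta>))" for x
    by (rule square_integrable_translate[OF square_integrable_c])
  have lim: "((\<lambda>x. \<integral>\<eta>. F \<eta> * c (translate x \<eta>) \<partial>\<nu>) \<longlongrightarrow> (\<integral>\<eta>. F \<eta> \<partial>\<nu>) * (\<integral>\<eta>. c \<eta> \<partial>\<nu>))
          (filtercomap abs at_top)"
    using mixing assms square_integrable_c supp(3) unfolding mixing_exp_moments_def Lp_2_iff local_fun_def
    by blast
  have f1: "filterlim (\<lambda>N. int N + 1) (filtercomap abs at_top) sequentially"
    unfolding filterlim_filtercomap_iff o_def
    by (rule filterlim_at_top_mono[OF filterlim_int_sequentially]) simp
  have f2: "filterlim (\<lambda>N. - int N) (filtercomap abs at_top) sequentially"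
    unfolding filterlim_filtercomap_iff o_def
    by (rule filterlim_at_top_mono[OF filterlim_int_sequentially]) simp
  have "(\<lambda>N. (\<integral>\<eta>. F \<eta> * c (translate (int N + 1) \<eta>) \<partial>\<nu>) - (\<integral>\<eta>. F \<eta> * c (translate (- int N) \<eta>) \<partial>\<nu>))
      \<longlonglongrightarrow> (\<integral>\<eta>. F \<eta> \<partial>\<nu>) * (\<integral>\<eta>. c \<eta> \<partial>\<nu>) - (\<integral>\<eta>. F \<eta> \<partial>\<nu>) * (\<integral>\<eta>. c \<eta> \<partial>\<nu>)"
    using filterlim_compose[OF lim f1] filterlim_compose[OF lim f2] by (intro tendsto_diff)
  moreover have "(\<integral>\<eta>. (\<Sum>x\<in>box N. rL x \<eta> - rR x \<eta>) * F \<eta> \<partial>\<nu>)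
     = (\<integral>\<eta>. F \<eta> * c (translate (int N + 1) \<eta>) \<partial>\<nu>) - (\<integral>\<eta>. F \<eta> * c (translate (- int N) \<eta>) \<partial>\<nu>)" for N
    unfolding telescope_rates
    by (subst Bochner_Integration.integral_diff[symmetric])
      (use square_integrable_mult[OF assms(2) ct] in \<open>auto simp: algebra_simps\<close>)
  ultimately show ?thesis by simp
qed

text \<open>After the change of variables in \<open>reversible_L2\<close>, the bond at
  \<open>x\<close> contributes the mean of \<open>(rL x - rR x) * f\<close>, weighted by the
  asymmetry \<open>2 p - 1\<close> of the jump probability \<open>p\<close>. The integral does not
  depend on the window, so \<open>boundary_vanishes\<close> makes it zero. This is the source of the
  invariance of \<open>\<nu>\<close>.\<close>

lemma generator_mean_zero:
  assumes supp_f: "supported_on l f" and f: "square_integrable \<nu> f"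
  shows "(\<integral>\<eta>. generator_formula bR bL a \<gamma> n f \<eta> \<partial>\<nu>) = 0"
proof -
  let ?p = "jump_prob a \<gamma> n"
  have loc: "local_fun f" using supp_f by (rule local_funI)
  have eq: "(\<integral>\<eta>. generator_formula bR bL a \<gamma> n f \<eta> \<partial>\<nu>)
      = (real n)\<^sup>2 * (2 * ?p - 1) * (\<integral>\<eta>. (\<Sum>x\<in>box N. rL x \<eta> - rR x \<eta>) * f \<eta> \<partial>\<nu>)" if "l < N" for N
  proof -
    have iR: "integrable \<nu> (\<lambda>\<eta>. rR x \<eta> * f \<eta>)" and iL: "integrable \<nu> (\<lambda>\<eta>. rL x \<eta> * f \<eta>)" for x
      using square_integrable_mult[OF _ f] square_integrable_rates by blast+
    note r = reversible_L2[OF loc f]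
    have t: "rR x \<eta> * ?p * grad x (x + 1) f \<eta> + rL x \<eta> * (1 - ?p) * grad (x + 1) x f \<eta>
       = ?p * (rR x \<eta> * f (move x (x + 1) \<eta>) - rR x \<eta> * f \<eta>)
         + (1 - ?p) * (rL x \<eta> * f (move (x + 1) x \<eta>) - rL x \<eta> * f \<eta>)" for x \<eta>
      by (simp add: grad_def algebra_simps)
    have "(\<integral>\<eta>. generator_formula bR bL a \<gamma> n f \<eta> \<partial>\<nu>) = (real n)\<^sup>2 * (\<Sum>x\<in>box N.
        ?p * ((\<integral>\<eta>. rL x \<eta> * f \<eta> \<partial>\<nu>) - (\<integral>\<eta>. rR x \<eta> * f \<eta> \<partial>\<nu>))
         + (1 - ?p) * ((\<integral>\<eta>. rR x \<eta> * f \<eta> \<partial>\<nu>) - (\<integral>\<eta>. rL x \<eta> * f \<eta> \<partial>\<nu>)))"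
      unfolding generator_formula_finite[OF supp_f that] t using r iR iL by simp
    also have "\<dots> = (real n)\<^sup>2 * (2 * ?p - 1) * (\<Sum>x\<in>box N. (\<integral>\<eta>. rL x \<eta> * f \<eta> \<partial>\<nu>) - (\<integral>\<eta>. rR x \<eta> * f \<eta> \<partial>\<nu>))"
      by (simp add: sum_distrib_left algebra_simps)
    also have "(\<Sum>x\<in>box N. (\<integral>\<eta>. rL x \<eta> * f \<eta> \<partial>\<nu>) - (\<integral>\<eta>. rR x \<eta> * f \<eta> \<partial>\<nu>))
       = (\<integral>\<eta>. (\<Sum>x\<in>box N. rL x \<eta> - rR x \<eta>) * f \<eta> \<partial>\<nu>)"
      using iR iL by (simp add: sum_distrib_right left_diff_distrib)
    finally show ?thesis .
  qed
  have "(\<lambda>N. (real n)\<^sup>2 * (2 * ?p - 1) * (\<integral>\<eta>. (\<Sum>x\<in>box N. rL x \<eta> - rR x \<eta>) * f \<eta> \<partial>\<nu>))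
      \<longlonglongrightarrow> 0"
    by (intro tendsto_mult_right_zero boundary_vanishes loc f)
  then have "(\<lambda>N. \<integral>\<eta>. generator_formula bR bL a \<gamma> n f \<eta> \<partial>\<nu>) \<longlonglongrightarrow> 0"
    by (rule Lim_transform_eventually)
      (rule eventually_sequentiallyI[of "Suc l"], rule eq[symmetric], simp)
  then show ?thesis by (simp add: LIMSEQ_const_iff)
qed

text \<open>A truncation \<open>g\<close> of \<open>f\<close> is used because detailed balance is only assumed for bounded functions.
  With \<open>huber m\<close> the primitive of \<open>clip m\<close>, convexity bounds \<open>g\<close> times the increment of \<open>f\<close> by an exact
  increment, whose contributions telescope by the gradient condition, minus half the squared
  increment of \<open>g\<close>.\<close>

lemma truncated_energy:
  assumes supp_f: "supported_on l f" and f: "square_integrable \<nu> f"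
    and Lf: "square_integrable \<nu> (generator_formula bR bL a \<gamma> n f)"
    and p: "0 \<le> jump_prob a \<gamma> n" "jump_prob a \<gamma> n \<le> 1" and m: "0 \<le> m"
  defines "g \<equiv> \<lambda>\<eta>. clip m (f \<eta>)"
  shows "(\<integral>\<eta>. g \<eta> * generator_formula bR bL a \<gamma> n f \<eta> \<partial>\<nu>)
      \<le> - ((real n)\<^sup>2 / 2) * (\<Sum>x\<in>box (l + 1). bond_energy \<nu> (bR n) x g)"
proof -
  let ?p = "jump_prob a \<gamma> n"
  let ?H = "\<lambda>\<eta>. huber m (f \<eta>)"
  have loc: "local_fun f" using supp_f by (rule local_funI)
  have locH: "local_fun ?H" and locg: "local_fun g" and locg2: "local_fun (\<lambda>\<eta>. (g \<eta>)\<^sup>2)"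
    unfolding g_def using loc by (auto intro: local_fun_comp local_fun_comp[of f "\<lambda>y. (clip m y)\<^sup>2"])
  have gb: "\<bar>g \<eta>\<bar> \<le> m" for \<eta> unfolding g_def using clip_bound[OF m] .
  have g2b: "\<bar>(g \<eta>)\<^sup>2\<bar> \<le> m\<^sup>2" for \<eta> using gb[of \<eta>] by (metis abs_le_square_iff abs_of_nonneg m abs_power2)
  have sqH: "square_integrable \<nu> ?H"
    by (rule square_integrable_dominated[OF square_integrable_cmult[OF f, of m]])
      (use huber_bounds[OF m] local_fun_meas[OF locH] m in \<open>auto simp: abs_mult\<close>)
  have sqg2: "square_integrable \<nu> (\<lambda>\<eta>. (g \<eta>)\<^sup>2)"
    by (rule square_integrable_bounded[OF local_fun_meas[OF locg2] g2b])
  have sqg: "square_integrable \<nu> g"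
    by (rule square_integrable_bounded[OF local_fun_meas[OF locg] gb])
  have [measurable]: "g \<in> borel_measurable \<nu>" "(\<lambda>\<eta>. g (move x y \<eta>)) \<in> borel_measurable \<nu>" for x y
    using locg local_fun_move local_fun_meas by blast+
  have iHR: "integrable \<nu> (\<lambda>\<eta>. rR x \<eta> * ?H \<eta>)" and iHL: "integrable \<nu> (\<lambda>\<eta>. rL x \<eta> * ?H \<eta>)" for x
    using square_integrable_mult[OF _ sqH] square_integrable_rates by blast+
  note rH = reversible_L2[OF locH sqH]
  note rg = reversible_L2[OF locg2 sqg2]
  let ?e = "\<lambda>x. bond_energy \<nu> (bR n) x g"
  have ig: "integrable \<nu> (\<lambda>\<eta>. rR x \<eta> * (g \<eta>)\<^sup>2)" "integrable \<nu> (\<lambda>\<eta>. rL x \<eta> * (g \<eta>)\<^sup>2)" for x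
    using square_integrable_mult[OF _ sqg2] square_integrable_rates by blast+
  have igg: "integrable \<nu> (\<lambda>\<eta>. rR x \<eta> * (g \<eta> * g (move x (x + 1) \<eta>)))"
       "integrable \<nu> (\<lambda>\<eta>. rL x \<eta> * (g (move (x + 1) x \<eta>) * g \<eta>))" for x
    by (rule integrable_bounded_times[OF square_integrable_rates(1), where B="m * m"],
        use gb in \<open>auto simp: abs_mult intro!: mult_mono m\<close>)
       (rule integrable_bounded_times[OF square_integrable_rates(2), where B="m * m"],
        use gb in \<open>auto simp: abs_mult intro!: mult_mono m\<close>)
  have eR: "(\<lambda>\<eta>. rR x \<eta> * (grad x (x + 1) g \<eta>)\<^sup>2) = (\<lambda>\<eta>. rR x \<eta> * (g (move x (x + 1) \<eta>))\<^sup>2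
       - 2 * (rR x \<eta> * (g \<eta> * g (move x (x + 1) \<eta>))) + rR x \<eta> * (g \<eta>)\<^sup>2)" for x
    by (auto simp: grad_def power2_eq_square algebra_simps)
  have eL: "(\<lambda>\<eta>. rL x \<eta> * (grad (x + 1) x g \<eta>)\<^sup>2) = (\<lambda>\<eta>. rL x \<eta> * (g (move (x + 1) x \<eta>))\<^sup>2
       - 2 * (rL x \<eta> * (g (move (x + 1) x \<eta>) * g \<eta>)) + rL x \<eta> * (g \<eta>)\<^sup>2)" for x
    by (auto simp: grad_def power2_eq_square algebra_simps)
  have ieR: "integrable \<nu> (\<lambda>\<eta>. rR x \<eta> * (grad x (x + 1) g \<eta>)\<^sup>2)"
    and ieL: "integrable \<nu> (\<lambda>\<eta>. rL x \<eta> * (grad (x + 1) x g \<eta>)\<^sup>2)" for x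
    unfolding eR eL using ig igg rg by auto
  have gg: "(\<integral>\<eta>. rR x \<eta> * (g \<eta> * g (move x (x + 1) \<eta>)) \<partial>\<nu>) = (\<integral>\<eta>. rL x \<eta> * (g (move (x + 1) x \<eta>) * g \<eta>) \<partial>\<nu>)" for x
  proof -
    have "bounded (range g)" by (rule boundedI[of _ m]) (use gb in auto)
    from reversible[OF locg this locg this, of x] show ?thesis by (simp add: mult.assoc)
  qed
  \<comment> \<open>By detailed balance, left jumps over a bond carry the same energy as right
    jumps. Hence the weights \<open>?p\<close> and \<open>1 - ?p\<close> recombine to one and the
    asymmetry leaves no trace in the energy.\<close>
  have eeq: "(\<integral>\<eta>. rL x \<eta> * (grad (x + 1) x g \<eta>)\<^sup>2 \<partial>\<nu>) = ?e x" for x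
    unfolding bond_energy_def eR eL using ig[of x] igg[of x] rg[of x] gg[of x] by simp
  define U where "U x \<eta> = ?p * ((rR x \<eta> * ?H (move x (x + 1) \<eta>) - rR x \<eta> * ?H \<eta>) - rR x \<eta> * (grad x (x + 1) g \<eta>)\<^sup>2 / 2)
     + (1 - ?p) * ((rL x \<eta> * ?H (move (x + 1) x \<eta>) - rL x \<eta> * ?H \<eta>) - rL x \<eta> * (grad (x + 1) x g \<eta>)\<^sup>2 / 2)" for x \<eta>
  have iU: "integrable \<nu> (U x)" for x unfolding U_def[abs_def] using rH iHR iHL ieR ieL by auto
  have U: "(\<integral>\<eta>. U x \<eta> \<partial>\<nu>) = (2 * ?p - 1) * ((\<integral>\<eta>. rL x \<eta> * ?H \<eta> \<partial>\<nu>) - (\<integral>\<eta>. rR x \<eta> * ?H \<eta> \<partial>\<nu>)) - ?e x / 2" for x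
  proof -
    have "(\<integral>\<eta>. U x \<eta> \<partial>\<nu>) = ?p * (((\<integral>\<eta>. rL x \<eta> * ?H \<eta> \<partial>\<nu>) - (\<integral>\<eta>. rR x \<eta> * ?H \<eta> \<partial>\<nu>)) - ?e x / 2)
       + (1 - ?p) * (((\<integral>\<eta>. rR x \<eta> * ?H \<eta> \<partial>\<nu>) - (\<integral>\<eta>. rL x \<eta> * ?H \<eta> \<partial>\<nu>)) - ?e x / 2)"
      unfolding U_def using rH[of x] iHR[of x] iHL[of x] ieR[of x] ieL[of x] eeq[of x]
      by (simp add: bond_energy_def)
    then show ?thesis by (simp add: field_simps)
  qed
  \<comment> \<open>The convexity inequality is multiplied by the rates and by \<open>?p\<close> and
    \<open>1 - ?p\<close>; it survives because all of them are nonnegative.\<close>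
  have pointwise: "g \<eta> * (rR x \<eta> * ?p * grad x (x + 1) f \<eta> + rL x \<eta> * (1 - ?p) * grad (x + 1) x f \<eta>) \<le> U x \<eta>" for x \<eta>
  proof -
    have "g \<eta> * grad x y f \<eta> \<le> ?H (move x y \<eta>) - ?H \<eta> - (grad x y g \<eta>)\<^sup>2 / 2" for x y
      using huber_convex[OF m, of "f \<eta>" "f (move x y \<eta>)"] by (simp add: grad_def g_def)
    then have "rR x \<eta> * (g \<eta> * grad x (x + 1) f \<eta>) \<le> rR x \<eta> * (?H (move x (x + 1) \<eta>) - ?H \<eta> - (grad x (x + 1) g \<eta>)\<^sup>2 / 2)"
      "rL x \<eta> * (g \<eta> * grad (x + 1) x f \<eta>) \<le> rL x \<eta> * (?H (move (x + 1) x \<eta>) - ?H \<eta> - (grad (x + 1) x g \<eta>)\<^sup>2 / 2)"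
      using nonneg by (auto intro!: mult_left_mono)
    then have "?p * (rR x \<eta> * (g \<eta> * grad x (x + 1) f \<eta>)) + (1 - ?p) * (rL x \<eta> * (g \<eta> * grad (x + 1) x f \<eta>))
      \<le> ?p * (rR x \<eta> * (?H (move x (x + 1) \<eta>) - ?H \<eta> - (grad x (x + 1) g \<eta>)\<^sup>2 / 2))
       + (1 - ?p) * (rL x \<eta> * (?H (move (x + 1) x \<eta>) - ?H \<eta> - (grad (x + 1) x g \<eta>)\<^sup>2 / 2))"
      using p by (intro add_mono[OF mult_left_mono mult_left_mono]) auto
    then show ?thesis unfolding U_def by (simp add: algebra_simps)
  qed
  let ?E = "\<Sum>x\<in>box (l + 1). ?e x"
  have supp_g: "supported_on l g" unfolding g_def using supp_f by (rule supported_on_comp)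
  have Esum: "(\<Sum>x\<in>box N. ?e x) = ?E" if "l < N" for N
  proof (rule sum.mono_neutral_right)
    show "\<forall>x\<in>box N - box (l + 1). ?e x = 0"
    proof
      fix x assume "x \<in> box N - box (l + 1)"
      then have "x \<notin> box l" "x + 1 \<notin> box l" by (auto simp: box_def)
      then have "grad x (x + 1) g \<eta> = 0" for \<eta> by (rule grad_outside[OF supp_g])
      then show "?e x = 0" by (simp add: bond_energy_def)
    qed
  qed (use that box_mono[of "l + 1" N] in auto)
  have le: "(\<integral>\<eta>. g \<eta> * generator_formula bR bL a \<gamma> n f \<eta> \<partial>\<nu>)
      \<le> (real n)\<^sup>2 * ((2 * ?p - 1) * (\<integral>\<eta>. (\<Sum>x\<in>box N. rL x \<eta> - rR x \<eta>) * ?H \<eta> \<partial>\<nu>) - ?E / 2)" if "l < N" for N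
  proof -
    have "(\<integral>\<eta>. g \<eta> * generator_formula bR bL a \<gamma> n f \<eta> \<partial>\<nu>) \<le> (\<integral>\<eta>. (real n)\<^sup>2 * (\<Sum>x\<in>box N. U x \<eta>) \<partial>\<nu>)"
    proof (rule integral_mono)
      show "integrable \<nu> (\<lambda>\<eta>. g \<eta> * generator_formula bR bL a \<gamma> n f \<eta>)"
        by (rule square_integrable_mult[OF sqg Lf])
      show "integrable \<nu> (\<lambda>\<eta>. (real n)\<^sup>2 * (\<Sum>x\<in>box N. U x \<eta>))" using iU by auto
      fix \<eta>
      have "g \<eta> * generator_formula bR bL a \<gamma> n f \<eta> = (real n)\<^sup>2 * (\<Sum>x\<in>box N.
          g \<eta> * (rR x \<eta> * ?p * grad x (x + 1) f \<eta> + rL x \<eta> * (1 - ?p) * grad (x + 1) x f \<eta>))"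
        unfolding generator_formula_finite[OF supp_f that] by (simp add: sum_distrib_left mult.left_commute)
      also have "\<dots> \<le> (real n)\<^sup>2 * (\<Sum>x\<in>box N. U x \<eta>)"
        by (intro mult_left_mono sum_mono pointwise) auto
      finally show "g \<eta> * generator_formula bR bL a \<gamma> n f \<eta> \<le> (real n)\<^sup>2 * (\<Sum>x\<in>box N. U x \<eta>)" .
    qed
    also have "\<dots> = (real n)\<^sup>2 * (\<Sum>x\<in>box N. \<integral>\<eta>. U x \<eta> \<partial>\<nu>)" using iU by simp
    also have "(\<Sum>x\<in>box N. \<integral>\<eta>. U x \<eta> \<partial>\<nu>) = (2 * ?p - 1) * (\<Sum>x\<in>box N. (\<integral>\<eta>. rL x \<eta> * ?H \<eta> \<partial>\<nu>) - (\<integral>\<eta>. rR x \<eta> * ?H \<eta> \<partial>\<nu>)) - (\<Sum>x\<in>box N. ?e x) / 2"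
      unfolding U by (simp only: sum_subtractf sum_distrib_left[symmetric] sum_divide_distrib[symmetric])
    also have "(\<Sum>x\<in>box N. (\<integral>\<eta>. rL x \<eta> * ?H \<eta> \<partial>\<nu>) - (\<integral>\<eta>. rR x \<eta> * ?H \<eta> \<partial>\<nu>))
       = (\<integral>\<eta>. (\<Sum>x\<in>box N. rL x \<eta> - rR x \<eta>) * ?H \<eta> \<partial>\<nu>)"
      using iHR iHL by (simp add: sum_distrib_right left_diff_distrib)
    finally show ?thesis unfolding Esum[OF that] .
  qed
  \<comment> \<open>The left side of \<open>le\<close> and the energy \<open>?E\<close> do not
    depend on \<open>N\<close>; only the asymmetric part does, and it vanishes in the limit.\<close>
  have "(\<lambda>N. (real n)\<^sup>2 * ((2 * ?p - 1) * (\<integral>\<eta>. (\<Sum>x\<in>box N. rL x \<eta> - rR x \<eta>) * ?H \<eta> \<partial>\<nu>) - ?E / 2))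
      \<longlonglongrightarrow> (real n)\<^sup>2 * ((2 * ?p - 1) * 0 - ?E / 2)"
    by (intro tendsto_intros boundary_vanishes locH sqH)
  then have "(\<integral>\<eta>. g \<eta> * generator_formula bR bL a \<gamma> n f \<eta> \<partial>\<nu>) \<le> (real n)\<^sup>2 * ((2 * ?p - 1) * 0 - ?E / 2)"
    by (rule LIMSEQ_le_const) (use le in \<open>auto intro!: exI[of _ "Suc l"]\<close>)
  then show ?thesis by (simp add: field_simps)
qed

text \<open>The truncation level tends to infinity: dominated convergence on the generator side,
  where clipping only decreases the absolute value of the integrand, and Fatou on the energy side.
  Finiteness of the energy is part of the outcome, since \<open>f\<close> is only known to be square
  integrable.\<close>

lemma energy_bound:
  assumes supp_f: "supported_on l f" and f: "square_integrable \<nu> f"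
    and Lf: "square_integrable \<nu> (generator_formula bR bL a \<gamma> n f)"
    and p: "0 \<le> jump_prob a \<gamma> n" "jump_prob a \<gamma> n \<le> 1" and n: "n \<ge> 1"
  shows "integrable \<nu> (\<lambda>\<eta>. rR x \<eta> * (grad x (x + 1) f \<eta>)\<^sup>2)"
    and "(real n)\<^sup>2 / 2 * (\<Sum>x\<in>box (l + 1). bond_energy \<nu> (bR n) x f) \<le> - ip \<nu> f (generator_formula bR bL a \<gamma> n f)"
proof -
  let ?L = "generator_formula bR bL a \<gamma> n f"
  let ?g = "\<lambda>m \<eta>. clip (real m) (f \<eta>)"
  have loc: "local_fun f" using supp_f by (rule local_funI)
  have locg: "local_fun (?g m)" for m using loc by (rule local_fun_comp)
  have [measurable]: "f \<in> borel_measurable \<nu>" "?L \<in> borel_measurable \<nu>" "?g m \<in> borel_measurable \<nu>"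
     "grad x y f \<in> borel_measurable \<nu>" "grad x y (?g m) \<in> borel_measurable \<nu>" for m x y
    using loc Lf locg local_fun_grad local_fun_meas by (auto simp: square_integrable_def)
  have limg: "(\<lambda>m. ?g m \<eta>) \<longlonglongrightarrow> f \<eta>" for \<eta>
    by (rule tendsto_eventually[OF clip_eventually])
  have lim: "(\<lambda>m. \<integral>\<eta>. ?g m \<eta> * ?L \<eta> \<partial>\<nu>) \<longlonglongrightarrow> (\<integral>\<eta>. f \<eta> * ?L \<eta> \<partial>\<nu>)"
  proof (rule integral_dominated_convergence[where w="\<lambda>\<eta>. \<bar>f \<eta> * ?L \<eta>\<bar>"])
    show "integrable \<nu> (\<lambda>\<eta>. \<bar>f \<eta> * ?L \<eta>\<bar>)" using square_integrable_mult[OF f Lf] by simp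
    show "AE \<eta> in \<nu>. (\<lambda>m. ?g m \<eta> * ?L \<eta>) \<longlonglongrightarrow> f \<eta> * ?L \<eta>" by (intro always_eventually allI tendsto_mult limg tendsto_const)
    show "AE \<eta> in \<nu>. norm (?g m \<eta> * ?L \<eta>) \<le> \<bar>f \<eta> * ?L \<eta>\<bar>" for m
      by (intro always_eventually allI) (auto simp: abs_mult intro!: mult_right_mono clip_le)
  qed measurable
  define S where "S h \<eta> = (\<Sum>x\<in>box (l + 1). rR x \<eta> * (grad x (x + 1) h \<eta>)\<^sup>2)" for h \<eta>
  have Snn: "0 \<le> S h \<eta>" for h \<eta> unfolding S_def using nonneg by (auto intro!: sum_nonneg)
  have n2: "(real n)\<^sup>2 > 0" using n by simp
  have ig: "integrable \<nu> (\<lambda>\<eta>. rR x \<eta> * (grad x (x + 1) (?g m) \<eta>)\<^sup>2)" for x m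
  proof (rule integrable_bounded_times[OF square_integrable_rates(1), where B="(2 * real m)\<^sup>2"])
    fix \<eta>
    have "\<bar>grad x (x + 1) (?g m) \<eta>\<bar> \<le> 2 * real m"
      using clip_bound[of "real m" "f \<eta>"] clip_bound[of "real m" "f (move x (x + 1) \<eta>)"]
      unfolding grad_def by (intro abs_leI) linarith+
    then show "\<bar>(grad x (x + 1) (?g m) \<eta>)\<^sup>2\<bar> \<le> (2 * real m)\<^sup>2"
      using abs_le_square_iff[of "grad x (x + 1) (?g m) \<eta>" "2 * real m"] by simp
  qed measurable
  have Sg: "(\<integral>\<^sup>+\<eta>. ennreal (S (?g m) \<eta>) \<partial>\<nu>) \<le> ennreal (- (2 / (real n)\<^sup>2) * (\<integral>\<eta>. ?g m \<eta> * ?L \<eta> \<partial>\<nu>))" for m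
  proof -
    have "integrable \<nu> (S (?g m))" unfolding S_def[abs_def] using ig by auto
    then have "(\<integral>\<^sup>+\<eta>. ennreal (S (?g m) \<eta>) \<partial>\<nu>) = ennreal (\<integral>\<eta>. S (?g m) \<eta> \<partial>\<nu>)"
      by (intro nn_integral_eq_integral) (auto simp: Snn)
    also have "(\<integral>\<eta>. S (?g m) \<eta> \<partial>\<nu>) = (\<Sum>x\<in>box (l + 1). bond_energy \<nu> (bR n) x (?g m))"
      unfolding S_def bond_energy_def using ig by simp
    also have "ennreal \<dots> \<le> ennreal (- (2 / (real n)\<^sup>2) * (\<integral>\<eta>. ?g m \<eta> * ?L \<eta> \<partial>\<nu>))"
      using truncated_energy[OF supp_f f Lf p, of "real m"] n2 by (intro ennreal_leI) (simp add: field_simps)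
    finally show ?thesis .
  qed
  have "(\<integral>\<^sup>+\<eta>. ennreal (S f \<eta>) \<partial>\<nu>) = (\<integral>\<^sup>+\<eta>. liminf (\<lambda>m. ennreal (S (?g m) \<eta>)) \<partial>\<nu>)"
  proof (rule nn_integral_cong)
    fix \<eta>
    have "(\<lambda>m. S (?g m) \<eta>) \<longlonglongrightarrow> S f \<eta>"
      unfolding S_def grad_def by (intro tendsto_intros limg)
    then have "(\<lambda>m. ennreal (S (?g m) \<eta>)) \<longlonglongrightarrow> ennreal (S f \<eta>)" by (rule tendsto_ennrealI)
    from lim_imp_Liminf[OF trivial_limit_sequentially this]
    show "ennreal (S f \<eta>) = liminf (\<lambda>m. ennreal (S (?g m) \<eta>))" by simp
  qed
  also have "\<dots> \<le> liminf (\<lambda>m. \<integral>\<^sup>+\<eta>. ennreal (S (?g m) \<eta>) \<partial>\<nu>)"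
    by (rule nn_integral_liminf) (simp add: S_def)
  also have "\<dots> \<le> liminf (\<lambda>m. ennreal (- (2 / (real n)\<^sup>2) * (\<integral>\<eta>. ?g m \<eta> * ?L \<eta> \<partial>\<nu>)))"
    by (intro Liminf_mono always_eventually allI Sg)
  also have "\<dots> = ennreal (- (2 / (real n)\<^sup>2) * (\<integral>\<eta>. f \<eta> * ?L \<eta> \<partial>\<nu>))"
    by (intro lim_imp_Liminf tendsto_ennrealI tendsto_mult lim tendsto_const) simp
  finally have Sf: "(\<integral>\<^sup>+\<eta>. ennreal (S f \<eta>) \<partial>\<nu>) \<le> ennreal (- (2 / (real n)\<^sup>2) * (\<integral>\<eta>. f \<eta> * ?L \<eta> \<partial>\<nu>))" .
  have iS: "integrable \<nu> (S f)"
  proof (rule integrableI_nonneg)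
    show "S f \<in> borel_measurable \<nu>" unfolding S_def[abs_def] by measurable
    show "(\<integral>\<^sup>+\<eta>. ennreal (S f \<eta>) \<partial>\<nu>) < \<infinity>" using Sf by (auto simp: less_top[symmetric] top_unique)
  qed (simp add: Snn)
  have i: "integrable \<nu> (\<lambda>\<eta>. rR x \<eta> * (grad x (x + 1) f \<eta>)\<^sup>2)" for x
  proof (cases "x \<in> box (l + 1)")
    case True
    show ?thesis
    proof (rule Bochner_Integration.integrable_bound[OF iS])
      show "AE \<eta> in \<nu>. norm (rR x \<eta> * (grad x (x + 1) f \<eta>)\<^sup>2) \<le> norm (S f \<eta>)"
        using True nonneg Snn unfolding S_def
        by (intro always_eventually allI) (auto intro!: member_le_sum simp: sum_nonneg)
    qed measurable
  next
    case False
    then have "x \<notin> box l" "x + 1 \<notin> box l" by (auto simp: box_def)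
    then have "grad x (x + 1) f \<eta> = 0" for \<eta> by (rule grad_outside[OF supp_f])
    then show ?thesis by simp
  qed
  then show "integrable \<nu> (\<lambda>\<eta>. rR x \<eta> * (grad x (x + 1) f \<eta>)\<^sup>2)" .
  have en: "ennreal (\<integral>\<eta>. S f \<eta> \<partial>\<nu>) \<le> ennreal (- (2 / (real n)\<^sup>2) * (\<integral>\<eta>. f \<eta> * ?L \<eta> \<partial>\<nu>))"
    using Sf nn_integral_eq_integral[OF iS] Snn by simp
  \<comment> \<open>\<open>ennreal\<close> sends negative numbers to zero, so comparing the real
    integrals requires the sign of the limit. It is inherited from
    \<open>truncated_energy\<close>.\<close>
  have nn: "0 \<le> - (2 / (real n)\<^sup>2) * (\<integral>\<eta>. f \<eta> * ?L \<eta> \<partial>\<nu>)"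
  proof (rule LIMSEQ_le_const)
    show "(\<lambda>m. - (2 / (real n)\<^sup>2) * (\<integral>\<eta>. ?g m \<eta> * ?L \<eta> \<partial>\<nu>)) \<longlonglongrightarrow> - (2 / (real n)\<^sup>2) * (\<integral>\<eta>. f \<eta> * ?L \<eta> \<partial>\<nu>)"
      by (intro tendsto_mult lim tendsto_const)
    have "0 \<le> (\<Sum>x\<in>box (l + 1). bond_energy \<nu> (bR n) x (?g m))" for m
      unfolding bond_energy_def using nonneg by (auto intro!: sum_nonneg integral_nonneg)
    then have "- ((real n)\<^sup>2 / 2) * (\<Sum>x\<in>box (l + 1). bond_energy \<nu> (bR n) x (?g m)) \<le> 0" for m
      by (intro mult_nonpos_nonneg) auto
    then have "(\<integral>\<eta>. ?g m \<eta> * ?L \<eta> \<partial>\<nu>) \<le> 0" for m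
      using truncated_energy[OF supp_f f Lf p, of "real m"] by (meson of_nat_0_le_iff order_trans)
    then have "0 \<le> - (2 / (real n)\<^sup>2) * (\<integral>\<eta>. ?g m \<eta> * ?L \<eta> \<partial>\<nu>)" for m
      by (intro mult_nonpos_nonpos) auto
    then show "\<exists>N. \<forall>m\<ge>N. 0 \<le> - (2 / (real n)\<^sup>2) * (\<integral>\<eta>. ?g m \<eta> * ?L \<eta> \<partial>\<nu>)" by blast
  qed
  have "(\<Sum>x\<in>box (l + 1). bond_energy \<nu> (bR n) x f) = (\<integral>\<eta>. S f \<eta> \<partial>\<nu>)"
    unfolding S_def bond_energy_def using i by simp
  also have "\<dots> \<le> - (2 / (real n)\<^sup>2) * (\<integral>\<eta>. f \<eta> * ?L \<eta> \<partial>\<nu>)"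
    using en nn by simp
  finally show "(real n)\<^sup>2 / 2 * (\<Sum>x\<in>box (l + 1). bond_energy \<nu> (bR n) x f) \<le> - ip \<nu> f ?L"
    using n2 by (simp add: ip_def field_simps)
qed

end

section \<open>Semigroups on L2, their time integrals and generators\<close>

lemma right_continuous_measurable:
  fixes F :: "real \<Rightarrow> real"
  assumes "\<And>s. 0 \<le> s \<Longrightarrow> ((\<lambda>t. F (s + t)) \<longlongrightarrow> F s) (at_right 0)"
  shows "(\<lambda>s. F (max 0 s)) \<in> borel_measurable borel"
proof (rule borel_measurable_LIMSEQ_real)
  \<comment> \<open>Grid points just to the right of \<open>s\<close>. The \<open>+ 1\<close> keeps
    them strictly above \<open>max 0 s\<close>, because the limit is known along
    \<open>at_right\<close> only. For fixed \<open>n\<close> the composition with \<open>F\<close>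
    factors through an integer and so is measurable whatever \<open>F\<close> is.\<close>
  let ?u = "\<lambda>n s. (real_of_int \<lfloor>real (Suc n) * max 0 s\<rfloor> + 1) / real (Suc n)"
  show "(\<lambda>s. F (?u n s)) \<in> borel_measurable borel" for n
  proof -
    have "(\<lambda>s. \<lfloor>real (Suc n) * max 0 s\<rfloor>) \<in> borel \<rightarrow>\<^sub>M count_space UNIV" by measurable
    then show ?thesis
      by (rule measurable_compose[where g="\<lambda>k. F ((real_of_int k + 1) / real (Suc n))"]) simp
  qed
  fix s :: real
  let ?s = "max 0 s"
  have lo: "0 < ?u n s - ?s" and hi: "?u n s - ?s \<le> 1 / real (Suc n)" for n
  proof -
    have "real (Suc n) * ?s < real_of_int \<lfloor>real (Suc n) * ?s\<rfloor> + 1" by linarith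
    then have "?s < ?u n s" by (subst pos_less_divide_eq) (simp_all only: mult.commute of_nat_0_less_iff zero_less_Suc)
    then show "0 < ?u n s - ?s" by simp
    have "real_of_int \<lfloor>real (Suc n) * ?s\<rfloor> \<le> real (Suc n) * ?s" by linarith
    then have "?u n s \<le> (real (Suc n) * ?s + 1) / real (Suc n)" by (intro divide_right_mono) auto
    also have "\<dots> = ?s + 1 / real (Suc n)" by (simp add: add_divide_distrib)
    finally show "?u n s - ?s \<le> 1 / real (Suc n)" by simp
  qed
  have "(\<lambda>n. ?u n s - ?s) \<longlonglongrightarrow> 0"
    by (rule tendsto_sandwich[OF _ _ tendsto_const LIMSEQ_Suc[OF lim_1_over_n]])
      (use lo hi in \<open>auto intro!: always_eventually less_imp_le simp del: of_nat_Suc\<close>)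
  then have "filterlim (\<lambda>n. ?u n s - ?s) (at_right 0) sequentially"
    using lo by (intro tendsto_imp_filterlim_at_right always_eventually) auto
  from filterlim_compose[OF assms[of ?s] this] show "(\<lambda>n. F (?u n s)) \<longlonglongrightarrow> F ?s" by simp
qed

locale L2_semigroup = prob_space \<nu> for \<nu> :: "config measure" +
  fixes T :: "real \<Rightarrow> (config \<Rightarrow> real) \<Rightarrow> config \<Rightarrow> real"
  assumes semigroup: "markov_semigroup \<nu> T"
begin

lemmas sg = semigroup[unfolded markov_semigroup_def]

lemma T_sq: "0 \<le> t \<Longrightarrow> square_integrable \<nu> f \<Longrightarrow> square_integrable \<nu> (T t f)"
  using sg[THEN conjunct1] by (auto simp: Lp_2_iff Lnorm_2)

lemma T_lincomb: "0 \<le> t \<Longrightarrow> square_integrable \<nu> f \<Longrightarrow> square_integrable \<nu> g \<Longrightarrow>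
    AE \<eta> in \<nu>. T t (\<lambda>\<zeta>. \<alpha> * f \<zeta> + \<beta> * g \<zeta>) \<eta> = \<alpha> * T t f \<eta> + \<beta> * T t g \<eta>"
  using sg[THEN conjunct2, THEN conjunct1] by (auto simp: Lp_2_iff Lnorm_2)

lemma T_bounded:
  assumes "0 \<le> t"
  obtains K where "0 \<le> K" "\<And>f. square_integrable \<nu> f \<Longrightarrow> n2 \<nu> (T t f) \<le> K * n2 \<nu> f"
proof -
  obtain K where K: "\<And>f. square_integrable \<nu> f \<Longrightarrow> n2 \<nu> (T t f) \<le> K * n2 \<nu> f"
    using sg[THEN conjunct2, THEN conjunct2, THEN conjunct1] assms by (auto simp: Lp_2_iff Lnorm_2 Ball_def)
  have "n2 \<nu> (T t f) \<le> max 0 K * n2 \<nu> f" if "square_integrable \<nu> f" for f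
    using K[OF that] by (rule order_trans) (intro mult_right_mono, auto)
  then show thesis by (intro that[of "max 0 K"]) auto
qed

lemma T_pos: "0 \<le> t \<Longrightarrow> square_integrable \<nu> f \<Longrightarrow> AE \<eta> in \<nu>. 0 \<le> f \<eta> \<Longrightarrow> AE \<eta> in \<nu>. 0 \<le> T t f \<eta>"
  using sg[THEN conjunct2, THEN conjunct2, THEN conjunct2, THEN conjunct1] by (auto simp: Lp_2_iff Lnorm_2)

lemma T_one: "0 \<le> t \<Longrightarrow> AE \<eta> in \<nu>. T t (\<lambda>_. 1) \<eta> = 1"
  using sg[THEN conjunct2, THEN conjunct2, THEN conjunct2, THEN conjunct2, THEN conjunct1] by auto

lemma T_zero: "square_integrable \<nu> f \<Longrightarrow> AE \<eta> in \<nu>. T 0 f \<eta> = f \<eta>"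
  using sg[THEN conjunct2, THEN conjunct2, THEN conjunct2, THEN conjunct2, THEN conjunct2, THEN conjunct1] by (auto simp: Lp_2_iff)

lemma T_add: "0 \<le> s \<Longrightarrow> 0 \<le> t \<Longrightarrow> square_integrable \<nu> f \<Longrightarrow> AE \<eta> in \<nu>. T (s + t) f \<eta> = T s (T t f) \<eta>"
  using sg[THEN conjunct2, THEN conjunct2, THEN conjunct2, THEN conjunct2, THEN conjunct2, THEN conjunct2, THEN conjunct1] by (auto simp: Lp_2_iff)

lemma T_continuous_0:
  "square_integrable \<nu> f \<Longrightarrow> ((\<lambda>t. n2 \<nu> (\<lambda>\<eta>. T t f \<eta> - f \<eta>)) \<longlongrightarrow> 0) (at_right 0)"
  using sg[THEN conjunct2, THEN conjunct2, THEN conjunct2, THEN conjunct2, THEN conjunct2, THEN conjunct2, THEN conjunct2] by (auto simp: Lp_2_iff Lnorm_2)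

lemma T_measurable: "0 \<le> t \<Longrightarrow> square_integrable \<nu> f \<Longrightarrow> T t f \<in> borel_measurable \<nu>"
  using T_sq by (simp add: square_integrable_def)

text \<open>The difference is \<open>T s\<close> applied to \<open>T t f - f\<close>, and
  \<open>T s\<close> is bounded. The bound may depend on \<open>s\<close>, so only right limits are
  available before contraction is known.\<close>

lemma T_right_continuous:
  assumes f: "square_integrable \<nu> f" and s: "0 \<le> s"
  shows "((\<lambda>t. n2 \<nu> (\<lambda>\<eta>. T (s + t) f \<eta> - T s f \<eta>)) \<longlongrightarrow> 0) (at_right 0)"
proof -
  obtain K where K: "0 \<le> K" "\<And>f. square_integrable \<nu> f \<Longrightarrow> n2 \<nu> (T s f) \<le> K * n2 \<nu> f"
    using T_bounded[OF s] by blast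
  have *: "n2 \<nu> (\<lambda>\<eta>. T (s + t) f \<eta> - T s f \<eta>) \<le> K * n2 \<nu> (\<lambda>\<eta>. T t f \<eta> - f \<eta>)" if t: "0 < t" for t
  proof -
    have sq: "square_integrable \<nu> (T t f)" using t f by (auto intro: T_sq)
    have dsq: "square_integrable \<nu> (\<lambda>\<zeta>. 1 * T t f \<zeta> + (-1) * f \<zeta>)" by (intro square_integrable_lincomb sq f)
    have "n2 \<nu> (\<lambda>\<eta>. T (s + t) f \<eta> - T s f \<eta>) = n2 \<nu> (T s (\<lambda>\<zeta>. 1 * T t f \<zeta> + (-1) * f \<zeta>))"
    proof (rule n2_cong_AE)
      show "(\<lambda>\<eta>. T (s + t) f \<eta> - T s f \<eta>) \<in> borel_measurable \<nu>"
        using s t f by (intro borel_measurable_diff T_measurable) auto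
      show "T s (\<lambda>\<zeta>. 1 * T t f \<zeta> + (-1) * f \<zeta>) \<in> borel_measurable \<nu>" by (intro T_measurable s dsq)
      show "AE \<eta> in \<nu>. T (s + t) f \<eta> - T s f \<eta> = T s (\<lambda>\<zeta>. 1 * T t f \<zeta> + (-1) * f \<zeta>) \<eta>"
        using T_lincomb[OF s sq f, of 1 "-1"] T_add[OF s _ f, of t] t by auto
    qed
    also have "\<dots> \<le> K * n2 \<nu> (\<lambda>\<zeta>. 1 * T t f \<zeta> + (-1) * f \<zeta>)" by (rule K(2)[OF dsq])
    finally show ?thesis by simp
  qed
  show ?thesis
  proof (rule tendsto_sandwich[OF _ _ tendsto_const])
    show "((\<lambda>t. K * n2 \<nu> (\<lambda>\<eta>. T t f \<eta> - f \<eta>)) \<longlongrightarrow> 0) (at_right 0)"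
      by (rule tendsto_mult_right_zero[OF T_continuous_0[OF f]])
    show "\<forall>\<^sub>F t in at_right 0. n2 \<nu> (\<lambda>\<eta>. T (s + t) f \<eta> - T s f \<eta>) \<le> K * n2 \<nu> (\<lambda>\<eta>. T t f \<eta> - f \<eta>)"
      using * by (auto simp: eventually_at_right_field intro: exI[of _ 1])
  qed simp
qed

text \<open>The integrated semigroup below is known only through its pairings. To apply
  \<open>T t\<close> to it, the operator is moved to the test function.\<close>

lemma T_adjoint:
  assumes t: "0 \<le> t" and g: "square_integrable \<nu> g"
  obtains w where "square_integrable \<nu> w" "\<And>h. square_integrable \<nu> h \<Longrightarrow> ip \<nu> g (T t h) = ip \<nu> w h"
proof -
  obtain K where K: "0 \<le> K" "\<And>f. square_integrable \<nu> f \<Longrightarrow> n2 \<nu> (T t f) \<le> K * n2 \<nu> f"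
    using T_bounded[OF t] by blast
  have "\<exists>v. square_integrable \<nu> v \<and> (\<forall>h. square_integrable \<nu> h \<longrightarrow> ip \<nu> g (T t h) = ip \<nu> v h)"
  proof (rule L2_Riesz)
    fix f h :: "config \<Rightarrow> real" and a b assume fh: "square_integrable \<nu> f" "square_integrable \<nu> h"
    have "ip \<nu> (T t (\<lambda>x. a * f x + b * h x)) g = ip \<nu> (\<lambda>x. a * T t f x + b * T t h x) g"
      using T_lincomb[OF t fh, of a b]
      by (intro ip_cong_AE) (auto intro!: T_sq t square_integrable_lincomb fh g)
    then show "ip \<nu> g (T t (\<lambda>x. a * f x + b * h x)) = a * ip \<nu> g (T t f) + b * ip \<nu> g (T t h)"
      using ip_lincomb_left[OF T_sq[OF t fh(1)] T_sq[OF t fh(2)] g] by (simp add: ip_commute)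
  next
    fix f assume f: "square_integrable \<nu> f"
    have "\<bar>ip \<nu> g (T t f)\<bar> \<le> n2 \<nu> g * n2 \<nu> (T t f)" by (intro ip_Cauchy_Schwarz g T_sq t f)
    also have "\<dots> \<le> n2 \<nu> g * (K * n2 \<nu> f)" by (intro mult_left_mono K f) auto
    finally show "\<bar>ip \<nu> g (T t f)\<bar> \<le> (n2 \<nu> g * K) * n2 \<nu> f" by (simp add: mult.assoc)
  qed
  then show thesis using that by blast
qed

lemma T_pairing_right_continuous:
  assumes "square_integrable \<nu> f" "square_integrable \<nu> g" "0 \<le> s"
  shows "((\<lambda>t. ip \<nu> (T (s + t) f) g) \<longlongrightarrow> ip \<nu> (T s f) g) (at_right 0)"
proof -
  have "((\<lambda>t. ip \<nu> (T (s + t) f) g - ip \<nu> (T s f) g) \<longlongrightarrow> 0) (at_right 0)"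
  proof (rule Lim_null_comparison)
    show "((\<lambda>t. n2 \<nu> (\<lambda>\<eta>. T (s + t) f \<eta> - T s f \<eta>) * n2 \<nu> g) \<longlongrightarrow> 0) (at_right 0)"
      by (rule tendsto_mult_left_zero[OF T_right_continuous[OF assms(1,3)]])
    have "norm (ip \<nu> (T (s + t) f) g - ip \<nu> (T s f) g) \<le> n2 \<nu> (\<lambda>\<eta>. T (s + t) f \<eta> - T s f \<eta>) * n2 \<nu> g" if "0 < t" for t
    proof -
      have sq: "square_integrable \<nu> (T (s + t) f)" "square_integrable \<nu> (T s f)" using assms that by (auto intro: T_sq)
      show ?thesis using ip_Cauchy_Schwarz[OF square_integrable_diff[OF sq] assms(2)]
        by (simp add: ip_diff_left[OF sq assms(2)])
    qed
    then show "\<forall>\<^sub>F t in at_right 0. norm (ip \<nu> (T (s + t) f) g - ip \<nu> (T s f) g) \<le> n2 \<nu> (\<lambda>\<eta>. T (s + t) f \<eta> - T s f \<eta>) * n2 \<nu> g"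
      by (auto simp: eventually_at_right_field intro: exI[of _ 1])
  qed
  then show ?thesis by (simp add: LIM_zero_iff)
qed

lemma T_pairing_measurable:
  assumes "square_integrable \<nu> f" "square_integrable \<nu> g"
  shows "(\<lambda>s. ip \<nu> (T (max 0 s) f) g) \<in> borel_measurable borel"
  by (rule right_continuous_measurable[where F="\<lambda>s. ip \<nu> (T s f) g"]) (rule T_pairing_right_continuous[OF assms])

lemma has_generator_iff:
  "has_generator \<nu> T f g \<longleftrightarrow> square_integrable \<nu> f \<and> square_integrable \<nu> g \<and>
     ((\<lambda>t. n2 \<nu> (\<lambda>\<eta>. (T t f \<eta> - f \<eta>) / t - g \<eta>)) \<longlongrightarrow> 0) (at_right 0)"
  by (simp add: has_generator_def Lp_2_iff Lnorm_2)

definition discounted :: "real \<Rightarrow> (config \<Rightarrow> real) \<Rightarrow> real \<Rightarrow> config \<Rightarrow> real" where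
  "discounted \<mu> f s \<eta> = exp (- \<mu> * s) * T s f \<eta>"

lemma discounted_sq: "0 \<le> s \<Longrightarrow> square_integrable \<nu> f \<Longrightarrow> square_integrable \<nu> (discounted \<mu> f s)"
  unfolding discounted_def[abs_def] by (intro square_integrable_cmult T_sq)

lemma ip_discounted: "ip \<nu> g (discounted \<mu> f s) = exp (- \<mu> * s) * ip \<nu> g (T s f)"
  unfolding ip_def discounted_def
  by (simp only: mult.left_commute[of _ "exp (- \<mu> * s)"] Bochner_Integration.integral_mult_right_zero)

lemma discounted_right_continuous:
  assumes f: "square_integrable \<nu> f" and c: "0 \<le> c"
  shows "((\<lambda>t. n2 \<nu> (\<lambda>\<eta>. discounted \<mu> f (c + t) \<eta> - discounted \<mu> f c \<eta>)) \<longlongrightarrow> 0) (at_right 0)"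
proof (rule tendsto_sandwich[OF _ _ tendsto_const])
  let ?B = "\<lambda>t. exp (- \<mu> * (c + t)) * n2 \<nu> (\<lambda>\<eta>. T (c + t) f \<eta> - T c f \<eta>)
     + \<bar>exp (- \<mu> * (c + t)) - exp (- \<mu> * c)\<bar> * n2 \<nu> (T c f)"
  have "((\<lambda>t. ?B t) \<longlongrightarrow> exp (- \<mu> * (c + 0)) * 0 + \<bar>exp (- \<mu> * (c + 0)) - exp (- \<mu> * c)\<bar> * n2 \<nu> (T c f)) (at_right 0)"
    by (intro tendsto_intros T_right_continuous f c)
  then show "((\<lambda>t. ?B t) \<longlongrightarrow> 0) (at_right 0)" by simp
  have "n2 \<nu> (\<lambda>\<eta>. discounted \<mu> f (c + t) \<eta> - discounted \<mu> f c \<eta>) \<le> ?B t" if "0 < t" for t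
  proof -
    have sq: "square_integrable \<nu> (T (c + t) f)" "square_integrable \<nu> (T c f)" using c f that by (auto intro: T_sq)
    have eq: "(\<lambda>\<eta>. discounted \<mu> f (c + t) \<eta> - discounted \<mu> f c \<eta>) =
      (\<lambda>\<eta>. exp (- \<mu> * (c + t)) * (T (c + t) f \<eta> - T c f \<eta>) + (exp (- \<mu> * (c + t)) - exp (- \<mu> * c)) * T c f \<eta>)"
      by (auto simp: discounted_def algebra_simps)
    have "n2 \<nu> (\<lambda>\<eta>. exp (- \<mu> * (c + t)) * (T (c + t) f \<eta> - T c f \<eta>) + (exp (- \<mu> * (c + t)) - exp (- \<mu> * c)) * T c f \<eta>)
       \<le> n2 \<nu> (\<lambda>\<eta>. exp (- \<mu> * (c + t)) * (T (c + t) f \<eta> - T c f \<eta>))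
       + n2 \<nu> (\<lambda>\<eta>. (exp (- \<mu> * (c + t)) - exp (- \<mu> * c)) * T c f \<eta>)"
      by (intro n2_triangle square_integrable_cmult square_integrable_diff sq)
    also have "\<dots> = ?B t" by (simp only: n2_cmult abs_exp_cancel)
    finally show ?thesis unfolding eq .
  qed
  then show "\<forall>\<^sub>F t in at_right 0. n2 \<nu> (\<lambda>\<eta>. discounted \<mu> f (c + t) \<eta> - discounted \<mu> f c \<eta>) \<le> ?B t"
    by (auto simp: eventually_at_right_field intro: exI[of _ 1])
qed simp

lemma discounted_near:
  assumes f: "square_integrable \<nu> f" and c: "0 \<le> c" and e: "0 < \<epsilon>"
  shows "\<forall>\<^sub>F t in at_right 0. \<forall>s\<in>{c..c + t}. n2 \<nu> (\<lambda>\<eta>. discounted \<mu> f s \<eta> - discounted \<mu> f c \<eta>) \<le> \<epsilon>"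
proof -
  have "\<forall>\<^sub>F t in at_right 0. n2 \<nu> (\<lambda>\<eta>. discounted \<mu> f (c + t) \<eta> - discounted \<mu> f c \<eta>) < \<epsilon>"
    using order_tendstoD(2)[OF discounted_right_continuous[OF f c] e] .
  then obtain b where b: "b > 0" "\<And>t. 0 < t \<Longrightarrow> t < b \<Longrightarrow> n2 \<nu> (\<lambda>\<eta>. discounted \<mu> f (c + t) \<eta> - discounted \<mu> f c \<eta>) < \<epsilon>"
    by (auto simp: eventually_at_right_field)
  have "n2 \<nu> (\<lambda>\<eta>. discounted \<mu> f s \<eta> - discounted \<mu> f c \<eta>) \<le> \<epsilon>" if "0 < t" "t < b" "s \<in> {c..c + t}" for t s
  proof (cases "s = c")
    case True then show ?thesis using e by simp
  next
    case False
    then have "0 < s - c" "s - c < b" using that by auto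
    from b(2)[OF this] show ?thesis by simp
  qed
  then show ?thesis using b(1) by (auto simp: eventually_at_right_field)
qed

text \<open>Weak measurability is enough: right continuity makes the pairing measurable in time, and
  the orbit bound \<open>M\<close> makes it bounded on the interval.\<close>

lemma pairing_integrable:
  assumes f: "square_integrable \<nu> f" and M: "\<And>s. 0 \<le> s \<Longrightarrow> n2 \<nu> (T s f) \<le> M"
    and g: "square_integrable \<nu> g" and c: "0 \<le> c"
  shows "(\<lambda>s. ip \<nu> g (discounted \<mu> f s)) integrable_on {c..d}"
proof -
  let ?F = "\<lambda>s. exp (- \<mu> * s) * ip \<nu> (T (max 0 s) f) g"
  have [measurable]: "(\<lambda>s. ip \<nu> (T (max 0 s) f) g) \<in> borel_measurable borel"
    by (rule T_pairing_measurable[OF f g])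
  have "set_integrable lborel {c..d} ?F"
  proof (rule set_integrable_bound)
    show "set_integrable lborel {c..d} (\<lambda>s. exp (- \<mu> * s) * (M * n2 \<nu> g))"
      by (intro borel_integrable_atLeastAtMost' continuous_intros)
    show "set_borel_measurable lborel {c..d} ?F" unfolding set_borel_measurable_def by measurable
    have "\<bar>ip \<nu> (T s f) g\<bar> \<le> M * n2 \<nu> g" if "0 \<le> s" for s
    proof -
      have "\<bar>ip \<nu> (T s f) g\<bar> \<le> n2 \<nu> (T s f) * n2 \<nu> g" by (intro ip_Cauchy_Schwarz T_sq that f g)
      also have "\<dots> \<le> M * n2 \<nu> g" by (intro mult_right_mono M that) auto
      finally show ?thesis .
    qed
    then have "\<bar>ip \<nu> (T (max 0 s) f) g\<bar> \<le> \<bar>M * n2 \<nu> g\<bar>" for s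
      by (meson abs_ge_self max.cobounded1 order_trans)
    then show "AE s in lborel. s \<in> {c..d} \<longrightarrow> norm (?F s) \<le> norm (exp (- \<mu> * s) * (M * n2 \<nu> g))"
      unfolding real_norm_def abs_mult[of "exp _"] by (intro always_eventually allI impI mult_left_mono) auto
  qed
  then have "?F integrable_on {c..d}" by (rule set_borel_integral_eq_integral(1))
  then show ?thesis
    by (rule integrable_eq) (use c in \<open>auto simp: ip_discounted max_def ip_commute\<close>)
qed

lemma pairing_bound:
  assumes f: "square_integrable \<nu> f" and M: "\<And>s. 0 \<le> s \<Longrightarrow> n2 \<nu> (T s f) \<le> M"
    and g: "square_integrable \<nu> g" and s: "0 \<le> s" and \<mu>: "0 \<le> \<mu>"
  shows "\<bar>ip \<nu> g (discounted \<mu> f s)\<bar> \<le> n2 \<nu> g * M"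
proof -
  have "\<bar>ip \<nu> g (discounted \<mu> f s)\<bar> \<le> n2 \<nu> g * n2 \<nu> (discounted \<mu> f s)"
    by (intro ip_Cauchy_Schwarz discounted_sq f g s)
  also have "n2 \<nu> (discounted \<mu> f s) = exp (- \<mu> * s) * n2 \<nu> (T s f)"
    unfolding discounted_def by (simp add: n2_cmult)
  also have "\<dots> \<le> 1 * M" using s \<mu> by (intro mult_mono M) auto
  finally show ?thesis by (simp add: mult_left_mono)
qed

lemma integral_le_const:
  fixes F :: "real \<Rightarrow> real"
  assumes "F integrable_on {c..d}" "c \<le> d" "\<And>s. s \<in> {c..d} \<Longrightarrow> \<bar>F s\<bar> \<le> B" "0 \<le> B"
  shows "\<bar>integral {c..d} F\<bar> \<le> B * (d - c)"
  using has_integral_bound[of B F "integral {c..d} F" c d] assms by (auto simp: integrable_integral)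

text \<open>The estimate of \<open>integrated_semigroup\<close> with the functions stripped off.
  There \<open>E\<close> is \<open>exp (\<mu> * t)\<close>, \<open>v\<close> a pairing with the
  integral, \<open>I\<close> and \<open>J\<close> are integrals over short intervals starting at
  \<open>a\<close> and at \<open>0\<close>, \<open>F\<close> and \<open>H\<close> the integrands at
  the left ends, and \<open>G\<close> is the norm of the test function, in which the bound is
  linear.\<close>

lemma generator_error_bound:
  fixes X :: real
  assumes t: "0 < t" and eq: "t * X = (E - 1 - \<mu> * t) * v + (E - 1) * (I - J) + (I - t * F) - (J - t * H)"
    and b: "\<bar>v\<bar> \<le> G * V" "\<bar>I\<bar> \<le> G * M * t" "\<bar>J\<bar> \<le> G * M * t"
      "\<bar>I - t * F\<bar> \<le> G * \<epsilon> * t" "\<bar>J - t * H\<bar> \<le> G * \<epsilon> * t"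
  shows "\<bar>X\<bar> \<le> G * (\<bar>(E - 1) / t - \<mu>\<bar> * V + \<bar>E - 1\<bar> * (2 * M) + 2 * \<epsilon>)"
proof -
  have four: "\<bar>A + B + C - D\<bar> \<le> \<bar>A\<bar> + \<bar>B\<bar> + \<bar>C\<bar> + \<bar>D\<bar>" for A B C D :: real by linarith
  have "\<bar>I - J\<bar> \<le> G * M * t + G * M * t" using b(2,3) by linarith
  then have "\<bar>E - 1\<bar> * \<bar>I - J\<bar> \<le> \<bar>E - 1\<bar> * (G * M * t + G * M * t)" by (intro mult_left_mono) auto
  moreover have D: "\<bar>E - 1 - \<mu> * t\<bar> = t * \<bar>(E - 1) / t - \<mu>\<bar>"
  proof -
    have "E - 1 - \<mu> * t = t * ((E - 1) / t - \<mu>)" using t by (simp add: field_simps)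
    then show ?thesis using t by (simp only: abs_mult abs_of_pos)
  qed
  moreover have "\<bar>E - 1 - \<mu> * t\<bar> * \<bar>v\<bar> \<le> t * \<bar>(E - 1) / t - \<mu>\<bar> * (G * V)"
    unfolding D by (intro mult_left_mono b) (use t in auto)
  moreover have "t * \<bar>X\<bar> = \<bar>t * X\<bar>" using t by (simp add: abs_mult)
  moreover have "\<bar>t * X\<bar> \<le> \<bar>E - 1 - \<mu> * t\<bar> * \<bar>v\<bar> + \<bar>E - 1\<bar> * \<bar>I - J\<bar> + \<bar>I - t * F\<bar> + \<bar>J - t * H\<bar>"
    unfolding eq abs_mult[symmetric] by (rule four)
  ultimately have "t * \<bar>X\<bar> \<le> t * \<bar>(E - 1) / t - \<mu>\<bar> * (G * V) + \<bar>E - 1\<bar> * (G * M * t + G * M * t) + G * \<epsilon> * t + G * \<epsilon> * t"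
    using b(4,5) by linarith
  then have "t * \<bar>X\<bar> \<le> t * (G * (\<bar>(E - 1) / t - \<mu>\<bar> * V + \<bar>E - 1\<bar> * (2 * M) + 2 * \<epsilon>))"
    by (simp add: algebra_simps)
  then show ?thesis using t by simp
qed

text \<open>\<open>v\<close> is the integral of \<open>discounted \<mu> f\<close> over
  \<open>[0, a]\<close>, and its image under the generator is the fundamental theorem of calculus.
  It is defined through its pairings and \<open>L2_Riesz\<close>, so that only integrals of real
  functions occur. A finite horizon also allows \<open>\<mu> = 0\<close>. The orbit bound is a
  hypothesis because it has two sources: positivity when \<open>f\<close> is bounded, and later
  contraction, which itself depends on the invariance derived from this lemma.\<close>

lemma integrated_semigroup:
  assumes f: "square_integrable \<nu> f" and M: "\<And>s. 0 \<le> s \<Longrightarrow> n2 \<nu> (T s f) \<le> M"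
    and a: "0 \<le> a" and \<mu>: "0 \<le> \<mu>"
  obtains v where "square_integrable \<nu> v"
    "\<And>g. square_integrable \<nu> g \<Longrightarrow> ip \<nu> g v = integral {0..a} (\<lambda>s. ip \<nu> g (discounted \<mu> f s))"
    "has_generator \<nu> T v (\<lambda>\<eta>. \<mu> * v \<eta> - f \<eta> + discounted \<mu> f a \<eta>)"
proof -
  define F where "F g s = ip \<nu> g (discounted \<mu> f s)" for g s
  have Fint: "F g integrable_on {c..d}" if "square_integrable \<nu> g" "0 \<le> c" for g c d
    unfolding F_def[abs_def] by (rule pairing_integrable[OF f M that])
  have Fb: "\<bar>F g s\<bar> \<le> n2 \<nu> g * M" if "square_integrable \<nu> g" "0 \<le> s" for g s
    unfolding F_def by (rule pairing_bound[OF f M that \<mu>])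
  have M0: "0 \<le> M" using M[of 0] n2_nonneg[of \<nu> "T 0 f"] by linarith
  have "\<exists>v. square_integrable \<nu> v \<and> (\<forall>g. square_integrable \<nu> g \<longrightarrow> integral {0..a} (F g) = ip \<nu> v g)"
  proof (rule L2_Riesz)
    fix g h :: "config \<Rightarrow> real" and x y assume gh: "square_integrable \<nu> g" "square_integrable \<nu> h"
    have "integral {0..a} (F (\<lambda>\<eta>. x * g \<eta> + y * h \<eta>)) = integral {0..a} (\<lambda>s. x * F g s + y * F h s)"
      by (rule integral_cong) (auto simp: F_def ip_lincomb_left[OF gh discounted_sq[OF _ f]])
    also have "\<dots> = x * integral {0..a} (F g) + y * integral {0..a} (F h)"
      using Fint[OF gh(1) order_refl, of a] Fint[OF gh(2) order_refl, of a]
      by (subst integral_add) (auto intro: integrable_on_mult_right)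
    finally show "integral {0..a} (F (\<lambda>\<eta>. x * g \<eta> + y * h \<eta>)) = x * integral {0..a} (F g) + y * integral {0..a} (F h)" .
  next
    fix g :: "config \<Rightarrow> real" assume g: "square_integrable \<nu> g"
    have "\<bar>integral {0..a} (F g)\<bar> \<le> n2 \<nu> g * M * (a - 0)"
      using Fint[OF g order_refl] a Fb[OF g] M0 by (intro integral_le_const) auto
    then show "\<bar>integral {0..a} (F g)\<bar> \<le> (M * a) * n2 \<nu> g" by (simp add: algebra_simps)
  qed
  then obtain v where v: "square_integrable \<nu> v" "\<And>g. square_integrable \<nu> g \<Longrightarrow> integral {0..a} (F g) = ip \<nu> v g"
    by blast
  have vF: "ip \<nu> g v = integral {0..a} (F g)" if "square_integrable \<nu> g" for g
    using v(2)[OF that] by (simp add: ip_commute)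
  \<comment> \<open>Weak form of the shift: \<open>T t\<close> moves the window of integration from
    \<open>[0, a]\<close> to \<open>[t, t + a]\<close> at the price of the factor
    \<open>exp (\<mu> * t)\<close>. The adjoint carries \<open>T t\<close> to the test function,
    whose pairing with \<open>v\<close> is known.\<close>
  have Tv: "ip \<nu> g (T t v) = exp (\<mu> * t) * integral {t..t + a} (F g)" if g: "square_integrable \<nu> g" and t: "0 \<le> t" for g t
  proof -
    obtain w where w: "square_integrable \<nu> w" "\<And>h. square_integrable \<nu> h \<Longrightarrow> ip \<nu> g (T t h) = ip \<nu> w h"
      using T_adjoint[OF t g] by blast
    have "F w s = exp (\<mu> * t) * F g (t + s)" if "0 \<le> s" for s
    proof -
      have "F w s = exp (- \<mu> * s) * ip \<nu> g (T t (T s f))"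
        unfolding F_def ip_discounted by (simp add: w(2) T_sq that f)
      also have "ip \<nu> g (T t (T s f)) = ip \<nu> g (T (t + s) f)"
      proof -
        have "ip \<nu> (T t (T s f)) g = ip \<nu> (T (t + s) f) g"
          using T_add[OF t that f] t that f g by (intro ip_cong_AE) (auto intro!: T_sq)
        then show ?thesis by (simp add: ip_commute)
      qed
      also have "exp (- \<mu> * s) * \<dots> = exp (\<mu> * t) * F g (t + s)"
        unfolding F_def ip_discounted by (simp add: exp_add[symmetric] algebra_simps)
      finally show ?thesis .
    qed
    then have "integral {0..a} (F w) = integral {0..a} (\<lambda>s. exp (\<mu> * t) * (F g \<circ> (+) t) s)"
      by (intro integral_cong) auto
    also have "\<dots> = exp (\<mu> * t) * integral {0..a} (F g \<circ> (+) t)" by (simp add: comp_def)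
    also have "integral {0..a} (F g \<circ> (+) t) = integral {0 + t..a + t} (F g)" by (rule integral_shift_Icc_real)
    finally show ?thesis using w(2)[OF v(1)] vF[OF w(1)] by (simp add: add.commute)
  qed
  let ?w = "\<lambda>\<eta>. \<mu> * v \<eta> - f \<eta> + discounted \<mu> f a \<eta>"
  have wsq: "square_integrable \<nu> ?w"
    by (intro square_integrable_add square_integrable_diff square_integrable_cmult v f discounted_sq a)
  define d where "d t \<eta> = (T t v \<eta> - v \<eta>) / t - ?w \<eta>" for t \<eta>
  have d_eq: "d t = (\<lambda>\<eta>. ((1 / t) * T t v \<eta> + (- 1 / t) * v \<eta>) - ((\<mu> * v \<eta> - f \<eta>) + discounted \<mu> f a \<eta>))" for t
    by (auto simp: d_def diff_divide_distrib)
  have dsq: "square_integrable \<nu> (d t)" if "0 < t" for t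
    unfolding d_eq using that
    by (intro square_integrable_diff square_integrable_lincomb square_integrable_add square_integrable_cmult v f discounted_sq a T_sq) auto
  have dbound: "n2 \<nu> (d t) \<le> \<bar>(exp (\<mu> * t) - 1) / t - \<mu>\<bar> * n2 \<nu> v + \<bar>exp (\<mu> * t) - 1\<bar> * (2 * M) + 2 * \<epsilon>"
    if t: "0 < t" and e: "0 < \<epsilon>" and near_a: "\<forall>s\<in>{a..a + t}. n2 \<nu> (\<lambda>\<eta>. discounted \<mu> f s \<eta> - discounted \<mu> f a \<eta>) \<le> \<epsilon>"
      and near_0: "\<forall>s\<in>{0..0 + t}. n2 \<nu> (\<lambda>\<eta>. discounted \<mu> f s \<eta> - discounted \<mu> f 0 \<eta>) \<le> \<epsilon>" for t \<epsilon>
  proof -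
    let ?R = "\<bar>(exp (\<mu> * t) - 1) / t - \<mu>\<bar> * n2 \<nu> v + \<bar>exp (\<mu> * t) - 1\<bar> * (2 * M) + 2 * \<epsilon>"
    \<comment> \<open>Every error term is the norm of \<open>g\<close> times a quantity that does
      not depend on \<open>g\<close>.\<close>
    have pair: "\<bar>ip \<nu> g (d t)\<bar> \<le> n2 \<nu> g * ?R" if g: "square_integrable \<nu> g" for g
    proof -
      have loc: "\<bar>integral {c..c + t} (F g) - t * F g c\<bar> \<le> n2 \<nu> g * \<epsilon> * t"
        if c: "0 \<le> c" and near: "\<forall>s\<in>{c..c + t}. n2 \<nu> (\<lambda>\<eta>. discounted \<mu> f s \<eta> - discounted \<mu> f c \<eta>) \<le> \<epsilon>" for c
      proof -
        have "integral {c..c + t} (\<lambda>s. F g s - F g c) = integral {c..c + t} (F g) - integral {c..c + t} (\<lambda>s. F g c)"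
          using Fint[OF g c] by (intro Henstock_Kurzweil_Integration.integral_diff) auto
        then have eq: "integral {c..c + t} (F g) - t * F g c = integral {c..c + t} (\<lambda>s. F g s - F g c)"
          using t by simp
        have "\<bar>integral {c..c + t} (\<lambda>s. F g s - F g c)\<bar> \<le> n2 \<nu> g * \<epsilon> * (c + t - c)"
        proof (rule integral_le_const)
          show "(\<lambda>s. F g s - F g c) integrable_on {c..c + t}"
            using Fint[OF g c] by (intro Henstock_Kurzweil_Integration.integrable_diff) auto
          fix s assume s: "s \<in> {c..c + t}"
          have eq: "F g s - F g c = ip \<nu> g (\<lambda>\<eta>. discounted \<mu> f s \<eta> - discounted \<mu> f c \<eta>)"
            unfolding F_def using s c by (subst ip_diff_right) (auto intro: discounted_sq f g)
          have "\<bar>ip \<nu> g (\<lambda>\<eta>. discounted \<mu> f s \<eta> - discounted \<mu> f c \<eta>)\<bar> \<le> n2 \<nu> g * n2 \<nu> (\<lambda>\<eta>. discounted \<mu> f s \<eta> - discounted \<mu> f c \<eta>)"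
            using s c by (intro ip_Cauchy_Schwarz g square_integrable_diff discounted_sq f) auto
          also have "\<dots> \<le> n2 \<nu> g * \<epsilon>" by (intro mult_left_mono near[rule_format, OF s] n2_nonneg)
          finally show "\<bar>F g s - F g c\<bar> \<le> n2 \<nu> g * \<epsilon>" unfolding eq .
        qed (use t e in auto)
        then show ?thesis using eq by simp
      qed
      let ?E = "exp (\<mu> * t)" and ?Ia = "integral {a..a + t} (F g)" and ?I0 = "integral {0..0 + t} (F g)"
      have split: "integral {t..t + a} (F g) = integral {0..a} (F g) + ?Ia - ?I0"
        using Henstock_Kurzweil_Integration.integral_combine[of 0 t "t + a" "F g"]
          Henstock_Kurzweil_Integration.integral_combine[of 0 a "a + t" "F g"] Fint[OF g order_refl] t a
        by (simp add: add.commute)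
      have ipd: "ip \<nu> g (d t) = (1 / t) * ip \<nu> g (T t v) + (- 1 / t) * ip \<nu> g v - (\<mu> * ip \<nu> g v - ip \<nu> g f + F g a)"
      proof -
        have 1: "ip \<nu> g (\<lambda>\<eta>. (1 / t) * T t v \<eta> + (- 1 / t) * v \<eta>) = (1 / t) * ip \<nu> g (T t v) + (- 1 / t) * ip \<nu> g v"
          using t by (intro ip_lincomb_right T_sq v g) auto
        have 2: "ip \<nu> g (\<lambda>\<eta>. \<mu> * v \<eta> - f \<eta>) = \<mu> * ip \<nu> g v - ip \<nu> g f"
          using ip_lincomb_right[OF v(1) f g, of \<mu> "-1"] by simp
        have 3: "ip \<nu> g (\<lambda>\<eta>. (\<mu> * v \<eta> - f \<eta>) + discounted \<mu> f a \<eta>) = (\<mu> * ip \<nu> g v - ip \<nu> g f) + F g a"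
          unfolding F_def 2[symmetric]
          using ip_lincomb_right[OF square_integrable_diff[OF square_integrable_cmult[OF v(1)] f] discounted_sq[OF a f] g, of 1 \<mu> 1 \<mu>]
          by simp
        show ?thesis unfolding d_eq 1[symmetric] 3[symmetric]
          using t by (intro ip_diff_right g square_integrable_lincomb T_sq v square_integrable_add square_integrable_diff square_integrable_cmult f discounted_sq a) auto
      qed
      have F0: "F g 0 = ip \<nu> g f"
      proof -
        have "ip \<nu> (T 0 f) g = ip \<nu> f g" using T_zero[OF f] f g by (intro ip_cong_AE) (auto intro: T_sq)
        then show ?thesis unfolding F_def ip_discounted by (simp add: ip_commute)
      qed
      have "t * ip \<nu> g (d t) = ?E * (ip \<nu> g v + ?Ia - ?I0) - ip \<nu> g v - t * (\<mu> * ip \<nu> g v - F g 0 + F g a)"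
        unfolding ipd Tv[OF g less_imp_le[OF t]] split vF[OF g, symmetric] F0 using t by (simp add: field_simps)
      also have "\<dots> = (?E - 1 - \<mu> * t) * ip \<nu> g v + (?E - 1) * (?Ia - ?I0) + (?Ia - t * F g a) - (?I0 - t * F g 0)"
        by (simp add: algebra_simps)
      finally have eq: "t * ip \<nu> g (d t) = (?E - 1 - \<mu> * t) * ip \<nu> g v + (?E - 1) * (?Ia - ?I0) + (?Ia - t * F g a) - (?I0 - t * F g 0)" .
      have I: "\<bar>integral {c..c + t} (F g)\<bar> \<le> n2 \<nu> g * M * t" if "0 \<le> c" for c
        using integral_le_const[of "F g" c "c + t" "n2 \<nu> g * M"] Fint[OF g that] Fb[OF g] that t M0 by auto
      show ?thesis
        by (rule generator_error_bound[OF t eq ip_Cauchy_Schwarz[OF g v(1)] I[OF a] I[OF order_refl]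
              loc[OF a near_a] loc[OF order_refl near_0]])
    qed
    \<comment> \<open>Testing with \<open>g = d t\<close> itself turns the weak estimate into one in
      norm.\<close>
    have "(n2 \<nu> (d t))\<^sup>2 \<le> n2 \<nu> (d t) * ?R"
      using pair[OF dsq[OF t]] by (simp add: ip_self)
    then show ?thesis
    proof (cases "n2 \<nu> (d t) = 0")
      case False
      then have "0 < n2 \<nu> (d t)" using n2_nonneg[of \<nu> "d t"] by linarith
      then show ?thesis using \<open>(n2 \<nu> (d t))\<^sup>2 \<le> n2 \<nu> (d t) * ?R\<close> by (simp add: power2_eq_square)
    qed (use M0 e in simp)
  qed
  have "((\<lambda>t. n2 \<nu> (d t)) \<longlongrightarrow> 0) (at_right 0)"
  proof (rule tendstoI)
    fix e :: real assume e: "0 < e"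
    define \<epsilon> where "\<epsilon> = e / 4"
    have ep: "0 < \<epsilon>" using e by (simp add: \<epsilon>_def)
    have "((\<lambda>t. exp (\<mu> * t)) has_real_derivative \<mu>) (at 0)"
      by (auto intro!: derivative_eq_intros)
    then have D: "((\<lambda>t. (exp (\<mu> * t) - 1) / t) \<longlongrightarrow> \<mu>) (at_right 0)"
      unfolding DERIV_def by (simp add: filterlim_at_split)
    have "((\<lambda>t. \<bar>(exp (\<mu> * t) - 1) / t - \<mu>\<bar> * n2 \<nu> v + \<bar>exp (\<mu> * t) - 1\<bar> * (2 * M)) \<longlongrightarrow>
       \<bar>\<mu> - \<mu>\<bar> * n2 \<nu> v + \<bar>exp (\<mu> * 0) - 1\<bar> * (2 * M)) (at_right 0)"
      by (intro tendsto_intros D)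
    then have "\<forall>\<^sub>F t in at_right 0. \<bar>(exp (\<mu> * t) - 1) / t - \<mu>\<bar> * n2 \<nu> v + \<bar>exp (\<mu> * t) - 1\<bar> * (2 * M) < \<epsilon>"
      by (rule order_tendstoD) (use ep in simp)
    moreover note discounted_near[OF f a ep, of \<mu>] discounted_near[OF f order_refl ep, of \<mu>]
    moreover have "\<forall>\<^sub>F t in at_right (0::real). 0 < t" by (simp add: eventually_at_right_less)
    ultimately show "\<forall>\<^sub>F t in at_right 0. dist (n2 \<nu> (d t)) 0 < e"
    proof eventually_elim
      case (elim t)
      have "n2 \<nu> (d t) < e" using dbound[OF elim(4) ep elim(2,3)] elim(1) ep \<epsilon>_def by linarith
      then show ?case by simp
    qed
  qed
  then have "has_generator \<nu> T v ?w"
    unfolding has_generator_iff d_def using v(1) wsq by blast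
  then show thesis using that v(1) vF unfolding F_def by blast
qed

text \<open>Approximation in the graph norm in the form of a sequence, so that identities and
  inequalities on the core pass to the limit.\<close>

lemma generator_core_approx:
  assumes core: "generator_core \<nu> T L D" and g: "has_generator \<nu> T u w"
  shows "\<exists>U. (\<forall>n::nat. U n \<in> D \<and> square_integrable \<nu> (U n) \<and> square_integrable \<nu> (L (U n))) \<and>
    (\<lambda>n. n2 \<nu> (\<lambda>\<eta>. U n \<eta> - u \<eta>)) \<longlonglongrightarrow> 0 \<and> (\<lambda>n. n2 \<nu> (\<lambda>\<eta>. L (U n) \<eta> - w \<eta>)) \<longlonglongrightarrow> 0"
proof -
  have "\<exists>v\<in>D. n2 \<nu> (\<lambda>\<eta>. u \<eta> - v \<eta>) < 1 / real (Suc n) \<and> n2 \<nu> (\<lambda>\<eta>. w \<eta> - L v \<eta>) < 1 / real (Suc n)" for n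
    using core g unfolding generator_core_def Lnorm_2 by (meson of_nat_0_less_iff zero_less_Suc zero_less_divide_1_iff)
  then obtain U where U: "\<And>n. U n \<in> D" "\<And>n. n2 \<nu> (\<lambda>\<eta>. u \<eta> - U n \<eta>) < 1 / real (Suc n)"
      "\<And>n. n2 \<nu> (\<lambda>\<eta>. w \<eta> - L (U n) \<eta>) < 1 / real (Suc n)"
    by metis
  have "has_generator \<nu> T (U n) (L (U n))" for n using core U(1) unfolding generator_core_def by blast
  then have sq: "square_integrable \<nu> (U n)" "square_integrable \<nu> (L (U n))" for n unfolding has_generator_iff by auto
  have "(\<lambda>n. n2 \<nu> (\<lambda>\<eta>. U n \<eta> - u \<eta>)) \<longlonglongrightarrow> 0"
    by (rule tendsto_sandwich[OF _ _ tendsto_const LIMSEQ_Suc[OF lim_1_over_n]])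
      (use U(2) in \<open>auto intro!: always_eventually less_imp_le simp: n2_minus_commute[of _ _ u] simp del: of_nat_Suc\<close>)
  moreover have "(\<lambda>n. n2 \<nu> (\<lambda>\<eta>. L (U n) \<eta> - w \<eta>)) \<longlonglongrightarrow> 0"
    by (rule tendsto_sandwich[OF _ _ tendsto_const LIMSEQ_Suc[OF lim_1_over_n]])
      (use U(3) in \<open>auto intro!: always_eventually less_imp_le simp: n2_minus_commute[of _ _ w] simp del: of_nat_Suc\<close>)
  ultimately show ?thesis using U(1) sq by blast
qed

text \<open>Positivity is applied to \<open>B - f\<close> and \<open>B + f\<close>, and constants
  are preserved.\<close>

lemma T_bounded_fun:
  assumes f: "f \<in> borel_measurable \<nu>" "\<And>\<eta>. \<bar>f \<eta>\<bar> \<le> B" and t: "0 \<le> t"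
  shows "AE \<eta> in \<nu>. \<bar>T t f \<eta>\<bar> \<le> B" "n2 \<nu> (T t f) \<le> B"
proof -
  have sq: "square_integrable \<nu> f" by (rule square_integrable_bounded[OF f])
  have b: "f \<eta> \<le> B" and c: "0 \<le> B + f \<eta>" for \<eta> using f(2)[of \<eta>] by linarith+
  have "AE \<eta> in \<nu>. 0 \<le> T t (\<lambda>\<zeta>. B * 1 + (-1) * f \<zeta>) \<eta>"
    by (rule T_pos[OF t square_integrable_lincomb[OF square_integrable_const sq]]) (simp add: b)
  moreover have "AE \<eta> in \<nu>. 0 \<le> T t (\<lambda>\<zeta>. B * 1 + 1 * f \<zeta>) \<eta>"
    by (rule T_pos[OF t square_integrable_lincomb[OF square_integrable_const sq]])
      (simp add: c)
  moreover note T_lincomb[OF t square_integrable_const[of 1] sq, of B "-1"] T_lincomb[OF t square_integrable_const[of 1] sq, of B 1] T_one[OF t]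
  ultimately show AE: "AE \<eta> in \<nu>. \<bar>T t f \<eta>\<bar> \<le> B" by eventually_elim auto
  have B: "0 \<le> B" using b[of undefined] c[of undefined] by linarith
  have "(n2 \<nu> (T t f))\<^sup>2 \<le> (\<integral>\<eta>. B\<^sup>2 \<partial>\<nu>)"
    unfolding n2_sq
  proof (rule integral_mono_AE)
    show "AE \<eta> in \<nu>. (T t f \<eta>)\<^sup>2 \<le> B\<^sup>2" using AE by eventually_elim (metis abs_ge_zero power2_abs power_mono)
  qed (use T_sq[OF t sq] in \<open>auto simp: square_integrable_def\<close>)
  then have "(n2 \<nu> (T t f))\<^sup>2 \<le> B\<^sup>2" by (simp add: prob_space)
  then show "n2 \<nu> (T t f) \<le> B" using B by (rule power2_le_imp_le)
qed

text \<open>With zero discount the generator sends the integrated semigroup to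
  \<open>T t f - f\<close>. This is a limit of images of core functions, all of mean zero.\<close>

lemma invariant_bounded:
  assumes core: "generator_core \<nu> T L D" and zero: "\<And>u. u \<in> D \<Longrightarrow> (\<integral>\<eta>. L u \<eta> \<partial>\<nu>) = 0"
    and f: "f \<in> borel_measurable \<nu>" "\<And>\<eta>. \<bar>f \<eta>\<bar> \<le> B" and t: "0 \<le> t"
  shows "(\<integral>\<eta>. T t f \<eta> \<partial>\<nu>) = (\<integral>\<eta>. f \<eta> \<partial>\<nu>)"
proof -
  have sq: "square_integrable \<nu> f" by (rule square_integrable_bounded[OF f])
  obtain v where "has_generator \<nu> T v (\<lambda>\<eta>. 0 * v \<eta> - f \<eta> + discounted 0 f t \<eta>)"
    using integrated_semigroup[OF sq T_bounded_fun(2)[OF f] t order_refl] by blast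
  then have g: "has_generator \<nu> T v (\<lambda>\<eta>. T t f \<eta> - f \<eta>)" by (simp add: discounted_def)
  then have wsq: "square_integrable \<nu> (\<lambda>\<eta>. T t f \<eta> - f \<eta>)" by (simp add: has_generator_iff)
  obtain U where U: "\<And>n::nat. U n \<in> D" "\<And>n. square_integrable \<nu> (U n)" "\<And>n. square_integrable \<nu> (L (U n))"
    "(\<lambda>n. n2 \<nu> (\<lambda>\<eta>. U n \<eta> - v \<eta>)) \<longlonglongrightarrow> 0"
    "(\<lambda>n. n2 \<nu> (\<lambda>\<eta>. L (U n) \<eta> - (T t f \<eta> - f \<eta>))) \<longlonglongrightarrow> 0"
    using generator_core_approx[OF core g] by (elim exE conjE, intro that) (simp_all only:)
  have "(\<lambda>n. ip \<nu> (L (U n)) (\<lambda>_. 1)) \<longlonglongrightarrow> ip \<nu> (\<lambda>\<eta>. T t f \<eta> - f \<eta>) (\<lambda>_. 1)"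
    by (rule ip_tendsto_left[OF wsq square_integrable_const U(3,5)])
  then have "ip \<nu> (\<lambda>\<eta>. T t f \<eta> - f \<eta>) (\<lambda>_. 1) = 0"
    by (simp add: ip_def zero[OF U(1)] LIMSEQ_const_iff)
  then show ?thesis
    using square_integrable_integrable[OF sq] square_integrable_integrable[OF T_sq[OF t sq]] by (simp add: ip_def)
qed

end

subsection \<open>The stationary process\<close>

locale stationary_process = L2_semigroup \<nu> T + P: prob_space P
  for \<nu> T and P :: "'w measure" +
  fixes X :: "real \<Rightarrow> 'w \<Rightarrow> config"
  assumes sets_nu: "sets \<nu> = sets config_space"
    and process: "markov_process \<nu> T P X"
    and invariant: "\<And>f B t. f \<in> borel_measurable \<nu> \<Longrightarrow> (\<And>\<eta>. \<bar>f \<eta>\<bar> \<le> B) \<Longrightarrow> 0 \<le> t \<Longrightarrow>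
      (\<integral>\<eta>. T t f \<eta> \<partial>\<nu>) = (\<integral>\<eta>. f \<eta> \<partial>\<nu>)"
begin

lemma measurable_nu: "measurable \<nu> N = measurable config_space N"
  by (rule measurable_cong_sets[OF sets_nu refl])

text \<open>\<open>X\<close> is jointly measurable on nonnegative times only. Freezing it at time
  \<open>0\<close> before that gives a process on the whole line, to which Fubini with
  \<open>lborel\<close> applies.\<close>

definition Y :: "real \<Rightarrow> 'w \<Rightarrow> config" where
  "Y s = X (max 0 s)"

lemma Y_nonneg: "0 \<le> s \<Longrightarrow> Y s = X s"
  by (simp add: Y_def)

lemma joint_measurable: "(\<lambda>(s, \<omega>). Y s \<omega>) \<in> borel \<Otimes>\<^sub>M P \<rightarrow>\<^sub>M config_space"
proof -
  have "(\<lambda>(s, \<omega>). X s \<omega>) \<in> restrict_space borel {0..} \<Otimes>\<^sub>M P \<rightarrow>\<^sub>M config_space"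
    using process by (simp add: markov_process_def)
  moreover have "(\<lambda>(s::real, \<omega>). (max 0 s, \<omega>)) \<in> borel \<Otimes>\<^sub>M P \<rightarrow>\<^sub>M restrict_space borel {0..} \<Otimes>\<^sub>M P"
    unfolding split_beta'
    by (intro measurable_Pair measurable_restrict_space2) auto
  ultimately have "(\<lambda>(s, \<omega>). X s \<omega>) \<circ> (\<lambda>(s, \<omega>). (max 0 s, \<omega>)) \<in> borel \<Otimes>\<^sub>M P \<rightarrow>\<^sub>M config_space"
    by (rule measurable_comp[rotated])
  then show ?thesis by (simp add: comp_def split_beta' Y_def)
qed

lemma Y_measurable: "Y s \<in> P \<rightarrow>\<^sub>M config_space"
  using measurable_Pair2[OF joint_measurable, of s] by (simp add: space_PiM)

lemma past_subalgebra: "subalgebra P (past P X s)"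
proof -
  have "{X u -` A \<inter> space P | u A. 0 \<le> u \<and> u \<le> s \<and> A \<in> sets config_space} \<subseteq> sets P"
  proof
    fix B assume "B \<in> {X u -` A \<inter> space P | u A. 0 \<le> u \<and> u \<le> s \<and> A \<in> sets config_space}"
    then obtain u A where B: "B = X u -` A \<inter> space P" "0 \<le> u" "A \<in> sets config_space" by blast
    from measurable_sets[OF Y_measurable[of u] B(3)] show "B \<in> sets P" by (simp add: B Y_nonneg)
  qed
  then show ?thesis
    unfolding subalgebra_def past_def
    by (auto simp: sets_measure_of_conv space_measure_of_conv intro: sets.sigma_sets_subset[THEN subsetD])
qed

lemma past_measurable:
  assumes "0 \<le> s" shows "X s \<in> past P X s \<rightarrow>\<^sub>M config_space"
proof (rule measurableI)
  fix A assume "A \<in> sets config_space"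
  then have "X s -` A \<inter> space P \<in> sets (past P X s)"
    unfolding past_def using assms by (intro in_measure_of) auto
  then show "X s -` A \<inter> space (past P X s) \<in> sets (past P X s)"
    using past_subalgebra[of s] by (simp add: subalgebra_def)
qed simp

lemma markov_pairing:
  assumes s: "0 \<le> s" "0 \<le> t" and h: "h \<in> borel_measurable \<nu>" and g: "square_integrable \<nu> g"
    and int: "integrable P (\<lambda>\<omega>. h (X s \<omega>) * g (X (s + t) \<omega>))"
  shows "(\<integral>\<omega>. h (X s \<omega>) * g (X (s + t) \<omega>) \<partial>P) = (\<integral>\<omega>. h (X s \<omega>) * T t g (X s \<omega>) \<partial>P)"
proof -
  interpret F: finite_measure_subalgebra P "past P X s"
    by unfold_locales (rule past_subalgebra)
  have g': "g \<in> borel_measurable config_space" and h': "h \<in> borel_measurable config_space"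
    using g h by (simp_all add: square_integrable_def measurable_nu)
  have Xm: "X s \<in> P \<rightarrow>\<^sub>M config_space" "X (s + t) \<in> P \<rightarrow>\<^sub>M config_space"
    using Y_measurable[of s] Y_measurable[of "s + t"] s by (simp_all add: Y_nonneg)
  have T': "T t g \<in> borel_measurable config_space"
    using T_measurable[OF s(2) g] by (simp add: measurable_nu)
  have AE: "AE \<omega> in P. real_cond_exp P (past P X s) (\<lambda>\<omega>'. g (X (s + t) \<omega>')) \<omega> = T t g (X s \<omega>)"
    using process s g by (simp add: markov_process_def Lp_2_iff)
  have "(\<integral>\<omega>. h (X s \<omega>) * g (X (s + t) \<omega>) \<partial>P)
     = (\<integral>\<omega>. h (X s \<omega>) * real_cond_exp P (past P X s) (\<lambda>\<omega>'. g (X (s + t) \<omega>')) \<omega> \<partial>P)"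
    by (rule F.real_cond_exp_intg(2)[symmetric, OF int])
      (use measurable_compose[OF past_measurable[OF s(1)] h'] measurable_compose[OF Xm(2) g'] in auto)
  also have "\<dots> = (\<integral>\<omega>. h (X s \<omega>) * T t g (X s \<omega>) \<partial>P)"
    by (rule integral_cong_AE)
      (use AE measurable_compose[OF Xm(1) h'] measurable_compose[OF Xm(1) T'] in auto)
  finally show ?thesis .
qed

lemma distr_X0: "distr P config_space (X 0) = \<nu>"
  using process by (simp add: markov_process_def)

text \<open>Indicators are bounded, so \<open>invariant\<close> applies to them; the Markov property
  at time \<open>0\<close> transfers it to the path.\<close>

lemma distr_X: assumes t: "0 \<le> t" shows "distr P config_space (X t) = \<nu>"
proof (rule measure_eqI)
  show "sets (distr P config_space (X t)) = sets \<nu>" by (simp add: sets_nu)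
  have Xm: "X t \<in> P \<rightarrow>\<^sub>M config_space" "X 0 \<in> P \<rightarrow>\<^sub>M config_space"
    using Y_measurable[of t] Y_measurable[of 0] t by (simp_all add: Y_nonneg)
  fix A assume "A \<in> sets (distr P config_space (X t))"
  then have A: "A \<in> sets config_space" by simp
  let ?g = "indicator A :: config \<Rightarrow> real"
  have gm: "?g \<in> borel_measurable \<nu>" unfolding measurable_nu using A by (rule borel_measurable_indicator)
  have gsq: "square_integrable \<nu> ?g" by (rule square_integrable_bounded[OF gm, of 1]) (simp split: split_indicator)
  have gm': "(\<lambda>\<omega>. ?g (X t \<omega>)) \<in> borel_measurable P"
    by (rule measurable_compose[OF Xm(1) borel_measurable_indicator[OF A]])
  have int: "integrable P (\<lambda>\<omega>. 1 * ?g (X (0 + t) \<omega>))"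
    using gm' by (intro P.integrable_const_bound[where B=1]) (auto split: split_indicator)
  have T': "T t ?g \<in> borel_measurable config_space"
    using T_measurable[OF t gsq] by (simp add: measurable_nu)
  have "measure P (X t -` A \<inter> space P) = (\<integral>\<omega>. ?g (X t \<omega>) \<partial>P)"
  proof -
    have "(\<integral>\<omega>. ?g (X t \<omega>) \<partial>P) = (\<integral>\<omega>. indicator (X t -` A \<inter> space P) \<omega> \<partial>P)"
      by (rule Bochner_Integration.integral_cong) (auto split: split_indicator)
    then show ?thesis using measurable_sets[OF Xm(1) A] by simp
  qed
  also have "(\<integral>\<omega>. ?g (X t \<omega>) \<partial>P) = (\<integral>\<omega>. T t ?g (X 0 \<omega>) \<partial>P)"
    using markov_pairing[OF order_refl t borel_measurable_const gsq int] by simp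
  also have "\<dots> = (\<integral>\<eta>. T t ?g \<eta> \<partial>distr P config_space (X 0))"
    by (rule integral_distr[symmetric, OF Xm(2) T'])
  also have "\<dots> = (\<integral>\<eta>. T t ?g \<eta> \<partial>\<nu>)" by (simp only: distr_X0)
  also have "\<dots> = (\<integral>\<eta>. ?g \<eta> \<partial>\<nu>)" by (rule invariant[OF gm _ t, of 1]) (simp split: split_indicator)
  also have "\<dots> = measure \<nu> A" using A sets_eq_imp_space_eq[OF sets_nu] by simp
  finally show "emeasure (distr P config_space (X t)) A = emeasure \<nu> A"
    using A by (simp add: emeasure_distr[OF Xm(1)] P.emeasure_eq_measure emeasure_eq_measure)
qed

lemma X_measurable: "0 \<le> t \<Longrightarrow> X t \<in> P \<rightarrow>\<^sub>M config_space"
  using Y_measurable[of t] by (simp add: Y_nonneg)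

lemma integral_X:
  assumes "0 \<le> t" "(f :: config \<Rightarrow> real) \<in> borel_measurable \<nu>"
  shows "(\<integral>\<omega>. f (X t \<omega>) \<partial>P) = (\<integral>\<eta>. f \<eta> \<partial>\<nu>)" "integrable P (\<lambda>\<omega>. f (X t \<omega>)) \<longleftrightarrow> integrable \<nu> f"
proof -
  have f: "f \<in> borel_measurable config_space" using assms by (simp add: measurable_nu)
  show "(\<integral>\<omega>. f (X t \<omega>) \<partial>P) = (\<integral>\<eta>. f \<eta> \<partial>\<nu>)"
    using integral_distr[OF X_measurable[OF assms(1)] f] by (simp add: distr_X[OF assms(1)])
  show "integrable P (\<lambda>\<omega>. f (X t \<omega>)) \<longleftrightarrow> integrable \<nu> f"
    using integrable_distr_eq[OF X_measurable[OF assms(1)] f] by (simp add: distr_X[OF assms(1)])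
qed

lemma X_compose_measurable: "0 \<le> t \<Longrightarrow> f \<in> borel_measurable \<nu> \<Longrightarrow> (\<lambda>\<omega>. f (X t \<omega>)) \<in> borel_measurable P"
  using measurable_compose[OF X_measurable, of t f borel] by (simp add: measurable_nu)

lemma square_integrable_X:
  assumes "0 \<le> t" "square_integrable \<nu> f"
  shows "square_integrable P (\<lambda>\<omega>. f (X t \<omega>))" "n2 P (\<lambda>\<omega>. f (X t \<omega>)) = n2 \<nu> f"
proof -
  have f: "f \<in> borel_measurable \<nu>" using assms by (simp add: square_integrable_def)
  then have f2: "(\<lambda>\<eta>. (f \<eta>)\<^sup>2) \<in> borel_measurable \<nu>" by measurable
  show "square_integrable P (\<lambda>\<omega>. f (X t \<omega>))"
    using assms integral_X(2)[OF assms(1) f2] X_compose_measurable[OF assms(1) f] by (simp add: square_integrable_def)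
  show "n2 P (\<lambda>\<omega>. f (X t \<omega>)) = n2 \<nu> f"
    unfolding n2_def using integral_X(1)[OF assms(1) f2] by simp
qed

lemma covariance:
  assumes s: "0 \<le> s" "0 \<le> t" and h: "square_integrable \<nu> h" and g: "square_integrable \<nu> g"
  shows "(\<integral>\<omega>. h (X s \<omega>) * g (X (s + t) \<omega>) \<partial>P) = ip \<nu> h (T t g)"
proof -
  have "(\<integral>\<omega>. h (X s \<omega>) * g (X (s + t) \<omega>) \<partial>P) = (\<integral>\<omega>. h (X s \<omega>) * T t g (X s \<omega>) \<partial>P)"
    using s h g square_integrable_mult[OF square_integrable_X(1)[OF s(1) h] square_integrable_X(1)[of "s + t", OF _ g]]
    by (intro markov_pairing) (auto simp: square_integrable_def)
  also have "\<dots> = ip \<nu> h (T t g)"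
    unfolding ip_def using h T_sq[OF s(2) g]
    by (intro integral_X(1)[OF s(1), of "\<lambda>\<eta>. h \<eta> * T t g \<eta>"]) (auto simp: square_integrable_def)
  finally show ?thesis .
qed

text \<open>The squared norm of \<open>T t g\<close> is the correlation of
  \<open>T t g (X 0)\<close> and \<open>g (X t)\<close>. Cauchy--Schwarz on path space and
  stationarity bound it by the product of the norms of \<open>T t g\<close> and
  \<open>g\<close>.\<close>

lemma contraction:
  assumes t: "0 \<le> t" and g: "square_integrable \<nu> g"
  shows "n2 \<nu> (T t g) \<le> n2 \<nu> g"
proof -
  note Tg = T_sq[OF t g]
  have "(n2 \<nu> (T t g))\<^sup>2 = (\<integral>\<omega>. T t g (X 0 \<omega>) * g (X (0 + t) \<omega>) \<partial>P)"
    using covariance[OF order_refl t Tg g] by (simp add: ip_self)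
  also have "\<dots> = ip P (\<lambda>\<omega>. T t g (X 0 \<omega>)) (\<lambda>\<omega>. g (X t \<omega>))" by (simp add: ip_def)
  also have "\<dots> \<le> n2 P (\<lambda>\<omega>. T t g (X 0 \<omega>)) * n2 P (\<lambda>\<omega>. g (X t \<omega>))"
    using ip_Cauchy_Schwarz[OF square_integrable_X(1)[OF order_refl Tg] square_integrable_X(1)[OF t g]] by linarith
  also have "\<dots> = n2 \<nu> (T t g) * n2 \<nu> g" using t g Tg by (simp add: square_integrable_X)
  finally have *: "(n2 \<nu> (T t g))\<^sup>2 \<le> n2 \<nu> (T t g) * n2 \<nu> g" .
  show ?thesis
  proof (cases "n2 \<nu> (T t g) = 0")
    case False
    then have "0 < n2 \<nu> (T t g)" using n2_nonneg[of \<nu> "T t g"] by linarith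
    with * show ?thesis by (simp add: power2_eq_square)
  qed simp
qed

end

subsection \<open>From Laplace transforms to time averages\<close>

lemma integral_reflect_shift:
  fixes f :: "real \<Rightarrow> real"
  shows "integral {a..s} (\<lambda>r. f (s - r)) = integral {0..s - a} f"
proof -
  have "integral {a..s} ((\<lambda>x. f (- x)) \<circ> (+) (- s)) = integral {a + (- s)..s + (- s)} (\<lambda>x. f (- x))"
    by (rule integral_shift_Icc_real)
  also have "\<dots> = integral {- (s - a)..- 0} (\<lambda>x. f (- x))" by simp
  also have "\<dots> = integral {0..s - a} f" by (rule Henstock_Kurzweil_Integration.integral_reflect_real)
  finally show ?thesis by (simp add: comp_def)
qed

lemma integral_shift_back:
  fixes f :: "real \<Rightarrow> real"
  shows "integral {s..b} (\<lambda>r. f (r - s)) = integral {0..b - s} f"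
  using integral_shift_Icc_real[of s b f "- s"] by (simp add: comp_def)

text \<open>The square is cut along the diagonal and the two triangles contribute equally. With
  \<open>C\<close> the autocovariance, the left side is the second moment of a time
  integral.\<close>

lemma double_integral_symmetric:
  fixes C :: "real \<Rightarrow> real"
  assumes C: "continuous_on {0..} C" and ab: "a \<le> b"
  shows "integral {a..b} (\<lambda>s. integral {a..b} (\<lambda>r. C \<bar>s - r\<bar>)) = 2 * integral {0..b - a} (\<lambda>s. integral {0..s} C)"
proof -
  let ?G = "\<lambda>s. integral {0..s} C"
  have iC: "continuous_on {c..d} C" if "0 \<le> c" for c d
    by (rule continuous_on_subset[OF C]) (use that in auto)
  have inner: "integral {a..b} (\<lambda>r. C \<bar>s - r\<bar>) = ?G (s - a) + ?G (b - s)" if s: "a \<le> s" "s \<le> b" for s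
  proof -
    have "continuous_on {a..b} (\<lambda>r. C \<bar>s - r\<bar>)"
      by (rule continuous_on_compose2[OF C]) (auto intro!: continuous_intros)
    then have "integral {a..b} (\<lambda>r. C \<bar>s - r\<bar>) = integral {a..s} (\<lambda>r. C \<bar>s - r\<bar>) + integral {s..b} (\<lambda>r. C \<bar>s - r\<bar>)"
      by (intro Henstock_Kurzweil_Integration.integral_combine[symmetric] s integrable_continuous_interval)
    also have "integral {a..s} (\<lambda>r. C \<bar>s - r\<bar>) = integral {a..s} (\<lambda>r. C (s - r))"
      by (rule integral_cong) auto
    also have "integral {s..b} (\<lambda>r. C \<bar>s - r\<bar>) = integral {s..b} (\<lambda>r. C (r - s))"
      by (rule integral_cong) (auto simp: abs_minus_commute)
    finally show ?thesis by (simp add: integral_reflect_shift integral_shift_back)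
  qed
  have G: "continuous_on {0..d} ?G" for d
    by (rule indefinite_integral_continuous_1[OF integrable_continuous_interval[OF iC]]) simp
  have G1: "continuous_on {a..b} (\<lambda>s. ?G (s - a))" and G2: "continuous_on {a..b} (\<lambda>s. ?G (b - s))"
    by (rule continuous_on_compose2[OF G[of "b - a"]]; auto intro!: continuous_intros)+
  have "integral {a..b} (\<lambda>s. integral {a..b} (\<lambda>r. C \<bar>s - r\<bar>)) = integral {a..b} (\<lambda>s. ?G (s - a) + ?G (b - s))"
    by (rule integral_cong) (use inner in auto)
  also have "\<dots> = integral {a..b} (\<lambda>s. ?G (s - a)) + integral {a..b} (\<lambda>s. ?G (b - s))"
    using G1 G2 by (intro Henstock_Kurzweil_Integration.integral_add integrable_continuous_interval)
  finally show ?thesis using integral_reflect_shift[of a b ?G] integral_shift_back[of a b ?G] by simp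
qed

text \<open>With \<open>G\<close> the integral of \<open>C\<close> and \<open>F\<close> twice the integral of \<open>G\<close>, integration by parts gives
  \<open>\<integral> exp (- \<mu> s) C s ds = \<mu>\<^sup>2 / 2 * \<integral> exp (- \<mu> s) F s ds\<close> up to boundary terms. Almost subadditivity
  of \<open>F\<close> turns the resulting bound on an average of \<open>F\<close> into a pointwise one, with \<open>\<mu> = 1 / t\<close>.\<close>

lemma laplace_to_average:
  fixes C :: "real \<Rightarrow> real"
  assumes C: "continuous_on {0..} C" and B: "\<And>s. 0 \<le> s \<Longrightarrow> \<bar>C s\<bar> \<le> B"
  defines "G \<equiv> \<lambda>x. integral {0..x} C"
  defines "F \<equiv> \<lambda>x. 2 * integral {0..x} G"
  assumes A: "\<And>\<mu> \<epsilon>. 0 < \<mu> \<Longrightarrow> 0 < \<epsilon> \<Longrightarrow> \<forall>\<^sub>F N in at_top. integral {0..N} (\<lambda>s. exp (- \<mu> * s) * C s) \<le> A + \<epsilon>"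
    and F0: "\<And>s. 0 \<le> s \<Longrightarrow> 0 \<le> F s"
    and Fsub: "\<And>s t. 0 \<le> s \<Longrightarrow> s \<le> t \<Longrightarrow> F t \<le> 2 * F s + 2 * F (t - s)"
    and t: "0 < t"
  shows "F t \<le> 24 * t * A"
proof -
  have iC: "continuous_on {0..d} C" for d
    by (rule continuous_on_subset[OF C]) auto
  have Gd: "(G has_real_derivative C x) (at x within {0..d})" if "x \<in> {0..d}" for x d
    unfolding G_def by (rule integral_has_real_derivative[OF iC that])
  have Gc: "continuous_on {0..d} G" for d
    using Gd by (meson DERIV_continuous_on)
  have Fd: "(F has_real_derivative 2 * G x) (at x within {0..d})" if "x \<in> {0..d}" for x d
    unfolding F_def by (intro DERIV_cmult integral_has_real_derivative[OF Gc that])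
  have Fc: "continuous_on {0..d} F" for d
    using Fd by (meson DERIV_continuous_on)
  have B0: "0 \<le> B" using B[of 0] by linarith
  have Gb: "\<bar>G x\<bar> \<le> B * x" if "0 \<le> x" for x
    unfolding G_def using has_integral_bound[of B C "integral {0..x} C" 0 x] that B0 B
      integrable_integral[OF integrable_continuous_interval[OF iC]] by auto
  have Fb: "\<bar>F x\<bar> \<le> 2 * (B * x * x)" if x: "0 \<le> x" for x
  proof -
    have "\<bar>G y\<bar> \<le> B * x" if "y \<in> {0..x}" for y
      using Gb[of y] that mult_left_mono[of y x B] B0 by auto
    then have "\<bar>integral {0..x} G\<bar> \<le> B * x * x"
      using has_integral_bound[of "B * x" G "integral {0..x} G" 0 x] x B0
        integrable_integral[OF integrable_continuous_interval[OF Gc]] by auto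
    then show ?thesis unfolding F_def by simp
  qed
  define \<mu> where "\<mu> = 1 / t"
  have \<mu>: "0 < \<mu>" using t by (simp add: \<mu>_def)
  \<comment> \<open>The boundary terms of the double integration by parts. The derivative of
    \<open>H\<close> is the discounted \<open>C\<close> minus \<open>\<mu> ^ 2 / 2\<close> times the
    discounted \<open>F\<close>.\<close>
  define H where "H N = exp (- \<mu> * N) * (G N + \<mu> * F N / 2)" for N
  have H0: "H 0 = 0" by (simp add: H_def G_def F_def)
  have parts: "integral {0..N} (\<lambda>s. exp (- \<mu> * s) * C s) = H N + \<mu>\<^sup>2 / 2 * integral {0..N} (\<lambda>s. exp (- \<mu> * s) * F s)"
    if N: "0 \<le> N" for N
  proof -
    have "((\<lambda>s. exp (- \<mu> * s) * C s - \<mu>\<^sup>2 / 2 * (exp (- \<mu> * s) * F s)) has_integral (H N - H 0)) {0..N}"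
    proof (rule fundamental_theorem_of_calculus[OF N])
      fix s assume s: "s \<in> {0..N}"
      have "(H has_real_derivative exp (- \<mu> * s) * (C s + \<mu> * (2 * G s) / 2) + (exp (- \<mu> * s) * (- \<mu> * 1)) * (G s + \<mu> * F s / 2)) (at s within {0..N})"
        unfolding H_def[abs_def]
        by (intro DERIV_mult' DERIV_add DERIV_cdivide DERIV_cmult Gd[OF s] Fd[OF s] DERIV_chain2[OF DERIV_exp] DERIV_ident)
      then show "(H has_vector_derivative exp (- \<mu> * s) * C s - \<mu>\<^sup>2 / 2 * (exp (- \<mu> * s) * F s)) (at s within {0..N})"
        unfolding has_real_derivative_iff_has_vector_derivative[symmetric]
        by (rule DERIV_cong) (simp add: algebra_simps power2_eq_square)
    qed
    then have "integral {0..N} (\<lambda>s. exp (- \<mu> * s) * C s - \<mu>\<^sup>2 / 2 * (exp (- \<mu> * s) * F s)) = H N"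
      by (simp add: integral_unique H0)
    moreover have "integral {0..N} (\<lambda>s. exp (- \<mu> * s) * C s - \<mu>\<^sup>2 / 2 * (exp (- \<mu> * s) * F s))
       = integral {0..N} (\<lambda>s. exp (- \<mu> * s) * C s) - integral {0..N} (\<lambda>s. \<mu>\<^sup>2 / 2 * (exp (- \<mu> * s) * F s))"
      by (intro Henstock_Kurzweil_Integration.integral_diff integrable_continuous_interval continuous_intros iC Fc)
    ultimately show ?thesis by simp
  qed
  have Hlim: "\<forall>\<^sub>F N in at_top. - \<epsilon> \<le> H N" if e: "0 < \<epsilon>" for \<epsilon>
  proof -
    \<comment> \<open>\<open>G\<close> grows at most linearly and \<open>F\<close> at most
      quadratically, so the exponential wins. A lower bound for \<open>H\<close> suffices, because
      the integral of \<open>F\<close> is to be bounded from above.\<close>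
    have Hb: "- ((B / \<mu>) * ((\<mu> * N) ^ 1 / exp (\<mu> * N) + (\<mu> * N) ^ 2 / exp (\<mu> * N))) \<le> H N" if N: "0 \<le> N" for N
    proof -
      have "\<bar>H N\<bar> = exp (- \<mu> * N) * \<bar>G N + \<mu> * F N / 2\<bar>" by (simp add: H_def abs_mult)
      also have "\<bar>G N + \<mu> * F N / 2\<bar> \<le> B * N + \<mu> * (B * N * N)"
      proof -
        have "\<bar>\<mu> * F N / 2\<bar> \<le> \<mu> * (B * N * N)"
          using mult_left_mono[OF Fb[OF N], of \<mu>] \<mu> by (simp add: abs_mult)
        then show ?thesis using Gb[OF N] by linarith
      qed
      also have "exp (- \<mu> * N) * (B * N + \<mu> * (B * N * N)) = (B / \<mu>) * ((\<mu> * N) ^ 1 / exp (\<mu> * N) + (\<mu> * N) ^ 2 / exp (\<mu> * N))"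
        using \<mu> by (simp add: exp_minus field_simps power2_eq_square)
      finally show ?thesis by (simp add: mult_left_mono)
    qed
    have f: "filterlim (\<lambda>N. \<mu> * N) at_top at_top"
      by (rule filterlim_tendsto_pos_mult_at_top[OF tendsto_const \<mu> filterlim_ident])
    have "((\<lambda>N. (B / \<mu>) * ((\<mu> * N) ^ 1 / exp (\<mu> * N) + (\<mu> * N) ^ 2 / exp (\<mu> * N))) \<longlongrightarrow> (B / \<mu>) * (0 + 0)) at_top"
      by (intro tendsto_intros filterlim_compose[OF tendsto_power_div_exp_0 f])
    then have "\<forall>\<^sub>F N in at_top. (B / \<mu>) * ((\<mu> * N) ^ 1 / exp (\<mu> * N) + (\<mu> * N) ^ 2 / exp (\<mu> * N)) < \<epsilon>"
      by (rule order_tendstoD) (use e in simp)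
    then show ?thesis using eventually_ge_at_top[of 0]
    proof eventually_elim
      case (elim N) then show ?case using Hb[of N] by linarith
    qed
  qed
  have avg: "integral {0..t} F \<le> 6 * t\<^sup>2 * A"
  proof (rule field_le_epsilon)
    fix e :: real assume e: "0 < e"
    \<comment> \<open>Chosen so that the error \<open>3 * (2 * t ^ 2 * (2 * \<epsilon>))\<close>
      equals \<open>e\<close>. Here \<open>2 * t ^ 2\<close> undoes the factor
      \<open>\<mu> ^ 2 / 2\<close>, and \<open>3\<close> bounds \<open>exp 1\<close>, lost because
      the weight on \<open>[0, t]\<close> is only known to be at least
      \<open>exp (- 1)\<close>.\<close>
    define \<epsilon> where "\<epsilon> = e / (12 * t\<^sup>2)"
    have ep: "0 < \<epsilon>" using e t by (simp add: \<epsilon>_def)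
    obtain N where N: "t \<le> N" "integral {0..N} (\<lambda>s. exp (- \<mu> * s) * C s) \<le> A + \<epsilon>" "- \<epsilon> \<le> H N"
      using eventually_happens'[OF trivial_limit_at_top_linorder
          eventually_conj[OF eventually_ge_at_top[of t] eventually_conj[OF A[OF \<mu> ep] Hlim[OF ep]]]] by blast
    have iE: "(\<lambda>s. exp (- \<mu> * s) * F s) integrable_on {0..d}" for d
      by (intro integrable_continuous_interval continuous_intros Fc)
    have "exp (- 1) * integral {0..t} F = integral {0..t} (\<lambda>s. exp (- 1) * F s)" by simp
    also have "\<dots> \<le> integral {0..t} (\<lambda>s. exp (- \<mu> * s) * F s)"
    proof (rule integral_le[OF _ iE])
      show "(\<lambda>s. exp (- 1) * F s) integrable_on {0..t}"
        by (intro integrable_continuous_interval continuous_intros Fc)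
      fix s assume s: "s \<in> {0..t}"
      then have "s / t \<le> 1" using t by simp
      then show "exp (- 1) * F s \<le> exp (- \<mu> * s) * F s"
        using s by (intro mult_right_mono F0) (auto simp: \<mu>_def)
    qed
    also have "\<dots> \<le> integral {0..N} (\<lambda>s. exp (- \<mu> * s) * F s)"
      by (rule integral_subset_le) (use iE F0 N(1) in auto)
    finally have 1: "exp (- 1) * integral {0..t} F \<le> integral {0..N} (\<lambda>s. exp (- \<mu> * s) * F s)" .
    have "\<mu>\<^sup>2 / 2 * integral {0..N} (\<lambda>s. exp (- \<mu> * s) * F s) \<le> A + 2 * \<epsilon>"
      using parts[of N] N t by linarith
    then have "integral {0..N} (\<lambda>s. exp (- \<mu> * s) * F s) \<le> 2 * t\<^sup>2 * (A + 2 * \<epsilon>)"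
      using t by (simp add: \<mu>_def field_simps)
    with 1 have 2: "exp (- 1) * integral {0..t} F \<le> 2 * t\<^sup>2 * (A + 2 * \<epsilon>)" by linarith
    have F0t: "0 \<le> integral {0..t} F" by (rule integral_nonneg[OF integrable_continuous_interval[OF Fc]]) (use F0 in auto)
    have pos: "0 \<le> 2 * t\<^sup>2 * (A + 2 * \<epsilon>)" using 2 F0t by (meson exp_ge_zero mult_nonneg_nonneg order_trans)
    have "integral {0..t} F = exp 1 * (exp (- 1) * integral {0..t} F)" by (simp add: exp_minus)
    also have "\<dots> \<le> exp 1 * (2 * t\<^sup>2 * (A + 2 * \<epsilon>))" by (intro mult_left_mono 2) simp
    also have "\<dots> \<le> 3 * (2 * t\<^sup>2 * (A + 2 * \<epsilon>))" by (intro mult_right_mono exp_le pos)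
    also have "\<dots> = 6 * t\<^sup>2 * A + e" using t by (simp add: \<epsilon>_def field_simps)
    finally show "integral {0..t} F \<le> 6 * t\<^sup>2 * A + e" .
  qed
  have Fr: "continuous_on {0..t} (\<lambda>s. F (t - s))"
    by (rule continuous_on_compose2[OF Fc[of t]]) (auto intro!: continuous_intros)
  \<comment> \<open>Almost subadditivity averaged over \<open>s\<close> in \<open>[0, t]\<close>
    bounds \<open>t * F t\<close> by four times the integral of \<open>F\<close>; hence
    \<open>24 = 4 * 6\<close>.\<close>
  have "t * F t = integral {0..t} (\<lambda>s. F t)" using t by simp
  also have "\<dots> \<le> integral {0..t} (\<lambda>s. 2 * F s + 2 * F (t - s))"
    by (rule integral_le) (auto intro!: integrable_continuous_interval continuous_intros Fc Fr Fsub)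
  also have "\<dots> = integral {0..t} (\<lambda>s. 2 * F s) + integral {0..t} (\<lambda>s. 2 * F (t - s))"
    by (intro Henstock_Kurzweil_Integration.integral_add integrable_continuous_interval continuous_intros Fc Fr)
  also have "\<dots> = 4 * integral {0..t} F" using integral_reflect_shift[of 0 t F] by simp
  also have "\<dots> \<le> t * (24 * t * A)" using avg by (simp add: power2_eq_square mult_ac)
  finally show ?thesis using t by simp
qed

subsection \<open>Second moments of time integrals\<close>

text \<open>Cauchy--Schwarz in time for arbitrary measurable paths. A path without square integrable
  restriction makes the right side infinite, except on an interval of length zero.\<close>

lemma sq_set_integral_le:
  fixes g :: "real \<Rightarrow> real"
  assumes g: "g \<in> borel_measurable borel" and ab: "a \<le> b"
  shows "ennreal ((LBINT s:{a..b}. g s)\<^sup>2) \<le> ennreal (b - a) * (\<integral>\<^sup>+s. indicator {a..b} s * ennreal ((g s)\<^sup>2) \<partial>lborel)"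
proof -
  let ?R = "restrict_space lborel {a..b}"
  have gm: "g \<in> borel_measurable ?R" using g by (intro measurable_restrict_space1) simp
  have nn: "(\<integral>\<^sup>+s. indicator {a..b} s * ennreal ((g s)\<^sup>2) \<partial>lborel) = (\<integral>\<^sup>+s. ennreal ((g s)\<^sup>2) \<partial>?R)"
    by (subst nn_integral_restrict_space) (auto simp: mult.commute)
  have eq: "(LBINT s:{a..b}. g s) = (\<integral>s. g s \<partial>?R)"
    by (subst integral_restrict_space) (auto simp: set_lebesgue_integral_def)
  have fin: "finite_measure ?R" by (rule finite_measureI) (simp add: emeasure_restrict_space space_restrict_space ab)
  show ?thesis
  proof (cases "(\<integral>\<^sup>+s. ennreal ((g s)\<^sup>2) \<partial>?R) = \<infinity>")
    case True
    show ?thesis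
    \<comment> \<open>In \<open>ennreal\<close> zero times infinity is zero, so the one-point
      interval needs its own argument; there the left side vanishes.\<close>
    proof (cases "a = b")
      case True
      have "(LBINT s:{a..b}. g s) = 0"
        unfolding set_lebesgue_integral_def True
        by (rule integral_eq_zero_AE, rule AE_mp[OF AE_lborel_singleton[of b]]) (auto split: split_indicator)
      then show ?thesis by simp
    next
      case False
      then have "0 < b - a" using ab by simp
      then show ?thesis unfolding nn True by (simp add: ennreal_mult_top)
    qed
  next
    case False
    then have sq: "square_integrable ?R g"
      unfolding square_integrable_def using gm by (auto intro!: integrableI_nonneg simp: less_top)
    have one: "square_integrable ?R (\<lambda>_. 1)" by (rule finite_measure.square_integrable_const[OF fin])
    have n1: "(n2 ?R (\<lambda>_. 1))\<^sup>2 = b - a"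
      unfolding n2_sq by (simp add: measure_restrict_space space_restrict_space ab)
    have "\<bar>ip ?R g (\<lambda>_. 1)\<bar>\<^sup>2 \<le> (n2 ?R g * n2 ?R (\<lambda>_. 1))\<^sup>2"
      by (intro power_mono ip_Cauchy_Schwarz sq one) simp
    then have "(\<integral>s. g s \<partial>?R)\<^sup>2 \<le> (b - a) * (n2 ?R g)\<^sup>2"
      by (simp add: ip_def power_mult_distrib n1 mult.commute)
    then have "ennreal ((\<integral>s. g s \<partial>?R)\<^sup>2) \<le> ennreal (b - a) * ennreal ((n2 ?R g)\<^sup>2)"
      using ab by (subst ennreal_mult[symmetric]) (auto intro: ennreal_leI)
    also have "ennreal ((n2 ?R g)\<^sup>2) = (\<integral>\<^sup>+s. ennreal ((g s)\<^sup>2) \<partial>?R)"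
      unfolding n2_sq using sq by (intro nn_integral_eq_integral[symmetric]) (auto simp: square_integrable_def)
    finally show ?thesis unfolding nn eq .
  qed
qed

context stationary_process
begin

definition time_integral :: "(config \<Rightarrow> real) \<Rightarrow> real \<Rightarrow> real \<Rightarrow> 'w \<Rightarrow> real" where
  "time_integral V a b \<omega> = (LBINT s:{a..b}. V (X s \<omega>))"

lemma time_integral_Y: "0 \<le> a \<Longrightarrow> time_integral V a b \<omega> = (LBINT s:{a..b}. V (Y s \<omega>))"
  unfolding time_integral_def set_lebesgue_integral_def
  by (rule Bochner_Integration.integral_cong) (auto simp: Y_nonneg split: split_indicator)

lemma joint_compose:
  assumes "V \<in> borel_measurable \<nu>"
  shows "(\<lambda>(s, \<omega>). V (Y s \<omega>)) \<in> borel_measurable (lborel \<Otimes>\<^sub>M P)"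
proof -
  have "sets (lborel \<Otimes>\<^sub>M P) = sets (borel \<Otimes>\<^sub>M P)" by (intro sets_pair_measure_cong) auto
  then have m: "(\<lambda>(s, \<omega>). Y s \<omega>) \<in> lborel \<Otimes>\<^sub>M P \<rightarrow>\<^sub>M config_space"
    using joint_measurable measurable_cong_sets[of "lborel \<Otimes>\<^sub>M P" "borel \<Otimes>\<^sub>M P"] by auto
  have "V \<in> borel_measurable config_space" using assms by (simp add: measurable_nu)
  from measurable_compose[OF m this] show ?thesis by (simp add: split_beta')
qed

sublocale LP: pair_sigma_finite lborel P ..

lemma path_measurable:
  assumes "V \<in> borel_measurable \<nu>" "\<omega> \<in> space P" shows "(\<lambda>s. V (Y s \<omega>)) \<in> borel_measurable borel"
  using measurable_Pair1[OF joint_compose[OF assms(1)] assms(2)] by simp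

lemma time_integral_measurable:
  assumes "V \<in> borel_measurable \<nu>" "0 \<le> a"
  shows "time_integral V a b \<in> borel_measurable P"
proof -
  note [measurable] = joint_compose[OF assms(1)]
  have "(\<lambda>\<omega>. \<integral>s. indicator {a..b} s * V (Y s \<omega>) \<partial>lborel) \<in> borel_measurable P"
    by (rule lborel.borel_measurable_lebesgue_integral) (simp add: split_beta')
  then show ?thesis using assms(2)
    by (subst measurable_cong[where g="\<lambda>\<omega>. \<integral>s. indicator {a..b} s * V (Y s \<omega>) \<partial>lborel"])
      (auto simp: time_integral_Y set_lebesgue_integral_def)
qed

text \<open>Cauchy--Schwarz in time, Tonelli and stationarity. It sees no cancellation in time and
  is meant for functions that are small already in norm.\<close>

lemma time_integral_second_moment:
  assumes V: "V \<in> borel_measurable \<nu>" and ab: "0 \<le> a" "a \<le> b"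
  shows "(\<integral>\<^sup>+\<omega>. ennreal ((time_integral V a b \<omega>)\<^sup>2) \<partial>P) \<le> ennreal ((b - a)\<^sup>2) * (\<integral>\<^sup>+\<eta>. ennreal ((V \<eta>)\<^sup>2) \<partial>\<nu>)"
proof -
  note [measurable] = joint_compose[OF V]
  have "(\<integral>\<^sup>+\<omega>. ennreal ((time_integral V a b \<omega>)\<^sup>2) \<partial>P)
      \<le> (\<integral>\<^sup>+\<omega>. ennreal (b - a) * (\<integral>\<^sup>+s. indicator {a..b} s * ennreal ((V (Y s \<omega>))\<^sup>2) \<partial>lborel) \<partial>P)"
    by (intro nn_integral_mono) (use ab sq_set_integral_le[OF path_measurable[OF V]] in \<open>auto simp: time_integral_Y\<close>)
  also have "\<dots> = ennreal (b - a) * (\<integral>\<^sup>+\<omega>. (\<integral>\<^sup>+s. indicator {a..b} s * ennreal ((V (Y s \<omega>))\<^sup>2) \<partial>lborel) \<partial>P)"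
    by (rule nn_integral_cmult) measurable
  also have "(\<integral>\<^sup>+\<omega>. (\<integral>\<^sup>+s. indicator {a..b} s * ennreal ((V (Y s \<omega>))\<^sup>2) \<partial>lborel) \<partial>P)
     = (\<integral>\<^sup>+s. (\<integral>\<^sup>+\<omega>. indicator {a..b} s * ennreal ((V (Y s \<omega>))\<^sup>2) \<partial>P) \<partial>lborel)"
    by (rule LP.Fubini') measurable
  also have "\<dots> = (\<integral>\<^sup>+s. (\<integral>\<^sup>+\<eta>. ennreal ((V \<eta>)\<^sup>2) \<partial>\<nu>) * indicator {a..b} s \<partial>lborel)"
  proof (rule nn_integral_cong)
    fix s
    have Vm: "(\<lambda>\<eta>. ennreal ((V \<eta>)\<^sup>2)) \<in> borel_measurable config_space" using V by (simp add: measurable_nu)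
    have "(\<integral>\<^sup>+\<omega>. ennreal ((V (Y s \<omega>))\<^sup>2) \<partial>P) = (\<integral>\<^sup>+\<eta>. ennreal ((V \<eta>)\<^sup>2) \<partial>distr P config_space (Y s))"
      by (rule nn_integral_distr[symmetric, OF Y_measurable]) (use Vm in simp)
    also have "distr P config_space (Y s) = \<nu>" using distr_X[of "max 0 s"] by (simp add: Y_def)
    finally show "(\<integral>\<^sup>+\<omega>. indicator {a..b} s * ennreal ((V (Y s \<omega>))\<^sup>2) \<partial>P) = (\<integral>\<^sup>+\<eta>. ennreal ((V \<eta>)\<^sup>2) \<partial>\<nu>) * indicator {a..b} s"
      by (cases "s \<in> {a..b}") auto
  qed
  also have "\<dots> = (\<integral>\<^sup>+\<eta>. ennreal ((V \<eta>)\<^sup>2) \<partial>\<nu>) * ennreal (b - a)"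
    using ab by (subst nn_integral_cmult_indicator) auto
  also have "ennreal (b - a) * ((\<integral>\<^sup>+\<eta>. ennreal ((V \<eta>)\<^sup>2) \<partial>\<nu>) * ennreal (b - a)) = ennreal ((b - a)\<^sup>2) * (\<integral>\<^sup>+\<eta>. ennreal ((V \<eta>)\<^sup>2) \<partial>\<nu>)"
    using ab by (simp add: power2_eq_square ennreal_mult mult_ac)
  finally show ?thesis .
qed

lemma time_integral_square_integrable:
  assumes V: "square_integrable \<nu> V" and ab: "0 \<le> a" "a \<le> b"
  shows "square_integrable P (time_integral V a b)"
proof -
  have Vm: "V \<in> borel_measurable \<nu>" using V by (simp add: square_integrable_def)
  have "(\<integral>\<^sup>+\<eta>. ennreal ((V \<eta>)\<^sup>2) \<partial>\<nu>) < \<infinity>"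
    using V by (subst nn_integral_eq_integral) (auto simp: square_integrable_def)
  then have "(\<integral>\<^sup>+\<omega>. ennreal ((time_integral V a b \<omega>)\<^sup>2) \<partial>P) < \<infinity>"
    by (intro le_less_trans[OF time_integral_second_moment[OF Vm ab]]) (simp add: ennreal_mult_less_top)
  then show ?thesis
    unfolding square_integrable_def using time_integral_measurable[OF Vm ab(1)]
    by (auto intro!: integrableI_nonneg)
qed

text \<open>\<open>W\<close> is general because the variance formula uses the lemma twice: with
  \<open>W\<close> the observable at a fixed time and with \<open>W\<close> the time integral
  itself.\<close>

lemma time_integral_pairing:
  assumes V: "square_integrable \<nu> V" and W: "square_integrable P W" and ab: "0 \<le> a" "a \<le> b"
  shows "(\<integral>\<omega>. W \<omega> * time_integral V a b \<omega> \<partial>P) = (LBINT s:{a..b}. \<integral>\<omega>. W \<omega> * V (X s \<omega>) \<partial>P)"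
proof -
  have Vm: "V \<in> borel_measurable \<nu>" using V by (simp add: square_integrable_def)
  note [measurable] = joint_compose[OF Vm] square_integrable_measurable[OF W]
  have WV: "integrable P (\<lambda>\<omega>. W \<omega> * V (Y s \<omega>))" for s
    unfolding Y_def by (intro square_integrable_mult W square_integrable_X(1) V) simp
  have b: "(\<integral>\<omega>. \<bar>W \<omega> * V (Y s \<omega>)\<bar> \<partial>P) \<le> n2 P W * n2 \<nu> V" for s
  proof -
    have s: "0 \<le> max 0 s" by simp
    have a: "square_integrable P (\<lambda>\<omega>. \<bar>W \<omega>\<bar>)" "square_integrable P (\<lambda>\<omega>. \<bar>V (Y s \<omega>)\<bar>)"
      using W square_integrable_X(1)[OF s V] by (auto simp: square_integrable_def Y_def)
    have "\<bar>ip P (\<lambda>\<omega>. \<bar>W \<omega>\<bar>) (\<lambda>\<omega>. \<bar>V (Y s \<omega>)\<bar>)\<bar> \<le> n2 P (\<lambda>\<omega>. \<bar>W \<omega>\<bar>) * n2 P (\<lambda>\<omega>. \<bar>V (Y s \<omega>)\<bar>)"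
      by (rule ip_Cauchy_Schwarz[OF a])
    moreover have "n2 P (\<lambda>\<omega>. \<bar>V (Y s \<omega>)\<bar>) = n2 \<nu> V"
      using square_integrable_X(2)[OF s V] by (simp add: n2_def Y_def)
    moreover have "n2 P (\<lambda>\<omega>. \<bar>W \<omega>\<bar>) = n2 P W" by (simp add: n2_def)
    ultimately show ?thesis by (simp add: ip_def abs_mult)
  qed
  have int: "integrable (lborel \<Otimes>\<^sub>M P) (\<lambda>(s, \<omega>). indicator {a..b} s * (W \<omega> * V (Y s \<omega>)))"
  proof (rule LP.Fubini_integrable)
    show "(\<lambda>(s, \<omega>). indicator {a..b} s * (W \<omega> * V (Y s \<omega>))) \<in> borel_measurable (lborel \<Otimes>\<^sub>M P)"
      by (simp add: split_beta')
    show "AE s in lborel. integrable P (\<lambda>\<omega>. case (s, \<omega>) of (s, \<omega>) \<Rightarrow> indicator {a..b} s * (W \<omega> * V (Y s \<omega>)))"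
      using WV by simp
    show "integrable lborel (\<lambda>s. \<integral>\<omega>. norm (case (s, \<omega>) of (s, \<omega>) \<Rightarrow> indicator {a..b} s * (W \<omega> * V (Y s \<omega>))) \<partial>P)"
    proof (rule Bochner_Integration.integrable_bound)
      show "integrable lborel (\<lambda>s. indicator {a..b} s * (n2 P W * n2 \<nu> V))"
        by (intro integrable_mult_left integrable_real_indicator) (auto simp: ab)
      show "AE s in lborel. norm (\<integral>\<omega>. norm (case (s, \<omega>) of (s, \<omega>) \<Rightarrow> indicator {a..b} s * (W \<omega> * V (Y s \<omega>))) \<partial>P)
          \<le> norm (indicator {a..b} s * (n2 P W * n2 \<nu> V))"
      proof (intro always_eventually allI)
        fix s
        have "(\<integral>\<omega>. \<bar>indicator {a..b} s * (W \<omega> * V (Y s \<omega>))\<bar> \<partial>P) = indicator {a..b} s * (\<integral>\<omega>. \<bar>W \<omega> * V (Y s \<omega>)\<bar> \<partial>P)"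
          by (simp add: abs_mult)
        then show "norm (\<integral>\<omega>. norm (case (s, \<omega>) of (s, \<omega>) \<Rightarrow> indicator {a..b} s * (W \<omega> * V (Y s \<omega>))) \<partial>P)
          \<le> norm (indicator {a..b} s * (n2 P W * n2 \<nu> V))"
          using b[of s] by (auto simp: indicator_def intro: order_trans[OF _ abs_ge_self])
      qed
    qed measurable
  qed
  have "(\<integral>\<omega>. W \<omega> * time_integral V a b \<omega> \<partial>P) = (\<integral>\<omega>. (\<integral>s. indicator {a..b} s * (W \<omega> * V (Y s \<omega>)) \<partial>lborel) \<partial>P)"
    unfolding time_integral_Y[OF ab(1)] set_lebesgue_integral_def
    by (intro Bochner_Integration.integral_cong refl)
      (subst integral_mult_right_zero[symmetric], auto intro!: Bochner_Integration.integral_cong simp: mult_ac)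
  also have "\<dots> = (\<integral>s. (\<integral>\<omega>. indicator {a..b} s * (W \<omega> * V (Y s \<omega>)) \<partial>P) \<partial>lborel)"
    by (rule LP.Fubini_integral[OF int])
  also have "\<dots> = (LBINT s:{a..b}. \<integral>\<omega>. W \<omega> * V (X s \<omega>) \<partial>P)"
    unfolding set_lebesgue_integral_def
    by (intro Bochner_Integration.integral_cong refl) (use ab in \<open>auto simp: Y_nonneg split: split_indicator\<close>)
  finally show ?thesis .
qed

definition autocov :: "(config \<Rightarrow> real) \<Rightarrow> real \<Rightarrow> real" where
  "autocov V r = ip \<nu> V (T r V)"

lemma correlation:
  assumes V: "square_integrable \<nu> V" and s: "0 \<le> s" "0 \<le> r"
  shows "(\<integral>\<omega>. V (X s \<omega>) * V (X r \<omega>) \<partial>P) = autocov V \<bar>s - r\<bar>"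
proof (cases "s \<le> r")
  case True
  then show ?thesis using covariance[OF s(1) _ V V, of "r - s"] by (simp add: autocov_def)
next
  case False
  then show ?thesis using covariance[OF s(2) _ V V, of "s - r"] by (simp add: autocov_def mult.commute)
qed

lemma autocov_bound:
  assumes V: "square_integrable \<nu> V" and s: "0 \<le> s" shows "\<bar>autocov V s\<bar> \<le> (n2 \<nu> V)\<^sup>2"
proof -
  have "\<bar>autocov V s\<bar> \<le> n2 \<nu> V * n2 \<nu> (T s V)" unfolding autocov_def by (intro ip_Cauchy_Schwarz V T_sq s)
  also have "\<dots> \<le> n2 \<nu> V * n2 \<nu> V" by (intro mult_left_mono contraction V s) simp
  finally show ?thesis by (simp add: power2_eq_square)
qed

text \<open>By contraction an increment over a time step \<open>h\<close> is bounded by that of the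
  orbit at time \<open>0\<close>, uniformly in the starting time. Right continuity at
  \<open>0\<close> therefore gives continuity from both sides.\<close>

lemma autocov_continuous:
  assumes V: "square_integrable \<nu> V" shows "continuous_on {0..} (autocov V)"
proof -
  let ?w = "\<lambda>h. n2 \<nu> (\<lambda>\<eta>. T h V \<eta> - V \<eta>)"
  have le: "\<bar>autocov V (s + h) - autocov V s\<bar> \<le> n2 \<nu> V * ?w h" if s: "0 \<le> s" "0 \<le> h" for s h
  proof -
    have sq: "square_integrable \<nu> (T h V)" "square_integrable \<nu> (T s V)" "square_integrable \<nu> (T (s + h) V)"
      using s V by (auto intro: T_sq)
    have d: "square_integrable \<nu> (\<lambda>\<zeta>. 1 * T h V \<zeta> + (-1) * V \<zeta>)" by (rule square_integrable_lincomb[OF sq(1) V])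
    have "autocov V (s + h) - autocov V s = ip \<nu> V (\<lambda>\<eta>. T (s + h) V \<eta> - T s V \<eta>)"
      unfolding autocov_def by (rule ip_diff_right[symmetric, OF sq(3,2) V])
    moreover have "\<bar>ip \<nu> V (\<lambda>\<eta>. T (s + h) V \<eta> - T s V \<eta>)\<bar> \<le> n2 \<nu> V * n2 \<nu> (\<lambda>\<eta>. T (s + h) V \<eta> - T s V \<eta>)"
      by (intro ip_Cauchy_Schwarz V square_integrable_diff sq)
    moreover have "n2 \<nu> (\<lambda>\<eta>. T (s + h) V \<eta> - T s V \<eta>) = n2 \<nu> (T s (\<lambda>\<zeta>. 1 * T h V \<zeta> + (-1) * V \<zeta>))"
    proof (rule n2_cong_AE)
      show "AE \<eta> in \<nu>. T (s + h) V \<eta> - T s V \<eta> = T s (\<lambda>\<zeta>. 1 * T h V \<zeta> + (-1) * V \<zeta>) \<eta>"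
        using T_add[OF s V] T_lincomb[OF s(1) sq(1) V, of 1 "-1"] by eventually_elim simp
      show "(\<lambda>\<eta>. T (s + h) V \<eta> - T s V \<eta>) \<in> borel_measurable \<nu>"
        using sq by (intro borel_measurable_diff) (auto simp: square_integrable_def)
      show "T s (\<lambda>\<zeta>. 1 * T h V \<zeta> + (-1) * V \<zeta>) \<in> borel_measurable \<nu>"
        by (rule T_measurable[OF s(1) d])
    qed
    moreover have "n2 \<nu> (T s (\<lambda>\<zeta>. 1 * T h V \<zeta> + (-1) * V \<zeta>)) \<le> n2 \<nu> (\<lambda>\<zeta>. 1 * T h V \<zeta> + (-1) * V \<zeta>)"
      by (rule contraction[OF s(1) d])
    ultimately have "\<bar>autocov V (s + h) - autocov V s\<bar> \<le> n2 \<nu> V * n2 \<nu> (\<lambda>\<eta>. T (s + h) V \<eta> - T s V \<eta>)"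
      "n2 \<nu> (\<lambda>\<eta>. T (s + h) V \<eta> - T s V \<eta>) \<le> ?w h" by simp_all
    then show ?thesis by (meson mult_left_mono n2_nonneg order_trans)
  qed
  have lim: "((\<lambda>h. n2 \<nu> V * ?w h) \<longlongrightarrow> 0) (at_right 0)"
    by (rule tendsto_mult_right_zero[OF T_continuous_0[OF V]])
  show ?thesis
    unfolding continuous_on_iff
  proof (intro ballI allI impI)
    fix x e :: real assume x: "x \<in> {0..}" and e: "0 < e"
    from order_tendstoD(2)[OF lim e] obtain b where b: "0 < b" "\<And>h. 0 < h \<Longrightarrow> h < b \<Longrightarrow> n2 \<nu> V * ?w h < e"
      by (auto simp: eventually_at_right_field)
    have "dist (autocov V y) (autocov V x) < e" if y: "0 \<le> y" "dist y x < b" for y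
    proof (cases "y = x")
      case False
      define h where "h = \<bar>y - x\<bar>"
      have h: "0 < h" "h < b" using False y by (auto simp: h_def dist_real_def)
      have "\<bar>autocov V y - autocov V x\<bar> \<le> n2 \<nu> V * ?w h"
      proof (cases "x \<le> y")
        case True then show ?thesis using le[of x h] x h by (simp add: h_def)
      next
        case False then show ?thesis using le[of y h] y h by (simp add: h_def abs_minus_commute)
      qed
      then show ?thesis using b(2)[OF h] by (simp add: dist_real_def)
    qed (use e in simp)
    then show "\<exists>d>0. \<forall>x'\<in>{0..}. dist x' x < d \<longrightarrow> dist (autocov V x') (autocov V x) < e"
      using b(1) by auto
  qed
qed

text \<open>Two applications of \<open>time_integral_pairing\<close> bring in the autocovariance. By
  stationarity only the length of the interval remains, so that a shifted window counts like an
  initial one.\<close>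

lemma time_integral_variance:
  assumes V: "square_integrable \<nu> V" and ab: "0 \<le> a" "a \<le> b"
  shows "(n2 P (time_integral V a b))\<^sup>2 = 2 * integral {0..b - a} (\<lambda>s. integral {0..s} (autocov V))"
proof -
  let ?Z = "time_integral V a b"
  note Z = time_integral_square_integrable[OF V ab]
  note cont = autocov_continuous[OF V]
  have c1: "continuous_on {a..b} (\<lambda>r. autocov V \<bar>s - r\<bar>)" for s
    by (rule continuous_on_compose2[OF cont]) (auto intro!: continuous_intros)
  have set_eq: "(LBINT r:{a..b}. g r) = integral {a..b} g" if "continuous_on {a..b} g" for g :: "real \<Rightarrow> real"
    by (rule set_borel_integral_eq_integral(2)[OF borel_integrable_atLeastAtMost'[OF that]])
  have inner: "(\<integral>\<omega>. ?Z \<omega> * V (X s \<omega>) \<partial>P) = integral {a..b} (\<lambda>r. autocov V \<bar>s - r\<bar>)" if s: "s \<in> {a..b}" for s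
  proof -
    have "0 \<le> s" using s ab by simp
    have "(\<integral>\<omega>. ?Z \<omega> * V (X s \<omega>) \<partial>P) = (\<integral>\<omega>. V (X s \<omega>) * ?Z \<omega> \<partial>P)" by (simp add: mult.commute)
    also have "\<dots> = (LBINT r:{a..b}. \<integral>\<omega>. V (X s \<omega>) * V (X r \<omega>) \<partial>P)"
      by (rule time_integral_pairing[OF V square_integrable_X(1)[OF \<open>0 \<le> s\<close> V] ab])
    also have "\<dots> = (LBINT r:{a..b}. autocov V \<bar>s - r\<bar>)"
      by (rule set_lebesgue_integral_cong) (use correlation[OF V \<open>0 \<le> s\<close>] ab in auto)
    also have "\<dots> = integral {a..b} (\<lambda>r. autocov V \<bar>s - r\<bar>)" by (rule set_eq[OF c1])
    finally show ?thesis .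
  qed
  have cG: "continuous_on {a..b} (\<lambda>s. integral {a..b} (\<lambda>r. autocov V \<bar>s - r\<bar>))"
  proof -
    have "continuous_on ({a..b} \<times> cbox a b) (\<lambda>(s, r). autocov V \<bar>s - r\<bar>)"
      unfolding split_beta' by (rule continuous_on_compose2[OF cont]) (auto intro!: continuous_intros)
    from integral_continuous_on_param[OF this] show ?thesis by simp
  qed
  have "(n2 P ?Z)\<^sup>2 = (\<integral>\<omega>. ?Z \<omega> * ?Z \<omega> \<partial>P)" unfolding n2_sq by (simp add: power2_eq_square)
  also have "\<dots> = (LBINT s:{a..b}. \<integral>\<omega>. ?Z \<omega> * V (X s \<omega>) \<partial>P)" by (rule time_integral_pairing[OF V Z ab])
  also have "\<dots> = (LBINT s:{a..b}. integral {a..b} (\<lambda>r. autocov V \<bar>s - r\<bar>))"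
    by (rule set_lebesgue_integral_cong) (use inner in auto)
  also have "\<dots> = integral {a..b} (\<lambda>s. integral {a..b} (\<lambda>r. autocov V \<bar>s - r\<bar>))" by (rule set_eq[OF cG])
  also have "\<dots> = 2 * integral {0..b - a} (\<lambda>s. integral {0..s} (autocov V))"
    by (rule double_integral_symmetric[OF cont ab(2)])
  finally show ?thesis .
qed

text \<open>The Bochner integral of a non-integrable path is zero, so additivity of time integrals,
  in the interval or in the observable, is guaranteed only on integrable paths. Almost all paths are
  of this kind.\<close>

lemma path_set_integrable:
  assumes V: "square_integrable \<nu> V" and t: "0 \<le> t"
  shows "AE \<omega> in P. set_integrable lborel {0..t} (\<lambda>u. V (Y u \<omega>))"
proof -
  have Vm: "V \<in> borel_measurable \<nu>" using V by (simp add: square_integrable_def)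
  note [measurable] = joint_compose[OF Vm]
  have "(\<integral>\<^sup>+\<omega>. (\<integral>\<^sup>+u. indicator {0..t} u * ennreal \<bar>V (Y u \<omega>)\<bar> \<partial>lborel) \<partial>P)
      = (\<integral>\<^sup>+u. (\<integral>\<^sup>+\<omega>. indicator {0..t} u * ennreal \<bar>V (Y u \<omega>)\<bar> \<partial>P) \<partial>lborel)"
    by (rule LP.Fubini') measurable
  also have "\<dots> \<le> (\<integral>\<^sup>+u. ennreal (n2 \<nu> V) * indicator {0..t} u \<partial>lborel)"
  proof (rule nn_integral_mono)
    fix u :: real
    have u: "0 \<le> max 0 u" by simp
    note sqY = square_integrable_X[OF u V]
    have iY: "integrable P (\<lambda>\<omega>. \<bar>V (Y u \<omega>)\<bar>)" using P.square_integrable_integrable[OF sqY(1)] by (simp add: Y_def)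
    have "(\<integral>\<^sup>+\<omega>. ennreal \<bar>V (Y u \<omega>)\<bar> \<partial>P) = ennreal (\<integral>\<omega>. \<bar>V (Y u \<omega>)\<bar> \<partial>P)"
      by (rule nn_integral_eq_integral[OF iY]) simp
    also have "\<dots> \<le> ennreal (n2 \<nu> V)"
      using P.integral_abs_le_n2[OF sqY(1)] by (intro ennreal_leI) (simp add: sqY(2) Y_def)
    finally show "(\<integral>\<^sup>+\<omega>. indicator {0..t} u * ennreal \<bar>V (Y u \<omega>)\<bar> \<partial>P) \<le> ennreal (n2 \<nu> V) * indicator {0..t} u"
      by (cases "u \<in> {0..t}") auto
  qed
  also have "\<dots> < \<infinity>" using t by (subst nn_integral_cmult_indicator) (auto simp: ennreal_mult_less_top)
  finally have "AE \<omega> in P. (\<integral>\<^sup>+u. indicator {0..t} u * ennreal \<bar>V (Y u \<omega>)\<bar> \<partial>lborel) \<noteq> \<infinity>"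
    by (intro nn_integral_PInf_AE) auto
  then show ?thesis
  proof (rule AE_mp, intro AE_I2 impI)
    fix \<omega> assume w: "\<omega> \<in> space P" and fin: "(\<integral>\<^sup>+u. indicator {0..t} u * ennreal \<bar>V (Y u \<omega>)\<bar> \<partial>lborel) \<noteq> \<infinity>"
    have m: "(\<lambda>u. V (Y u \<omega>)) \<in> borel_measurable borel" by (rule path_measurable[OF Vm w])
    show "set_integrable lborel {0..t} (\<lambda>u. V (Y u \<omega>))"
      unfolding set_integrable_def
    proof (rule integrableI_bounded)
      have "(\<integral>\<^sup>+u. ennreal (norm (indicator {0..t} u *\<^sub>R V (Y u \<omega>))) \<partial>lborel)
         = (\<integral>\<^sup>+u. indicator {0..t} u * ennreal \<bar>V (Y u \<omega>)\<bar> \<partial>lborel)"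
        by (rule nn_integral_cong) (auto split: split_indicator)
      then show "(\<integral>\<^sup>+u. ennreal (norm (indicator {0..t} u *\<^sub>R V (Y u \<omega>))) \<partial>lborel) < \<infinity>"
        using fin by (simp add: less_top)
    qed (use m in measurable)
  qed
qed

text \<open>The almost subadditivity that \<open>laplace_to_average\<close> asks of its function
  \<open>F\<close>.\<close>

lemma time_integral_split:
  assumes V: "square_integrable \<nu> V" and s: "0 \<le> s" "s \<le> t"
  shows "(n2 P (time_integral V 0 t))\<^sup>2 \<le> 2 * (n2 P (time_integral V 0 s))\<^sup>2 + 2 * (n2 P (time_integral V s t))\<^sup>2"
proof -
  let ?Z = "time_integral V"
  have Vm: "V \<in> borel_measurable \<nu>" using V by (simp add: square_integrable_def)
  have t: "0 \<le> t" using s by simp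
  note Z0 = time_integral_square_integrable[OF V order_refl s(1)] and Z1 = time_integral_square_integrable[OF V s]
    and Zt = time_integral_square_integrable[OF V order_refl t]
  have AE: "AE \<omega> in P. ?Z 0 t \<omega> = ?Z 0 s \<omega> + ?Z s t \<omega>"
  proof -
    show ?thesis using path_set_integrable[OF V t]
    proof (rule AE_mp, intro AE_I2 impI)
      fix \<omega> assume w: "\<omega> \<in> space P" and int: "set_integrable lborel {0..t} (\<lambda>u. V (Y u \<omega>))"
      have m: "(\<lambda>u. V (Y u \<omega>)) \<in> borel_measurable borel" by (rule path_measurable[OF Vm w])
      have "(LBINT u:{0..t}. V (Y u \<omega>)) = (LBINT u:{0..s}. V (Y u \<omega>)) + (LBINT u:{s<..t}. V (Y u \<omega>))"
      proof -
        have "{0..t} = {0..s} \<union> {s<..t}" using s by auto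
        moreover have "set_integrable lborel {0..s} (\<lambda>u. V (Y u \<omega>))" "set_integrable lborel {s<..t} (\<lambda>u. V (Y u \<omega>))"
          by (rule set_integrable_subset[OF int]; use s in auto)+
        moreover have "{0..s} \<inter> {s<..t} = {}" by auto
        ultimately show ?thesis by (simp add: set_integral_Un)
      qed
      also have "(LBINT u:{s<..t}. V (Y u \<omega>)) = (LBINT u:{s..t}. V (Y u \<omega>))"
        unfolding set_lebesgue_integral_def
        by (rule integral_cong_AE, use m in measurable, use m in measurable,
            rule AE_mp[OF AE_lborel_singleton[of s]]) (auto split: split_indicator)
      finally show "?Z 0 t \<omega> = ?Z 0 s \<omega> + ?Z s t \<omega>" using s by (simp add: time_integral_Y)
    qed
  qed
  have "n2 P (?Z 0 t) = n2 P (\<lambda>\<omega>. ?Z 0 s \<omega> + ?Z s t \<omega>)"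
    using Z0 Z1 Zt AE by (intro n2_cong_AE) (auto simp: square_integrable_def)
  also have "\<dots> \<le> n2 P (?Z 0 s) + n2 P (?Z s t)" by (rule n2_triangle[OF Z0 Z1])
  finally have "(n2 P (?Z 0 t))\<^sup>2 \<le> (n2 P (?Z 0 s) + n2 P (?Z s t))\<^sup>2" by (rule power_mono) simp
  also have "\<dots> \<le> 2 * (n2 P (?Z 0 s))\<^sup>2 + 2 * (n2 P (?Z s t))\<^sup>2"
    using zero_le_power2[of "n2 P (?Z 0 s) - n2 P (?Z s t)"] by (simp add: power2_sum power2_diff)
  finally show ?thesis .
qed

text \<open>Let \<open>v\<close> be the integrated semigroup up to time \<open>N\<close>. It solves
  \<open>\<mu> v - L v = V - discounted \<mu> V N\<close>, and its pairing with \<open>V\<close> is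
  the Laplace integral. The hypothesis on \<open>A\<close>, extended from the core to
  \<open>v\<close>, is tested with \<open>v\<close> itself, and the term \<open>\<mu>\<close> times
  the squared norm of \<open>v\<close> absorbs the contribution of the cut at time
  \<open>N\<close>.\<close>

lemma discounted_autocov_bound:
  assumes core: "generator_core \<nu> T L D" and V: "square_integrable \<nu> V" and A0: "0 \<le> A"
    and A: "\<And>\<phi>. \<phi> \<in> D \<Longrightarrow> (ip \<nu> V \<phi>)\<^sup>2 \<le> A * (- ip \<nu> \<phi> (L \<phi>))"
    and \<mu>: "0 < \<mu>" and N: "0 \<le> N"
  shows "(integral {0..N} (\<lambda>s. exp (- \<mu> * s) * autocov V s))\<^sup>2
     \<le> A * (integral {0..N} (\<lambda>s. exp (- \<mu> * s) * autocov V s) + exp (- \<mu> * N) * ((n2 \<nu> V)\<^sup>2 / (4 * \<mu>)))"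
proof -
  let ?I = "integral {0..N} (\<lambda>s. exp (- \<mu> * s) * autocov V s)"
  let ?w = "\<lambda>v \<eta>. \<mu> * v \<eta> - V \<eta> + discounted \<mu> V N \<eta>"
  obtain v where v: "square_integrable \<nu> v"
    "\<And>g. square_integrable \<nu> g \<Longrightarrow> ip \<nu> g v = integral {0..N} (\<lambda>s. ip \<nu> g (discounted \<mu> V s))"
    "has_generator \<nu> T v (?w v)"
    using integrated_semigroup[OF V contraction[OF _ V] N less_imp_le[OF \<mu>]] by blast
  have Vv: "ip \<nu> V v = ?I" unfolding v(2)[OF V] ip_discounted autocov_def ..
  have wsq: "square_integrable \<nu> (?w v)" using v(3) by (simp add: has_generator_iff)
  note dsq = discounted_sq[OF N V, of \<mu>]
  obtain U where U: "\<forall>n::nat. U n \<in> D \<and> square_integrable \<nu> (U n) \<and> square_integrable \<nu> (L (U n))"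
    "(\<lambda>n. n2 \<nu> (\<lambda>\<eta>. U n \<eta> - v \<eta>)) \<longlonglongrightarrow> 0" "(\<lambda>n. n2 \<nu> (\<lambda>\<eta>. L (U n) \<eta> - ?w v \<eta>)) \<longlonglongrightarrow> 0"
    using generator_core_approx[OF core v(3)] by blast
  have Usq: "square_integrable \<nu> (U n)" "square_integrable \<nu> (L (U n))" for n using U(1) by auto
  have l1: "(\<lambda>n. ip \<nu> (U n) V) \<longlonglongrightarrow> ip \<nu> v V" by (rule ip_tendsto_left[OF v(1) V Usq(1) U(2)])
  have l2: "(\<lambda>n. ip \<nu> (U n) (L (U n))) \<longlonglongrightarrow> ip \<nu> v (?w v)"
  proof -
    \<comment> \<open>Both arguments vary with \<open>n\<close>. The expansion leaves one term that
      is small in both and otherwise limits in one argument.\<close>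
    have d: "ip \<nu> (U n) (L (U n)) = ip \<nu> (\<lambda>\<eta>. U n \<eta> - v \<eta>) (\<lambda>\<eta>. L (U n) \<eta> - ?w v \<eta>) + ip \<nu> (U n) (?w v) + (ip \<nu> (L (U n)) v - ip \<nu> v (?w v))" for n
      using ip_diff_right[OF Usq(2)[of n] wsq square_integrable_diff[OF Usq(1)[of n] v(1)]]
        ip_diff_left[OF Usq(1)[of n] v(1) Usq(2)[of n]] ip_diff_left[OF Usq(1)[of n] v(1) wsq]
      by (simp add: ip_commute[of \<nu> "L (U n)" v])
    have small: "(\<lambda>n. ip \<nu> (\<lambda>\<eta>. U n \<eta> - v \<eta>) (\<lambda>\<eta>. L (U n) \<eta> - ?w v \<eta>)) \<longlonglongrightarrow> 0"
    proof (rule Lim_null_comparison)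
      show "\<forall>\<^sub>F n in sequentially. norm (ip \<nu> (\<lambda>\<eta>. U n \<eta> - v \<eta>) (\<lambda>\<eta>. L (U n) \<eta> - ?w v \<eta>))
         \<le> n2 \<nu> (\<lambda>\<eta>. U n \<eta> - v \<eta>) * n2 \<nu> (\<lambda>\<eta>. L (U n) \<eta> - ?w v \<eta>)"
        unfolding real_norm_def
        by (intro always_eventually allI ip_Cauchy_Schwarz square_integrable_diff[OF Usq(1) v(1)] square_integrable_diff[OF Usq(2) wsq])
      show "(\<lambda>n. n2 \<nu> (\<lambda>\<eta>. U n \<eta> - v \<eta>) * n2 \<nu> (\<lambda>\<eta>. L (U n) \<eta> - ?w v \<eta>)) \<longlonglongrightarrow> 0"
        using tendsto_mult[OF U(2,3)] by simp
    qed
    have "(\<lambda>n. ip \<nu> (U n) (L (U n))) \<longlonglongrightarrow> 0 + ip \<nu> v (?w v) + (ip \<nu> (?w v) v - ip \<nu> v (?w v))"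
      unfolding d by (intro tendsto_add tendsto_diff tendsto_const small
          ip_tendsto_left[OF v(1) wsq Usq(1) U(2)] ip_tendsto_left[OF wsq v(1) Usq(2) U(3)])
    then show ?thesis by (simp add: ip_commute[of \<nu> "?w v" v])
  qed
  have lim: "(ip \<nu> v V)\<^sup>2 \<le> A * (- ip \<nu> v (?w v))"
  proof (rule LIMSEQ_le)
    show "(\<lambda>n. (ip \<nu> (U n) V)\<^sup>2) \<longlonglongrightarrow> (ip \<nu> v V)\<^sup>2" by (intro tendsto_power l1)
    show "(\<lambda>n. A * (- ip \<nu> (U n) (L (U n)))) \<longlonglongrightarrow> A * (- ip \<nu> v (?w v))" by (intro tendsto_intros l2)
    show "\<exists>N. \<forall>n\<ge>N. (ip \<nu> (U n) V)\<^sup>2 \<le> A * (- ip \<nu> (U n) (L (U n)))"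
      using A U(1) by (simp add: ip_commute[of \<nu> _ V])
  qed
  have vw: "ip \<nu> v (?w v) = \<mu> * (n2 \<nu> v)\<^sup>2 - ip \<nu> v V + ip \<nu> v (discounted \<mu> V N)"
    using ip_lincomb_right[OF square_integrable_diff[OF square_integrable_cmult[OF v(1), of \<mu>] V] dsq v(1), of 1 1]
      ip_lincomb_right[OF v(1) V v(1), of \<mu> "-1"] by (simp add: ip_self)
  have "- ip \<nu> v (discounted \<mu> V N) \<le> n2 \<nu> v * (exp (- \<mu> * N) * n2 \<nu> V)"
  proof -
    have "\<bar>ip \<nu> v (discounted \<mu> V N)\<bar> \<le> n2 \<nu> v * n2 \<nu> (discounted \<mu> V N)" by (rule ip_Cauchy_Schwarz[OF v(1) dsq])
    also have "n2 \<nu> (discounted \<mu> V N) = exp (- \<mu> * N) * n2 \<nu> (T N V)"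
      unfolding discounted_def by (simp add: n2_cmult)
    also have "n2 \<nu> v * (exp (- \<mu> * N) * n2 \<nu> (T N V)) \<le> n2 \<nu> v * (exp (- \<mu> * N) * n2 \<nu> V)"
      by (intro mult_left_mono contraction N V) auto
    finally show ?thesis by linarith
  qed
  moreover have "n2 \<nu> v * (exp (- \<mu> * N) * n2 \<nu> V) - \<mu> * (n2 \<nu> v)\<^sup>2 \<le> (exp (- \<mu> * N) * n2 \<nu> V)\<^sup>2 / (4 * \<mu>)"
  proof -
    \<comment> \<open>Completing the square: a linear minus a quadratic function of the norm of
      \<open>v\<close> is at most its maximum.\<close>
    have "0 \<le> (2 * \<mu> * n2 \<nu> v - exp (- \<mu> * N) * n2 \<nu> V)\<^sup>2" by simp
    then have "4 * \<mu> * (n2 \<nu> v * (exp (- \<mu> * N) * n2 \<nu> V) - \<mu> * (n2 \<nu> v)\<^sup>2) \<le> (exp (- \<mu> * N) * n2 \<nu> V)\<^sup>2"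
      by (simp add: power2_diff power2_eq_square algebra_simps)
    then show ?thesis using \<mu> by (simp add: pos_le_divide_eq mult.commute)
  qed
  moreover have "(exp (- \<mu> * N) * n2 \<nu> V)\<^sup>2 / (4 * \<mu>) \<le> exp (- \<mu> * N) * ((n2 \<nu> V)\<^sup>2 / (4 * \<mu>))"
  proof -
    have "(exp (- \<mu> * N))\<^sup>2 \<le> exp (- \<mu> * N)"
      using \<mu> N by (simp add: power2_eq_square mult_left_le)
    then show ?thesis using \<mu> by (simp add: power_mult_distrib divide_right_mono mult_right_mono)
  qed
  ultimately have "- ip \<nu> v (?w v) \<le> ip \<nu> v V + exp (- \<mu> * N) * ((n2 \<nu> V)\<^sup>2 / (4 * \<mu>))"
    unfolding vw by linarith
  then have "(ip \<nu> v V)\<^sup>2 \<le> A * (ip \<nu> v V + exp (- \<mu> * N) * ((n2 \<nu> V)\<^sup>2 / (4 * \<mu>)))"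
    using lim A0 by (meson mult_left_mono order_trans)
  then show ?thesis using Vv by (simp add: ip_commute)
qed

text \<open>The variational bound \<open>A\<close> plays the role of the squared dual Dirichlet norm of \<open>V\<close>. No symmetry
  of the generator is needed, since only its quadratic form enters.\<close>

lemma dual_norm_bound:
  assumes core: "generator_core \<nu> T L D" and V: "square_integrable \<nu> V" and A0: "0 \<le> A"
    and A: "\<And>\<phi>. \<phi> \<in> D \<Longrightarrow> (ip \<nu> V \<phi>)\<^sup>2 \<le> A * (- ip \<nu> \<phi> (L \<phi>))"
    and t: "0 \<le> t"
  shows "(n2 P (time_integral V 0 t))\<^sup>2 \<le> 24 * t * A"
proof (cases "t = 0")
  case True
  then show ?thesis using time_integral_variance[OF V order_refl order_refl] by simp
next
  case False
  then have t: "0 < t" using t by simp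
  note var = time_integral_variance[OF V]
  have "2 * integral {0..t} (\<lambda>s. integral {0..s} (autocov V)) \<le> 24 * t * A"
  proof (rule laplace_to_average[OF autocov_continuous[OF V] autocov_bound[OF V] _ _ _ t])
    show "0 \<le> 2 * integral {0..s} (\<lambda>x. integral {0..x} (autocov V))" if "0 \<le> s" for s
      using var[OF order_refl that] by (metis diff_zero zero_le_power2)
    show "2 * integral {0..t} (\<lambda>x. integral {0..x} (autocov V))
       \<le> 2 * (2 * integral {0..s} (\<lambda>x. integral {0..x} (autocov V))) + 2 * (2 * integral {0..t - s} (\<lambda>x. integral {0..x} (autocov V)))"
      if "0 \<le> s" "s \<le> t" for s t
      using time_integral_split[OF V that] var[OF order_refl, of t] var[OF order_refl that(1)] var[OF that] that by simp
    fix \<mu> \<epsilon> :: real assume \<mu>: "0 < \<mu>" and e: "0 < \<epsilon>"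
    let ?I = "\<lambda>N. integral {0..N} (\<lambda>s. exp (- \<mu> * s) * autocov V s)"
    let ?\<delta> = "\<lambda>N. exp (- \<mu> * N) * ((n2 \<nu> V)\<^sup>2 / (4 * \<mu>))"
    have f: "filterlim (\<lambda>N. - \<mu> * N) at_bot at_top"
      using filterlim_tendsto_neg_mult_at_bot[OF tendsto_const _ filterlim_ident, of "- \<mu>"] \<mu> by simp
    have "((\<lambda>N. A * ?\<delta> N) \<longlongrightarrow> A * (0 * ((n2 \<nu> V)\<^sup>2 / (4 * \<mu>)))) at_top"
      by (intro tendsto_mult tendsto_const filterlim_compose[OF exp_at_bot f])
    then have "\<forall>\<^sub>F N in at_top. A * ?\<delta> N < \<epsilon>\<^sup>2"
      by (rule order_tendstoD) (use e in simp)
    then show "\<forall>\<^sub>F N in at_top. ?I N \<le> A + \<epsilon>"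
      using eventually_ge_at_top[of 0]
    proof eventually_elim
      case (elim N)
      have b: "(?I N)\<^sup>2 \<le> A * ?I N + A * ?\<delta> N"
        using discounted_autocov_bound[OF core V A0 A \<mu> elim(2)] by (simp add: distrib_left)
      show ?case
      \<comment> \<open>If the integral exceeds \<open>A + \<epsilon>\<close>, then it times its
        excess over \<open>A\<close> is at least \<open>\<epsilon> ^ 2\<close>, whereas
        \<open>b\<close> allows at most \<open>A * ?\<delta> N\<close>, which is already
        smaller.\<close>
      proof (rule ccontr)
        assume "\<not> ?I N \<le> A + \<epsilon>"
        then have "\<epsilon> < ?I N - A" "\<epsilon> \<le> ?I N" using A0 e by auto
        then have "\<epsilon> * \<epsilon> \<le> (?I N - A) * ?I N" using e by (intro mult_mono) auto
        then show False using b elim(1) by (simp add: power2_eq_square algebra_simps)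
      qed
    qed
  qed
  then show ?thesis using var[OF order_refl, of t] t by simp
qed

end

subsection \<open>Disintegration with respect to the canonical algebra\<close>

definition particle_number :: "nat \<Rightarrow> config \<Rightarrow> nat" where
  "particle_number l \<eta> = (\<Sum>x\<in>box l. \<eta> x)"

definition glue :: "nat \<Rightarrow> config \<Rightarrow> config \<Rightarrow> config" where
  "glue l p \<xi> = (\<lambda>x. if x \<in> box l then p x else \<xi> x)"

definition patterns :: "nat \<Rightarrow> nat \<Rightarrow> config set" where
  "patterns l k = {p \<in> box l \<rightarrow>\<^sub>E UNIV. particle_number l p = k}"

definition cylinder :: "nat \<Rightarrow> config \<Rightarrow> config set" where
  "cylinder l p = {\<eta>. \<forall>x\<in>box l. \<eta> x = p x}"

text \<open>Single occupation numbers are unbounded, but a fixed total bounds each of them. This is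
  what turns canonical averages into finite sums.\<close>

lemma finite_patterns: "finite (patterns l k)"
proof (rule finite_subset)
  show "patterns l k \<subseteq> box l \<rightarrow>\<^sub>E {..k}"
  proof
    fix p assume p: "p \<in> patterns l k"
    have "p x \<le> k" if "x \<in> box l" for x
      using p member_le_sum[OF that, of p] by (auto simp: patterns_def particle_number_def)
    with p show "p \<in> box l \<rightarrow>\<^sub>E {..k}" by (auto simp: patterns_def PiE_iff)
  qed
qed (intro finite_PiE, auto)

lemma particle_number_glue: "particle_number l (glue l p \<xi>) = particle_number l p"
  by (simp add: particle_number_def glue_def)

lemma cylinder_glue: "cylinder l (glue l p \<xi>) = cylinder l p"
  by (auto simp: cylinder_def glue_def)

lemma glue_cylinder: "\<eta> \<in> cylinder l p \<Longrightarrow> glue l p \<eta> = \<eta>"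
  by (auto simp: cylinder_def glue_def)

lemma indicator_particle_number:
  "indicator {\<eta>. particle_number l \<eta> = k} \<eta> = (\<Sum>p\<in>patterns l k. indicator (cylinder l p) \<eta> :: ennreal)"
proof (cases "particle_number l \<eta> = k")
  case True
  let ?p = "restrict \<eta> (box l)"
  have p: "?p \<in> patterns l k" using True by (auto simp: patterns_def particle_number_def)
  have "indicator (cylinder l p) \<eta> = (if p = ?p then 1 else 0 :: ennreal)" if "p \<in> patterns l k" for p
    using that by (auto simp: patterns_def cylinder_def indicator_def PiE_iff extensional_def fun_eq_iff) metis
  then show ?thesis using True p finite_patterns by (simp add: sum.delta)
next
  case False
  then have "\<eta> \<notin> cylinder l p" if "p \<in> patterns l k" for p
    using that by (auto simp: patterns_def cylinder_def particle_number_def) (metis sum.cong)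
  then show ?thesis using False by simp
qed

lemma block_avg_particle_number: "block_avg l \<eta> 0 = real (particle_number l \<eta>) / (2 * real l + 1)"
  by (simp add: block_avg_def particle_number_def)

lemma canonical_configurations:
  "{\<eta> \<in> agree_off l \<xi>. (\<Sum>x\<in>box l. \<eta> x) = k} = (\<lambda>p. glue l p \<xi>) ` patterns l k"
proof (intro equalityI subsetI)
  fix \<eta> assume \<eta>: "\<eta> \<in> {\<eta> \<in> agree_off l \<xi>. (\<Sum>x\<in>box l. \<eta> x) = k}"
  then have "\<eta> = glue l (restrict \<eta> (box l)) \<xi>" by (auto simp: glue_def agree_off_def)
  moreover have "restrict \<eta> (box l) \<in> patterns l k" using \<eta> by (auto simp: patterns_def particle_number_def)
  ultimately show "\<eta> \<in> (\<lambda>p. glue l p \<xi>) ` patterns l k" by blast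
next
  fix \<eta> assume "\<eta> \<in> (\<lambda>p. glue l p \<xi>) ` patterns l k"
  then show "\<eta> \<in> {\<eta> \<in> agree_off l \<xi>. (\<Sum>x\<in>box l. \<eta> x) = k}"
    using particle_number_glue by (auto simp: glue_def agree_off_def patterns_def particle_number_def)
qed

lemma inj_on_glue: "inj_on (\<lambda>p. glue l p \<xi>) (patterns l k)"
proof (rule inj_onI)
  fix p q assume pq: "p \<in> patterns l k" "q \<in> patterns l k" "glue l p \<xi> = glue l q \<xi>"
  show "p = q"
  proof (rule PiE_ext)
    show "p \<in> box l \<rightarrow>\<^sub>E UNIV" "q \<in> box l \<rightarrow>\<^sub>E UNIV" using pq by (auto simp: patterns_def)
    show "p x = q x" if "x \<in> box l" for x
      using fun_cong[OF pq(3), of x] that by (simp add: glue_def)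
  qed
qed

lemma point_measure_uniform_nn_integral:
  assumes E: "finite E" "E \<subseteq> \<Omega>"
  shows "(\<integral>\<^sup>+x. g x \<partial>uniform_measure (point_measure \<Omega> m) E) = (\<Sum>x\<in>E. g x * m x) / (\<Sum>x\<in>E. m x)"
proof -
  let ?c = "\<Sum>x\<in>E. m x"
  have c: "emeasure (point_measure \<Omega> m) E = ?c" by (rule emeasure_point_measure_finite2) (use E in auto)
  have "(\<integral>\<^sup>+x. g x \<partial>uniform_measure (point_measure \<Omega> m) E)
     = (\<integral>\<^sup>+x. m x * (indicator E x / ?c * g x) \<partial>count_space \<Omega>)"
    unfolding uniform_measure_def c
    by (subst nn_integral_density, simp_all add: point_measure_def) (subst nn_integral_density, simp_all)
  also have "\<dots> = (\<Sum>x\<in>E. m x * (indicator E x / ?c * g x))"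
    by (rule nn_integral_count_space'[OF E(1) _ E(2)]) simp
  also have "\<dots> = (\<Sum>x\<in>E. g x * m x * inverse ?c)"
    by (rule sum.cong) (auto simp: divide_ennreal_def mult_ac)
  also have "\<dots> = (\<Sum>x\<in>E. g x * m x) / ?c"
    by (simp add: sum_distrib_right divide_ennreal_def)
  finally show ?thesis .
qed

context stationary_config
begin

lemma outside_alg_measurable: "(\<lambda>\<eta>. restrict \<eta> (- box l)) \<in> outside_alg l \<rightarrow>\<^sub>M Pi\<^sub>M (- box l) (\<lambda>_. count_space UNIV)"
  unfolding outside_alg_def by (rule measurable_vimage_algebra1) (auto simp: space_PiM)

lemma canonical_alg_measurable:
  "(\<lambda>\<eta>. (block_avg l \<eta> 0, restrict \<eta> (- box l))) \<in> canonical_alg l \<rightarrow>\<^sub>M borel \<Otimes>\<^sub>M Pi\<^sub>M (- box l) (\<lambda>_. count_space UNIV)"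
  unfolding canonical_alg_def by (rule measurable_vimage_algebra1) (auto simp: space_PiM space_pair_measure)

lemma space_algs[simp]: "space (outside_alg l) = UNIV" "space (canonical_alg l) = UNIV"
  by (simp_all add: outside_alg_def canonical_alg_def)

lemma restrict_measurable: "(\<lambda>\<eta>. restrict \<eta> A) \<in> config_space \<rightarrow>\<^sub>M Pi\<^sub>M A (\<lambda>_. count_space UNIV)"
  unfolding config_space_def by (rule measurable_restrict_subset) simp

lemma particle_number_measurable: "particle_number l \<in> config_space \<rightarrow>\<^sub>M count_space UNIV"
  unfolding particle_number_def[abs_def] by measurable

lemma block_avg_measurable: "(\<lambda>\<eta>. block_avg l \<eta> x) \<in> borel_measurable config_space"
proof -
  have [measurable]: "(\<lambda>\<eta>. real (\<eta> y)) \<in> borel_measurable config_space" for y :: int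
    by (rule measurable_compose[OF measurable_coord]) simp
  show ?thesis unfolding block_avg_def by measurable
qed

lemma subalgebra_outside: "subalgebra \<nu> (outside_alg l)"
  unfolding subalgebra_def
proof
  have "(\<lambda>\<eta>. restrict \<eta> (- box l)) \<in> \<nu> \<rightarrow>\<^sub>M Pi\<^sub>M (- box l) (\<lambda>_. count_space UNIV)"
    unfolding measurable_nu by (rule restrict_measurable)
  then show "sets (outside_alg l) \<subseteq> sets \<nu>"
    unfolding outside_alg_def by (simp add: measurable_iff_sets)
qed simp

lemma subalgebra_canonical: "subalgebra \<nu> (canonical_alg l)"
  unfolding subalgebra_def
proof
  have "(\<lambda>\<eta>. (block_avg l \<eta> 0, restrict \<eta> (- box l))) \<in> \<nu> \<rightarrow>\<^sub>M borel \<Otimes>\<^sub>M Pi\<^sub>M (- box l) (\<lambda>_. count_space UNIV)"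
    unfolding measurable_nu by (intro measurable_Pair block_avg_measurable restrict_measurable)
  then show "sets (canonical_alg l) \<subseteq> sets \<nu>"
    unfolding canonical_alg_def by (simp add: measurable_iff_sets)
qed simp

sublocale out: finite_measure_subalgebra \<nu> "outside_alg l" for l
  by unfold_locales (rule subalgebra_outside)

sublocale can: finite_measure_subalgebra \<nu> "canonical_alg l" for l
  by unfold_locales (rule subalgebra_canonical)

lemma subalgebra_canonical_outside: "subalgebra (canonical_alg l) (outside_alg l)"
  unfolding subalgebra_def
proof
  have "(\<lambda>\<eta>. restrict \<eta> (- box l)) \<in> canonical_alg l \<rightarrow>\<^sub>M Pi\<^sub>M (- box l) (\<lambda>_. count_space UNIV)"
    using measurable_compose[OF canonical_alg_measurable measurable_snd] by simp
  then show "sets (outside_alg l) \<subseteq> sets (canonical_alg l)"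
    unfolding outside_alg_def by (simp add: measurable_iff_sets)
qed simp

lemma particle_number_canonical: "particle_number l \<in> canonical_alg l \<rightarrow>\<^sub>M count_space UNIV"
proof -
  have b: "(\<lambda>\<eta>. block_avg l \<eta> 0) \<in> borel_measurable (canonical_alg l)"
    using measurable_compose[OF canonical_alg_measurable measurable_fst] by simp
  have "(\<lambda>\<eta>. nat \<lfloor>block_avg l \<eta> 0 * (2 * real l + 1)\<rfloor>) \<in> canonical_alg l \<rightarrow>\<^sub>M count_space UNIV"
    using b by measurable
  moreover have "nat \<lfloor>block_avg l \<eta> 0 * (2 * real l + 1)\<rfloor> = particle_number l \<eta>" for \<eta>
    by (simp add: block_avg_particle_number add_pos_nonneg less_imp_neq[symmetric])
  ultimately show ?thesis by (simp add: fun_eq_iff[symmetric] cong: measurable_cong)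
qed

text \<open>Once the particle number is fixed, the block density carries no further information.
  Conditioning on density and exterior thereby reduces to conditioning on the exterior, where
  \<open>pattern_prob\<close> lives.\<close>

lemma canonical_section:
  assumes "A \<in> sets (canonical_alg l)"
  obtains B where "B \<in> sets (outside_alg l)" "A \<inter> {\<eta>. particle_number l \<eta> = k} = B \<inter> {\<eta>. particle_number l \<eta> = k}"
proof -
  let ?N = "borel \<Otimes>\<^sub>M Pi\<^sub>M (- box l) (\<lambda>_. count_space (UNIV::nat set)) :: (real \<times> config) measure"
  obtain M where M: "M \<in> sets ?N" "A = (\<lambda>\<eta>. (block_avg l \<eta> 0, restrict \<eta> (- box l))) -` M"
    using assms unfolding canonical_alg_def
    by (subst (asm) sets_vimage_algebra2) (auto simp: space_PiM space_pair_measure)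
  let ?B = "{\<eta>. (real k / (2 * real l + 1), restrict \<eta> (- box l)) \<in> M}"
  have "(\<lambda>\<eta>. (real k / (2 * real l + 1), restrict \<eta> (- box l))) \<in> outside_alg l \<rightarrow>\<^sub>M ?N"
    by (intro measurable_Pair outside_alg_measurable) simp
  from measurable_sets[OF this M(1)] have "?B \<in> sets (outside_alg l)" by (simp add: vimage_def)
  moreover have "A \<inter> {\<eta>. particle_number l \<eta> = k} = ?B \<inter> {\<eta>. particle_number l \<eta> = k}"
    unfolding M(2) by (auto simp: block_avg_particle_number)
  ultimately show thesis by (rule that)
qed

definition pattern_prob :: "nat \<Rightarrow> config \<Rightarrow> config \<Rightarrow> ennreal" where
  "pattern_prob l p = nn_cond_exp \<nu> (outside_alg l) (indicator (cylinder l p))"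

text \<open>Bayes' formula: the average of \<open>f\<close> over the completions of
  \<open>\<xi>\<close> with \<open>k\<close> particles in the box, weighted by the conditional
  pattern probabilities. It is the common form to which both the conditional expectation and the
  integral under \<open>canonical_law\<close> are reduced.\<close>

definition canonical_avg :: "nat \<Rightarrow> (config \<Rightarrow> ennreal) \<Rightarrow> nat \<Rightarrow> config \<Rightarrow> ennreal" where
  "canonical_avg l f k \<xi> = (\<Sum>p\<in>patterns l k. f (glue l p \<xi>) * pattern_prob l p \<xi>) / (\<Sum>p\<in>patterns l k. pattern_prob l p \<xi>)"

lemma cylinder_sets[measurable]: "cylinder l p \<in> sets \<nu>"
proof -
  have "cylinder l p = {\<eta> \<in> space config_space. \<forall>x\<in>box l. \<eta> x = p x}" by (simp add: cylinder_def)
  also have "\<dots> \<in> sets config_space" by measurable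
  finally show ?thesis by (simp add: sets_nu)
qed

lemma pattern_prob_measurable[measurable]: "pattern_prob l p \<in> borel_measurable (outside_alg l)"
  unfolding pattern_prob_def by (rule borel_measurable_nn_cond_exp)

lemma glue_measurable: "glue l p \<in> outside_alg l \<rightarrow>\<^sub>M config_space"
  unfolding config_space_def
proof (rule measurable_PiM_single')
  fix x :: int
  show "(\<lambda>\<xi>. glue l p \<xi> x) \<in> outside_alg l \<rightarrow>\<^sub>M count_space UNIV"
  proof (cases "x \<in> box l")
    case False
    then have "(\<lambda>\<xi>. restrict \<xi> (- box l) x) \<in> outside_alg l \<rightarrow>\<^sub>M count_space UNIV"
      by (intro measurable_compose[OF outside_alg_measurable] measurable_component_singleton) simp
    with False show ?thesis by (simp add: glue_def)
  qed (simp add: glue_def)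
qed (auto simp: space_PiM)

text \<open>On a cylinder \<open>f\<close> agrees with its composition with \<open>glue\<close>,
  which is measurable in the exterior and may be pulled out of the conditional expectation of the
  cylinder's indicator.\<close>

lemma section_integral:
  assumes f: "f \<in> borel_measurable \<nu>" and B: "B \<in> sets (outside_alg l)"
  shows "(\<integral>\<^sup>+\<eta>. indicator B \<eta> * (indicator {\<eta>. particle_number l \<eta> = k} \<eta> * f \<eta>) \<partial>\<nu>)
      = (\<integral>\<^sup>+\<eta>. indicator B \<eta> * (\<Sum>p\<in>patterns l k. f (glue l p \<eta>) * pattern_prob l p \<eta>) \<partial>\<nu>)"
proof -
  have fo: "(\<lambda>\<eta>. f (glue l p \<eta>)) \<in> borel_measurable (outside_alg l)" for p
    using measurable_compose[OF glue_measurable, of f borel] f by (simp add: measurable_nu)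
  have Bf: "(\<lambda>\<eta>. indicator B \<eta> * f (glue l p \<eta>)) \<in> borel_measurable (outside_alg l)" for p
    using fo B by measurable
  note [measurable] = measurable_from_subalg[OF subalgebra_outside Bf] measurable_from_subalg[OF subalgebra_outside pattern_prob_measurable]
  have pt: "indicator B \<eta> * (indicator {\<eta>. particle_number l \<eta> = k} \<eta> * f \<eta>)
      = (\<Sum>p\<in>patterns l k. (indicator B \<eta> * f (glue l p \<eta>)) * indicator (cylinder l p) \<eta>)" for \<eta>
  proof -
    have "f (glue l p \<eta>) * indicator (cylinder l p) \<eta> = f \<eta> * indicator (cylinder l p) \<eta>" for p
      using glue_cylinder[of \<eta> l p] by (auto split: split_indicator)
    then show ?thesis
      unfolding indicator_particle_number sum_distrib_right sum_distrib_left
      by (intro sum.cong refl) (simp add: mult.assoc, simp add: mult.commute)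
  qed
  have "(\<integral>\<^sup>+\<eta>. indicator B \<eta> * (indicator {\<eta>. particle_number l \<eta> = k} \<eta> * f \<eta>) \<partial>\<nu>)
     = (\<Sum>p\<in>patterns l k. \<integral>\<^sup>+\<eta>. (indicator B \<eta> * f (glue l p \<eta>)) * indicator (cylinder l p) \<eta> \<partial>\<nu>)"
    unfolding pt by (rule nn_integral_sum) measurable
  also have "\<dots> = (\<Sum>p\<in>patterns l k. \<integral>\<^sup>+\<eta>. (indicator B \<eta> * f (glue l p \<eta>)) * pattern_prob l p \<eta> \<partial>\<nu>)"
    unfolding pattern_prob_def
    by (intro sum.cong refl out.nn_cond_exp_intg[symmetric] Bf borel_measurable_indicator cylinder_sets)
  also have "\<dots> = (\<integral>\<^sup>+\<eta>. (\<Sum>p\<in>patterns l k. (indicator B \<eta> * f (glue l p \<eta>)) * pattern_prob l p \<eta>) \<partial>\<nu>)"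
    by (rule nn_integral_sum[symmetric]) measurable
  finally show ?thesis by (simp add: sum_distrib_left mult.assoc)
qed

lemma pattern_prob_le_1: "AE \<xi> in \<nu>. pattern_prob l p \<xi> \<le> 1"
proof -
  have "AE \<xi> in \<nu>. pattern_prob l p \<xi> \<le> nn_cond_exp \<nu> (outside_alg l) (\<lambda>_. 1) \<xi>"
    unfolding pattern_prob_def by (rule out.nn_cond_exp_mono) (auto split: split_indicator)
  moreover have "AE \<xi> in \<nu>. 1 = nn_cond_exp \<nu> (outside_alg l) (\<lambda>_. 1) \<xi>"
    by (rule out.nn_cond_exp_F_meas) simp
  ultimately show ?thesis by eventually_elim simp
qed

text \<open>There are countably many patterns, so their exceptional null sets can be united.\<close>

lemma AE_patterns:
  assumes "\<And>p :: config. AE \<xi> in \<nu>. Q p \<xi>"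
  shows "AE \<xi> in \<nu>. \<forall>p\<in>box l \<rightarrow>\<^sub>E UNIV. Q p \<xi>"
  using assms by (intro AE_ball_countable[THEN iffD2] countable_box_patterns ballI)

lemma canonical_avg_measurable:
  assumes "f \<in> borel_measurable \<nu>"
  shows "(\<lambda>\<eta>. canonical_avg l f (particle_number l \<eta>) \<eta>) \<in> borel_measurable (canonical_alg l)"
proof (rule measurable_compose_countable[OF _ particle_number_canonical])
  fix k
  have "(\<lambda>\<eta>. f (glue l p \<eta>)) \<in> borel_measurable (outside_alg l)" for p
    using measurable_compose[OF glue_measurable, of f borel] assms by (simp add: measurable_nu)
  then have "canonical_avg l f k \<in> borel_measurable (outside_alg l)"
    unfolding canonical_avg_def[abs_def] by measurable
  then show "canonical_avg l f k \<in> borel_measurable (canonical_alg l)"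
    by (rule measurable_from_subalg[OF subalgebra_canonical_outside])
qed

text \<open>The defining integral identity is checked on each set of fixed particle number. There
  \<open>canonical_section\<close> replaces the canonical event by an exterior one, and summing the
  pattern probabilities cancels the denominator of \<open>canonical_avg\<close>.\<close>

lemma canonical_avg_cond_exp:
  assumes f: "f \<in> borel_measurable \<nu>"
  shows "AE \<eta> in \<nu>. canonical_avg l f (particle_number l \<eta>) \<eta> = nn_cond_exp \<nu> (canonical_alg l) f \<eta>"
proof (rule can.nn_cond_exp_charact[OF _ f canonical_avg_measurable[OF f]])
  let ?H = "\<lambda>\<eta>. canonical_avg l f (particle_number l \<eta>) \<eta>"
  let ?S = "\<lambda>k. {\<eta>. particle_number l \<eta> = k}"
  have HM: "?H \<in> borel_measurable \<nu>"
    by (rule measurable_from_subalg[OF subalgebra_canonical canonical_avg_measurable[OF f]])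
  fix A assume A: "A \<in> sets (canonical_alg l)"
  have AM: "A \<in> sets \<nu>" using A subalgebra_canonical by (auto simp: subalgebra_def)
  have SM: "?S k \<in> sets \<nu>" for k
    using measurable_sets[OF particle_number_measurable, of "{k}" l] by (simp add: sets_nu vimage_def)
  have split: "(\<integral>\<^sup>+\<eta>\<in>A. g \<eta> \<partial>\<nu>) = (\<Sum>k. \<integral>\<^sup>+\<eta>. indicator A \<eta> * (indicator (?S k) \<eta> * g \<eta>) \<partial>\<nu>)"
    if g: "g \<in> borel_measurable \<nu>" for g
  proof -
    have one: "(\<Sum>k. indicator (?S k) \<eta>) = (1 :: ennreal)" for \<eta>
    proof -
      have "(\<Sum>k. indicator (?S k) \<eta>) = (\<Sum>k\<in>{particle_number l \<eta>}. indicator (?S k) \<eta> :: ennreal)"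
        by (rule suminf_finite) auto
      then show ?thesis by simp
    qed
    have "g \<eta> * indicator A \<eta> = (\<Sum>k. indicator A \<eta> * (indicator (?S k) \<eta> * g \<eta>))" for \<eta>
      by (simp add: one mult.commute)
    then have "(\<integral>\<^sup>+\<eta>\<in>A. g \<eta> \<partial>\<nu>) = (\<integral>\<^sup>+\<eta>. (\<Sum>k. indicator A \<eta> * (indicator (?S k) \<eta> * g \<eta>)) \<partial>\<nu>)" by simp
    also have "\<dots> = (\<Sum>k. \<integral>\<^sup>+\<eta>. indicator A \<eta> * (indicator (?S k) \<eta> * g \<eta>) \<partial>\<nu>)"
      by (rule nn_integral_suminf) (use AM SM g in measurable)
    finally show ?thesis .
  qed
  have "(\<integral>\<^sup>+\<eta>. indicator A \<eta> * (indicator (?S k) \<eta> * f \<eta>) \<partial>\<nu>) = (\<integral>\<^sup>+\<eta>. indicator A \<eta> * (indicator (?S k) \<eta> * ?H \<eta>) \<partial>\<nu>)" for k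
  proof -
    obtain B where B: "B \<in> sets (outside_alg l)" "A \<inter> ?S k = B \<inter> ?S k" using canonical_section[OF A] by metis
    have AB: "indicator A \<eta> * (indicator (?S k) \<eta> * y) = indicator B \<eta> * (indicator (?S k) \<eta> * y)" for \<eta> and y :: ennreal
      using B(2) by (auto split: split_indicator)
    let ?num = "\<lambda>\<eta>. \<Sum>p\<in>patterns l k. f (glue l p \<eta>) * pattern_prob l p \<eta>"
    let ?den = "\<lambda>\<eta>. \<Sum>p\<in>patterns l k. pattern_prob l p \<eta>"
    have fo: "(\<lambda>\<eta>. f (glue l p \<eta>)) \<in> borel_measurable (outside_alg l)" for p
      using measurable_compose[OF glue_measurable, of f borel] f by (simp add: measurable_nu)
    have ho: "canonical_avg l f k \<in> borel_measurable (outside_alg l)"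
      unfolding canonical_avg_def[abs_def] using fo by measurable
    have h\<nu>: "canonical_avg l f k \<in> borel_measurable \<nu>" by (rule measurable_from_subalg[OF subalgebra_outside ho])
    have Bh: "(\<lambda>\<eta>. indicator B \<eta> * canonical_avg l f k \<eta>) \<in> borel_measurable (outside_alg l)"
      using ho B(1) by measurable
    note [measurable] = measurable_from_subalg[OF subalgebra_outside Bh] measurable_from_subalg[OF subalgebra_outside pattern_prob_measurable]
    have pp: "AE \<eta> in \<nu>. \<forall>p\<in>box l \<rightarrow>\<^sub>E UNIV. pattern_prob l p \<eta> \<le> 1" by (rule AE_patterns[OF pattern_prob_le_1])
    have "(\<integral>\<^sup>+\<eta>. indicator A \<eta> * (indicator (?S k) \<eta> * ?H \<eta>) \<partial>\<nu>)
        = (\<integral>\<^sup>+\<eta>. (\<Sum>p\<in>patterns l k. (indicator B \<eta> * canonical_avg l f k \<eta>) * indicator (cylinder l p) \<eta>) \<partial>\<nu>)"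
    proof (rule nn_integral_cong)
      fix \<eta>
      have "indicator (?S k) \<eta> * ?H \<eta> = canonical_avg l f k \<eta> * indicator (?S k) \<eta>" by (auto split: split_indicator)
      then show "indicator A \<eta> * (indicator (?S k) \<eta> * ?H \<eta>) = (\<Sum>p\<in>patterns l k. (indicator B \<eta> * canonical_avg l f k \<eta>) * indicator (cylinder l p) \<eta>)"
        unfolding AB by (simp add: indicator_particle_number sum_distrib_left mult.assoc)
    qed
    also have "\<dots> = (\<Sum>p\<in>patterns l k. \<integral>\<^sup>+\<eta>. (indicator B \<eta> * canonical_avg l f k \<eta>) * indicator (cylinder l p) \<eta> \<partial>\<nu>)"
      by (rule nn_integral_sum) measurable
    also have "\<dots> = (\<Sum>p\<in>patterns l k. \<integral>\<^sup>+\<eta>. (indicator B \<eta> * canonical_avg l f k \<eta>) * pattern_prob l p \<eta> \<partial>\<nu>)"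
      unfolding pattern_prob_def
      by (intro sum.cong refl out.nn_cond_exp_intg[symmetric] Bh borel_measurable_indicator cylinder_sets)
    also have "\<dots> = (\<integral>\<^sup>+\<eta>. (\<Sum>p\<in>patterns l k. (indicator B \<eta> * canonical_avg l f k \<eta>) * pattern_prob l p \<eta>) \<partial>\<nu>)"
      by (rule nn_integral_sum[symmetric]) measurable
    also have "\<dots> = (\<integral>\<^sup>+\<eta>. indicator B \<eta> * ?num \<eta> \<partial>\<nu>)"
    proof (rule nn_integral_cong_AE, use pp in eventually_elim)
      case (elim \<eta>)
      have "?den \<eta> \<le> (\<Sum>p\<in>patterns l k. 1)" using elim by (intro sum_mono) (auto simp: patterns_def)
      also have "\<dots> < top" by (simp add: of_nat_less_top)
      finally have dtop: "?den \<eta> \<noteq> top" by simp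
      \<comment> \<open>If the denominator vanishes, so do all pattern probabilities and with them
        the numerator. Otherwise the cancellation is legitimate because the denominator is
        finite.\<close>
      have "?num \<eta> / ?den \<eta> * ?den \<eta> = ?num \<eta>"
      proof (cases "?den \<eta> = 0")
        case True
        then have "pattern_prob l p \<eta> = 0" if "p \<in> patterns l k" for p
          using that finite_patterns by (simp add: sum_eq_0_iff)
        then show ?thesis by simp
      next
        case False
        then show ?thesis using dtop by (simp only: ennreal_divide_times ennreal_divide_self mult_1_right not_False_eq_True top.not_eq_extremum[symmetric])
      qed
      then have "(indicator B \<eta> * canonical_avg l f k \<eta>) * ?den \<eta> = indicator B \<eta> * ?num \<eta>"
        unfolding canonical_avg_def by (simp only: mult.assoc)
      then show ?case by (simp only: sum_distrib_left)
    qed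
    also have "\<dots> = (\<integral>\<^sup>+\<eta>. indicator B \<eta> * (indicator (?S k) \<eta> * f \<eta>) \<partial>\<nu>)" by (rule section_integral[OF f B(1), symmetric])
    finally show ?thesis unfolding AB by simp
  qed
  then show "(\<integral>\<^sup>+\<eta>\<in>A. f \<eta> \<partial>\<nu>) = (\<integral>\<^sup>+\<eta>\<in>A. ?H \<eta> \<partial>\<nu>)" unfolding split[OF f] split[OF HM] by simp
qed

text \<open>\<open>cond_law\<close> is built from \<open>real_cond_exp\<close>, the disintegration
  from \<open>nn_cond_exp\<close>; the two agree because conditional probabilities are
  finite.\<close>

lemma pattern_prob_real: "AE \<xi> in \<nu>. ennreal (real_cond_exp \<nu> (outside_alg l) (indicator (cylinder l p)) \<xi>) = pattern_prob l p \<xi>"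
proof -
  have "AE \<xi> in \<nu>. 0 = nn_cond_exp \<nu> (outside_alg l) (\<lambda>_. 0) \<xi>"
    by (rule out.nn_cond_exp_F_meas) simp
  with pattern_prob_le_1[of l p] show ?thesis
  proof eventually_elim
    case (elim \<xi>)
    have 1: "(\<lambda>\<eta>. ennreal (indicator (cylinder l p) \<eta>)) = indicator (cylinder l p)" by (auto split: split_indicator)
    have 2: "(\<lambda>\<eta>. ennreal (- indicator (cylinder l p) \<eta>)) = (\<lambda>_. 0)" by (auto split: split_indicator simp: ennreal_neg)
    have "pattern_prob l p \<xi> < top" using elim(1) by (rule order_le_less_trans) simp
    then show ?case
      unfolding real_cond_exp_def 1 2 elim(2)[symmetric] pattern_prob_def[symmetric] by simp
  qed
qed

text \<open>The exceptional set stems from the countably many pattern probabilities alone. One null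
  set therefore serves all \<open>g\<close>, measurable or not.\<close>

lemma canonical_law_nn_integral:
  "AE \<eta> in \<nu>. \<forall>g. (\<integral>\<^sup>+\<zeta>. g \<zeta> \<partial>canonical_law \<nu> (particle_number l \<eta>) l \<eta>) = canonical_avg l g (particle_number l \<eta>) \<eta>"
proof -
  have "AE \<xi> in \<nu>. \<forall>p\<in>box l \<rightarrow>\<^sub>E UNIV. ennreal (real_cond_exp \<nu> (outside_alg l) (indicator (cylinder l p)) \<xi>) = pattern_prob l p \<xi>"
    by (rule AE_patterns[OF pattern_prob_real])
  then show ?thesis
  proof eventually_elim
    case (elim \<eta>)
    let ?k = "particle_number l \<eta>"
    let ?E = "{\<zeta> \<in> agree_off l \<eta>. (\<Sum>x\<in>box l. \<zeta> x) = ?k}"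
    let ?m = "\<lambda>e. ennreal (real_cond_exp \<nu> (outside_alg l) (indicator (cylinder l e)) \<eta>)"
    have cl: "canonical_law \<nu> ?k l \<eta> = uniform_measure (point_measure (agree_off l \<eta>) ?m) ?E"
      unfolding canonical_law_def cond_law_def cylinder_def ..
    have fin: "finite ?E" unfolding canonical_configurations using finite_patterns by simp
    have m: "?m (glue l p \<eta>) = pattern_prob l p \<eta>" if "p \<in> patterns l ?k" for p
      using elim that unfolding cylinder_glue by (auto simp: patterns_def)
    show ?case
    proof
      fix g
      have "(\<integral>\<^sup>+\<zeta>. g \<zeta> \<partial>canonical_law \<nu> ?k l \<eta>) = (\<Sum>x\<in>?E. g x * ?m x) / (\<Sum>x\<in>?E. ?m x)"
        unfolding cl by (rule point_measure_uniform_nn_integral[OF fin]) auto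
      then show "(\<integral>\<^sup>+\<zeta>. g \<zeta> \<partial>canonical_law \<nu> ?k l \<eta>) = canonical_avg l g ?k \<eta>"
        unfolding canonical_configurations canonical_avg_def
        by (simp add: sum.reindex[OF inj_on_glue] m)
    qed
  qed
qed

lemma canonical_law_integral:
  fixes f :: "config \<Rightarrow> real"
  assumes f: "integrable \<nu> f"
  shows "AE \<eta> in \<nu>. integrable (canonical_law \<nu> (particle_number l \<eta>) l \<eta>) f \<and>
     (\<integral>\<zeta>. f \<zeta> \<partial>canonical_law \<nu> (particle_number l \<eta>) l \<eta>) = real_cond_exp \<nu> (canonical_alg l) f \<eta>"
proof -
  have m: "f \<in> borel_measurable \<nu>" using f by simp
  have ma: "(\<lambda>x. ennreal (norm (f x))) \<in> borel_measurable \<nu>" using m by measurable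
  have "(\<integral>\<^sup>+\<eta>. 1 * nn_cond_exp \<nu> (canonical_alg l) (\<lambda>x. ennreal (norm (f x))) \<eta> \<partial>\<nu>) = (\<integral>\<^sup>+\<eta>. 1 * ennreal (norm (f \<eta>)) \<partial>\<nu>)"
    by (rule can.nn_cond_exp_intg) (use ma in auto)
  also have "\<dots> < \<infinity>" using f by (simp add: integrable_iff_bounded)
  finally have "AE \<eta> in \<nu>. nn_cond_exp \<nu> (canonical_alg l) (\<lambda>x. ennreal (norm (f x))) \<eta> \<noteq> \<infinity>"
    by (intro nn_integral_PInf_AE) auto
  with canonical_law_nn_integral[of l] canonical_avg_cond_exp[OF ma, of l]
    canonical_avg_cond_exp[of "\<lambda>x. ennreal (f x)" l] canonical_avg_cond_exp[of "\<lambda>x. ennreal (- f x)" l] m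
  have "AE \<eta> in \<nu>. (\<forall>g. (\<integral>\<^sup>+\<zeta>. g \<zeta> \<partial>canonical_law \<nu> (particle_number l \<eta>) l \<eta>) = canonical_avg l g (particle_number l \<eta>) \<eta>) \<and>
     canonical_avg l (\<lambda>x. ennreal (norm (f x))) (particle_number l \<eta>) \<eta> \<noteq> \<infinity> \<and>
     canonical_avg l (\<lambda>x. ennreal (f x)) (particle_number l \<eta>) \<eta> = nn_cond_exp \<nu> (canonical_alg l) (\<lambda>x. ennreal (f x)) \<eta> \<and>
     canonical_avg l (\<lambda>x. ennreal (- f x)) (particle_number l \<eta>) \<eta> = nn_cond_exp \<nu> (canonical_alg l) (\<lambda>x. ennreal (- f x)) \<eta>"
    by auto
  then show ?thesis
  proof eventually_elim
    case (elim \<eta>)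
    let ?\<kappa> = "canonical_law \<nu> (particle_number l \<eta>) l \<eta>"
    have "sets ?\<kappa> = Pow (agree_off l \<eta>)" "space ?\<kappa> = agree_off l \<eta>"
      by (simp_all add: canonical_law_def cond_law_def uniform_measure_def point_measure_def)
    then have "f \<in> borel_measurable ?\<kappa>" by (auto simp: measurable_def)
    then have int: "integrable ?\<kappa> f"
      unfolding integrable_iff_bounded using elim by (simp add: less_top)
    then show ?case
      using elim by (simp add: real_lebesgue_integral_def real_cond_exp_def)
  qed
qed

text \<open>Every admissible constant dominates the quotient of a single test function. When the
  energy is zero, admissibility forces the variance to be zero, and \<open>ennreal\<close> sets
  \<open>0 / 0\<close> to \<open>0\<close>.\<close>

lemma inv_gap_lower:
  "ennreal (var_under (canonical_law \<nu> k l \<xi>) f) / ennreal (dirichlet_box (canonical_law \<nu> k l \<xi>) (b n) l f)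
    \<le> inv_gap \<nu> b k l \<xi> n"
  unfolding inv_gap_def
proof (rule Inf_greatest)
  fix w assume "w \<in> {w. \<forall>f. ennreal (var_under (canonical_law \<nu> k l \<xi>) f)
     \<le> w * ennreal (dirichlet_box (canonical_law \<nu> k l \<xi>) (b n) l f)}"
  then have w: "ennreal (var_under (canonical_law \<nu> k l \<xi>) f) \<le> w * ennreal (dirichlet_box (canonical_law \<nu> k l \<xi>) (b n) l f)"
    by blast
  show "ennreal (var_under (canonical_law \<nu> k l \<xi>) f) / ennreal (dirichlet_box (canonical_law \<nu> k l \<xi>) (b n) l f) \<le> w"
    (is "?v / ?d \<le> w")
  proof (cases "?d = 0")
    case True
    then have "?v = 0" using w by simp
    then show ?thesis by simp
  next
    case False
    have "?v / ?d \<le> w * ?d / ?d" by (rule divide_right_mono_ennreal[OF w])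
    also have "\<dots> = w" using False by (simp add: mult_divide_eq_ennreal)
    finally show ?thesis .
  qed
qed

text \<open>A variance under a law that itself depends on \<open>\<eta>\<close> is replaced by a
  conditional variance, which is visibly measurable in the canonical algebra.\<close>

lemma var_under_cond_exp:
  assumes \<phi>: "square_integrable \<nu> \<phi>"
  shows "AE \<eta> in \<nu>. var_under (canonical_law \<nu> (particle_number l \<eta>) l \<eta>) \<phi>
    = real_cond_exp \<nu> (canonical_alg l) (\<lambda>\<zeta>. (\<phi> \<zeta>)\<^sup>2) \<eta> - (real_cond_exp \<nu> (canonical_alg l) \<phi> \<eta>)\<^sup>2"
proof -
  \<comment> \<open>The definition of \<open>canonical_law\<close> does not make it a probability
    measure. That its mass is almost surely one is read off from the constant function.\<close>
  have one: "AE \<eta> in \<nu>. real_cond_exp \<nu> (canonical_alg l) (\<lambda>_. 1) \<eta> = 1"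
    by (rule can.real_cond_exp_F_meas) auto
  note canonical_law_integral[OF square_integrable_integrable[OF \<phi>], of l]
    canonical_law_integral[OF square_integrable_sq[OF \<phi>], of l] canonical_law_integral[OF integrable_const, of l 1] one
  then show ?thesis
  proof eventually_elim
    case (elim \<eta>)
    let ?\<kappa> = "canonical_law \<nu> (particle_number l \<eta>) l \<eta>" and ?m = "real_cond_exp \<nu> (canonical_alg l) \<phi> \<eta>"
    have a: "integrable ?\<kappa> (\<lambda>\<zeta>. (\<phi> \<zeta>)\<^sup>2)" by (rule conjunct1[OF elim(2)])
    have b: "integrable ?\<kappa> (\<lambda>\<zeta>. 2 * ?m * \<phi> \<zeta>)" by (rule integrable_mult_right) (rule conjunct1[OF elim(1)])
    have c: "integrable ?\<kappa> (\<lambda>\<zeta>. ?m\<^sup>2 * 1)" by (rule integrable_mult_right) (rule conjunct1[OF elim(3)])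
    have "var_under ?\<kappa> \<phi> = (\<integral>\<zeta>. (\<phi> \<zeta>)\<^sup>2 - 2 * ?m * \<phi> \<zeta> + ?m\<^sup>2 * 1 \<partial>?\<kappa>)"
      unfolding var_under_def conjunct2[OF elim(1)]
      by (rule Bochner_Integration.integral_cong[OF refl]) (simp add: power2_diff algebra_simps)
    also have "\<dots> = (\<integral>\<zeta>. (\<phi> \<zeta>)\<^sup>2 \<partial>?\<kappa>) - 2 * ?m * (\<integral>\<zeta>. \<phi> \<zeta> \<partial>?\<kappa>) + ?m\<^sup>2 * (\<integral>\<zeta>. 1 \<partial>?\<kappa>)"
      by (subst Bochner_Integration.integral_add[OF Bochner_Integration.integrable_diff[OF a b] c],
          subst Bochner_Integration.integral_diff[OF a b]) (simp only: Bochner_Integration.integral_mult_right_zero)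
    also have "\<dots> = real_cond_exp \<nu> (canonical_alg l) (\<lambda>\<zeta>. (\<phi> \<zeta>)\<^sup>2) \<eta> - ?m\<^sup>2"
      unfolding conjunct2[OF elim(1)] conjunct2[OF elim(2)] trans[OF conjunct2[OF elim(3)] elim(4)]
      by (simp add: power2_eq_square)
    finally show ?case .
  qed
qed

lemma dirichlet_box_cond_exp:
  assumes e: "\<And>x. integrable \<nu> (\<lambda>\<eta>. b (translate x \<eta>) * (grad x (x + 1) \<phi> \<eta>)\<^sup>2)"
  shows "AE \<eta> in \<nu>. dirichlet_box (canonical_law \<nu> (particle_number l \<eta>) l \<eta>) b l \<phi>
    = (\<Sum>x | x \<in> box l \<and> x + 1 \<in> box l. real_cond_exp \<nu> (canonical_alg l) (\<lambda>\<eta>. b (translate x \<eta>) * (grad x (x + 1) \<phi> \<eta>)\<^sup>2) \<eta>) / 2"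
proof -
  have "AE \<eta> in \<nu>. \<forall>x. (\<integral>\<zeta>. b (translate x \<zeta>) * (grad x (x + 1) \<phi> \<zeta>)\<^sup>2 \<partial>canonical_law \<nu> (particle_number l \<eta>) l \<eta>)
     = real_cond_exp \<nu> (canonical_alg l) (\<lambda>\<eta>. b (translate x \<eta>) * (grad x (x + 1) \<phi> \<eta>)\<^sup>2) \<eta>"
    unfolding AE_all_countable using canonical_law_integral[OF e] by (auto elim!: eventually_mono)
  then show ?thesis unfolding dirichlet_box_def by eventually_elim simp
qed

lemma square_integrable_cond_exp:
  assumes \<phi>: "square_integrable \<nu> \<phi>"
  shows "square_integrable \<nu> (real_cond_exp \<nu> (canonical_alg l) \<phi>)"
proof -
  have "integrable \<nu> (\<lambda>\<eta>. (real_cond_exp \<nu> (canonical_alg l) \<phi> \<eta>)\<^sup>2)"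
    by (rule can.integrable_convex_cond_exp[where I=UNIV])
      (use square_integrable_integrable[OF \<phi>] square_integrable_sq[OF \<phi>] convex_power2 in auto)
  then show ?thesis using \<phi> by (simp add: square_integrable_def)
qed

text \<open>The weighted Cauchy-Schwarz inequality with the weight \<open>z\<close>, a measurable lower bound for the inverse
  spectral gap, avoids having to know that \<open>inv_gap\<close> is measurable.\<close>

lemma gap_bound:
  assumes b: "\<And>\<eta>. 0 \<le> b n \<eta>" and G: "0 \<le> G"
    and gap: "(\<integral>\<^sup>+\<eta>. (inv_gap \<nu> b (particle_number l \<eta>) l \<eta> n)\<^sup>2 \<partial>\<nu>) \<le> ennreal G"
    and F: "F \<in> borel_measurable \<nu>" "integrable \<nu> (\<lambda>\<eta>. (F \<eta>) ^ 4)"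
    and F0: "AE \<eta> in \<nu>. real_cond_exp \<nu> (canonical_alg l) F \<eta> = 0"
    and \<phi>: "square_integrable \<nu> \<phi>"
    and e: "\<And>x. integrable \<nu> (\<lambda>\<eta>. b n (translate x \<eta>) * (grad x (x + 1) \<phi> \<eta>)\<^sup>2)"
  shows "(ip \<nu> F \<phi>)\<^sup>2 \<le> sqrt (\<integral>\<eta>. (F \<eta>) ^ 4 \<partial>\<nu>) * sqrt G
     * ((\<Sum>x | x \<in> box l \<and> x + 1 \<in> box l. bond_energy \<nu> (b n) x \<phi>) / 2)"
proof -
  let ?E = "real_cond_exp \<nu> (canonical_alg l)"
  let ?B = "{x. x \<in> box l \<and> x + 1 \<in> box l}"
  have F4: "(F \<eta>) ^ 4 = ((F \<eta>)\<^sup>2)\<^sup>2" for \<eta> by (simp flip: power_mult)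
  have F2sq: "square_integrable \<nu> (\<lambda>\<eta>. (F \<eta>)\<^sup>2)"
    unfolding square_integrable_def F4[symmetric] using F by auto
  have Fsq: "square_integrable \<nu> F" using F(1) square_integrable_integrable[OF F2sq] by (simp add: square_integrable_def)
  define v where "v \<eta> = ?E (\<lambda>\<zeta>. (\<phi> \<zeta>)\<^sup>2) \<eta> - (?E \<phi> \<eta>)\<^sup>2" for \<eta>
  define d where "d \<eta> = (\<Sum>x\<in>?B. ?E (\<lambda>\<eta>. b n (translate x \<eta>) * (grad x (x + 1) \<phi> \<eta>)\<^sup>2) \<eta>) / 2" for \<eta>
  define Z where "Z \<eta> = ennreal (v \<eta>) / ennreal (d \<eta>)" for \<eta>
  define z where "z \<eta> = enn2real (Z \<eta>)" for \<eta>
  have [measurable]: "v \<in> borel_measurable (canonical_alg l)" "d \<in> borel_measurable (canonical_alg l)"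
    unfolding v_def[abs_def] d_def[abs_def] by measurable
  have zm[measurable]: "z \<in> borel_measurable (canonical_alg l)"
    and Zm[measurable]: "Z \<in> borel_measurable (canonical_alg l)"
    unfolding z_def[abs_def] Z_def[abs_def] by measurable
  note meas\<nu> = measurable_from_subalg[OF subalgebra_canonical]
  have Z2: "(\<integral>\<^sup>+\<eta>. (Z \<eta>)\<^sup>2 \<partial>\<nu>) \<le> ennreal G"
  proof -
    have "(\<integral>\<^sup>+\<eta>. (Z \<eta>)\<^sup>2 \<partial>\<nu>) \<le> (\<integral>\<^sup>+\<eta>. (inv_gap \<nu> b (particle_number l \<eta>) l \<eta> n)\<^sup>2 \<partial>\<nu>)"
    proof (rule nn_integral_mono_AE)
      show "AE \<eta> in \<nu>. (Z \<eta>)\<^sup>2 \<le> (inv_gap \<nu> b (particle_number l \<eta>) l \<eta> n)\<^sup>2"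
        using var_under_cond_exp[OF \<phi>, of l] dirichlet_box_cond_exp[OF e, of l]
      proof eventually_elim
        case (elim \<eta>)
        have "Z \<eta> \<le> inv_gap \<nu> b (particle_number l \<eta>) l \<eta> n"
          using inv_gap_lower[of "particle_number l \<eta>" l \<eta> \<phi> b n] unfolding Z_def v_def d_def elim .
        then show ?case by (rule power_mono) simp
      qed
    qed
    also note gap
    finally show ?thesis .
  qed
  \<comment> \<open>\<open>enn2real\<close> sends infinity to zero, so without almost sure
    finiteness the bound of \<open>v\<close> by \<open>z * d\<close> could fail.\<close>
  have Zfin: "AE \<eta> in \<nu>. Z \<eta> \<noteq> \<infinity>"
  proof -
    have "AE \<eta> in \<nu>. (Z \<eta>)\<^sup>2 \<noteq> \<infinity>"
      by (rule nn_integral_PInf_AE) (use meas\<nu>[OF Zm] Z2 in \<open>auto simp: top_unique\<close>)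
    then show ?thesis by eventually_elim auto
  qed
  have zz: "AE \<eta> in \<nu>. ennreal ((z \<eta>)\<^sup>2) = (Z \<eta>)\<^sup>2"
    using Zfin by eventually_elim (simp add: z_def less_top flip: ennreal_power)
  have z2: "(\<integral>\<^sup>+\<eta>. ennreal ((z \<eta>)\<^sup>2) \<partial>\<nu>) \<le> ennreal G"
    using Z2 nn_integral_cong_AE[OF zz] by simp
  have zsq: "square_integrable \<nu> z"
    unfolding square_integrable_def
  proof
    show "z \<in> borel_measurable \<nu>" by (rule meas\<nu>[OF zm])
    then show "integrable \<nu> (\<lambda>\<eta>. (z \<eta>)\<^sup>2)"
      by (intro integrableI_nonneg) (use z2 in \<open>auto simp: top_unique less_top[symmetric]\<close>)
  qed
  have nz: "n2 \<nu> z \<le> sqrt G"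
  proof -
    have "ennreal (\<integral>\<eta>. (z \<eta>)\<^sup>2 \<partial>\<nu>) \<le> ennreal G"
      using z2 nn_integral_eq_integral[OF square_integrable_sq[OF zsq]] by simp
    then show ?thesis unfolding n2_def using G by simp
  qed
  have znn: "0 \<le> z \<eta>" for \<eta> by (simp add: z_def)
  have dnn: "AE \<eta> in \<nu>. 0 \<le> d \<eta>"
  proof -
    have "AE \<eta> in \<nu>. \<forall>x. 0 \<le> ?E (\<lambda>\<eta>. b n (translate x \<eta>) * (grad x (x + 1) \<phi> \<eta>)\<^sup>2) \<eta>"
      unfolding AE_all_countable by (intro allI can.real_cond_exp_pos) (use b e in auto)
    then show ?thesis unfolding d_def by eventually_elim (auto intro!: sum_nonneg)
  qed
  have vzd: "AE \<eta> in \<nu>. v \<eta> \<le> z \<eta> * d \<eta>"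
    using Zfin dnn
  proof eventually_elim
    case (elim \<eta>)
    show ?case
    proof (cases "d \<eta> = 0")
      case True
      \<comment> \<open>In \<open>ennreal\<close> a positive number divided by zero is infinite, so
        finiteness of \<open>Z\<close> excludes positive variance with zero energy.\<close>
      then have "ennreal (v \<eta>) = 0"
        using elim(1) unfolding Z_def by (auto split: if_splits)
      then show ?thesis using True by (simp add: ennreal_eq_0_iff)
    next
      case False
      then have d: "0 < d \<eta>" using elim(2) by simp
      have "z \<eta> = max 0 (v \<eta>) / d \<eta>"
        unfolding z_def Z_def using d by (cases "0 \<le> v \<eta>") (auto simp: divide_ennreal ennreal_neg)
      then show ?thesis using d by simp
    qed
  qed
  let ?\<phi>' = "?E \<phi>"
  define \<psi> where "\<psi> \<eta> = \<phi> \<eta> - ?\<phi>' \<eta>" for \<eta>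
  have csq: "square_integrable \<nu> ?\<phi>'" by (rule square_integrable_cond_exp[OF \<phi>])
  have \<psi>sq: "square_integrable \<nu> \<psi>" unfolding \<psi>_def[abs_def] by (rule square_integrable_diff[OF \<phi> csq])
  \<comment> \<open>\<open>F\<close> is orthogonal to what is measurable in the canonical algebra,
    so \<open>\<phi>\<close> may be centred by its conditional expectation; the centred function has
    conditional second moment \<open>v\<close>.\<close>
  have "(\<integral>\<eta>. ?\<phi>' \<eta> * F \<eta> \<partial>\<nu>) = (\<integral>\<eta>. ?\<phi>' \<eta> * ?E F \<eta> \<partial>\<nu>)"
    by (rule can.real_cond_exp_intg(2)[symmetric]) (use F(1) square_integrable_mult[OF csq Fsq] in auto)
  also have "\<dots> = (\<integral>\<eta>. 0 \<partial>\<nu>)"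
  proof (rule integral_cong_AE)
    show "AE \<eta> in \<nu>. ?\<phi>' \<eta> * ?E F \<eta> = 0" using F0 by eventually_elim simp
  qed (use csq in \<open>auto simp: square_integrable_def\<close>)
  finally have F\<psi>: "ip \<nu> F \<phi> = ip \<nu> F \<psi>"
    unfolding \<psi>_def[abs_def] ip_diff_right[OF \<phi> csq Fsq] by (simp add: ip_def mult.commute)
  have E\<psi>: "AE \<eta> in \<nu>. ?E (\<lambda>\<zeta>. (\<psi> \<zeta>)\<^sup>2) \<eta> = v \<eta>"
  proof -
    have i1: "integrable \<nu> (\<lambda>\<eta>. (\<phi> \<eta>)\<^sup>2)" by (rule square_integrable_sq[OF \<phi>])
    have i2: "integrable \<nu> (\<lambda>\<eta>. ?\<phi>' \<eta> * \<phi> \<eta>)" by (rule square_integrable_mult[OF csq \<phi>])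
    have i3: "integrable \<nu> (\<lambda>\<eta>. (?\<phi>' \<eta>)\<^sup>2)" by (rule square_integrable_sq[OF csq])
    have eq: "(\<lambda>\<zeta>. (\<psi> \<zeta>)\<^sup>2) = (\<lambda>\<zeta>. ((\<phi> \<zeta>)\<^sup>2 - 2 * (?\<phi>' \<zeta> * \<phi> \<zeta>)) + (?\<phi>' \<zeta>)\<^sup>2)"
      by (auto simp: \<psi>_def power2_diff)
    have "AE \<eta> in \<nu>. ?E (\<lambda>\<zeta>. ((\<phi> \<zeta>)\<^sup>2 - 2 * (?\<phi>' \<zeta> * \<phi> \<zeta>)) + (?\<phi>' \<zeta>)\<^sup>2) \<eta>
       = ?E (\<lambda>\<zeta>. (\<phi> \<zeta>)\<^sup>2 - 2 * (?\<phi>' \<zeta> * \<phi> \<zeta>)) \<eta> + ?E (\<lambda>\<zeta>. (?\<phi>' \<zeta>)\<^sup>2) \<eta>"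
      by (rule can.real_cond_exp_add) (use i1 i2 i3 in auto)
    moreover have "AE \<eta> in \<nu>. ?E (\<lambda>\<zeta>. (\<phi> \<zeta>)\<^sup>2 - 2 * (?\<phi>' \<zeta> * \<phi> \<zeta>)) \<eta> = ?E (\<lambda>\<zeta>. (\<phi> \<zeta>)\<^sup>2) \<eta> - ?E (\<lambda>\<zeta>. 2 * (?\<phi>' \<zeta> * \<phi> \<zeta>)) \<eta>"
      by (rule can.real_cond_exp_diff) (use i1 i2 in auto)
    moreover have "AE \<eta> in \<nu>. ?E (\<lambda>\<zeta>. 2 * (?\<phi>' \<zeta> * \<phi> \<zeta>)) \<eta> = 2 * ?E (\<lambda>\<zeta>. ?\<phi>' \<zeta> * \<phi> \<zeta>) \<eta>"
      by (rule can.real_cond_exp_cmult[OF i2])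
    moreover have "AE \<eta> in \<nu>. ?E (\<lambda>\<zeta>. ?\<phi>' \<zeta> * \<phi> \<zeta>) \<eta> = ?\<phi>' \<eta> * ?E \<phi> \<eta>"
      by (rule can.real_cond_exp_mult) (use i2 \<phi> in \<open>auto simp: square_integrable_def\<close>)
    moreover have "AE \<eta> in \<nu>. ?E (\<lambda>\<zeta>. (?\<phi>' \<zeta>)\<^sup>2) \<eta> = (?\<phi>' \<eta>)\<^sup>2"
      by (rule can.real_cond_exp_F_meas[OF i3]) measurable
    ultimately show ?thesis unfolding eq
      by eventually_elim (simp add: v_def power2_eq_square)
  qed
  let ?D = "(\<Sum>x\<in>?B. bond_energy \<nu> (b n) x \<phi>) / 2"
  have di: "integrable \<nu> d" unfolding d_def[abs_def] by (auto intro!: Bochner_Integration.integrable_sum can.real_cond_exp_int(1) e)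
  have dI: "(\<integral>\<eta>. d \<eta> \<partial>\<nu>) = ?D"
    unfolding d_def bond_energy_def
    by (simp add: can.real_cond_exp_int(1)[OF e] can.real_cond_exp_int(2)[OF e])
  let ?K = "sqrt (\<integral>\<eta>. (F \<eta>) ^ 4 \<partial>\<nu>) * sqrt G"
  have main: "(ip \<nu> F \<psi>)\<^sup>2 \<le> (?K + \<epsilon> * (n2 \<nu> F)\<^sup>2) * ?D" if eps: "0 < \<epsilon>" for \<epsilon>
  proof -
    \<comment> \<open>The shift by \<open>\<epsilon>\<close> keeps the weight away from zero, so
      that dividing by its square root preserves integrability. It is removed at the end.\<close>
    define s where "s \<eta> = z \<eta> + \<epsilon>" for \<eta>
    have s: "0 < s \<eta>" for \<eta> using znn[of \<eta>] eps by (simp add: s_def)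
    have sm[measurable]: "s \<in> borel_measurable (canonical_alg l)" unfolding s_def[abs_def] by measurable
    note s\<nu>[measurable] = meas\<nu>[OF sm]
    note [measurable] = F(1) square_integrable_measurable[OF \<psi>sq]
    let ?f = "\<lambda>\<eta>. F \<eta> * sqrt (s \<eta>)" and ?g = "\<lambda>\<eta>. \<psi> \<eta> / sqrt (s \<eta>)"
    have f2: "(?f \<eta>)\<^sup>2 = (F \<eta>)\<^sup>2 * z \<eta> + \<epsilon> * (F \<eta>)\<^sup>2" for \<eta>
      using s[of \<eta>] by (simp add: power_mult_distrib s_def algebra_simps)
    have g2: "(?g \<eta>)\<^sup>2 = 1 / s \<eta> * (\<psi> \<eta>)\<^sup>2" for \<eta>
      using s[of \<eta>] by (simp add: power_divide)
    have fi: "integrable \<nu> (\<lambda>\<eta>. (F \<eta>)\<^sup>2 * z \<eta>)" by (rule square_integrable_mult[OF F2sq zsq])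
    have fsq: "square_integrable \<nu> ?f"
      unfolding square_integrable_def f2 using fi square_integrable_sq[OF Fsq] by auto
    have gsi: "integrable \<nu> (\<lambda>\<eta>. 1 / s \<eta> * (\<psi> \<eta>)\<^sup>2)"
    proof (rule Bochner_Integration.integrable_bound)
      show "integrable \<nu> (\<lambda>\<eta>. 1 / \<epsilon> * (\<psi> \<eta>)\<^sup>2)" using square_integrable_sq[OF \<psi>sq] by simp
      have "\<bar>1 / s \<eta>\<bar> \<le> \<bar>1 / \<epsilon>\<bar>" for \<eta> using eps znn[of \<eta>] by (simp add: s_def frac_le)
      then show "AE \<eta> in \<nu>. norm (1 / s \<eta> * (\<psi> \<eta>)\<^sup>2) \<le> norm (1 / \<epsilon> * (\<psi> \<eta>)\<^sup>2)"
        unfolding real_norm_def abs_mult by (intro always_eventually allI mult_right_mono) auto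
    qed measurable
    have gsq: "square_integrable \<nu> ?g" unfolding square_integrable_def g2 using gsi by auto
    have "(n2 \<nu> ?g)\<^sup>2 = (\<integral>\<eta>. 1 / s \<eta> * (\<psi> \<eta>)\<^sup>2 \<partial>\<nu>)" unfolding n2_sq g2 ..
    \<comment> \<open>The weight is measurable in the canonical algebra, so the square of
      \<open>\<psi>\<close> may be replaced by its conditional expectation \<open>v\<close>, which
      is at most \<open>s * d\<close>.\<close>
    also have "\<dots> = (\<integral>\<eta>. 1 / s \<eta> * ?E (\<lambda>\<zeta>. (\<psi> \<zeta>)\<^sup>2) \<eta> \<partial>\<nu>)"
      by (rule can.real_cond_exp_intg(2)[symmetric, OF gsi]) measurable
    also have "\<dots> \<le> (\<integral>\<eta>. d \<eta> \<partial>\<nu>)"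
    proof (rule integral_mono_AE[OF _ di])
      show "integrable \<nu> (\<lambda>\<eta>. 1 / s \<eta> * ?E (\<lambda>\<zeta>. (\<psi> \<zeta>)\<^sup>2) \<eta>)"
        by (rule can.real_cond_exp_intg(1)[OF gsi]) measurable
      show "AE \<eta> in \<nu>. 1 / s \<eta> * ?E (\<lambda>\<zeta>. (\<psi> \<zeta>)\<^sup>2) \<eta> \<le> d \<eta>"
        using E\<psi> vzd dnn
      proof eventually_elim
        case (elim \<eta>)
        have "v \<eta> \<le> s \<eta> * d \<eta>" using elim(2,3) eps by (simp add: s_def distrib_right add_increasing2)
        then show ?case using elim(1) s[of \<eta>] by (simp add: pos_divide_le_eq mult.commute)
      qed
    qed
    finally have gD: "(n2 \<nu> ?g)\<^sup>2 \<le> ?D" using dI by simp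
    have "(n2 \<nu> ?f)\<^sup>2 = ip \<nu> (\<lambda>\<eta>. (F \<eta>)\<^sup>2) z + \<epsilon> * (n2 \<nu> F)\<^sup>2"
      unfolding n2_sq f2 ip_def using fi square_integrable_sq[OF Fsq] by simp
    also have "ip \<nu> (\<lambda>\<eta>. (F \<eta>)\<^sup>2) z \<le> n2 \<nu> (\<lambda>\<eta>. (F \<eta>)\<^sup>2) * n2 \<nu> z"
      using ip_Cauchy_Schwarz[OF F2sq zsq] by linarith
    also have "\<dots> \<le> ?K" unfolding n2_def[of \<nu> "\<lambda>\<eta>. (F \<eta>)\<^sup>2"] F4 by (intro mult_left_mono nz) simp
    finally have fK: "(n2 \<nu> ?f)\<^sup>2 \<le> ?K + \<epsilon> * (n2 \<nu> F)\<^sup>2" by simp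
    have "ip \<nu> F \<psi> = ip \<nu> ?f ?g"
      unfolding ip_def using s by (intro Bochner_Integration.integral_cong refl) (simp add: less_imp_neq[symmetric])
    then have "\<bar>ip \<nu> F \<psi>\<bar> \<le> n2 \<nu> ?f * n2 \<nu> ?g" using ip_Cauchy_Schwarz[OF fsq gsq] by simp
    then have "\<bar>ip \<nu> F \<psi>\<bar>\<^sup>2 \<le> (n2 \<nu> ?f * n2 \<nu> ?g)\<^sup>2" by (rule power_mono) simp
    then have "(ip \<nu> F \<psi>)\<^sup>2 \<le> (n2 \<nu> ?f)\<^sup>2 * (n2 \<nu> ?g)\<^sup>2" by (simp add: power_mult_distrib)
    also have "\<dots> \<le> (?K + \<epsilon> * (n2 \<nu> F)\<^sup>2) * ?D"
      by (rule mult_mono[OF fK gD]) (use eps G in auto)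
    finally show ?thesis .
  qed
  have lim: "((\<lambda>\<epsilon>. (?K + \<epsilon> * (n2 \<nu> F)\<^sup>2) * ?D) \<longlongrightarrow> (?K + 0 * (n2 \<nu> F)\<^sup>2) * ?D) (at_right 0)"
    by (intro tendsto_intros)
  have "(ip \<nu> F \<psi>)\<^sup>2 \<le> (?K + 0 * (n2 \<nu> F)\<^sup>2) * ?D"
    by (rule tendsto_lowerbound[OF lim]) (use main in \<open>auto simp: eventually_at_right_field intro: exI[of _ 1]\<close>)
  then show ?thesis unfolding F\<psi> by simp
qed

end

subsection \<open>Fourth and fifth moments\<close>

lemma Lnorm_nonneg[simp]: "0 \<le> Lnorm p M f"
  by (simp add: Lnorm_def)

lemma Lnorm_4_pow: "(Lnorm 4 M f) ^ 4 = (\<integral>x. (f x) ^ 4 \<partial>M)"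
proof -
  have "(\<integral>x. \<bar>f x\<bar> powr 4 \<partial>M) = (\<integral>x. (f x) ^ 4 \<partial>M)" by (simp add: abs_powr_numeral)
  moreover have "0 \<le> (\<integral>x. (f x) ^ 4 \<partial>M)" by (rule Bochner_Integration.integral_nonneg) simp
  ultimately show ?thesis
    unfolding Lnorm_def by (cases "(\<integral>x. (f x) ^ 4 \<partial>M) = 0") (simp_all add: powr_powr flip: powr_realpow)
qed

lemma Lnorm_5_pow: "(Lnorm 5 M f) ^ 5 = (\<integral>x. \<bar>f x\<bar> ^ 5 \<partial>M)"
proof -
  have "(\<integral>x. \<bar>f x\<bar> powr 5 \<partial>M) = (\<integral>x. \<bar>f x\<bar> ^ 5 \<partial>M)" by (simp add: abs_powr_numeral)
  moreover have "0 \<le> (\<integral>x. \<bar>f x\<bar> ^ 5 \<partial>M)" by (rule Bochner_Integration.integral_nonneg) simp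
  ultimately show ?thesis
    unfolding Lnorm_def by (cases "(\<integral>x. \<bar>f x\<bar> ^ 5 \<partial>M) = 0") (simp_all add: powr_powr flip: powr_realpow)
qed

lemma Lnorm_4_le:
  assumes "(\<integral>x. (f x) ^ 4 \<partial>M) \<le> B ^ 4" "0 \<le> B" shows "Lnorm 4 M f \<le> B"
  using assms unfolding Lnorm_4_pow[symmetric] by (simp add: power_mono_iff)

definition fourth_integrable :: "'a measure \<Rightarrow> ('a \<Rightarrow> real) \<Rightarrow> bool" where
  "fourth_integrable M f \<longleftrightarrow> f \<in> borel_measurable M \<and> integrable M (\<lambda>x. (f x) ^ 4)"

lemma pow4_add_le: "(a + b) ^ 4 \<le> 8 * (a ^ 4 + (b::real) ^ 4)"
proof -
  have 1: "(a + b)\<^sup>2 \<le> 2 * (a\<^sup>2 + b\<^sup>2)" for a b :: real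
    using zero_le_power2[of "a - b"] by (simp add: power2_sum power2_diff)
  have "((a + b)\<^sup>2)\<^sup>2 \<le> (2 * (a\<^sup>2 + b\<^sup>2))\<^sup>2" by (rule power_mono[OF 1]) simp
  also have "\<dots> = 4 * (a\<^sup>2 + b\<^sup>2)\<^sup>2" unfolding power_mult_distrib by simp
  also have "\<dots> \<le> 4 * (2 * ((a\<^sup>2)\<^sup>2 + (b\<^sup>2)\<^sup>2))" by (intro mult_left_mono 1) simp
  finally show ?thesis by (simp flip: power_mult)
qed

text \<open>A triangle inequality with an extra factor \<open>2\<close> is enough for the later
  estimates. It follows from \<open>pow4_add_le\<close> because
  \<open>8 * 2 = 2 ^ 4\<close>.\<close>

lemma fourth_integrable_add:
  assumes "fourth_integrable M f" "fourth_integrable M g"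
  shows "fourth_integrable M (\<lambda>x. f x + g x)"
    and "Lnorm 4 M (\<lambda>x. f x + g x) \<le> 2 * (Lnorm 4 M f + Lnorm 4 M g)"
proof -
  have m[measurable]: "f \<in> borel_measurable M" "g \<in> borel_measurable M"
    and i: "integrable M (\<lambda>x. (f x) ^ 4)" "integrable M (\<lambda>x. (g x) ^ 4)"
    using assms by (auto simp: fourth_integrable_def)
  have i8: "integrable M (\<lambda>x. 8 * ((f x) ^ 4 + (g x) ^ 4))" using i by simp
  have int: "integrable M (\<lambda>x. (f x + g x) ^ 4)"
    by (rule Bochner_Integration.integrable_bound[OF i8]) (use pow4_add_le in \<open>auto intro!: always_eventually\<close>)
  then show "fourth_integrable M (\<lambda>x. f x + g x)" by (simp add: fourth_integrable_def)
  let ?a = "Lnorm 4 M f" and ?b = "Lnorm 4 M g"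
  show "Lnorm 4 M (\<lambda>x. f x + g x) \<le> 2 * (?a + ?b)"
  proof (rule Lnorm_4_le)
    have "(\<integral>x. (f x + g x) ^ 4 \<partial>M) \<le> (\<integral>x. 8 * ((f x) ^ 4 + (g x) ^ 4) \<partial>M)"
      by (rule integral_mono[OF int i8]) (rule pow4_add_le)
    also have "\<dots> = 8 * (?a ^ 4 + ?b ^ 4)" using i by (simp add: Lnorm_4_pow)
    also have "\<dots> \<le> 8 * ((?a + ?b) ^ 4 + (?a + ?b) ^ 4)"
      by (intro mult_left_mono add_mono power_mono) auto
    also have "\<dots> = (2 * (?a + ?b)) ^ 4" unfolding power_mult_distrib by simp
    finally show "(\<integral>x. (f x + g x) ^ 4 \<partial>M) \<le> (2 * (?a + ?b)) ^ 4" .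
  qed simp
qed

lemma fourth_integrable_cmult:
  assumes "fourth_integrable M f"
  shows "fourth_integrable M (\<lambda>x. c * f x)" "Lnorm 4 M (\<lambda>x. c * f x) \<le> \<bar>c\<bar> * Lnorm 4 M f"
proof -
  show "fourth_integrable M (\<lambda>x. c * f x)" using assms by (auto simp: fourth_integrable_def power_mult_distrib)
  show "Lnorm 4 M (\<lambda>x. c * f x) \<le> \<bar>c\<bar> * Lnorm 4 M f"
    by (rule Lnorm_4_le) (simp_all add: power_mult_distrib Lnorm_4_pow)
qed

lemma fourth_integrable_diff:
  assumes "fourth_integrable M f" "fourth_integrable M g"
  shows "fourth_integrable M (\<lambda>x. f x - g x)"
    and "Lnorm 4 M (\<lambda>x. f x - g x) \<le> 2 * (Lnorm 4 M f + Lnorm 4 M g)"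
  using fourth_integrable_add[OF assms(1) fourth_integrable_cmult(1)[OF assms(2), of "-1"]]
    fourth_integrable_cmult(2)[OF assms(2), of "-1"] by auto

text \<open>The tangent inequality for the convex power \<open>5/4\<close> of \<open>u ^ 4\<close>,
  in factored form. With \<open>a\<close> the fourth norm, integrating it shows that the fourth norm
  is at most the fifth.\<close>

lemma pow4_pow5_tangent: "5 * a * u ^ 4 - a ^ 5 \<le> 4 * (u::real) ^ 5" if "0 \<le> u" "0 \<le> a"
proof -
  have "0 \<le> (u - a)\<^sup>2 * (4 * u ^ 3 + 3 * a * u\<^sup>2 + 2 * a\<^sup>2 * u + a ^ 3)" using that by simp
  also have "\<dots> = 4 * u ^ 5 - 5 * a * u ^ 4 + a ^ 5" by (simp add: power2_eq_square numeral_eq_Suc algebra_simps)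
  finally show ?thesis by simp
qed

context prob_space
begin

lemma fourth_integrable_const[simp]: "fourth_integrable M (\<lambda>_. c)"
  by (simp add: fourth_integrable_def)

lemma Lnorm_4_const: "Lnorm 4 M (\<lambda>_. c) \<le> \<bar>c\<bar>"
  by (rule Lnorm_4_le) (simp_all add: prob_space)

lemma square_of_fourth:
  assumes "fourth_integrable M f"
  shows "square_integrable M (\<lambda>x. (f x)\<^sup>2)" "square_integrable M f" "n2 M f \<le> Lnorm 4 M f"
proof -
  have p: "((f x)\<^sup>2)\<^sup>2 = (f x) ^ 4" for x by (simp flip: power_mult)
  show s2: "square_integrable M (\<lambda>x. (f x)\<^sup>2)" using assms unfolding square_integrable_def p fourth_integrable_def by auto
  show s: "square_integrable M f"
    using assms square_integrable_integrable[OF s2] by (simp add: square_integrable_def fourth_integrable_def)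
  have "(n2 M f)\<^sup>2 \<le> n2 M (\<lambda>x. (f x)\<^sup>2)" unfolding n2_sq using abs_integral_le_n2[OF s2] by linarith
  then have "((n2 M f)\<^sup>2)\<^sup>2 \<le> (n2 M (\<lambda>x. (f x)\<^sup>2))\<^sup>2" by (rule power_mono) simp
  also have "\<dots> = (Lnorm 4 M f) ^ 4" unfolding n2_sq p Lnorm_4_pow ..
  finally have "(n2 M f) ^ 4 \<le> (Lnorm 4 M f) ^ 4" by (simp flip: power_mult)
  then show "n2 M f \<le> Lnorm 4 M f" by (simp add: power_mono_iff)
qed

lemma fourth_of_fifth:
  assumes "f \<in> Lp 5 M"
  shows "fourth_integrable M f" "Lnorm 4 M f \<le> Lnorm 5 M f"
proof -
  have [measurable]: "f \<in> borel_measurable M" and i5: "integrable M (\<lambda>x. \<bar>f x\<bar> ^ 5)"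
    using assms by (auto simp: Lp_def abs_powr_numeral)
  have "integrable M (\<lambda>x. 1 + \<bar>f x\<bar> ^ 5)" using i5 by simp
  then have i4: "integrable M (\<lambda>x. (f x) ^ 4)"
  proof (rule Bochner_Integration.integrable_bound)
    have "u ^ 4 \<le> 1 + u ^ 5" if "0 \<le> u" for u :: real
    proof (cases "u \<le> 1")
      case True
      then have "u ^ 4 \<le> 1" using that by (intro power_le_one)
      then show ?thesis using zero_le_power[OF that, of 5] by linarith
    next
      case False
      then have "u ^ 4 \<le> u ^ 5" by (intro power_increasing) auto
      then show ?thesis by simp
    qed
    from this[of "\<bar>f x\<bar>" for x] show "AE x in M. norm ((f x) ^ 4) \<le> norm (1 + \<bar>f x\<bar> ^ 5)"
      by (intro always_eventually allI) (simp add: power_even_abs abs_of_nonneg)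
  qed measurable
  then show f4: "fourth_integrable M f" by (simp add: fourth_integrable_def)
  define a where "a = Lnorm 4 M f"
  have a0: "0 \<le> a" by (simp add: a_def)
  have "(\<integral>x. 5 * a * (f x) ^ 4 - a ^ 5 \<partial>M) \<le> (\<integral>x. 4 * \<bar>f x\<bar> ^ 5 \<partial>M)"
  proof (rule integral_mono)
    show "5 * a * (f x) ^ 4 - a ^ 5 \<le> 4 * \<bar>f x\<bar> ^ 5" for x
      using pow4_pow5_tangent[of "\<bar>f x\<bar>" a] a0 by (simp add: power_even_abs)
  qed (use i4 i5 in auto)
  then have "5 * a * a ^ 4 - a ^ 5 \<le> 4 * (Lnorm 5 M f) ^ 5"
    using i4 i5 by (simp add: prob_space a_def Lnorm_4_pow Lnorm_5_pow)
  then have "a ^ 5 \<le> (Lnorm 5 M f) ^ 5" by (simp add: numeral_eq_Suc)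
  then show "Lnorm 4 M f \<le> Lnorm 5 M f" using a0 unfolding a_def by (simp add: power_mono_iff)
qed

end

lemma convex_pow4: "convex_on UNIV (\<lambda>x::real. x ^ 4)"
  by (rule convex_on_realI[where f'="\<lambda>x. 4 * x ^ 3"])
    (auto intro!: derivative_eq_intros simp: power_mono_odd)

context stationary_config
begin

lemma cond_exp_fourth:
  assumes f: "fourth_integrable \<nu> f"
  shows "fourth_integrable \<nu> (real_cond_exp \<nu> (canonical_alg l) f)"
    "Lnorm 4 \<nu> (real_cond_exp \<nu> (canonical_alg l) f) \<le> Lnorm 4 \<nu> f"
proof -
  have i: "integrable \<nu> f" using square_integrable_integrable[OF square_of_fourth(2)[OF f]] .
  have i4: "integrable \<nu> (\<lambda>x. (f x) ^ 4)" using f by (simp add: fourth_integrable_def)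
  have c4: "integrable \<nu> (\<lambda>\<eta>. (real_cond_exp \<nu> (canonical_alg l) f \<eta>) ^ 4)"
    by (rule can.integrable_convex_cond_exp[where I=UNIV and q="\<lambda>x. x ^ 4"]) (use i i4 convex_pow4 in auto)
  then show f4: "fourth_integrable \<nu> (real_cond_exp \<nu> (canonical_alg l) f)"
    unfolding fourth_integrable_def by auto
  have "AE \<eta> in \<nu>. (real_cond_exp \<nu> (canonical_alg l) f \<eta>) ^ 4 \<le> real_cond_exp \<nu> (canonical_alg l) (\<lambda>x. (f x) ^ 4) \<eta>"
    by (rule can.real_cond_exp_jensens_inequality(2)[where I=UNIV and q="\<lambda>x. x ^ 4"]) (use i i4 convex_pow4 in auto)
  then have "(\<integral>\<eta>. (real_cond_exp \<nu> (canonical_alg l) f \<eta>) ^ 4 \<partial>\<nu>) \<le> (\<integral>\<eta>. real_cond_exp \<nu> (canonical_alg l) (\<lambda>x. (f x) ^ 4) \<eta> \<partial>\<nu>)"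
    by (intro integral_mono_AE c4 can.real_cond_exp_int(1) i4)
  also have "\<dots> = (Lnorm 4 \<nu> f) ^ 4" by (simp add: can.real_cond_exp_int(2)[OF i4] Lnorm_4_pow)
  finally show "Lnorm 4 \<nu> (real_cond_exp \<nu> (canonical_alg l) f) \<le> Lnorm 4 \<nu> f" by (rule Lnorm_4_le) simp
qed

lemma Lnorm_translate:
  assumes "f \<in> borel_measurable \<nu>" shows "Lnorm p \<nu> (\<lambda>\<eta>. f (translate x \<eta>)) = Lnorm p \<nu> f"
  using integral_translate[of "\<lambda>\<eta>. \<bar>f \<eta>\<bar> powr p" x] assms by (simp add: Lnorm_def)

lemma fourth_integrable_translate:
  assumes "fourth_integrable \<nu> f" shows "fourth_integrable \<nu> (\<lambda>\<eta>. f (translate x \<eta>))"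
proof -
  have [measurable]: "f \<in> borel_measurable \<nu>" using assms by (simp add: fourth_integrable_def)
  show ?thesis using assms integrable_translate[of "\<lambda>\<eta>. (f \<eta>) ^ 4" x] by (simp add: fourth_integrable_def)
qed

subsection \<open>Density fluctuations of a block\<close>

text \<open>The fourth norm of the squared density fluctuation is an eighth moment.\<close>

lemma pow8_sum_integrable:
  assumes "finite S"
  shows "integrable \<nu> (\<lambda>\<eta>. (\<Sum>x\<in>S. real (\<eta> x) - \<rho>) ^ 8)"
proof -
  have pow8: "(a + b) ^ 8 \<le> 128 * (a ^ 8 + (b::real) ^ 8)" for a b
  proof -
    have "((a + b) ^ 4)\<^sup>2 \<le> (8 * (a ^ 4 + b ^ 4))\<^sup>2" by (rule power_mono[OF pow4_add_le]) simp
    also have "\<dots> = 64 * (a ^ 4 + b ^ 4)\<^sup>2" unfolding power_mult_distrib by simp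
    also have "\<dots> \<le> 64 * (2 * ((a ^ 4)\<^sup>2 + (b ^ 4)\<^sup>2))"
      using zero_le_power2[of "a ^ 4 - b ^ 4"] by (intro mult_left_mono) (simp_all add: power2_sum power2_diff)
    finally show ?thesis by (simp flip: power_mult)
  qed
  have m: "(\<lambda>\<eta>. (\<Sum>x\<in>S. real (\<eta> x) - \<rho>)) \<in> borel_measurable \<nu>" for S :: "int set"
  proof -
    have [measurable]: "(\<lambda>\<eta>. real (\<eta> x)) \<in> borel_measurable \<nu>" for x by (intro local_fun_meas) auto
    show ?thesis by measurable
  qed
  have add: "integrable \<nu> (\<lambda>\<eta>. (f \<eta> + g \<eta>) ^ 8)"
    if [measurable]: "f \<in> borel_measurable \<nu>" "g \<in> borel_measurable \<nu>"
      and i: "integrable \<nu> (\<lambda>\<eta>. (f \<eta>) ^ 8)" "integrable \<nu> (\<lambda>\<eta>. (g \<eta>) ^ 8)" for f g :: "config \<Rightarrow> real"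
  proof (rule Bochner_Integration.integrable_bound)
    show "integrable \<nu> (\<lambda>\<eta>. 128 * ((f \<eta>) ^ 8 + (g \<eta>) ^ 8))" using i by simp
    show "AE \<eta> in \<nu>. norm ((f \<eta> + g \<eta>) ^ 8) \<le> norm (128 * ((f \<eta>) ^ 8 + (g \<eta>) ^ 8))"
      using pow8 by (intro always_eventually allI) simp
  qed measurable
  show ?thesis using assms
  proof induction
    case (insert x S)
    have "(\<lambda>\<eta>. real (\<eta> x)) \<in> borel_measurable \<nu>" by (intro local_fun_meas) auto
    then have "integrable \<nu> (\<lambda>\<eta>. (real (\<eta> x) + (- \<rho>)) ^ 8)"
      by (intro add coord_moment) auto
    then have "integrable \<nu> (\<lambda>\<eta>. ((real (\<eta> x) - \<rho>) + (\<Sum>x\<in>S. real (\<eta> x) - \<rho>)) ^ 8)"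
      using insert m[of S] m[of "{x}"] by (intro add) auto
    then show ?case using insert by simp
  qed simp
qed

definition density_dev :: "nat \<Rightarrow> config \<Rightarrow> real" where
  "density_dev l \<eta> = block_avg l \<eta> 0 - \<rho>"

lemma density_dev_eq: "density_dev l \<eta> = (\<Sum>x\<in>box l. real (\<eta> x) - \<rho>) / (2 * real l + 1)"
  by (simp add: density_dev_def block_avg_def sum_subtractf card_box field_simps)

lemma density_dev_measurable: "density_dev l \<in> borel_measurable \<nu>"
  unfolding density_dev_def[abs_def] measurable_nu by (intro borel_measurable_diff block_avg_measurable) simp

lemma density_dev_sq_fourth: "fourth_integrable \<nu> (\<lambda>\<eta>. (density_dev l \<eta>)\<^sup>2)"
proof -
  have "((density_dev l \<eta>)\<^sup>2) ^ 4 = (\<Sum>x\<in>box l. real (\<eta> x) - \<rho>) ^ 8 / (2 * real l + 1) ^ 8" for \<eta>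
    by (simp add: density_dev_eq power_divide flip: power_mult)
  then show ?thesis
    unfolding fourth_integrable_def using pow8_sum_integrable[OF finite_box[of l]] density_dev_measurable by simp
qed

lemma density_dev_fourth: "fourth_integrable \<nu> (density_dev l)"
proof -
  have "integrable \<nu> (\<lambda>\<eta>. ((density_dev l \<eta>)\<^sup>2)\<^sup>2)"
    using square_integrable_sq[OF square_of_fourth(2)[OF density_dev_sq_fourth]] .
  then show ?thesis unfolding fourth_integrable_def using density_dev_measurable by (simp flip: power_mult)
qed

text \<open>The moment assumption concerns the sites \<open>1, ..., l\<close>. A centred block is a
  translate of the first \<open>2 * l + 1\<close> of them, and \<open>\<nu>\<close> is translation
  invariant.\<close>

lemma density_dev_bounds:
  assumes B: "\<And>l. l \<ge> 1 \<Longrightarrow> Lnorm 4 \<nu> (\<lambda>\<eta>. ((\<Sum>x = 1..int l. real (\<eta> x) - \<rho>) / sqrt (real l))\<^sup>2) \<le> B"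
  shows "Lnorm 4 \<nu> (\<lambda>\<eta>. (density_dev l \<eta>)\<^sup>2) \<le> B / (2 * real l + 1)"
    and "Lnorm 4 \<nu> (density_dev l) \<le> sqrt (B / (2 * real l + 1))"
    and "\<bar>sigma2 \<nu> \<rho> l\<bar> \<le> B"
proof -
  let ?m = "2 * l + 1"
  have rm: "real ?m = 2 * real l + 1" by simp
  let ?U = "\<lambda>\<eta>. ((\<Sum>x = 1..int ?m. real (\<eta> x) - \<rho>) / sqrt (real ?m))\<^sup>2"
  let ?y = "- int l - 1"
  have shift: "(\<Sum>x\<in>box l. real (\<eta> x) - \<rho>) = (\<Sum>x = 1..int ?m. real (translate ?y \<eta> x) - \<rho>)" for \<eta>
    by (rule sum.reindex_bij_witness[of _ "\<lambda>x. x + ?y" "\<lambda>x. x - ?y"]) (auto simp: box_def translate_def)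
  have U: "((\<Sum>x\<in>box l. real (\<eta> x) - \<rho>) / sqrt (2 * real l + 1))\<^sup>2 = ?U (translate ?y \<eta>)" for \<eta>
    unfolding shift rm ..
  have dev: "(density_dev l \<eta>)\<^sup>2 = (1 / real ?m) * ?U (translate ?y \<eta>)" for \<eta>
    unfolding density_dev_eq shift by (simp add: power_divide power2_eq_square add.commute)
  have Um: "?U \<in> borel_measurable \<nu>"
  proof -
    have [measurable]: "(\<lambda>\<eta>. real (\<eta> x)) \<in> borel_measurable \<nu>" for x by (intro local_fun_meas) auto
    show ?thesis by measurable
  qed
  have U4: "fourth_integrable \<nu> ?U"
  proof -
    have "(?U \<eta>) ^ 4 = (\<Sum>x = 1..int ?m. real (\<eta> x) - \<rho>) ^ 8 / (real ?m) ^ 4" for \<eta>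
    proof -
      have "(sqrt (real ?m)) ^ 8 = (real ?m) ^ 4" using power_mult[of "sqrt (real ?m)" 2 4] by simp
      moreover have "(?U \<eta>) ^ 4 = (\<Sum>x = 1..int ?m. real (\<eta> x) - \<rho>) ^ 8 / (sqrt (real ?m)) ^ 8"
        unfolding power_divide power_mult[symmetric] by simp
      ultimately show ?thesis by simp
    qed
    then show ?thesis
      unfolding fourth_integrable_def using Um pow8_sum_integrable[of "{1..int ?m}"] by auto
  qed
  note Ut = fourth_integrable_translate[OF U4, of ?y]
  have BU: "Lnorm 4 \<nu> ?U \<le> B" by (rule B) simp
  have "Lnorm 4 \<nu> (\<lambda>\<eta>. (density_dev l \<eta>)\<^sup>2) \<le> \<bar>1 / real ?m\<bar> * Lnorm 4 \<nu> (\<lambda>\<eta>. ?U (translate ?y \<eta>))"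
    unfolding dev by (rule fourth_integrable_cmult(2)[OF Ut])
  also have "\<dots> = Lnorm 4 \<nu> ?U / real ?m" unfolding Lnorm_translate[OF Um] by simp
  also have "\<dots> \<le> B / real ?m" by (rule divide_right_mono[OF BU]) simp
  finally show dB: "Lnorm 4 \<nu> (\<lambda>\<eta>. (density_dev l \<eta>)\<^sup>2) \<le> B / (2 * real l + 1)" unfolding rm .
  have B0: "0 \<le> B" using BU Lnorm_nonneg order_trans by blast
  show "Lnorm 4 \<nu> (density_dev l) \<le> sqrt (B / (2 * real l + 1))"
  proof (rule Lnorm_4_le)
    let ?s = "\<lambda>\<eta>. (density_dev l \<eta>)\<^sup>2"
    have p: "(density_dev l \<eta>) ^ 4 = (?s \<eta>)\<^sup>2" for \<eta> by (simp flip: power_mult)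
    have "(\<integral>\<eta>. (density_dev l \<eta>) ^ 4 \<partial>\<nu>) = (n2 \<nu> ?s)\<^sup>2" unfolding n2_sq p ..
    also have "\<dots> \<le> (B / (2 * real l + 1))\<^sup>2"
      using order_trans[OF square_of_fourth(3)[OF density_dev_sq_fourth] dB] by (intro power_mono) auto
    also have "\<dots> = (sqrt (B / (2 * real l + 1))) ^ 4"
    proof -
      have "(sqrt (B / (2 * real l + 1))) ^ 4 = ((sqrt (B / (2 * real l + 1)))\<^sup>2)\<^sup>2" by (simp flip: power_mult)
      then show ?thesis using B0 by simp
    qed
    finally show "(\<integral>\<eta>. (density_dev l \<eta>) ^ 4 \<partial>\<nu>) \<le> (sqrt (B / (2 * real l + 1))) ^ 4" .
  qed (use B0 in simp)
  have "sigma2 \<nu> \<rho> l = (\<integral>\<eta>. ?U (translate ?y \<eta>) \<partial>\<nu>)" unfolding sigma2_def U ..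
  also have "\<dots> = (\<integral>\<eta>. ?U \<eta> \<partial>\<nu>)" by (rule integral_translate[OF Um])
  finally have "\<bar>sigma2 \<nu> \<rho> l\<bar> \<le> n2 \<nu> ?U" using abs_integral_le_n2[OF square_of_fourth(2)[OF U4]] by simp
  also have "\<dots> \<le> B" using square_of_fourth(3)[OF U4] BU by linarith
  finally show "\<bar>sigma2 \<nu> \<rho> l\<bar> \<le> B" .
qed

end

subsection \<open>The multiscale estimate\<close>

context stationary_config
begin

text \<open>Larger blocks give smaller algebras: the particle number of the larger block is that of
  the smaller one plus the occupations in between, which are exterior to the smaller block.\<close>

lemma canonical_nested:
  assumes "m \<le> l" shows "subalgebra (canonical_alg m) (canonical_alg l)"
  unfolding subalgebra_def
proof
  have sub: "box m \<subseteq> box l" using assms by (rule box_mono)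
  have ro: "(\<lambda>\<eta>. restrict \<eta> (- box m)) \<in> canonical_alg m \<rightarrow>\<^sub>M Pi\<^sub>M (- box m) (\<lambda>_. count_space UNIV)"
    using measurable_compose[OF canonical_alg_measurable measurable_snd] by simp
  have co: "(\<lambda>\<eta>. real (\<eta> x)) \<in> borel_measurable (canonical_alg m)" if "x \<notin> box m" for x
  proof -
    have "(\<lambda>\<eta>. restrict \<eta> (- box m) x) \<in> canonical_alg m \<rightarrow>\<^sub>M count_space UNIV"
      using that by (intro measurable_compose[OF ro] measurable_component_singleton) simp
    then have "(\<lambda>\<eta>. \<eta> x) \<in> canonical_alg m \<rightarrow>\<^sub>M count_space UNIV" using that by simp
    then show ?thesis by (rule measurable_compose) simp
  qed
  have pn: "(\<lambda>\<eta>. real (particle_number m \<eta>)) \<in> borel_measurable (canonical_alg m)"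
    by (rule measurable_compose[OF particle_number_canonical]) simp
  have eq: "block_avg l \<eta> 0 = (real (particle_number m \<eta>) + (\<Sum>x\<in>box l - box m. real (\<eta> x))) / (2 * real l + 1)" for \<eta>
    unfolding block_avg_def particle_number_def using sum.subset_diff[OF sub finite_box, of "\<lambda>x. real (\<eta> x)"]
    by (simp add: add.commute)
  have "(\<lambda>\<eta>. block_avg l \<eta> 0) \<in> borel_measurable (canonical_alg m)"
    unfolding eq by (intro borel_measurable_divide borel_measurable_add pn borel_measurable_sum co) auto
  moreover have "(\<lambda>\<eta>. restrict \<eta> (- box l)) \<in> canonical_alg m \<rightarrow>\<^sub>M Pi\<^sub>M (- box l) (\<lambda>_. count_space UNIV)"
  proof -
    have "(\<lambda>f. restrict f (- box l)) \<in> Pi\<^sub>M (- box m) (\<lambda>_. count_space UNIV) \<rightarrow>\<^sub>M Pi\<^sub>M (- box l) (\<lambda>_. count_space UNIV)"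
      by (rule measurable_restrict_subset) (use sub in auto)
    from measurable_compose[OF ro this] show ?thesis
    proof (rule measurable_cong[THEN iffD1, rotated])
      fix \<eta> show "restrict (restrict \<eta> (- box m)) (- box l) = restrict \<eta> (- box l)" for \<eta> :: config
        using sub by (auto simp: restrict_def fun_eq_iff)
    qed
  qed
  ultimately have "(\<lambda>\<eta>. (block_avg l \<eta> 0, restrict \<eta> (- box l))) \<in> canonical_alg m \<rightarrow>\<^sub>M borel \<Otimes>\<^sub>M Pi\<^sub>M (- box l) (\<lambda>_. count_space UNIV)"
    by (rule measurable_Pair)
  then show "sets (canonical_alg l) \<subseteq> sets (canonical_alg m)"
    unfolding canonical_alg_def[of l] by (simp add: measurable_iff_sets)
qed simp

text \<open>Tower property. Being centred given the larger block is the condition under which the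
  spectral gap applies to the increment between two block sizes.\<close>

lemma cond_exp_diff_zero:
  assumes f: "integrable \<nu> f" and ml: "m \<le> l"
  shows "AE \<eta> in \<nu>. real_cond_exp \<nu> (canonical_alg l)
     (\<lambda>\<zeta>. real_cond_exp \<nu> (canonical_alg m) f \<zeta> - real_cond_exp \<nu> (canonical_alg l) f \<zeta>) \<eta> = 0"
proof -
  have i: "integrable \<nu> (real_cond_exp \<nu> (canonical_alg k) f)" for k by (rule can.real_cond_exp_int(1)[OF f])
  have n: "AE \<eta> in \<nu>. real_cond_exp \<nu> (canonical_alg l) (real_cond_exp \<nu> (canonical_alg k) f) \<eta> = real_cond_exp \<nu> (canonical_alg l) f \<eta>"
    if "k \<le> l" for k
    by (rule can.real_cond_exp_nested_subalg[OF subalgebra_canonical canonical_nested[OF that] f])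
  from can.real_cond_exp_diff[OF i[of m] i[of l], of l] n[OF ml] n[OF order_refl] show ?thesis
    by eventually_elim simp
qed

lemma cond_exp_residual_zero:
  assumes f: "integrable \<nu> f"
  shows "AE \<eta> in \<nu>. real_cond_exp \<nu> (canonical_alg l) (\<lambda>\<zeta>. f \<zeta> - real_cond_exp \<nu> (canonical_alg l) f \<zeta>) \<eta> = 0"
proof -
  have i: "integrable \<nu> (real_cond_exp \<nu> (canonical_alg l) f)" by (rule can.real_cond_exp_int(1)[OF f])
  have n: "AE \<eta> in \<nu>. real_cond_exp \<nu> (canonical_alg l) (real_cond_exp \<nu> (canonical_alg l) f) \<eta> = real_cond_exp \<nu> (canonical_alg l) f \<eta>"
    by (rule can.real_cond_exp_F_meas[OF i]) simp
  from can.real_cond_exp_diff[OF f i, of l] n show ?thesis by eventually_elim simp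
qed

lemma grad_translate:
  "grad z (z + 1) (\<lambda>\<eta>. \<phi> (translate (- x) \<eta>)) \<eta> = grad (z + x) (z + x + 1) \<phi> (translate (- x) \<eta>)"
  unfolding grad_def move_translate by (simp add: algebra_simps)

lemma bond_energy_translate:
  assumes b: "b \<in> borel_measurable \<nu>" and \<phi>: "local_fun \<phi>"
  shows "bond_energy \<nu> b z (\<lambda>\<eta>. \<phi> (translate (- x) \<eta>)) = bond_energy \<nu> b (z + x) \<phi>"
    and "integrable \<nu> (\<lambda>\<eta>. b (translate (z + x) \<eta>) * (grad (z + x) (z + x + 1) \<phi> \<eta>)\<^sup>2) \<Longrightarrow>
      integrable \<nu> (\<lambda>\<eta>. b (translate z \<eta>) * (grad z (z + 1) (\<lambda>\<eta>. \<phi> (translate (- x) \<eta>)) \<eta>)\<^sup>2)"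
proof -
  let ?g = "\<lambda>\<eta>. b (translate (z + x) \<eta>) * (grad (z + x) (z + x + 1) \<phi> \<eta>)\<^sup>2"
  have [measurable]: "grad (z + x) (z + x + 1) \<phi> \<in> borel_measurable \<nu>"
    by (intro local_fun_meas local_fun_grad \<phi>)
  have gm: "?g \<in> borel_measurable \<nu>" using b by measurable
  have eq: "b (translate z \<eta>) * (grad z (z + 1) (\<lambda>\<eta>. \<phi> (translate (- x) \<eta>)) \<eta>)\<^sup>2 = ?g (translate (- x) \<eta>)" for \<eta>
    unfolding grad_translate translate_translate by simp
  show "bond_energy \<nu> b z (\<lambda>\<eta>. \<phi> (translate (- x) \<eta>)) = bond_energy \<nu> b (z + x) \<phi>"
    unfolding bond_energy_def eq by (rule integral_translate[OF gm])
  show "integrable \<nu> ?g \<Longrightarrow> integrable \<nu> (\<lambda>\<eta>. b (translate z \<eta>) * (grad z (z + 1) (\<lambda>\<eta>. \<phi> (translate (- x) \<eta>)) \<eta>)\<^sup>2)"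
    unfolding eq using integrable_translate[OF gm, of "- x"] by simp
qed

text \<open>Blocks of size \<open>l\<close> around the sites of \<open>I\<close> overlap at most \<open>2 l + 1\<close> times, whence the factor
  \<open>sqrt l\<close> besides the factor \<open>l\<close> from the spectral gap.\<close>

lemma block_sum_bound:
  assumes b: "\<And>\<eta>. 0 \<le> b n \<eta>" "b n \<in> borel_measurable \<nu>" and g0: "0 \<le> g\<^sub>0" and l: "1 \<le> l"
    and gap: "(\<integral>\<^sup>+\<eta>. (inv_gap \<nu> b (particle_number l \<eta>) l \<eta> n)\<^sup>2 \<partial>\<nu>) \<le> ennreal (g\<^sub>0 * real l ^ 4)"
    and F: "fourth_integrable \<nu> F" and F0: "AE \<eta> in \<nu>. real_cond_exp \<nu> (canonical_alg l) F \<eta> = 0"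
    and \<phi>: "supported_on L \<phi>" "square_integrable \<nu> \<phi>"
    and e: "\<And>x. integrable \<nu> (\<lambda>\<eta>. b n (translate x \<eta>) * (grad x (x + 1) \<phi> \<eta>)\<^sup>2)"
    and I: "finite I"
  shows "\<bar>ip \<nu> (\<lambda>\<eta>. \<Sum>x\<in>I. F (translate x \<eta>) * h x) \<phi>\<bar>
     \<le> sqrt (2 * sqrt g\<^sub>0) * (real l * sqrt (real l)) * Lnorm 4 \<nu> F
        * (sqrt (\<Sum>x\<in>I. (h x)\<^sup>2) * sqrt (\<Sum>x\<in>box (L + 1). bond_energy \<nu> (b n) x \<phi>))"
proof -
  let ?B = "{z. z \<in> box l \<and> z + 1 \<in> box l}"
  let ?e = "\<lambda>z. bond_energy \<nu> (b n) z \<phi>"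
  let ?E = "\<Sum>x\<in>box (L + 1). ?e x"
  let ?N = "Lnorm 4 \<nu> F"
  define K where "K = ?N * real l * sqrt (sqrt g\<^sub>0 / 2)"
  define S where "S x = (\<Sum>z\<in>?B. ?e (z + x))" for x
  have loc: "local_fun \<phi>" using \<phi>(1) by (rule local_funI)
  have Fsq: "square_integrable \<nu> F" by (rule square_of_fourth(2)[OF F])
  have Fm: "F \<in> borel_measurable \<nu>" and \<phi>m: "\<phi> \<in> borel_measurable \<nu>" using Fsq \<phi> by (auto simp: square_integrable_def)
  have e0: "0 \<le> ?e z" for z unfolding bond_energy_def using b(1) by (auto intro!: Bochner_Integration.integral_nonneg)
  have S0: "0 \<le> S x" for x unfolding S_def by (intro sum_nonneg e0)
  have E0: "0 \<le> ?E" by (intro sum_nonneg e0)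
  have K0: "0 \<le> K" using g0 by (simp add: K_def)
  \<comment> \<open>Instead of moving the block to \<open>x\<close>, the test function is translated
    by \<open>- x\<close>, so that the gap estimate at the origin serves all sites.\<close>
  have single: "\<bar>ip \<nu> F (\<lambda>\<eta>. \<phi> (translate (- x) \<eta>))\<bar> \<le> K * sqrt (S x)" for x
  proof -
    have "(ip \<nu> F (\<lambda>\<eta>. \<phi> (translate (- x) \<eta>)))\<^sup>2 \<le> sqrt (\<integral>\<eta>. (F \<eta>) ^ 4 \<partial>\<nu>) * sqrt (g\<^sub>0 * real l ^ 4)
       * ((\<Sum>z\<in>?B. bond_energy \<nu> (b n) z (\<lambda>\<eta>. \<phi> (translate (- x) \<eta>))) / 2)"
      using F e g0
      by (intro gap_bound[OF b(1) _ gap _ _ F0] square_integrable_translate \<phi>(2) bond_energy_translate(2)[OF b(2) loc])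
        (auto simp: fourth_integrable_def)
    also have "sqrt (\<integral>\<eta>. (F \<eta>) ^ 4 \<partial>\<nu>) = ?N\<^sup>2"
      unfolding Lnorm_4_pow[symmetric] by (rule real_sqrt_unique) (simp_all flip: power_mult)
    also have "sqrt (g\<^sub>0 * real l ^ 4) = sqrt g\<^sub>0 * (real l)\<^sup>2"
      by (rule real_sqrt_unique) (use g0 in \<open>simp_all add: power_mult_distrib flip: power_mult\<close>)
    also have "?N\<^sup>2 * (sqrt g\<^sub>0 * (real l)\<^sup>2) * ((\<Sum>z\<in>?B. bond_energy \<nu> (b n) z (\<lambda>\<eta>. \<phi> (translate (- x) \<eta>))) / 2) = (K * sqrt (S x))\<^sup>2"
      unfolding bond_energy_translate(1)[OF b(2) loc] S_def[symmetric]
      using g0 S0[of x] by (simp add: K_def power_mult_distrib)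
    finally show ?thesis using K0 S0[of x] by (intro power2_le_imp_le[of "\<bar>_\<bar>"]) simp_all
  qed
  have sumS: "(\<Sum>x\<in>I. S x) \<le> 3 * real l * ?E"
  proof -
    \<comment> \<open>For fixed \<open>z\<close> the sites \<open>z + x\<close> are distinct, and
      bonds starting outside \<open>box (L + 1)\<close> carry no energy. Each interior bond of the
      block therefore contributes at most the total energy.\<close>
    have shift: "(\<Sum>x\<in>I. ?e (z + x)) \<le> ?E" for z
    proof -
      have z: "?e y = 0" if "y \<notin> box (L + 1)" for y
      proof -
        have "y \<notin> box L" "y + 1 \<notin> box L" using that by (auto simp: box_def)
        then have "grad y (y + 1) \<phi> \<eta> = 0" for \<eta> by (rule grad_outside[OF \<phi>(1)])
        then show ?thesis by (simp add: bond_energy_def)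
      qed
      have "(\<Sum>x\<in>I. ?e (z + x)) = (\<Sum>y\<in>(+) z ` I. ?e y)" by (subst sum.reindex) (auto simp: inj_on_def)
      also have "\<dots> = (\<Sum>y\<in>(+) z ` I \<inter> box (L + 1). ?e y)"
        using I z by (intro sum.mono_neutral_right) auto
      also have "\<dots> \<le> ?E" by (rule sum_mono2) (auto intro: e0)
      finally show ?thesis .
    qed
    have "(\<Sum>x\<in>I. S x) = (\<Sum>z\<in>?B. \<Sum>x\<in>I. ?e (z + x))" unfolding S_def by (rule sum.swap)
    also have "\<dots> \<le> (\<Sum>z\<in>?B. ?E)" by (intro sum_mono shift)
    also have "\<dots> = real (card ?B) * ?E" by simp
    also have "\<dots> \<le> (3 * real l) * ?E"
    proof (rule mult_right_mono[OF _ E0])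
      \<comment> \<open>The bound \<open>2 * l + 1 <= 3 * l\<close> uses
        \<open>l >= 1\<close>.\<close>
      have "card ?B \<le> card (box l)" by (rule card_mono) auto
      then show "real (card ?B) \<le> 3 * real l" using l by (simp add: card_box)
    qed
    finally show ?thesis .
  qed
  have "ip \<nu> (\<lambda>\<eta>. \<Sum>x\<in>I. F (translate x \<eta>) * h x) \<phi> = (\<Sum>x\<in>I. ip \<nu> (\<lambda>\<eta>. h x * F (translate x \<eta>)) \<phi>)"
    by (subst mult.commute, rule ip_sum_left) (auto intro!: square_integrable_cmult square_integrable_translate Fsq \<phi>)
  also have "\<dots> = (\<Sum>x\<in>I. h x * ip \<nu> F (\<lambda>\<eta>. \<phi> (translate (- x) \<eta>)))"
    unfolding ip_translate_left[OF Fm \<phi>m, symmetric] by (simp add: ip_def mult.assoc)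
  finally have "\<bar>ip \<nu> (\<lambda>\<eta>. \<Sum>x\<in>I. F (translate x \<eta>) * h x) \<phi>\<bar> \<le> (\<Sum>x\<in>I. \<bar>h x * ip \<nu> F (\<lambda>\<eta>. \<phi> (translate (- x) \<eta>))\<bar>)"
    using sum_abs by simp
  also have "\<dots> \<le> (\<Sum>x\<in>I. \<bar>h x\<bar> * (K * sqrt (S x)))"
    unfolding abs_mult by (intro sum_mono mult_left_mono single) simp
  also have "\<dots> = K * (\<Sum>x\<in>I. \<bar>h x\<bar> * sqrt (S x))" by (simp add: sum_distrib_left mult_ac)
  also have "\<dots> \<le> K * (sqrt (\<Sum>x\<in>I. (h x)\<^sup>2) * sqrt (3 * real l * ?E))"
  proof (rule mult_left_mono[OF _ K0])
    have "(\<Sum>x\<in>I. \<bar>h x\<bar> * sqrt (S x))\<^sup>2 \<le> (\<Sum>x\<in>I. (h x)\<^sup>2) * (\<Sum>x\<in>I. S x)"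
      using Cauchy_Schwarz_ineq_sum[of "\<lambda>x. \<bar>h x\<bar>" "\<lambda>x. sqrt (S x)" I] S0 by simp
    also have "\<dots> \<le> (\<Sum>x\<in>I. (h x)\<^sup>2) * (3 * real l * ?E)" by (intro mult_left_mono sumS sum_nonneg) simp
    finally show "(\<Sum>x\<in>I. \<bar>h x\<bar> * sqrt (S x)) \<le> sqrt (\<Sum>x\<in>I. (h x)\<^sup>2) * sqrt (3 * real l * ?E)"
      unfolding real_sqrt_mult[symmetric] by (rule real_le_rsqrt)
  qed
  also have "\<dots> = (sqrt (sqrt g\<^sub>0 / 2) * sqrt 3) * (real l * sqrt (real l)) * ?N * (sqrt (\<Sum>x\<in>I. (h x)\<^sup>2) * sqrt ?E)"
    by (simp add: K_def real_sqrt_mult mult_ac)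
  also have "\<dots> \<le> sqrt (2 * sqrt g\<^sub>0) * (real l * sqrt (real l)) * ?N * (sqrt (\<Sum>x\<in>I. (h x)\<^sup>2) * sqrt ?E)"
  proof (intro mult_right_mono)
    \<comment> \<open>The left side is the root of \<open>3/2 * sqrt g\<^sub>0\<close>; the constant
      is rounded up from \<open>3/2\<close> to \<open>2\<close>.\<close>
    show "sqrt (sqrt g\<^sub>0 / 2) * sqrt 3 \<le> sqrt (2 * sqrt g\<^sub>0)" using g0 by (simp flip: real_sqrt_mult)
  qed (auto intro!: mult_nonneg_nonneg sum_nonneg e0)
  finally show ?thesis .
qed

text \<open>Halving the block size repeatedly: each step costs the size of the block to the power \<open>3/2\<close> times the
  fourth norm of the conditional expectations, and by the growth of \<open>g\<close> the last step dominates.\<close>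

lemma multiscale:
  assumes b: "\<And>\<eta>. 0 \<le> b n \<eta>" "b n \<in> borel_measurable \<nu>" and g0: "0 \<le> g\<^sub>0"
    and gap: "\<And>l. l \<ge> 1 \<Longrightarrow> (\<integral>\<^sup>+\<eta>. (inv_gap \<nu> b (particle_number l \<eta>) l \<eta> n)\<^sup>2 \<partial>\<nu>) \<le> ennreal (g\<^sub>0 * real l ^ 4)"
    and f: "fourth_integrable \<nu> f"
    and \<phi>: "supported_on L \<phi>" "square_integrable \<nu> \<phi>"
    and e: "\<And>x. integrable \<nu> (\<lambda>\<eta>. b n (translate x \<eta>) * (grad x (x + 1) \<phi> \<eta>)\<^sup>2)"
    and I: "finite I" and l1: "1 \<le> l\<^sub>1" and D0: "0 \<le> D"
    and D: "\<And>k. l\<^sub>1 \<le> k \<Longrightarrow> real k * sqrt (real k) * Lnorm 4 \<nu> (real_cond_exp \<nu> (canonical_alg k) f) \<le> D * g k"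
    and g: "\<And>k. 1 \<le> k \<Longrightarrow> 1 \<le> g k" "\<And>k. 2 \<le> k \<Longrightarrow> g (k div 2) \<le> 3/4 * g k"
    and l: "l\<^sub>1 \<le> l"
  shows "\<bar>ip \<nu> (\<lambda>\<eta>. \<Sum>x\<in>I. (f (translate x \<eta>) - real_cond_exp \<nu> (canonical_alg l) f (translate x \<eta>)) * h x) \<phi>\<bar>
     \<le> sqrt (2 * sqrt g\<^sub>0) * (64 * D + 16 * (real l\<^sub>1)\<^sup>2 * Lnorm 4 \<nu> f) * g l
        * (sqrt (\<Sum>x\<in>I. (h x)\<^sup>2) * sqrt (\<Sum>x\<in>box (L + 1). bond_energy \<nu> (b n) x \<phi>))"
  using l
proof (induction l rule: less_induct)
  case (less l)
  let ?f = "\<lambda>l. real_cond_exp \<nu> (canonical_alg l) f"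
  let ?W = "\<lambda>F. ip \<nu> (\<lambda>\<eta>. \<Sum>x\<in>I. F (translate x \<eta>) * h x) \<phi>"
  let ?N = "Lnorm 4 \<nu>"
  define H where "H = sqrt (\<Sum>x\<in>I. (h x)\<^sup>2) * sqrt (\<Sum>x\<in>box (L + 1). bond_energy \<nu> (b n) x \<phi>)"
  define \<kappa> where "\<kappa> = sqrt (2 * sqrt g\<^sub>0)"
  define c where "c = 64 * D + 16 * (real l\<^sub>1)\<^sup>2 * ?N f"
  have \<kappa>0: "0 \<le> \<kappa>" using g0 by (simp add: \<kappa>_def)
  have "0 \<le> bond_energy \<nu> (b n) x \<phi>" for x unfolding bond_energy_def using b(1) by (auto intro!: Bochner_Integration.integral_nonneg)
  then have H0: "0 \<le> H" unfolding H_def by (auto intro!: mult_nonneg_nonneg sum_nonneg)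
  have l1': "1 \<le> l" using less.prems l1 by simp
  have gl: "1 \<le> g l" by (rule g(1)[OF l1'])
  have fi: "integrable \<nu> f" by (rule square_integrable_integrable[OF square_of_fourth(2)[OF f]])
  have ll: "0 \<le> real l * sqrt (real l)" by simp
  have bsb: "\<bar>?W F\<bar> \<le> \<kappa> * (real l * sqrt (real l)) * ?N F * H"
    if "fourth_integrable \<nu> F" "AE \<eta> in \<nu>. real_cond_exp \<nu> (canonical_alg l) F \<eta> = 0" for F
    using block_sum_bound[OF b g0 l1' gap[OF l1'] that \<phi> e I] by (simp only: \<kappa>_def H_def)
  have goal: "\<bar>?W (\<lambda>\<eta>. f \<eta> - ?f l \<eta>)\<bar> \<le> \<kappa> * c * g l * H"
  proof (cases "l < 2 * l\<^sub>1")
    case True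
    \<comment> \<open>Halving stops here. A single application of the gap, with
      \<open>l ^ (3/2) <= l ^ 2 <= 4 * l\<^sub>1 ^ 2\<close> and a difference whose norm is at most
      \<open>4\<close> times that of \<open>f\<close>, produces the summand with
      \<open>16 = 4 * 4\<close> in \<open>c\<close>.\<close>
    have "\<bar>?W (\<lambda>\<eta>. f \<eta> - ?f l \<eta>)\<bar> \<le> \<kappa> * (real l * sqrt (real l)) * ?N (\<lambda>\<eta>. f \<eta> - ?f l \<eta>) * H"
      by (rule bsb[OF fourth_integrable_diff(1)[OF f cond_exp_fourth(1)[OF f]] cond_exp_residual_zero[OF fi]])
    also have "\<dots> = \<kappa> * ((real l * sqrt (real l)) * ?N (\<lambda>\<eta>. f \<eta> - ?f l \<eta>)) * H" by simp
    also have "\<dots> \<le> \<kappa> * ((4 * (real l\<^sub>1)\<^sup>2) * (4 * ?N f)) * H"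
    proof -
      have "sqrt (real l) \<le> real l" using l1' by (intro real_le_lsqrt) (auto simp: power2_eq_square)
      then have "real l * sqrt (real l) \<le> real l * real l" by (intro mult_left_mono) auto
      also have "\<dots> \<le> (2 * real l\<^sub>1) * (2 * real l\<^sub>1)" using True by (intro mult_mono) auto
      finally have 1: "real l * sqrt (real l) \<le> 4 * (real l\<^sub>1)\<^sup>2" by (simp add: power2_eq_square)
      have 2: "?N (\<lambda>\<eta>. f \<eta> - ?f l \<eta>) \<le> 4 * ?N f"
      proof -
        have "2 * (?N f + ?N (?f l)) \<le> 4 * ?N f" using cond_exp_fourth(2)[OF f, of l] by simp
        with fourth_integrable_diff(2)[OF f cond_exp_fourth(1)[OF f, of l]] show ?thesis by (rule order_trans)
      qed
      have "(real l * sqrt (real l)) * ?N (\<lambda>\<eta>. f \<eta> - ?f l \<eta>) \<le> (4 * (real l\<^sub>1)\<^sup>2) * (4 * ?N f)"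
        by (rule mult_mono[OF 1 2]) auto
      then show ?thesis by (intro mult_right_mono[OF _ H0] mult_left_mono[OF _ \<kappa>0])
    qed
    also have "\<dots> \<le> \<kappa> * (c * g l) * H"
    proof (intro mult_right_mono[OF _ H0] mult_left_mono[OF _ \<kappa>0])
      have "(4 * (real l\<^sub>1)\<^sup>2) * (4 * ?N f) \<le> c * 1" using D0 by (simp add: c_def)
      also have "\<dots> \<le> c * g l" using gl D0 by (intro mult_left_mono) (auto simp: c_def)
      finally show "(4 * (real l\<^sub>1)\<^sup>2) * (4 * ?N f) \<le> c * g l" .
    qed
    finally show ?thesis by (simp add: mult.assoc)
  next
    case False
    define m where "m = l div 2"
    have m: "l\<^sub>1 \<le> m" "m < l" "l \<le> 3 * m" "2 \<le> l" using False l1 by (auto simp: m_def)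
    have IH: "\<bar>?W (\<lambda>\<eta>. f \<eta> - ?f m \<eta>)\<bar> \<le> \<kappa> * c * g m * H"
      using less.IH[OF m(2,1)] by (simp only: \<kappa>_def c_def H_def)
    have gm: "g m \<le> 3/4 * g l" unfolding m_def by (rule g(2)[OF m(4)])
    let ?F = "\<lambda>\<eta>. ?f m \<eta> - ?f l \<eta>"
    have F4: "fourth_integrable \<nu> ?F" by (intro fourth_integrable_diff(1) cond_exp_fourth(1) f)
    have step: "\<bar>?W ?F\<bar> \<le> \<kappa> * (real l * sqrt (real l)) * ?N ?F * H"
      by (rule bsb[OF F4 cond_exp_diff_zero[OF fi less_imp_le[OF m(2)]]])
    have "(real l * sqrt (real l)) * ?N ?F \<le> (real l * sqrt (real l)) * (2 * (?N (?f m) + ?N (?f l)))"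
      by (intro mult_left_mono[OF _ ll] fourth_integrable_diff(2) cond_exp_fourth(1) f)
    also have "\<dots> = 2 * ((real l * sqrt (real l)) * ?N (?f m)) + 2 * ((real l * sqrt (real l)) * ?N (?f l))"
      by (simp add: algebra_simps)
    \<comment> \<open>The factor \<open>6 = 3 * 2\<close> comes from \<open>l <= 3 * m\<close> and
      \<open>sqrt l <= 2 * sqrt m\<close>; rounding down in \<open>l div 2\<close> accounts for the
      \<open>3\<close>.\<close>
    also have "(real l * sqrt (real l)) * ?N (?f m) \<le> (6 * (real m * sqrt (real m))) * ?N (?f m)"
    proof (rule mult_right_mono)
      have "sqrt (real l) \<le> sqrt (4 * real m)" using m(3) by simp
      then have "real l * sqrt (real l) \<le> (3 * real m) * (2 * sqrt (real m))"
        using m(3) by (intro mult_mono) (auto simp: real_sqrt_mult)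
      then show "real l * sqrt (real l) \<le> 6 * (real m * sqrt (real m))" by simp
    qed simp
    also have "2 * ((6 * (real m * sqrt (real m))) * ?N (?f m)) + 2 * ((real l * sqrt (real l)) * ?N (?f l)) \<le> 12 * (D * g m) + 2 * (D * g l)"
      using D[OF m(1)] D[OF less.prems] by linarith
    \<comment> \<open>\<open>12 * 3/4 + 2 = 11\<close>, rounded up.\<close>
    also have "\<dots> \<le> 16 * D * g l"
      using mult_left_mono[OF gm D0] mult_nonneg_nonneg[OF D0, of "g l"] gl by linarith
    finally have "\<kappa> * ((real l * sqrt (real l)) * ?N ?F) * H \<le> \<kappa> * (16 * D * g l) * H"
      by (intro mult_right_mono[OF _ H0] mult_left_mono[OF _ \<kappa>0]) simp
    with step have step': "\<bar>?W ?F\<bar> \<le> \<kappa> * (16 * D * g l) * H" by (simp add: mult.assoc)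
    have sq: "square_integrable \<nu> (\<lambda>\<eta>. \<Sum>x\<in>I. G (translate x \<eta>) * h x)" if "fourth_integrable \<nu> G" for G
      by (subst mult.commute) (intro square_integrable_sum square_integrable_cmult square_integrable_translate square_of_fourth(2) that)
    have "(\<lambda>\<eta>. \<Sum>x\<in>I. (f (translate x \<eta>) - ?f l (translate x \<eta>)) * h x)
      = (\<lambda>\<eta>. 1 * (\<Sum>x\<in>I. (f (translate x \<eta>) - ?f m (translate x \<eta>)) * h x) + 1 * (\<Sum>x\<in>I. (?f m (translate x \<eta>) - ?f l (translate x \<eta>)) * h x))"
      by (simp add: sum.distrib[symmetric] algebra_simps)
    then have "?W (\<lambda>\<eta>. f \<eta> - ?f l \<eta>) = 1 * ?W (\<lambda>\<eta>. f \<eta> - ?f m \<eta>) + 1 * ?W ?F"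
      using ip_lincomb_left[OF sq[OF fourth_integrable_diff(1)[OF f cond_exp_fourth(1)[OF f, of m]]] sq[OF F4] \<phi>(2), of 1 1] by simp
    then have "\<bar>?W (\<lambda>\<eta>. f \<eta> - ?f l \<eta>)\<bar> \<le> \<kappa> * c * g m * H + \<kappa> * (16 * D * g l) * H" using IH step' by linarith
    also have "\<dots> = \<kappa> * (c * g m + 16 * D * g l) * H" by (simp add: algebra_simps)
    also have "\<dots> \<le> \<kappa> * (c * g l) * H"
    proof (intro mult_right_mono[OF _ H0] mult_left_mono[OF _ \<kappa>0])
      \<comment> \<open>The \<open>64\<close> in \<open>c\<close> is \<open>4 * 16\<close>: the new
        contribution \<open>16 * D\<close> fits into the quarter of \<open>c\<close> that the factor
        \<open>3/4\<close> leaves free, as in the sum of a geometric series.\<close>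
      have c0: "0 \<le> c" using D0 by (simp add: c_def)
      have "c * g m \<le> c * (3/4 * g l)" by (rule mult_left_mono[OF gm c0])
      moreover have "64 * D * g l \<le> c * g l" using gl by (intro mult_right_mono) (auto simp: c_def)
      ultimately show "c * g m + 16 * D * g l \<le> c * g l" by (simp add: algebra_simps)
    qed
    finally show ?thesis by (simp add: mult.assoc)
  qed
  then show ?case by (simp only: \<kappa>_def c_def H_def)
qed

end

subsection \<open>Decay of the conditional expectations\<close>

context stationary_config
begin

definition quadratic_part where
  "quadratic_part \<nu>T f l \<eta> = phi'' \<nu>T \<theta>s f \<rho> / 2 * ((density_dev l \<eta>)\<^sup>2 - sigma2 \<nu> \<rho> l / (2 * real l + 1))"

definition linear_part where
  "linear_part \<nu>T f l \<eta> = phi' \<nu>T \<theta>s f \<rho> * density_dev l \<eta>"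

lemma fourth_quadratic_part: "fourth_integrable \<nu> (quadratic_part \<nu>T f l)"
  unfolding quadratic_part_def[abs_def]
  by (intro fourth_integrable_cmult(1) fourth_integrable_diff(1) density_dev_sq_fourth fourth_integrable_const)

lemma fourth_linear_part: "fourth_integrable \<nu> (linear_part \<nu>T f l)"
  unfolding linear_part_def[abs_def] by (intro fourth_integrable_cmult(1) density_dev_fourth)

text \<open>The equivalence of ensembles bounds the error of the expansion, the static moments bound
  the expansion itself, by order \<open>1 / k\<close> for the quadratic part and
  \<open>1 / sqrt k\<close> for the linear one. The error decays faster, so the conditional
  expectation inherits the order of its expansion. One constant, chosen before \<open>f\<close> and
  \<open>k\<close>, serves all four bounds.\<close>

lemma cond_exp_decay:
  assumes sf: "static_fluctuations \<nu> \<rho>" and dd: "density_derivatives \<nu> \<rho> \<theta>s \<nu>T"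
    and ee: "equivalence_of_ensembles \<nu> \<rho> \<theta>s \<nu>T \<alpha>\<^sub>0"
  shows "\<exists>D\<ge>0. \<forall>f k. supported_on l\<^sub>0 f \<and> f \<in> Lp 5 \<nu> \<and> phi \<nu>T \<theta>s f \<rho> = 0 \<and> l\<^sub>0 \<le> k \<and> 1 \<le> k \<longrightarrow>
    (phi' \<nu>T \<theta>s f \<rho> = 0 \<longrightarrow>
      Lnorm 4 \<nu> (real_cond_exp \<nu> (canonical_alg k) f) \<le> D * Lnorm 5 \<nu> f / real k \<and>
      Lnorm 4 \<nu> (\<lambda>\<eta>. real_cond_exp \<nu> (canonical_alg k) f \<eta> - quadratic_part \<nu>T f k \<eta>) \<le> D * Lnorm 5 \<nu> f * real k powr (- 1 - \<alpha>\<^sub>0 / 2)) \<and>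
    Lnorm 4 \<nu> (real_cond_exp \<nu> (canonical_alg k) f) \<le> D * Lnorm 5 \<nu> f / sqrt (real k) \<and>
    Lnorm 4 \<nu> (\<lambda>\<eta>. real_cond_exp \<nu> (canonical_alg k) f \<eta> - linear_part \<nu>T f k \<eta>) \<le> D * Lnorm 5 \<nu> f * real k powr (- 1 / 2 - \<alpha>\<^sub>0 / 2)"
proof -
  have \<alpha>: "\<alpha>\<^sub>0 > 0" using ee by (simp add: equivalence_of_ensembles_def)
  obtain B where B: "\<And>l. l \<ge> 1 \<Longrightarrow> Lnorm 4 \<nu> (\<lambda>\<eta>. ((\<Sum>x = 1..int l. real (\<eta> x) - \<rho>) / sqrt (real l))\<^sup>2) \<le> B"
    using sf unfolding static_fluctuations_def by blast
  have B0: "0 \<le> B" using B[OF order_refl] Lnorm_nonneg order_trans by blast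
  have "\<exists>C. \<forall>f l. supported_on l\<^sub>0 f \<and> f \<in> Lp 5 \<nu> \<and> l \<ge> l\<^sub>0 \<and> l \<ge> 1 \<and> phi \<nu>T \<theta>s f \<rho> = 0 \<longrightarrow>
     (phi' \<nu>T \<theta>s f \<rho> = 0 \<longrightarrow>
        Lnorm 4 \<nu> (\<lambda>\<eta>. real_cond_exp \<nu> (canonical_alg l) f \<eta> - quadratic_part \<nu>T f l \<eta>)
          \<le> C * Lnorm 5 \<nu> f * real l powr (- 1 - \<alpha>\<^sub>0 / 2)) \<and>
     Lnorm 4 \<nu> (\<lambda>\<eta>. real_cond_exp \<nu> (canonical_alg l) f \<eta> - linear_part \<nu>T f l \<eta>)
       \<le> C * Lnorm 5 \<nu> f * real l powr (- 1 / 2 - \<alpha>\<^sub>0 / 2)"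
    using ee unfolding equivalence_of_ensembles_def quadratic_part_def linear_part_def density_dev_def
    by (elim conjE) (drule spec[of _ l\<^sub>0], assumption)
  then obtain E where E: "\<forall>f l. supported_on l\<^sub>0 f \<and> f \<in> Lp 5 \<nu> \<and> l \<ge> l\<^sub>0 \<and> l \<ge> 1 \<and> phi \<nu>T \<theta>s f \<rho> = 0 \<longrightarrow>
     (phi' \<nu>T \<theta>s f \<rho> = 0 \<longrightarrow>
        Lnorm 4 \<nu> (\<lambda>\<eta>. real_cond_exp \<nu> (canonical_alg l) f \<eta> - quadratic_part \<nu>T f l \<eta>)
          \<le> E * Lnorm 5 \<nu> f * real l powr (- 1 - \<alpha>\<^sub>0 / 2)) \<and>
     Lnorm 4 \<nu> (\<lambda>\<eta>. real_cond_exp \<nu> (canonical_alg l) f \<eta> - linear_part \<nu>T f l \<eta>)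
       \<le> E * Lnorm 5 \<nu> f * real l powr (- 1 / 2 - \<alpha>\<^sub>0 / 2)"
    by (elim exE)
  have "\<exists>C. \<forall>f. supported_on l\<^sub>0 f \<and> f \<in> Lp 2 \<nu> \<longrightarrow>
        \<bar>phi' \<nu>T \<theta>s f \<rho>\<bar> \<le> C * Lnorm 2 \<nu> f \<and> \<bar>phi'' \<nu>T \<theta>s f \<rho>\<bar> \<le> C * Lnorm 2 \<nu> f"
    using dd unfolding density_derivatives_def by (elim conjE) (drule spec[of _ l\<^sub>0], assumption)
  then obtain K where K: "\<forall>f. supported_on l\<^sub>0 f \<and> f \<in> Lp 2 \<nu> \<longrightarrow>
        \<bar>phi' \<nu>T \<theta>s f \<rho>\<bar> \<le> K * Lnorm 2 \<nu> f \<and> \<bar>phi'' \<nu>T \<theta>s f \<rho>\<bar> \<le> K * Lnorm 2 \<nu> f"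
    by (elim exE)
  \<comment> \<open>The outer \<open>2\<close> is the loss in the triangle inequality for the fourth
    norm. \<open>2 * B\<close> covers the squared density deviation together with its subtracted
    mean, \<open>sqrt B\<close> the deviation itself, and \<open>K\<close> bounds the coefficients
    of the expansion.\<close>
  define D where "D = 2 * (\<bar>E\<bar> + \<bar>K\<bar> * (2 * B + sqrt B))"
  have D0: "0 \<le> D" using B0 by (simp add: D_def)
  have ED: "\<bar>E\<bar> \<le> D" using B0 by (simp add: D_def add_increasing2)
  have main: "(phi' \<nu>T \<theta>s f \<rho> = 0 \<longrightarrow>
      Lnorm 4 \<nu> (real_cond_exp \<nu> (canonical_alg k) f) \<le> D * Lnorm 5 \<nu> f / real k \<and>
      Lnorm 4 \<nu> (\<lambda>\<eta>. real_cond_exp \<nu> (canonical_alg k) f \<eta> - quadratic_part \<nu>T f k \<eta>) \<le> D * Lnorm 5 \<nu> f * real k powr (- 1 - \<alpha>\<^sub>0 / 2)) \<and>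
    Lnorm 4 \<nu> (real_cond_exp \<nu> (canonical_alg k) f) \<le> D * Lnorm 5 \<nu> f / sqrt (real k) \<and>
    Lnorm 4 \<nu> (\<lambda>\<eta>. real_cond_exp \<nu> (canonical_alg k) f \<eta> - linear_part \<nu>T f k \<eta>) \<le> D * Lnorm 5 \<nu> f * real k powr (- 1 / 2 - \<alpha>\<^sub>0 / 2)"
    if f: "supported_on l\<^sub>0 f" "f \<in> Lp 5 \<nu>" "phi \<nu>T \<theta>s f \<rho> = 0" "l\<^sub>0 \<le> k" and k: "1 \<le> k" for f k
  proof -
    let ?N = "Lnorm 5 \<nu> f" and ?f = "real_cond_exp \<nu> (canonical_alg k) f"
    let ?Q = "quadratic_part \<nu>T f k" and ?L = "linear_part \<nu>T f k"
    note f4 = fourth_of_fifth[OF f(2)]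
    have c4: "fourth_integrable \<nu> ?f" by (rule cond_exp_fourth(1)[OF f4(1)])
    have k0: "0 < real k" using k by simp
    have N2: "Lnorm 2 \<nu> f \<le> ?N" using square_of_fourth(3)[OF f4(1)] f4(2) by (simp add: Lnorm_2)
    have "f \<in> Lp 2 \<nu>" using square_of_fourth(2)[OF f4(1)] by (simp add: Lp_2_iff)
    then have "\<bar>phi' \<nu>T \<theta>s f \<rho>\<bar> \<le> K * Lnorm 2 \<nu> f" "\<bar>phi'' \<nu>T \<theta>s f \<rho>\<bar> \<le> K * Lnorm 2 \<nu> f" using K[rule_format, OF conjI, OF f(1)] by auto
    moreover have "K * Lnorm 2 \<nu> f \<le> \<bar>K\<bar> * ?N" using N2 by (intro mult_mono) auto
    ultimately have ph: "\<bar>phi' \<nu>T \<theta>s f \<rho>\<bar> \<le> \<bar>K\<bar> * ?N" "\<bar>phi'' \<nu>T \<theta>s f \<rho>\<bar> \<le> \<bar>K\<bar> * ?N" by linarith+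
    have EE: "E * ?N * x \<le> \<bar>E\<bar> * ?N * x" if "0 \<le> x" for x using that by (intro mult_right_mono) auto
    have EDN: "\<bar>E\<bar> * ?N * x \<le> D * ?N * x" if "0 \<le> x" for x using that ED by (intro mult_right_mono) auto
    have sum4: "Lnorm 4 \<nu> ?f \<le> 2 * (Lnorm 4 \<nu> (\<lambda>\<eta>. ?f \<eta> - q \<eta>) + Lnorm 4 \<nu> q)" if "fourth_integrable \<nu> q" for q
      using fourth_integrable_add(2)[OF fourth_integrable_diff(1)[OF c4 that] that] by simp
    note e = E[rule_format, of f k, OF conjI[OF f(1) conjI[OF f(2) conjI[OF f(4) conjI[OF k f(3)]]]]]
    have lin: "Lnorm 4 \<nu> (\<lambda>\<eta>. ?f \<eta> - ?L \<eta>) \<le> \<bar>E\<bar> * ?N * real k powr (- 1 / 2 - \<alpha>\<^sub>0 / 2)"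
      using e[THEN conjunct2] EE[OF powr_ge_zero, of "real k" "- 1 / 2 - \<alpha>\<^sub>0 / 2"] by (rule order_trans)
    have L4: "Lnorm 4 \<nu> ?L \<le> \<bar>K\<bar> * ?N * (sqrt B / sqrt (real k))"
    proof -
      have "Lnorm 4 \<nu> ?L \<le> \<bar>phi' \<nu>T \<theta>s f \<rho>\<bar> * Lnorm 4 \<nu> (density_dev k)"
        unfolding linear_part_def[abs_def] by (rule fourth_integrable_cmult(2)[OF density_dev_fourth])
      also have "\<dots> \<le> (\<bar>K\<bar> * ?N) * (sqrt B / sqrt (real k))"
      proof (rule mult_mono[OF ph(1)])
        have "Lnorm 4 \<nu> (density_dev k) \<le> sqrt (B / (2 * real k + 1))" by (rule density_dev_bounds(2)[OF B])
        also have "\<dots> \<le> sqrt (B / real k)" using B0 k0 by (intro real_sqrt_le_mono divide_left_mono) auto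
        finally show "Lnorm 4 \<nu> (density_dev k) \<le> sqrt B / sqrt (real k)" by (simp add: real_sqrt_divide)
      qed auto
      finally show ?thesis .
    qed
    have pw: "real k powr (- 1 / 2 - \<alpha>\<^sub>0 / 2) \<le> 1 / sqrt (real k)"
    proof -
      have "real k powr (- 1 / 2 - \<alpha>\<^sub>0 / 2) \<le> real k powr (- (1 / 2))" using k \<alpha> by (intro powr_mono) auto
      then show ?thesis using k0 by (simp only: powr_minus powr_half_sqrt less_imp_le inverse_eq_divide)
    qed
    have r2: "Lnorm 4 \<nu> ?f \<le> D * ?N / sqrt (real k)"
    proof -
      have "Lnorm 4 \<nu> ?f \<le> 2 * (\<bar>E\<bar> * ?N * (1 / sqrt (real k)) + \<bar>K\<bar> * ?N * (sqrt B / sqrt (real k)))"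
      proof -
        have "\<bar>E\<bar> * ?N * real k powr (- 1 / 2 - \<alpha>\<^sub>0 / 2) \<le> \<bar>E\<bar> * ?N * (1 / sqrt (real k))"
          by (intro mult_left_mono pw) simp
        from order_trans[OF lin this] show ?thesis
          by (intro order_trans[OF sum4[OF fourth_linear_part[of \<nu>T f k]]] mult_left_mono add_mono L4) auto
      qed
      also have "\<dots> = (2 * (\<bar>E\<bar> + \<bar>K\<bar> * sqrt B)) * (?N / sqrt (real k))" by (simp add: algebra_simps add_divide_distrib)
      also have "\<dots> \<le> D * (?N / sqrt (real k))"
        using B0 by (intro mult_right_mono) (auto simp: D_def intro!: mult_left_mono)
      finally show ?thesis by simp
    qed
    have r1: "Lnorm 4 \<nu> ?f \<le> D * ?N / real k \<and>
      Lnorm 4 \<nu> (\<lambda>\<eta>. ?f \<eta> - ?Q \<eta>) \<le> D * ?N * real k powr (- 1 - \<alpha>\<^sub>0 / 2)" if z: "phi' \<nu>T \<theta>s f \<rho> = 0"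
    proof -
      have quad: "Lnorm 4 \<nu> (\<lambda>\<eta>. ?f \<eta> - ?Q \<eta>) \<le> \<bar>E\<bar> * ?N * real k powr (- 1 - \<alpha>\<^sub>0 / 2)"
        using e[THEN conjunct1, rule_format, OF z] EE[OF powr_ge_zero, of "real k" "- 1 - \<alpha>\<^sub>0 / 2"] by (rule order_trans)
      have Q4: "Lnorm 4 \<nu> ?Q \<le> \<bar>K\<bar> * ?N * (2 * B / real k)"
      proof -
        let ?s = "sigma2 \<nu> \<rho> k / (2 * real k + 1)"
        have "Lnorm 4 \<nu> ?Q \<le> \<bar>phi'' \<nu>T \<theta>s f \<rho> / 2\<bar> * Lnorm 4 \<nu> (\<lambda>\<eta>. (density_dev k \<eta>)\<^sup>2 - ?s)"
          unfolding quadratic_part_def[abs_def]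
          by (intro fourth_integrable_cmult(2) fourth_integrable_diff(1) density_dev_sq_fourth fourth_integrable_const)
        also have "\<dots> \<le> (\<bar>K\<bar> * ?N) * (2 * B / real k)"
        proof (rule mult_mono)
          show "\<bar>phi'' \<nu>T \<theta>s f \<rho> / 2\<bar> \<le> \<bar>K\<bar> * ?N" using ph(2) by simp
          have s: "\<bar>?s\<bar> \<le> B / (2 * real k + 1)" using density_dev_bounds(3)[OF B, of k] by (simp add: divide_right_mono)
          have "Lnorm 4 \<nu> (\<lambda>\<eta>. (density_dev k \<eta>)\<^sup>2 - ?s) \<le> 2 * (Lnorm 4 \<nu> (\<lambda>\<eta>. (density_dev k \<eta>)\<^sup>2) + Lnorm 4 \<nu> (\<lambda>_. ?s))"
            by (rule fourth_integrable_diff(2)[OF density_dev_sq_fourth fourth_integrable_const])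
          also have "\<dots> \<le> 2 * (B / (2 * real k + 1) + B / (2 * real k + 1))"
            by (intro mult_left_mono add_mono density_dev_bounds(1)[OF B] order_trans[OF Lnorm_4_const s]) auto
          also have "\<dots> = 4 * B / (2 * real k + 1)" by simp
          also have "\<dots> \<le> 4 * B / (2 * real k)" using B0 k0 by (intro divide_left_mono) auto
          also have "\<dots> = 2 * B / real k" by simp
          finally show "Lnorm 4 \<nu> (\<lambda>\<eta>. (density_dev k \<eta>)\<^sup>2 - ?s) \<le> 2 * B / real k" .
        qed auto
        finally show ?thesis .
      qed
      have pw1: "real k powr (- 1 - \<alpha>\<^sub>0 / 2) \<le> 1 / real k"
      proof -
        have "real k powr (- 1 - \<alpha>\<^sub>0 / 2) \<le> real k powr (- 1)" using k \<alpha> by (intro powr_mono) auto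
        then show ?thesis using k0 by (simp only: powr_minus powr_one less_imp_le inverse_eq_divide)
      qed
      have "Lnorm 4 \<nu> ?f \<le> 2 * (\<bar>E\<bar> * ?N * (1 / real k) + \<bar>K\<bar> * ?N * (2 * B / real k))"
      proof -
        have "\<bar>E\<bar> * ?N * real k powr (- 1 - \<alpha>\<^sub>0 / 2) \<le> \<bar>E\<bar> * ?N * (1 / real k)"
          by (intro mult_left_mono pw1) simp
        from order_trans[OF quad this] show ?thesis
          by (intro order_trans[OF sum4[OF fourth_quadratic_part[of \<nu>T f k]]] mult_left_mono add_mono Q4) auto
      qed
      also have "\<dots> = (2 * (\<bar>E\<bar> + \<bar>K\<bar> * (2 * B))) * (?N / real k)" by (simp add: algebra_simps add_divide_distrib)
      also have "\<dots> \<le> D * (?N / real k)"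
        using B0 by (intro mult_right_mono) (auto simp: D_def distrib_left)
      finally have "Lnorm 4 \<nu> ?f \<le> D * ?N / real k" by simp
      moreover have "Lnorm 4 \<nu> (\<lambda>\<eta>. ?f \<eta> - ?Q \<eta>) \<le> D * ?N * real k powr (- 1 - \<alpha>\<^sub>0 / 2)"
        using quad EDN[OF powr_ge_zero] by (rule order_trans)
      ultimately show ?thesis by (rule conjI)
    qed
    show ?thesis by (intro conjI[OF impI[OF r1] conjI[OF r2 order_trans[OF lin EDN[OF powr_ge_zero]]]])
  qed
  show ?thesis by (intro exI[of _ D] conjI[OF D0] allI impI, elim conjE, rule main)
qed

end

subsection \<open>The dynamical estimate\<close>

locale particle_dynamics = reversible_rates \<nu> \<rho> \<theta>s bR bL n c R C + proc: stationary_process \<nu> T P X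
  for \<nu> \<rho> \<theta>s bR bL n c R C T and P :: "'w measure" and X +
  fixes a \<gamma> :: real and \<D> :: "(config \<Rightarrow> real) set"
  assumes core: "generator_core \<nu> T (generator_formula bR bL a \<gamma> n) \<D>"
    and core_local: "\<And>u. u \<in> \<D> \<Longrightarrow> local_fun u"
    and jump: "0 \<le> jump_prob a \<gamma> n" "jump_prob a \<gamma> n \<le> 1" and n1: "1 \<le> n"
begin

text \<open>\<open>energy_bound\<close> converts a bound by bond energies into the form that
  \<open>dual_norm_bound\<close> requires; the \<open>2\<close> and the power of \<open>n\<close>
  are those of its prefactor. The hypothesis is conditional on a support radius and on finite
  energies, since both are available only once a core function is given.\<close>

lemma energy_dual:
  assumes \<phi>: "\<phi> \<in> \<D>"
    and A: "\<And>L. supported_on L \<phi> \<Longrightarrow> square_integrable \<nu> \<phi> \<Longrightarrow>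
      (\<And>x. integrable \<nu> (\<lambda>\<eta>. bR n (translate x \<eta>) * (grad x (x + 1) \<phi> \<eta>)\<^sup>2)) \<Longrightarrow>
      \<bar>ip \<nu> V \<phi>\<bar> \<le> A * sqrt (\<Sum>x\<in>box (L + 1). bond_energy \<nu> (bR n) x \<phi>)"
  shows "(ip \<nu> V \<phi>)\<^sup>2 \<le> (2 * A\<^sup>2 / (real n)\<^sup>2) * (- ip \<nu> \<phi> (generator_formula bR bL a \<gamma> n \<phi>))"
proof -
  have "has_generator \<nu> T \<phi> (generator_formula bR bL a \<gamma> n \<phi>)" using core \<phi> by (simp add: generator_core_def)
  then have sq: "square_integrable \<nu> \<phi>" "square_integrable \<nu> (generator_formula bR bL a \<gamma> n \<phi>)"
    by (simp_all add: proc.has_generator_iff)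
  obtain L where L: "supported_on L \<phi>" using core_local[OF \<phi>] by (auto simp: local_fun_def)
  note en = energy_bound[OF L sq jump n1]
  let ?E = "\<Sum>x\<in>box (L + 1). bond_energy \<nu> (bR n) x \<phi>"
  have E0: "0 \<le> ?E" unfolding bond_energy_def using nonneg by (auto intro!: sum_nonneg Bochner_Integration.integral_nonneg)
  have n0: "0 < (real n)\<^sup>2" using n1 by simp
  have "\<bar>ip \<nu> V \<phi>\<bar>\<^sup>2 \<le> (A * sqrt ?E)\<^sup>2" by (rule power_mono[OF A[OF L sq(1) en(1)]]) simp
  then have "(ip \<nu> V \<phi>)\<^sup>2 \<le> A\<^sup>2 * ?E" using E0 by (simp add: power_mult_distrib)
  also have "\<dots> \<le> A\<^sup>2 * (2 / (real n)\<^sup>2 * (- ip \<nu> \<phi> (generator_formula bR bL a \<gamma> n \<phi>)))"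
    using en(2) n0 by (intro mult_left_mono) (simp_all add: field_simps)
  finally show ?thesis by (simp add: mult.assoc mult.left_commute)
qed

text \<open>\<open>V\<close> is controlled through the dynamics, \<open>W\<close> through
  stationarity alone. The constant \<open>96\<close> is \<open>2 * 24 * 2\<close>, from squaring a
  sum, \<open>dual_norm_bound\<close> and \<open>energy_dual\<close>.\<close>

lemma two_part_bound:
  assumes V: "square_integrable \<nu> V" "square_integrable \<nu> W" and t: "0 \<le> t"
    and A: "\<And>\<phi> L. supported_on L \<phi> \<Longrightarrow> square_integrable \<nu> \<phi> \<Longrightarrow>
      (\<And>x. integrable \<nu> (\<lambda>\<eta>. bR n (translate x \<eta>) * (grad x (x + 1) \<phi> \<eta>)\<^sup>2)) \<Longrightarrow>
      \<bar>ip \<nu> V \<phi>\<bar> \<le> A * sqrt (\<Sum>x\<in>box (L + 1). bond_energy \<nu> (bR n) x \<phi>)"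
  shows "(\<integral>\<^sup>+\<omega>. ennreal ((proc.time_integral (\<lambda>\<eta>. V \<eta> + W \<eta>) 0 t \<omega>)\<^sup>2) \<partial>P)
     \<le> ennreal (96 * t * A\<^sup>2 / (real n)\<^sup>2 + 2 * t\<^sup>2 * (n2 \<nu> W)\<^sup>2)"
proof -
  let ?Z = "\<lambda>V. proc.time_integral V 0 t"
  have VW: "square_integrable \<nu> (\<lambda>\<eta>. V \<eta> + W \<eta>)" by (rule square_integrable_add[OF V])
  note Z = proc.time_integral_square_integrable[OF V(1) order_refl t] proc.time_integral_square_integrable[OF V(2) order_refl t]
    proc.time_integral_square_integrable[OF VW order_refl t]
  have AE: "AE \<omega> in P. ?Z (\<lambda>\<eta>. V \<eta> + W \<eta>) \<omega> = ?Z V \<omega> + ?Z W \<omega>"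
    using proc.path_set_integrable[OF V(1) t] proc.path_set_integrable[OF V(2) t]
    by eventually_elim (simp add: proc.time_integral_Y set_integral_add)
  have v: "(n2 P (?Z V))\<^sup>2 \<le> 24 * t * (2 * A\<^sup>2 / (real n)\<^sup>2)"
    by (rule proc.dual_norm_bound[OF core V(1) _ energy_dual[OF _ A] t]) auto
  have w: "(n2 P (?Z W))\<^sup>2 \<le> t\<^sup>2 * (n2 \<nu> W)\<^sup>2"
  proof -
    have "ennreal ((n2 P (?Z W))\<^sup>2) = (\<integral>\<^sup>+\<omega>. ennreal ((?Z W \<omega>)\<^sup>2) \<partial>P)"
      unfolding n2_sq using Z(2) by (intro nn_integral_eq_integral[symmetric]) (auto simp: square_integrable_def)
    also have "\<dots> \<le> ennreal ((t - 0)\<^sup>2) * (\<integral>\<^sup>+\<eta>. ennreal ((W \<eta>)\<^sup>2) \<partial>\<nu>)"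
      by (rule proc.time_integral_second_moment[OF _ order_refl t]) (use V in \<open>simp add: square_integrable_def\<close>)
    also have "(\<integral>\<^sup>+\<eta>. ennreal ((W \<eta>)\<^sup>2) \<partial>\<nu>) = ennreal ((n2 \<nu> W)\<^sup>2)"
      unfolding n2_sq using V(2) by (intro nn_integral_eq_integral) (auto simp: square_integrable_def)
    finally show ?thesis by (simp flip: ennreal_mult)
  qed
  have "n2 P (?Z (\<lambda>\<eta>. V \<eta> + W \<eta>)) = n2 P (\<lambda>\<omega>. ?Z V \<omega> + ?Z W \<omega>)"
    using Z AE by (intro n2_cong_AE) (auto simp: square_integrable_def)
  also have "\<dots> \<le> n2 P (?Z V) + n2 P (?Z W)" by (rule n2_triangle[OF Z(1,2)])
  finally have "(n2 P (?Z (\<lambda>\<eta>. V \<eta> + W \<eta>)))\<^sup>2 \<le> (n2 P (?Z V) + n2 P (?Z W))\<^sup>2" by (rule power_mono) simp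
  also have "\<dots> \<le> 2 * (n2 P (?Z V))\<^sup>2 + 2 * (n2 P (?Z W))\<^sup>2"
    using zero_le_power2[of "n2 P (?Z V) - n2 P (?Z W)"] by (simp add: power2_sum power2_diff)
  also have "\<dots> \<le> 96 * t * A\<^sup>2 / (real n)\<^sup>2 + 2 * t\<^sup>2 * (n2 \<nu> W)\<^sup>2" using v w by simp
  finally have "(n2 P (?Z (\<lambda>\<eta>. V \<eta> + W \<eta>)))\<^sup>2 \<le> 96 * t * A\<^sup>2 / (real n)\<^sup>2 + 2 * t\<^sup>2 * (n2 \<nu> W)\<^sup>2" .
  moreover have "(\<integral>\<^sup>+\<omega>. ennreal ((?Z (\<lambda>\<eta>. V \<eta> + W \<eta>) \<omega>)\<^sup>2) \<partial>P) = ennreal ((n2 P (?Z (\<lambda>\<eta>. V \<eta> + W \<eta>)))\<^sup>2)"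
    unfolding n2_sq using Z(3) by (intro nn_integral_eq_integral) (auto simp: square_integrable_def)
  ultimately show ?thesis by (simp add: ennreal_leI)
qed

text \<open>Unordered sums over the integers are limits along finite sets. Boxes are cofinal among
  these, so sums over boxes have the same limit.\<close>

lemma filterlim_box: "filterlim box (finite_subsets_at_top UNIV) sequentially"
  unfolding filterlim_finite_subsets_at_top
proof (intro allI impI, elim conjE)
  fix S :: "int set" assume S: "finite S"
  define M where "M = nat (\<Sum>x\<in>S. \<bar>x\<bar>)"
  have "S \<subseteq> box m" if "M \<le> m" for m
  proof
    fix x assume "x \<in> S"
    then have "\<bar>x\<bar> \<le> (\<Sum>x\<in>S. \<bar>x\<bar>)" using S by (intro member_le_sum) auto
    also have "\<dots> \<le> int m" using that by (simp add: M_def)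
    finally show "x \<in> box m" by (auto simp: box_def)
  qed
  then show "\<forall>\<^sub>F m in sequentially. finite (box m) \<and> S \<subseteq> box m \<and> box m \<subseteq> UNIV"
    by (auto simp: eventually_sequentially)
qed

text \<open>If a path of the infinite series is not measurable, its Bochner integral is zero and the bound is trivial.\<close>

lemma infinite_sum_limit:
  assumes g: "square_integrable \<nu> g" and h: "(\<lambda>x. \<bar>h x\<bar>) summable_on UNIV" and t: "0 \<le> t"
    and bound: "\<And>m. (\<integral>\<^sup>+\<omega>. ennreal ((proc.time_integral (\<lambda>\<eta>. \<Sum>x\<in>box m. g (translate x \<eta>) * h x) 0 t \<omega>)\<^sup>2) \<partial>P) \<le> ennreal K"
  shows "(\<integral>\<^sup>+\<omega>. ennreal ((LBINT s:{0..t}. (\<Sum>\<^sub>\<infinity>x\<in>UNIV. g (translate x (X s \<omega>)) * h x))\<^sup>2) \<partial>P) \<le> ennreal K"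
proof -
  have gm: "g \<in> borel_measurable \<nu>" using g by (simp add: square_integrable_def)
  let ?v = "\<lambda>m \<eta>. \<Sum>x\<in>box m. g (translate x \<eta>) * h x"
  let ?G = "\<lambda>m \<eta>. \<Sum>x\<in>box m. \<bar>g (translate x \<eta>) * h x\<bar>"
  let ?V = "\<lambda>\<eta>. \<Sum>\<^sub>\<infinity>x\<in>UNIV. g (translate x \<eta>) * h x"
  \<comment> \<open>Supremum of the absolute partial sums. Its mean is finite because
    \<open>h\<close> is summable; hence along almost every path it is finite at almost every time
    and dominates the partial sums by an integrable function.\<close>
  define S where "S \<eta> = (SUP m. ennreal (?G m \<eta>))" for \<eta>
  have [measurable]: "(\<lambda>\<eta>. g (translate x \<eta>)) \<in> borel_measurable \<nu>" for x
    by (rule measurable_compose[OF measurable_translate_nu gm])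
  have vm: "?v m \<in> borel_measurable \<nu>" for m by measurable
  have Sm[measurable]: "S \<in> borel_measurable \<nu>" unfolding S_def[abs_def] by measurable
  have Gmono: "?G k \<eta> \<le> ?G m \<eta>" if "k \<le> m" for k m \<eta>
    using box_mono[OF that] by (intro sum_mono2) auto
  have S_int: "(\<integral>\<^sup>+\<eta>. S \<eta> \<partial>\<nu>) < \<infinity>"
  proof -
    have "(\<integral>\<^sup>+\<eta>. S \<eta> \<partial>\<nu>) = (SUP m. \<integral>\<^sup>+\<eta>. ennreal (?G m \<eta>) \<partial>\<nu>)"
      unfolding S_def by (rule nn_integral_monotone_convergence_SUP)
        (auto simp: incseq_def le_fun_def intro!: ennreal_leI Gmono)
    also have "\<dots> \<le> ennreal (n2 \<nu> g * (\<Sum>\<^sub>\<infinity>x\<in>UNIV. \<bar>h x\<bar>))"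
    proof (rule SUP_least)
      fix m
      have gt: "square_integrable \<nu> (\<lambda>\<eta>. g (translate x \<eta>))" for x by (rule square_integrable_translate[OF g])
      have gi: "integrable \<nu> (\<lambda>\<eta>. \<bar>g (translate x \<eta>) * h x\<bar>)" for x
        using square_integrable_integrable[OF gt[of x]] by simp
      have "(\<integral>\<^sup>+\<eta>. ennreal (?G m \<eta>) \<partial>\<nu>) = ennreal (\<integral>\<eta>. ?G m \<eta> \<partial>\<nu>)"
        by (rule nn_integral_eq_integral) (use gi in \<open>auto intro!: sum_nonneg\<close>)
      also have "(\<integral>\<eta>. ?G m \<eta> \<partial>\<nu>) = (\<Sum>x\<in>box m. \<integral>\<eta>. \<bar>g (translate x \<eta>) * h x\<bar> \<partial>\<nu>)"
        by (rule Bochner_Integration.integral_sum) (rule gi)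
      also have "\<dots> \<le> (\<Sum>x\<in>box m. n2 \<nu> g * \<bar>h x\<bar>)"
      proof (rule sum_mono)
        fix x
        show "(\<integral>\<eta>. \<bar>g (translate x \<eta>) * h x\<bar> \<partial>\<nu>) \<le> n2 \<nu> g * \<bar>h x\<bar>"
          using integral_abs_le_n2[OF gt[of x]] by (simp add: abs_mult n2_translate[OF gm] mult_right_mono)
      qed
      also have "\<dots> = n2 \<nu> g * (\<Sum>x\<in>box m. \<bar>h x\<bar>)" by (simp add: sum_distrib_left)
      also have "\<dots> \<le> n2 \<nu> g * (\<Sum>\<^sub>\<infinity>x\<in>UNIV. \<bar>h x\<bar>)"
        by (intro mult_left_mono finite_sum_le_infsum h) auto
      finally show "(\<integral>\<^sup>+\<eta>. ennreal (?G m \<eta>) \<partial>\<nu>) \<le> ennreal (n2 \<nu> g * (\<Sum>\<^sub>\<infinity>x\<in>UNIV. \<bar>h x\<bar>))"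
        by (simp add: ennreal_leI)
    qed
    also have "\<dots> < \<infinity>" by simp
    finally show ?thesis .
  qed
  have G_le: "?G m \<eta> \<le> enn2real (S \<eta>)" if "S \<eta> < \<infinity>" for m \<eta>
  proof -
    have "ennreal (?G m \<eta>) \<le> S \<eta>" unfolding S_def by (rule SUP_upper) simp
    from enn2real_mono[OF this that[unfolded infinity_ennreal_def]] show ?thesis by (simp add: sum_nonneg)
  qed
  have lim: "(\<lambda>m. ?v m \<eta>) \<longlonglongrightarrow> ?V \<eta>" if fin: "S \<eta> < \<infinity>" for \<eta>
  proof -
    have "(\<lambda>x. \<bar>g (translate x \<eta>) * h x\<bar>) summable_on UNIV"
    proof (rule nonneg_bdd_above_summable_on)
      show "bdd_above (sum (\<lambda>x. \<bar>g (translate x \<eta>) * h x\<bar>) ` {F. F \<subseteq> UNIV \<and> finite F})"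
      proof (rule bdd_aboveI2)
        fix F :: "int set" assume "F \<in> {F. F \<subseteq> UNIV \<and> finite F}"
        then have "\<forall>\<^sub>F m in sequentially. F \<subseteq> box m"
          using filterlim_box unfolding filterlim_finite_subsets_at_top by (auto elim: eventually_mono)
        then obtain m where "F \<subseteq> box m" by (auto simp: eventually_sequentially)
        then have "(\<Sum>x\<in>F. \<bar>g (translate x \<eta>) * h x\<bar>) \<le> ?G m \<eta>" by (intro sum_mono2) auto
        also have "\<dots> \<le> enn2real (S \<eta>)" by (rule G_le[OF fin])
        finally show "(\<Sum>x\<in>F. \<bar>g (translate x \<eta>) * h x\<bar>) \<le> enn2real (S \<eta>)" .
      qed
    qed simp
    then have "(\<lambda>x. g (translate x \<eta>) * h x) summable_on UNIV"
      unfolding real_norm_def[symmetric] by (rule abs_summable_summable)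
    then have "((\<lambda>x. g (translate x \<eta>) * h x) has_sum ?V \<eta>) UNIV" by simp
    then show ?thesis unfolding has_sum_def by (rule filterlim_compose[OF _ filterlim_box])
  qed
  have AE_S: "AE \<omega> in P. (\<integral>\<^sup>+u. indicator {0..t} u * S (proc.Y u \<omega>) \<partial>lborel) \<noteq> \<infinity>"
  proof (rule nn_integral_PInf_AE)
    have Sc: "S \<in> borel_measurable config_space" using Sm by (simp add: measurable_nu)
    have jm: "(\<lambda>(s, \<omega>). proc.Y s \<omega>) \<in> lborel \<Otimes>\<^sub>M P \<rightarrow>\<^sub>M config_space"
    proof -
      have "sets (lborel \<Otimes>\<^sub>M P) = sets (borel \<Otimes>\<^sub>M P)" by (intro sets_pair_measure_cong) auto
      then show ?thesis using proc.joint_measurable measurable_cong_sets[of "lborel \<Otimes>\<^sub>M P" "borel \<Otimes>\<^sub>M P"] by auto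
    qed
    have jS[measurable]: "(\<lambda>(s, \<omega>). S (proc.Y s \<omega>)) \<in> borel_measurable (lborel \<Otimes>\<^sub>M P)"
      using measurable_compose[OF jm Sc] by (simp add: split_beta')
    show "(\<lambda>\<omega>. \<integral>\<^sup>+u. indicator {0..t} u * S (proc.Y u \<omega>) \<partial>lborel) \<in> borel_measurable P" by measurable
    have "(\<integral>\<^sup>+\<omega>. (\<integral>\<^sup>+u. indicator {0..t} u * S (proc.Y u \<omega>) \<partial>lborel) \<partial>P)
       = (\<integral>\<^sup>+u. (\<integral>\<^sup>+\<omega>. indicator {0..t} u * S (proc.Y u \<omega>) \<partial>P) \<partial>lborel)"
      by (rule proc.LP.Fubini') measurable
    also have "\<dots> = (\<integral>\<^sup>+u. (\<integral>\<^sup>+\<eta>. S \<eta> \<partial>\<nu>) * indicator {0..t} u \<partial>lborel)"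
    proof (rule nn_integral_cong)
      fix u
      have "(\<integral>\<^sup>+\<omega>. S (proc.Y u \<omega>) \<partial>P) = (\<integral>\<^sup>+\<eta>. S \<eta> \<partial>distr P config_space (proc.Y u))"
        by (rule nn_integral_distr[symmetric, OF proc.Y_measurable]) (use Sc in simp)
      also have "distr P config_space (proc.Y u) = \<nu>" using proc.distr_X[of "max 0 u"] by (simp add: proc.Y_def)
      finally show "(\<integral>\<^sup>+\<omega>. indicator {0..t} u * S (proc.Y u \<omega>) \<partial>P) = (\<integral>\<^sup>+\<eta>. S \<eta> \<partial>\<nu>) * indicator {0..t} u"
        by (cases "u \<in> {0..t}") auto
    qed
    also have "\<dots> < \<infinity>" using t S_int by (subst nn_integral_cmult_indicator) (auto simp: ennreal_mult_less_top)
    finally show "(\<integral>\<^sup>+\<omega>. (\<integral>\<^sup>+u. indicator {0..t} u * S (proc.Y u \<omega>) \<partial>lborel) \<partial>P) \<noteq> \<infinity>" by simp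
  qed
  have conv: "AE \<omega> in P. (LBINT s:{0..t}. ?V (X s \<omega>)) = 0 \<or>
     (\<lambda>m. proc.time_integral (?v m) 0 t \<omega>) \<longlonglongrightarrow> (LBINT s:{0..t}. ?V (X s \<omega>))"
    using AE_S
  proof (rule AE_mp, intro AE_I2 impI)
    fix \<omega> assume w: "\<omega> \<in> space P" and fin: "(\<integral>\<^sup>+u. indicator {0..t} u * S (proc.Y u \<omega>) \<partial>lborel) \<noteq> \<infinity>"
    have Vm: "(\<lambda>u. ?v m (proc.Y u \<omega>)) \<in> borel_measurable borel" for m by (rule proc.path_measurable[OF vm w])
    have Sy: "(\<lambda>u. S (proc.Y u \<omega>)) \<in> borel_measurable borel"
    proof -
      have Sc: "S \<in> borel_measurable config_space" using Sm by (simp add: measurable_nu)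
      show ?thesis using measurable_compose[OF measurable_Pair1[OF proc.joint_measurable w] Sc] by simp
    qed
    have YX: "(LBINT s:{0..t}. ?V (X s \<omega>)) = (LBINT s:{0..t}. ?V (proc.Y s \<omega>))"
      unfolding set_lebesgue_integral_def
      by (rule Bochner_Integration.integral_cong) (auto simp: proc.Y_nonneg split: split_indicator)
    have AEfin: "AE u in lborel. indicator {0..t} u * S (proc.Y u \<omega>) \<noteq> \<infinity>"
      by (rule nn_integral_PInf_AE[OF _ fin]) (use Sy in measurable)
    show "(LBINT s:{0..t}. ?V (X s \<omega>)) = 0 \<or> (\<lambda>m. proc.time_integral (?v m) 0 t \<omega>) \<longlonglongrightarrow> (LBINT s:{0..t}. ?V (X s \<omega>))"
    proof (cases "set_integrable lborel {0..t} (\<lambda>s. ?V (proc.Y s \<omega>))")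
      case False
      then have "(LBINT s:{0..t}. ?V (proc.Y s \<omega>)) = 0"
        unfolding set_lebesgue_integral_def set_integrable_def by (rule not_integrable_integral_eq)
      then show ?thesis unfolding YX by (rule disjI1)
    next
      case True
      have "(\<lambda>m. \<integral>u. indicator {0..t} u *\<^sub>R ?v m (proc.Y u \<omega>) \<partial>lborel) \<longlonglongrightarrow> (\<integral>u. indicator {0..t} u *\<^sub>R ?V (proc.Y u \<omega>) \<partial>lborel)"
      proof (rule integral_dominated_convergence[where w="\<lambda>u. indicator {0..t} u * enn2real (S (proc.Y u \<omega>))"])
        show "(\<lambda>u. indicator {0..t} u *\<^sub>R ?V (proc.Y u \<omega>)) \<in> borel_measurable lborel"
          using True by (simp add: set_integrable_def borel_measurable_integrable)
        show "(\<lambda>u. indicator {0..t} u *\<^sub>R ?v m (proc.Y u \<omega>)) \<in> borel_measurable lborel" for m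
          using Vm[of m] by measurable
        show "integrable lborel (\<lambda>u. indicator {0..t} u * enn2real (S (proc.Y u \<omega>)))"
        proof (rule integrableI_nonneg)
          show "(\<lambda>u. indicator {0..t} u * enn2real (S (proc.Y u \<omega>))) \<in> borel_measurable lborel" using Sy by measurable
          have "(\<integral>\<^sup>+u. ennreal (indicator {0..t} u * enn2real (S (proc.Y u \<omega>))) \<partial>lborel)
             \<le> (\<integral>\<^sup>+u. indicator {0..t} u * S (proc.Y u \<omega>) \<partial>lborel)"
            by (rule nn_integral_mono) (auto split: split_indicator simp: ennreal_enn2real_if)
          then show "(\<integral>\<^sup>+u. ennreal (indicator {0..t} u * enn2real (S (proc.Y u \<omega>))) \<partial>lborel) < \<infinity>"
            using fin by (auto simp: less_top[symmetric] top_unique)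
        qed simp
        show "AE u in lborel. (\<lambda>m. indicator {0..t} u *\<^sub>R ?v m (proc.Y u \<omega>)) \<longlonglongrightarrow> indicator {0..t} u *\<^sub>R ?V (proc.Y u \<omega>)"
          using AEfin
        proof eventually_elim
          case (elim u)
          show ?case
          proof (cases "u \<in> {0..t}")
            case True
            then have "S (proc.Y u \<omega>) < \<infinity>" using elim by (simp add: less_top)
            from lim[OF this] True show ?thesis by simp
          qed simp
        qed
        show "AE u in lborel. norm (indicator {0..t} u *\<^sub>R ?v m (proc.Y u \<omega>)) \<le> indicator {0..t} u * enn2real (S (proc.Y u \<omega>))" for m
          using AEfin
        proof eventually_elim
          case (elim u)
          show ?case
          proof (cases "u \<in> {0..t}")
            case True
            then have "S (proc.Y u \<omega>) < \<infinity>" using elim by (simp add: less_top)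
            then have "\<bar>?v m (proc.Y u \<omega>)\<bar> \<le> enn2real (S (proc.Y u \<omega>))"
              by (rule order_trans[OF sum_abs G_le])
            with True show ?thesis by simp
          qed simp
        qed
      qed
      then show ?thesis unfolding YX using t by (simp add: proc.time_integral_Y set_lebesgue_integral_def)
    qed
  qed
  \<comment> \<open>Fatou on path space carries the bound, which is uniform in the box, to the
    infinite series. Paths with vanishing integral satisfy the inequality trivially.\<close>
  have "(\<integral>\<^sup>+\<omega>. ennreal ((LBINT s:{0..t}. ?V (X s \<omega>))\<^sup>2) \<partial>P)
     \<le> (\<integral>\<^sup>+\<omega>. liminf (\<lambda>m. ennreal ((proc.time_integral (?v m) 0 t \<omega>)\<^sup>2)) \<partial>P)"
  proof (rule nn_integral_mono_AE, use conv in eventually_elim)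
    case (elim \<omega>)
    then show ?case
    proof
      assume "(\<lambda>m. proc.time_integral (?v m) 0 t \<omega>) \<longlonglongrightarrow> (LBINT s:{0..t}. ?V (X s \<omega>))"
      then have "(\<lambda>m. ennreal ((proc.time_integral (?v m) 0 t \<omega>)\<^sup>2)) \<longlonglongrightarrow> ennreal ((LBINT s:{0..t}. ?V (X s \<omega>))\<^sup>2)"
        by (intro tendsto_ennrealI tendsto_power)
      from lim_imp_Liminf[OF trivial_limit_sequentially this] show ?thesis by simp
    qed simp
  qed
  also have "\<dots> \<le> liminf (\<lambda>m. \<integral>\<^sup>+\<omega>. ennreal ((proc.time_integral (?v m) 0 t \<omega>)\<^sup>2) \<partial>P)"
    by (rule nn_integral_liminf) (use proc.time_integral_measurable[OF vm order_refl] in measurable)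
  also have "\<dots> \<le> liminf (\<lambda>m. ennreal K)" by (intro Liminf_mono always_eventually allI bound)
  finally show ?thesis by (simp add: Liminf_const)
qed

text \<open>The growth profile \<open>g\<close> and the subtracted function \<open>Q\<close> stay
  abstract, so that one argument covers both cases: square root and quadratic expansion, identity
  and linear expansion. Sums are first restricted to boxes, with bounds that involve the box only
  through \<open>H1\<close> and \<open>H2\<close>.\<close>

lemma multiscale_dynamics:
  assumes g0: "0 \<le> g\<^sub>0"
    and gap: "\<And>l. l \<ge> 1 \<Longrightarrow> (\<integral>\<^sup>+\<eta>. (inv_gap \<nu> bR (particle_number l \<eta>) l \<eta> n)\<^sup>2 \<partial>\<nu>) \<le> ennreal (g\<^sub>0 * real l ^ 4)"
    and f: "fourth_integrable \<nu> f" and Q: "fourth_integrable \<nu> Q"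
    and l1: "1 \<le> l\<^sub>1" and D0: "0 \<le> D"
    and D: "\<And>k. l\<^sub>1 \<le> k \<Longrightarrow> real k * sqrt (real k) * Lnorm 4 \<nu> (real_cond_exp \<nu> (canonical_alg k) f) \<le> D * g k"
    and g: "\<And>k. 1 \<le> k \<Longrightarrow> 1 \<le> g k" "\<And>k. 2 \<le> k \<Longrightarrow> g (k div 2) \<le> 3/4 * g k"
    and l: "l\<^sub>1 \<le> l" and t: "0 \<le> t"
    and q: "Lnorm 4 \<nu> (\<lambda>\<eta>. real_cond_exp \<nu> (canonical_alg l) f \<eta> - Q \<eta>) \<le> q"
    and h: "(\<lambda>x. \<bar>h x\<bar>) summable_on UNIV" "(\<lambda>x. (h x)\<^sup>2) summable_on UNIV"
  defines "H1 \<equiv> \<Sum>\<^sub>\<infinity>x\<in>UNIV. \<bar>h x\<bar>" and "H2 \<equiv> \<Sum>\<^sub>\<infinity>x\<in>UNIV. (h x)\<^sup>2"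
    and "\<kappa> \<equiv> sqrt (2 * sqrt g\<^sub>0) * (64 * D + 16 * (real l\<^sub>1)\<^sup>2 * Lnorm 4 \<nu> f)"
  shows "(\<integral>\<^sup>+\<omega>. ennreal ((LBINT s:{0..t}. (\<Sum>\<^sub>\<infinity>x\<in>UNIV. (f (translate x (X s \<omega>)) - Q (translate x (X s \<omega>))) * h x))\<^sup>2) \<partial>P)
     \<le> ennreal (96 * t * (\<kappa> * g l)\<^sup>2 * H2 / (real n)\<^sup>2 + 2 * t\<^sup>2 * (H1 * q)\<^sup>2)"
proof (rule infinite_sum_limit[where g="\<lambda>\<eta>. f \<eta> - Q \<eta>", OF _ h(1) t])
  show "square_integrable \<nu> (\<lambda>\<eta>. f \<eta> - Q \<eta>)" by (rule square_of_fourth(2)[OF fourth_integrable_diff(1)[OF f Q]])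
  fix m
  let ?f = "real_cond_exp \<nu> (canonical_alg l) f"
  let ?V = "\<lambda>\<eta>. \<Sum>x\<in>box m. (f (translate x \<eta>) - ?f (translate x \<eta>)) * h x"
  let ?W = "\<lambda>\<eta>. \<Sum>x\<in>box m. (?f (translate x \<eta>) - Q (translate x \<eta>)) * h x"
  have eq: "(\<lambda>\<eta>. \<Sum>x\<in>box m. (f (translate x \<eta>) - Q (translate x \<eta>)) * h x) = (\<lambda>\<eta>. ?V \<eta> + ?W \<eta>)"
    by (simp add: sum.distrib[symmetric] algebra_simps)
  have c4: "fourth_integrable \<nu> ?f" by (rule cond_exp_fourth(1)[OF f])
  have G: "square_integrable \<nu> (\<lambda>\<eta>. ?f \<eta> - Q \<eta>)" "n2 \<nu> (\<lambda>\<eta>. ?f \<eta> - Q \<eta>) \<le> q"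
    using square_of_fourth(2,3)[OF fourth_integrable_diff(1)[OF c4 Q]] q by auto
  have sq: "square_integrable \<nu> (\<lambda>\<eta>. \<Sum>x\<in>box m. F (translate x \<eta>) * h x)" if "square_integrable \<nu> F" for F
    by (subst mult.commute) (intro square_integrable_sum square_integrable_cmult square_integrable_translate that)
  have Vsq: "square_integrable \<nu> ?V" by (rule sq[OF square_of_fourth(2)[OF fourth_integrable_diff(1)[OF f c4]]])
  have Wsq: "square_integrable \<nu> ?W" by (rule sq[OF G(1)])
  have q0: "0 \<le> q" using q Lnorm_nonneg order_trans by blast
  let ?h2 = "\<Sum>x\<in>box m. (h x)\<^sup>2"
  have h2: "?h2 \<le> H2" unfolding H2_def by (intro finite_sum_le_infsum h(2)) auto
  have W: "n2 \<nu> ?W \<le> H1 * q"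
  proof -
    have "n2 \<nu> ?W \<le> (\<Sum>x\<in>box m. n2 \<nu> (\<lambda>\<eta>. h x * (?f (translate x \<eta>) - Q (translate x \<eta>))))"
      by (subst mult.commute, rule n2_sum_le)
        (intro square_integrable_cmult square_integrable_translate[OF G(1)])
    also have "\<dots> = (\<Sum>x\<in>box m. \<bar>h x\<bar> * n2 \<nu> (\<lambda>\<eta>. ?f \<eta> - Q \<eta>))"
      using n2_translate[of "\<lambda>\<eta>. ?f \<eta> - Q \<eta>"] G(1) by (simp add: n2_cmult square_integrable_def)
    also have "\<dots> \<le> (\<Sum>x\<in>box m. \<bar>h x\<bar> * q)" by (intro sum_mono mult_left_mono G(2)) simp
    also have "\<dots> = (\<Sum>x\<in>box m. \<bar>h x\<bar>) * q" by (simp add: sum_distrib_right)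
    also have "\<dots> \<le> H1 * q" unfolding H1_def by (intro mult_right_mono finite_sum_le_infsum h(1) q0) auto
    finally show ?thesis .
  qed
  have "(\<integral>\<^sup>+\<omega>. ennreal ((proc.time_integral (\<lambda>\<eta>. ?V \<eta> + ?W \<eta>) 0 t \<omega>)\<^sup>2) \<partial>P)
     \<le> ennreal (96 * t * (\<kappa> * g l * sqrt ?h2)\<^sup>2 / (real n)\<^sup>2 + 2 * t\<^sup>2 * (n2 \<nu> ?W)\<^sup>2)"
  proof (rule two_part_bound[OF Vsq Wsq t])
    fix \<phi> L assume \<phi>: "supported_on L \<phi>" "square_integrable \<nu> \<phi>"
      "\<And>x. integrable \<nu> (\<lambda>\<eta>. bR n (translate x \<eta>) * (grad x (x + 1) \<phi> \<eta>)\<^sup>2)"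
    have bm: "bR n \<in> borel_measurable \<nu>" using meas_rates(1)[of 0] by simp
    show "\<bar>ip \<nu> ?V \<phi>\<bar> \<le> \<kappa> * g l * sqrt ?h2 * sqrt (\<Sum>x\<in>box (L + 1). bond_energy \<nu> (bR n) x \<phi>)"
      using multiscale[OF nonneg(1) bm g0 gap f \<phi> finite_box[of m] l1 D0 D g l, of h]
      by (simp only: \<kappa>_def mult.assoc)
  qed
  also have "\<dots> \<le> ennreal (96 * t * (\<kappa> * g l)\<^sup>2 * H2 / (real n)\<^sup>2 + 2 * t\<^sup>2 * (H1 * q)\<^sup>2)"
  proof (intro ennreal_leI add_mono)
    have "(\<kappa> * g l * sqrt ?h2)\<^sup>2 = (\<kappa> * g l)\<^sup>2 * ?h2" by (simp add: power_mult_distrib sum_nonneg)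
    also have "\<dots> \<le> (\<kappa> * g l)\<^sup>2 * H2" by (intro mult_left_mono h2) simp
    finally have "96 * t * (\<kappa> * g l * sqrt ?h2)\<^sup>2 \<le> 96 * t * ((\<kappa> * g l)\<^sup>2 * H2)" using t by (intro mult_left_mono) auto
    then show "96 * t * (\<kappa> * g l * sqrt ?h2)\<^sup>2 / (real n)\<^sup>2 \<le> 96 * t * (\<kappa> * g l)\<^sup>2 * H2 / (real n)\<^sup>2"
      by (simp add: divide_right_mono mult.assoc)
    show "2 * t\<^sup>2 * (n2 \<nu> ?W)\<^sup>2 \<le> 2 * t\<^sup>2 * (H1 * q)\<^sup>2" by (intro mult_left_mono power_mono W) auto
  qed
  finally show "(\<integral>\<^sup>+\<omega>. ennreal ((proc.time_integral (\<lambda>\<eta>. \<Sum>x\<in>box m. (f (translate x \<eta>) - Q (translate x \<eta>)) * h x) 0 t \<omega>)\<^sup>2) \<partial>P)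
     \<le> ennreal (96 * t * (\<kappa> * g l)\<^sup>2 * H2 / (real n)\<^sup>2 + 2 * t\<^sup>2 * (H1 * q)\<^sup>2)"
    unfolding eq .
qed

end

section \<open>From the assumptions to the theorem\<close>

lemma particle_dynamics_exists:
  assumes st: "stationary_config \<nu> \<rho> \<theta>s" and gr: "gradient_rates bR bL" and db: "detailed_balance \<nu> bR bL"
    and n: "1 \<le> n" and jump: "0 \<le> jump_prob a \<gamma> n" "jump_prob a \<gamma> n \<le> 1"
    and pp: "particle_process \<nu> bR bL a \<gamma> n P X"
  shows "\<exists>c R C T \<D>. particle_dynamics \<nu> \<rho> \<theta>s bR bL n c R C T P X a \<gamma> \<D>"
proof -
  interpret stationary_config \<nu> \<rho> \<theta>s by (rule st)
  obtain R C c where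
    r: "\<forall>n\<ge>1. supported_on R (bR n) \<and> supported_on R (bL n)
        \<and> (\<forall>\<eta>. bR n \<eta> \<ge> 0 \<and> bL n \<eta> \<ge> 0)
        \<and> (\<forall>\<eta>. \<eta> 0 = 0 \<longrightarrow> bR n \<eta> = 0) \<and> (\<forall>\<eta>. \<eta> 1 = 0 \<longrightarrow> bL n \<eta> = 0)"
    and C: "\<forall>n\<ge>1. \<forall>\<eta>. \<bar>bR n \<eta>\<bar> + \<bar>bL n \<eta>\<bar> \<le> C * (\<Sum>y\<in>box R. real (\<eta> y))"
    and c: "\<forall>n\<ge>1. supported_on R (c n) \<and> (\<forall>\<eta>. c n \<eta> \<ge> 0) \<and>
          (\<forall>x \<eta>. bR n (translate x \<eta>) - bL n (translate x \<eta>) = c n (translate x \<eta>) - c n (translate (x + 1) \<eta>))"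
    using gr unfolding gradient_rates_def by (elim exE conjE)
  interpret reversible_rates \<nu> \<rho> \<theta>s bR bL n "c n" R C
  proof
    show "supported_on R (bR n)" "supported_on R (bL n)" "supported_on R (c n)" using r c n by auto
    show "0 \<le> bR n \<eta>" "0 \<le> bL n \<eta>" "0 \<le> c n \<eta>" for \<eta> using r c n by auto
    show "bR n \<eta> + bL n \<eta> \<le> C * (\<Sum>y\<in>box R. real (\<eta> y))" for \<eta>
      using C[rule_format, OF n, of \<eta>] by linarith
    show "bR n (translate x \<eta>) - bL n (translate x \<eta>) = c n (translate x \<eta>) - c n (translate (x + 1) \<eta>)" for x \<eta>
      using c[rule_format, OF n] by simp
    show "(\<integral>\<eta>. bR n (translate x \<eta>) * f \<eta> * g (move x (x + 1) \<eta>) \<partial>\<nu>)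
       = (\<integral>\<eta>. bL n (translate x \<eta>) * f (move (x + 1) x \<eta>) * g \<eta> \<partial>\<nu>)"
      if "local_fun f" "bounded (range f)" "local_fun g" "bounded (range g)" for f g x
      using db n that unfolding detailed_balance_def by simp
  qed
  obtain T \<D> where T: "markov_semigroup \<nu> T" and loc: "\<forall>u\<in>\<D>. local_fun u"
    and core: "generator_core \<nu> T (generator_formula bR bL a \<gamma> n) \<D>" and mp: "markov_process \<nu> T P X"
    using pp unfolding particle_process_def by (elim exE conjE)
  interpret S: L2_semigroup \<nu> T by unfold_locales (rule T)
  interpret P: prob_space P using mp by (simp add: markov_process_def)
  interpret stationary_process \<nu> T P X
  proof
    show "markov_process \<nu> T P X" by (rule mp)
    \<comment> \<open>\<open>stationary_process\<close> takes invariance as an assumption, so it is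
      established beforehand in \<open>L2_semigroup\<close>, from the zero mean of the generator on
      the core.\<close>
    have zero: "(\<integral>\<eta>. generator_formula bR bL a \<gamma> n u \<eta> \<partial>\<nu>) = 0" if u: "u \<in> \<D>" for u
    proof -
      obtain L where "supported_on L u" using bspec[OF loc u] unfolding local_fun_def by (elim exE)
      moreover have "square_integrable \<nu> u"
        using core u by (simp add: generator_core_def S.has_generator_iff)
      ultimately show ?thesis by (rule generator_mean_zero)
    qed
    show "(\<integral>\<eta>. T t f \<eta> \<partial>\<nu>) = (\<integral>\<eta>. f \<eta> \<partial>\<nu>)"
      if "f \<in> borel_measurable \<nu>" "\<And>\<eta>. \<bar>f \<eta>\<bar> \<le> B" "0 \<le> t" for f B t
      by (rule S.invariant_bounded[OF core zero that])
  qed (rule sets_nu)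
  have "particle_dynamics \<nu> \<rho> \<theta>s bR bL n (c n) R C T P X a \<gamma> \<D>"
    by unfold_locales (use core loc jump n in auto)
  then show ?thesis by blast
qed

text \<open>Both terms are charged to a common constant. Here \<open>p\<close> is the power of
  \<open>l\<close> in the theorem and \<open>r\<close> the decay rate with square
  \<open>1 / p\<close>; the summand \<open>1\<close> makes the constant positive.\<close>

lemma rearrange_bound:
  fixes N K D G H1 H2 t \<kappa> r p :: real
  assumes t: "0 \<le> t" and \<kappa>: "0 \<le> \<kappa>" "\<kappa> \<le> N * K" and H2: "0 \<le> H2" and n: "1 \<le> n"
    and p: "0 \<le> p" "r\<^sup>2 = 1 / p"
  shows "96 * t * (\<kappa> * G)\<^sup>2 * H2 / (real n)\<^sup>2 + 2 * t\<^sup>2 * (H1 * (D * N * r))\<^sup>2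
     \<le> (96 * K\<^sup>2 + 2 * D\<^sup>2 + 1) * N\<^sup>2 *
        (t * G\<^sup>2 / real n * (1 / real n * H2) + t\<^sup>2 * (real n)\<^sup>2 / p * (1 / real n * H1)\<^sup>2)"
proof -
  define u where "u = t * G\<^sup>2 / real n * (1 / real n * H2)"
  define v where "v = t\<^sup>2 * (real n)\<^sup>2 / p * (1 / real n * H1)\<^sup>2"
  have n0: "real n \<noteq> 0" using n by simp
  have u0: "0 \<le> u" using t H2 by (simp add: u_def)
  have v0: "0 \<le> v" using p by (simp add: v_def)
  have "\<kappa>\<^sup>2 \<le> (N * K)\<^sup>2" by (rule power_mono[OF \<kappa>(2,1)])
  then have "96 * (\<kappa>\<^sup>2 * u) \<le> 96 * ((N * K)\<^sup>2 * u)" using u0 by (intro mult_left_mono mult_right_mono) auto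
  moreover have "96 * t * (\<kappa> * G)\<^sup>2 * H2 / (real n)\<^sup>2 = 96 * (\<kappa>\<^sup>2 * u)"
    by (simp add: u_def power2_eq_square)
  moreover have "2 * t\<^sup>2 * (H1 * (D * N * r))\<^sup>2 = 2 * D\<^sup>2 * N\<^sup>2 * v"
    unfolding power_mult_distrib p(2) v_def using n0 by (simp add: power_divide)
  moreover have "(96 * K\<^sup>2 + 2 * D\<^sup>2 + 1) * N\<^sup>2 * (u + v)
     = 96 * ((N * K)\<^sup>2 * u) + 2 * D\<^sup>2 * N\<^sup>2 * v + (96 * K\<^sup>2 * (N\<^sup>2 * v) + 2 * D\<^sup>2 * (N\<^sup>2 * u) + N\<^sup>2 * (u + v))"
    by (simp add: algebra_simps)
  moreover have "0 \<le> 96 * K\<^sup>2 * (N\<^sup>2 * v) + 2 * D\<^sup>2 * (N\<^sup>2 * u) + N\<^sup>2 * (u + v)"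
    using u0 v0 by (intro add_nonneg_nonneg mult_nonneg_nonneg) auto
  ultimately show ?thesis unfolding u_def[symmetric] v_def[symmetric] by linarith
qed

lemma powr_halved_sq:
  fixes s r x :: real
  assumes "0 < x" shows "(x powr (- s - r / 2))\<^sup>2 = 1 / x powr (2 * s + r)"
proof -
  have "(x powr (- s - r / 2))\<^sup>2 = x powr (- (2 * s + r))"
    using assms by (simp add: powr_power left_diff_distrib mult.commute)
  then show ?thesis unfolding powr_minus_divide .
qed

lemma block_avg_translate: "block_avg l (translate x \<eta>) 0 = block_avg l \<eta> x"
  by (simp add: block_avg_def translate_def)

context particle_dynamics
begin

text \<open>The fifth norm of \<open>f\<close> is factored out, using that it dominates the fourth.
  What remains of the constant depends on \<open>g\<^sub>0\<close>, \<open>D\<close> and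
  \<open>l\<^sub>1\<close> only, and so neither on the dynamics nor on \<open>f\<close>.\<close>

lemma boltzmann_gibbs_bound:
  assumes g0: "0 \<le> g\<^sub>0"
    and gap: "\<And>l. l \<ge> 1 \<Longrightarrow> (\<integral>\<^sup>+\<eta>. (inv_gap \<nu> bR (particle_number l \<eta>) l \<eta> n)\<^sup>2 \<partial>\<nu>) \<le> ennreal (g\<^sub>0 * real l ^ 4)"
    and f: "f \<in> Lp 5 \<nu>" and Q: "fourth_integrable \<nu> Q"
    and l1: "1 \<le> l\<^sub>1" and D0: "0 \<le> D"
    and D: "\<And>k. l\<^sub>1 \<le> k \<Longrightarrow>
      real k * sqrt (real k) * Lnorm 4 \<nu> (real_cond_exp \<nu> (canonical_alg k) f) \<le> D * Lnorm 5 \<nu> f * g k"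
    and g: "\<And>k. 1 \<le> k \<Longrightarrow> 1 \<le> g k" "\<And>k. 2 \<le> k \<Longrightarrow> g (k div 2) \<le> 3/4 * g k"
    and l: "l\<^sub>1 \<le> l" and t: "0 \<le> t"
    and q: "Lnorm 4 \<nu> (\<lambda>\<eta>. real_cond_exp \<nu> (canonical_alg l) f \<eta> - Q \<eta>) \<le> D * Lnorm 5 \<nu> f * r"
    and p: "0 \<le> p" "r\<^sup>2 = 1 / p"
    and h: "(\<lambda>x. \<bar>h x\<bar>) summable_on UNIV" "(\<lambda>x. (h x)\<^sup>2) summable_on UNIV"
  shows "(\<integral>\<^sup>+\<omega>. ennreal ((LBINT s:{0..t}. (\<Sum>\<^sub>\<infinity>x\<in>UNIV. (f (translate x (X s \<omega>)) - Q (translate x (X s \<omega>))) * h x))\<^sup>2) \<partial>P)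
     \<le> ennreal ((96 * (sqrt (2 * sqrt g\<^sub>0) * (64 * D + 16 * (real l\<^sub>1)\<^sup>2))\<^sup>2 + 2 * D\<^sup>2 + 1) * (Lnorm 5 \<nu> f)\<^sup>2 *
        (t * (g l)\<^sup>2 / real n * (1 / real n * (\<Sum>\<^sub>\<infinity>x\<in>UNIV. (h x)\<^sup>2))
         + t\<^sup>2 * (real n)\<^sup>2 / p * (1 / real n * (\<Sum>\<^sub>\<infinity>x\<in>UNIV. \<bar>h x\<bar>))\<^sup>2))"
proof -
  note f4 = fourth_of_fifth[OF f]
  let ?\<kappa> = "sqrt (2 * sqrt g\<^sub>0) * (64 * (D * Lnorm 5 \<nu> f) + 16 * (real l\<^sub>1)\<^sup>2 * Lnorm 4 \<nu> f)"
  have N0: "0 \<le> D * Lnorm 5 \<nu> f" using D0 by simp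
  have "?\<kappa> \<le> sqrt (2 * sqrt g\<^sub>0) * (64 * (D * Lnorm 5 \<nu> f) + 16 * (real l\<^sub>1)\<^sup>2 * Lnorm 5 \<nu> f)"
    using g0 f4(2) by (intro mult_left_mono add_left_mono) auto
  then have \<kappa>: "?\<kappa> \<le> Lnorm 5 \<nu> f * (sqrt (2 * sqrt g\<^sub>0) * (64 * D + 16 * (real l\<^sub>1)\<^sup>2))"
    by (simp add: algebra_simps)
  have \<kappa>0: "0 \<le> ?\<kappa>" using g0 D0 by (intro mult_nonneg_nonneg add_nonneg_nonneg) auto
  have H2: "0 \<le> (\<Sum>\<^sub>\<infinity>x\<in>UNIV. (h x)\<^sup>2)" by (rule infsum_nonneg) simp
  show ?thesis
    by (rule order_trans[OF multiscale_dynamics[OF g0 gap f4(1) Q l1 N0 D g l t q h]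
      ennreal_leI[OF rearrange_bound[OF t \<kappa>0 \<kappa> H2 n1 p]]])
qed

end

theorem theorem3p2:
  fixes \<nu> :: "config measure" and \<rho> \<theta>s \<alpha>\<^sub>0 :: real
    and bR bL :: "nat \<Rightarrow> config \<Rightarrow> real"
    and \<nu>T :: "real \<Rightarrow> config measure"
    and l\<^sub>0 :: nat
  assumes "prob_space \<nu>" and "sets \<nu> = sets config_space"
    and "gradient_rates bR bL"
    and "detailed_balance \<nu> bR bL"
    and "mixing_exp_moments \<nu> \<rho> \<theta>s"
    and "static_fluctuations \<nu> \<rho>"
    and "tilted_family \<nu> \<rho> \<theta>s \<nu>T"
    and "density_derivatives \<nu> \<rho> \<theta>s \<nu>T"
    and "spectral_gap_bound \<nu> bR"
    and "equivalence_of_ensembles \<nu> \<rho> \<theta>s \<nu>T \<alpha>\<^sub>0"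
  shows "\<exists>C>0. \<forall>(a::real) (\<gamma>::real) (n\<^sub>0::nat) (P :: nat \<Rightarrow> 'w measure) (X :: nat \<Rightarrow> real \<Rightarrow> 'w \<Rightarrow> config).
    \<gamma> > 0 \<and> n\<^sub>0 \<ge> 1
    \<and> (\<forall>n\<ge>n\<^sub>0. 0 \<le> jump_prob a \<gamma> n \<and> jump_prob a \<gamma> n \<le> 1)
    \<and> (\<forall>n\<ge>n\<^sub>0. particle_process \<nu> bR bL a \<gamma> n (P n) (X n)) \<longrightarrow>
    (\<forall>n f t l (h :: int \<Rightarrow> real).
      n \<ge> n\<^sub>0 \<and> supported_on l\<^sub>0 f \<and> f \<in> Lp 5 \<nu> \<and> phi \<nu>T \<theta>s f \<rho> = 0
      \<and> t \<ge> 0 \<and> l \<ge> l\<^sub>0 ^ 3 \<and> l \<ge> 1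
      \<and> (\<lambda>x. \<bar>h x\<bar>) summable_on UNIV \<and> (\<lambda>x. (h x)\<^sup>2) summable_on UNIV \<longrightarrow>
      (phi' \<nu>T \<theta>s f \<rho> = 0 \<longrightarrow>
        (\<integral>\<^sup>+\<omega>. ennreal ((LBINT s:{0..t}. (\<Sum>\<^sub>\<infinity>x\<in>UNIV.
            (f (translate x (X n s \<omega>))
              - phi'' \<nu>T \<theta>s f \<rho> / 2
                * ((block_avg l (X n s \<omega>) x - \<rho>)\<^sup>2 - sigma2 \<nu> \<rho> l / (2 * real l + 1))) * h x))\<^sup>2) \<partial>P n)
        \<le> ennreal (C * (Lnorm 5 \<nu> f)\<^sup>2 *
            (t * real l / real n * (1 / real n * (\<Sum>\<^sub>\<infinity>x\<in>UNIV. (h x)\<^sup>2))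
             + t\<^sup>2 * (real n)\<^sup>2 / real l powr (2 + \<alpha>\<^sub>0)
                * (1 / real n * (\<Sum>\<^sub>\<infinity>x\<in>UNIV. \<bar>h x\<bar>))\<^sup>2)))
      \<and>
      (\<integral>\<^sup>+\<omega>. ennreal ((LBINT s:{0..t}. (\<Sum>\<^sub>\<infinity>x\<in>UNIV.
          (f (translate x (X n s \<omega>)) - phi' \<nu>T \<theta>s f \<rho> * (block_avg l (X n s \<omega>) x - \<rho>)) * h x))\<^sup>2) \<partial>P n)
      \<le> ennreal (C * (Lnorm 5 \<nu> f)\<^sup>2 *
          (t * (real l)\<^sup>2 / real n * (1 / real n * (\<Sum>\<^sub>\<infinity>x\<in>UNIV. (h x)\<^sup>2))
           + t\<^sup>2 * (real n)\<^sup>2 / real l powr (1 + \<alpha>\<^sub>0)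
              * (1 / real n * (\<Sum>\<^sub>\<infinity>x\<in>UNIV. \<bar>h x\<bar>))\<^sup>2)))"
proof -
  have st: "stationary_config \<nu> \<rho> \<theta>s"
    using assms(1,2,5) by (simp add: stationary_config_def stationary_config_axioms_def)
  interpret stationary_config \<nu> \<rho> \<theta>s by (rule st)
  obtain D where D0: "0 \<le> D" and
    D: "\<forall>f k. supported_on l\<^sub>0 f \<and> f \<in> Lp 5 \<nu> \<and> phi \<nu>T \<theta>s f \<rho> = 0 \<and> l\<^sub>0 \<le> k \<and> 1 \<le> k \<longrightarrow>
    (phi' \<nu>T \<theta>s f \<rho> = 0 \<longrightarrow>
      Lnorm 4 \<nu> (real_cond_exp \<nu> (canonical_alg k) f) \<le> D * Lnorm 5 \<nu> f / real k \<and>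
      Lnorm 4 \<nu> (\<lambda>\<eta>. real_cond_exp \<nu> (canonical_alg k) f \<eta> - quadratic_part \<nu>T f k \<eta>) \<le> D * Lnorm 5 \<nu> f * real k powr (- 1 - \<alpha>\<^sub>0 / 2)) \<and>
    Lnorm 4 \<nu> (real_cond_exp \<nu> (canonical_alg k) f) \<le> D * Lnorm 5 \<nu> f / sqrt (real k) \<and>
    Lnorm 4 \<nu> (\<lambda>\<eta>. real_cond_exp \<nu> (canonical_alg k) f \<eta> - linear_part \<nu>T f k \<eta>) \<le> D * Lnorm 5 \<nu> f * real k powr (- 1 / 2 - \<alpha>\<^sub>0 / 2)"
    using cond_exp_decay[OF assms(6,8,10), of l\<^sub>0] by (elim exE conjE)
  obtain G where G: "\<And>n l. 1 \<le> n \<Longrightarrow> 1 \<le> l \<Longrightarrow>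
      (\<integral>\<^sup>+\<eta>. (inv_gap \<nu> bR (particle_number l \<eta>) l \<eta> n)\<^sup>2 \<partial>\<nu>) \<le> ennreal (G * real l ^ 4)"
    using assms(9) unfolding spectral_gap_bound_def particle_number_def by blast
  \<comment> \<open>The constant of the gap assumption may be negative, where \<open>ennreal\<close>
    truncates it to zero; its positive part then gives the same bound.\<close>
  define g\<^sub>0 where "g\<^sub>0 = max 0 G"
  have g0: "0 \<le> g\<^sub>0" by (simp add: g\<^sub>0_def)
  have gap: "(\<integral>\<^sup>+\<eta>. (inv_gap \<nu> bR (particle_number l \<eta>) l \<eta> n)\<^sup>2 \<partial>\<nu>) \<le> ennreal (g\<^sub>0 * real l ^ 4)"
    if "1 \<le> n" "1 \<le> l" for n l
    by (rule order_trans[OF G[OF that] ennreal_leI]) (simp add: g\<^sub>0_def mult_right_mono)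
  \<comment> \<open>The smallest block of the halving: the equivalence of ensembles is available
    from \<open>l\<^sub>0\<close> on, and the decay in the block size from \<open>1\<close>
    on.\<close>
  define l\<^sub>1 where "l\<^sub>1 = max 1 l\<^sub>0"
  have l1: "1 \<le> l\<^sub>1" by (simp add: l\<^sub>1_def)
  \<comment> \<open>All ingredients are fixed before \<open>a\<close>, \<open>\<gamma>\<close>, the
    processes, \<open>n\<close> and \<open>f\<close> are introduced, which is the uniformity
    claimed.\<close>
  let ?C = "96 * (sqrt (2 * sqrt g\<^sub>0) * (64 * D + 16 * (real l\<^sub>1)\<^sup>2))\<^sup>2 + 2 * D\<^sup>2 + 1"
  have C0: "0 < ?C" by (intro add_nonneg_pos) auto
  have main: "(phi' \<nu>T \<theta>s f \<rho> = 0 \<longrightarrow>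
        (\<integral>\<^sup>+\<omega>. ennreal ((LBINT s:{0..t}. (\<Sum>\<^sub>\<infinity>x\<in>UNIV.
            (f (translate x (X n s \<omega>))
              - phi'' \<nu>T \<theta>s f \<rho> / 2
                * ((block_avg l (X n s \<omega>) x - \<rho>)\<^sup>2 - sigma2 \<nu> \<rho> l / (2 * real l + 1))) * h x))\<^sup>2) \<partial>P n)
        \<le> ennreal (?C * (Lnorm 5 \<nu> f)\<^sup>2 *
            (t * real l / real n * (1 / real n * (\<Sum>\<^sub>\<infinity>x\<in>UNIV. (h x)\<^sup>2))
             + t\<^sup>2 * (real n)\<^sup>2 / real l powr (2 + \<alpha>\<^sub>0)
                * (1 / real n * (\<Sum>\<^sub>\<infinity>x\<in>UNIV. \<bar>h x\<bar>))\<^sup>2)))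
      \<and>
      (\<integral>\<^sup>+\<omega>. ennreal ((LBINT s:{0..t}. (\<Sum>\<^sub>\<infinity>x\<in>UNIV.
          (f (translate x (X n s \<omega>)) - phi' \<nu>T \<theta>s f \<rho> * (block_avg l (X n s \<omega>) x - \<rho>)) * h x))\<^sup>2) \<partial>P n)
      \<le> ennreal (?C * (Lnorm 5 \<nu> f)\<^sup>2 *
          (t * (real l)\<^sup>2 / real n * (1 / real n * (\<Sum>\<^sub>\<infinity>x\<in>UNIV. (h x)\<^sup>2))
           + t\<^sup>2 * (real n)\<^sup>2 / real l powr (1 + \<alpha>\<^sub>0)
              * (1 / real n * (\<Sum>\<^sub>\<infinity>x\<in>UNIV. \<bar>h x\<bar>))\<^sup>2))"
    if n0: "n\<^sub>0 \<ge> 1" and jump: "\<forall>n\<ge>n\<^sub>0. 0 \<le> jump_prob a \<gamma> n \<and> jump_prob a \<gamma> n \<le> 1"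
      and pp: "\<forall>n\<ge>n\<^sub>0. particle_process \<nu> bR bL a \<gamma> n (P n) (X n)"
      and n: "n \<ge> n\<^sub>0" and f: "supported_on l\<^sub>0 f" "f \<in> Lp 5 \<nu>" "phi \<nu>T \<theta>s f \<rho> = 0"
      and t: "t \<ge> 0" and l: "l \<ge> l\<^sub>0 ^ 3" "l \<ge> 1"
      and h: "(\<lambda>x. \<bar>h x\<bar>) summable_on UNIV" "(\<lambda>x. (h x)\<^sup>2) summable_on UNIV"
    for a \<gamma> :: real and n\<^sub>0 and P :: "nat \<Rightarrow> 'w measure" and X :: "nat \<Rightarrow> real \<Rightarrow> 'w \<Rightarrow> config"
      and n f t l and h :: "int \<Rightarrow> real"
  proof -
    have n1: "1 \<le> n" using n0 n by simp
    obtain c R C T \<D> where pd: "particle_dynamics \<nu> \<rho> \<theta>s bR bL n c R C T (P n) (X n) a \<gamma> \<D>"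
      using particle_dynamics_exists[OF st assms(3,4) n1 _ _ pp[rule_format, OF n]] jump n by blast
    have "l\<^sub>0 \<le> l\<^sub>0 ^ 3" by (cases "l\<^sub>0 = 0") (auto intro: self_le_power)
    \<comment> \<open>The cubic lower bound places \<open>l\<close> above the smallest block, so the
      halving can start at \<open>l\<close>.\<close>
    then have ll: "l\<^sub>1 \<le> l" using l by (simp add: l\<^sub>1_def)
    have lp: "0 < real l" using l by simp
    have Dk: "l\<^sub>1 \<le> k \<Longrightarrow> supported_on l\<^sub>0 f \<and> f \<in> Lp 5 \<nu> \<and> phi \<nu>T \<theta>s f \<rho> = 0 \<and> l\<^sub>0 \<le> k \<and> 1 \<le> k" for k
      using f by (simp add: l\<^sub>1_def)
    note B = particle_dynamics.boltzmann_gibbs_bound[OF pd g0 gap[OF n1] f(2) _ l1 D0 _ _ _ ll t _ _ _ h]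
    have quad: "(\<integral>\<^sup>+\<omega>. ennreal ((LBINT s:{0..t}. (\<Sum>\<^sub>\<infinity>x\<in>UNIV. (f (translate x (X n s \<omega>))
          - quadratic_part \<nu>T f l (translate x (X n s \<omega>))) * h x))\<^sup>2) \<partial>P n)
        \<le> ennreal (?C * (Lnorm 5 \<nu> f)\<^sup>2 *
            (t * (sqrt (real l))\<^sup>2 / real n * (1 / real n * (\<Sum>\<^sub>\<infinity>x\<in>UNIV. (h x)\<^sup>2))
             + t\<^sup>2 * (real n)\<^sup>2 / real l powr (2 + \<alpha>\<^sub>0)
                * (1 / real n * (\<Sum>\<^sub>\<infinity>x\<in>UNIV. \<bar>h x\<bar>))\<^sup>2))" if z: "phi' \<nu>T \<theta>s f \<rho> = 0"
    \<comment> \<open>The profile \<open>sqrt k\<close> is the cost \<open>k ^ (3/2)\<close> times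
      the decay \<open>1 / k\<close>; its square is the factor \<open>l\<close> of the first
      estimate.\<close>
    proof (rule B[where g="\<lambda>k. sqrt (real k)", OF _ fourth_quadratic_part])
      fix k
      show "1 \<le> k \<Longrightarrow> 1 \<le> sqrt (real k)" by simp
      show "sqrt (real (k div 2)) \<le> 3 / 4 * sqrt (real k)"
      proof (rule real_le_lsqrt)
        have "real (k div 2) \<le> real k / 2" by linarith
        \<comment> \<open>The ratio \<open>3/4\<close> is chosen for this case: halving the block
          multiplies the square of the profile by at most \<open>1/2\<close>, and
          \<open>1/2 <= 9/16\<close>.\<close>
        also have "\<dots> \<le> (3 / 4 * sqrt (real k))\<^sup>2" by (simp add: power_mult_distrib power2_eq_square)
        finally show "real (k div 2) \<le> (3 / 4 * sqrt (real k))\<^sup>2" .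
      qed simp_all
      assume k: "l\<^sub>1 \<le> k"
      then have k0: "0 < real k" using l1 by simp
      have "real k * sqrt (real k) * Lnorm 4 \<nu> (real_cond_exp \<nu> (canonical_alg k) f)
        \<le> real k * sqrt (real k) * (D * Lnorm 5 \<nu> f / real k)"
        using D[rule_format, OF Dk[OF k]] z by (intro mult_left_mono) auto
      then show "real k * sqrt (real k) * Lnorm 4 \<nu> (real_cond_exp \<nu> (canonical_alg k) f)
        \<le> D * Lnorm 5 \<nu> f * sqrt (real k)" using k0 by simp
    next
      show "Lnorm 4 \<nu> (\<lambda>\<eta>. real_cond_exp \<nu> (canonical_alg l) f \<eta> - quadratic_part \<nu>T f l \<eta>)
         \<le> D * Lnorm 5 \<nu> f * real l powr (- 1 - \<alpha>\<^sub>0 / 2)"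
        using D[rule_format, OF Dk[OF ll]] z by simp
      show "(real l powr (- 1 - \<alpha>\<^sub>0 / 2))\<^sup>2 = 1 / real l powr (2 + \<alpha>\<^sub>0)"
        using powr_halved_sq[OF lp, of 1 \<alpha>\<^sub>0] by simp
    qed simp_all
    have lin: "(\<integral>\<^sup>+\<omega>. ennreal ((LBINT s:{0..t}. (\<Sum>\<^sub>\<infinity>x\<in>UNIV. (f (translate x (X n s \<omega>))
          - linear_part \<nu>T f l (translate x (X n s \<omega>))) * h x))\<^sup>2) \<partial>P n)
        \<le> ennreal (?C * (Lnorm 5 \<nu> f)\<^sup>2 *
            (t * (real l)\<^sup>2 / real n * (1 / real n * (\<Sum>\<^sub>\<infinity>x\<in>UNIV. (h x)\<^sup>2))
             + t\<^sup>2 * (real n)\<^sup>2 / real l powr (1 + \<alpha>\<^sub>0)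
                * (1 / real n * (\<Sum>\<^sub>\<infinity>x\<in>UNIV. \<bar>h x\<bar>))\<^sup>2))"
    \<comment> \<open>The profile \<open>k\<close> is the cost \<open>k ^ (3/2)\<close> times the
      weaker decay \<open>1 / sqrt k\<close>; its square is the factor \<open>l ^ 2\<close> of the
      second estimate.\<close>
    proof (rule B[where g=real, OF _ fourth_linear_part])
      fix k :: nat
      show "1 \<le> k \<Longrightarrow> 1 \<le> real k" by simp
      show "real (k div 2) \<le> 3 / 4 * real k" by linarith
      assume k: "l\<^sub>1 \<le> k"
      then have k0: "0 < real k" using l1 by simp
      have "real k * sqrt (real k) * Lnorm 4 \<nu> (real_cond_exp \<nu> (canonical_alg k) f)
        \<le> real k * sqrt (real k) * (D * Lnorm 5 \<nu> f / sqrt (real k))"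
        using D[rule_format, OF Dk[OF k]] by (intro mult_left_mono) auto
      then show "real k * sqrt (real k) * Lnorm 4 \<nu> (real_cond_exp \<nu> (canonical_alg k) f)
        \<le> D * Lnorm 5 \<nu> f * real k" using k0 by (simp add: mult.commute)
    next
      show "Lnorm 4 \<nu> (\<lambda>\<eta>. real_cond_exp \<nu> (canonical_alg l) f \<eta> - linear_part \<nu>T f l \<eta>)
         \<le> D * Lnorm 5 \<nu> f * real l powr (- 1 / 2 - \<alpha>\<^sub>0 / 2)"
        using D[rule_format, OF Dk[OF ll]] by simp
      show "(real l powr (- 1 / 2 - \<alpha>\<^sub>0 / 2))\<^sup>2 = 1 / real l powr (1 + \<alpha>\<^sub>0)"
        using powr_halved_sq[OF lp, of "1 / 2" \<alpha>\<^sub>0] by simp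
    qed simp_all
    show ?thesis
      using quad lin unfolding quadratic_part_def linear_part_def density_dev_def block_avg_translate
        real_sqrt_pow2[OF of_nat_0_le_iff] by (intro conjI impI)
  qed
  show ?thesis
  proof (intro exI[of _ ?C] conjI[OF C0] allI impI, elim conjE, goal_cases)
    case (1 a \<gamma> n\<^sub>0 P X n f t l h)
    show ?case
      by (rule main[of n\<^sub>0 a \<gamma> P X n f t l h]) (rule 1)+
  qed
qed

end
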